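(* Let $k$ be a field, let $\mathbf P=(\widetilde{\mathcal M},g,f)$ be a generic oriented matroid program on a finite set $E\sqcup\{g,f\}$, and let $U\subset k^E$ be a parameter space for the matroid $M=\underline{(\widetilde{\mathcal M}\setminus f)/g}$. Then the algebra $A(\mathbf P,U)$ is quadratic, and its quadratic dual is isomorphic to $A(\mathbf P^\vee,U^\perp)$, the algebra associated with the dual pair $(\mathbf P^\vee,U^\perp)$.
   Context: Oriented matroids. $E$ is a finite set, $n=|E|$. For $Z:I\to\{0,+,-\}$ put $\underline Z=\{i:Z(i)\neq 0\}$, $z(Z)=I\setminus\underline Z$; $(Z\circ Z')(i)=Z(i)$ if $Z(i)\ne 0$ and $Z'(i)$ otherwise; $Z$ is a face of $Z'$ if $Z\circ Z'=Z'$. The covectors of an oriented matroid are $0$ and all compositions of signed cocircuits; topes are the covectors maximal for the face order. $\underline{\mathcal M}$ is the underlying matroid; $\mathcal M^\vee$ the dual oriented matroid (signed circuits and cocircuits exchanged). Programs. An oriented matroid program $\mathbf P=(\widetilde{\mathcal M},g,f)$ is an oriented matroid $\widetilde{\mathcal M}$ on $E\sqcup\{g,f\}$ with $g$ not a loop and $f$ not a coloop. Put $\mathcal M=(\widetilde{\mathcal M}\setminus f)/g$, $M=\underline{\mathcal M}$, $d=\operatorname{rank}M$, $\mathcal N=\widetilde{\mathcal M}\setminus f$. $\mathbf P$ is generic if (1) every cocircuit $Y$ of $\mathcal N$ with $|z(Y)|>d$ has $Y(g)=0$, and (2) every circuit $X$ of $\widetilde{\mathcal M}/g$ with $|z(X)|>n-d$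 has $X(f)=0$. The dual program is $\mathbf P^\vee=(\widetilde{\mathcal M}^\vee,f,g)$ ($f$ now plays the role of $g$ and vice versa); it is generic iff $\mathbf P$ is. Feasible and bounded sign vectors. A covector $Y$ of $\mathcal N$ is feasible if $Y(g)=+$. Feasible topes of $\mathcal N$ (which has no loops) are identified with their restrictions to $E$; $\mathcal F\subset\{+,-\}^E$ denotes the set of feasible topes. A sign vector $\alpha\in\{+,-\}^E$ is unbounded if there is a covector $Z$ of $\widetilde{\mathcal M}$ with $Z(g)=0$, $Z(f)=+$ and $Z(i)\in\{0,\alpha(i)\}$ for all $i\in E$; otherwise it is bounded. $\mathcal B$ is the set of bounded sign vectors and $\mathcal P=\mathcal F\cap\mathcal B$. Parameter spaces. Let $k^E$ have basis $\{t_i\}_{i\in E}$ and $(k^E)^*$ the dual basis $\{u_i\}_{i\in E}$. A subspace $U\subset k^E$ is a parameter space for $M$ if for every basis $b$ of $M$ the composition $U\hookrightarrow k^E\twoheadrightarrow\operatorname{Span}\{t_i: i\in b\}$ is an isomorphism. $U^\perp\subset(k^E)^*$ is the annihilator of $U$; identifying $(k^E)^*$ with $k^E$ via the dual bases, $U^\perp$ is a parameter space for $M^\vee$. The algebra $A$. Two feasible topes are adjacent if they differ in exactly one coordinate; $\alpha^i$ denotes $\alpha$ with the $i$-th sign changed. Let $Q$ be the quiver with vertex set $\mathcal F$ and an arrow in each direction between any two adjacent topes, $P(Q)$ its path algebra over $k$, $e_\alpha$ the trivial path at $\alpha$, and $p(\alpha_1,\dots,\alpha_r)$ the path passing successively through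 $\alpha_1,\dots,\alpha_r$ (paths compose left to right). $\widetilde A(\mathbf P)$ is the quotient of $P(Q)\otimes_k k[u_i: i\in E]$ by the two-sided ideal generated by the relations: (A1) $e_\alpha=0$ for $\alpha\in\mathcal F\setminus\mathcal P$; (A2) $p(\alpha,\gamma,\beta)=p(\alpha,\delta,\beta)$ for any four distinct $\alpha,\beta,\gamma,\delta\in\mathcal F$ with $\alpha$ and $\beta$ each adjacent to both $\gamma$ and $\delta$; (A3) $p(\alpha,\alpha^i,\alpha)=e_\alpha u_i$ whenever $\alpha,\alpha^i\in\mathcal F$. $A(\mathbf P,U)$ is the quotient of $\widetilde A(\mathbf P)$ by the further relations (A4) $x=0$ for $x\in U^\perp$. Grading: $\deg e_\alpha=0$, arrows have degree $1$, $\deg u_i=2$. $A(\mathbf P^\vee,U^\perp)$ is the same construction applied to $\mathbf P^\vee$ and $U^\perp$ (with polynomial variables $t_i$ in place of $u_i$, so that (A4) becomes $x=0$ for $x\in U$). Quadratic algebras. A graded algebra $A$ is quadratic if the natural map $T_{A_0}(A_1)\to A$ is surjective with kernel generated by a sub-bimodule $W\subset A_1\otimes_{A_0}A_1$; its quadratic dual is $A^!=T_{A_0}(A_1^* )/(W^\perp)$, with $A_1^*$ the $k$-dual bimodule ($(e_\alpha A_1e_\beta)^*=e_\beta A_1^*e_\alpha$) and $W^\perp\subset A_1^*\otimes_{A_0}A_1^*\cong(A_1\otimes_{A_0}A_1)^*$ the annihilator of $W$. *)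

theory Defs
  imports
    "HOL-Algebra.QuotRing"
    "HOL-Algebra.Module"
    "HOL-Algebra.Algebraic_Closure_Type"
    "HOL-Library.Poly_Mapping"
    "HOL-Library.Function_Algebras"
begin

text \<open>Frees the identifier \<open>X\<close>.\<close>

no_notation Polynomials.var (\<open>X\<index>\<close>)

section \<open>Sign vectors and oriented matroids\<close>

text \<open>A sign vector on a set \<open>I\<close> is a function that takes the value \<open>Zero\<close> outside \<open>I\<close>.
  Restricting such a function to a smaller set that contains its support does not change it.\<close>

datatype sign = Zero | Pos | Neg

fun opp :: "sign \<Rightarrow> sign" where
  "opp Zero = Zero"
| "opp Pos = Neg"
| "opp Neg = Pos"

definition support :: "('e \<Rightarrow> sign) \<Rightarrow> 'e set" where
  "support Z = {i. Z i \<noteq> Zero}"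

definition sv_comp :: "('e \<Rightarrow> sign) \<Rightarrow> ('e \<Rightarrow> sign) \<Rightarrow> 'e \<Rightarrow> sign" (infixr "\<circ>\<^sub>s" 70) where
  "Z \<circ>\<^sub>s Z' = (\<lambda>i. if Z i \<noteq> Zero then Z i else Z' i)"

definition face_of :: "('e \<Rightarrow> sign) \<Rightarrow> ('e \<Rightarrow> sign) \<Rightarrow> bool" where
  "face_of Z Z' \<longleftrightarrow> Z \<circ>\<^sub>s Z' = Z'"

definition orthogonal_signs :: "('e \<Rightarrow> sign) \<Rightarrow> ('e \<Rightarrow> sign) \<Rightarrow> bool" where
  "orthogonal_signs X Y \<longleftrightarrow>
     support X \<inter> support Y = {} \<or>
     (\<exists>i \<in> support X \<inter> support Y. X i = Y i) \<and> (\<exists>j \<in> support X \<inter> support Y. X j = opp (Y j))"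

record 'e om =
  ground :: "'e set"
  circuits :: "('e \<Rightarrow> sign) set"

definition oriented_matroid :: "'e om \<Rightarrow> bool" where
  "oriented_matroid M \<longleftrightarrow>
     finite (ground M) \<and>
     (\<forall>X \<in> circuits M. support X \<subseteq> ground M \<and> support X \<noteq> {}) \<and>
     (\<forall>X \<in> circuits M. opp \<circ> X \<in> circuits M) \<and>
     (\<forall>X \<in> circuits M. \<forall>Y \<in> circuits M. support X \<subseteq> support Y \<longrightarrow> X = Y \<or> X = opp \<circ> Y) \<and>
     (\<forall>X \<in> circuits M. \<forall>Y \<in> circuits M. \<forall>e. X \<noteq> opp \<circ> Y \<and> X e = Pos \<and> Y e = Neg \<longrightarrow>
        (\<exists>Z \<in> circuits M. Z e = Zero \<and>
           (\<forall>i. Z i = Pos \<longrightarrow> X i = Pos \<or> Y i = Pos) \<and>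
           (\<forall>i. Z i = Neg \<longrightarrow> X i = Neg \<or> Y i = Neg)))"

text \<open>The underlying matroid: its circuits are the supports of the signed circuits.\<close>

definition indep_sets :: "'e om \<Rightarrow> 'e set set" where
  "indep_sets M = {I. I \<subseteq> ground M \<and> (\<forall>X \<in> circuits M. \<not> support X \<subseteq> I)}"

definition matroid_bases :: "'e om \<Rightarrow> 'e set set" where
  "matroid_bases M = {b \<in> indep_sets M. \<forall>I \<in> indep_sets M. b \<subseteq> I \<longrightarrow> I = b}"

definition matroid_rank :: "'e om \<Rightarrow> nat" where
  "matroid_rank M = Max (card ` indep_sets M)"

definition is_loop :: "'e om \<Rightarrow> 'e \<Rightarrow> bool" where
  "is_loop M e \<longleftrightarrow> (\<exists>X \<in> circuits M. support X = {e})"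

definition is_coloop :: "'e om \<Rightarrow> 'e \<Rightarrow> bool" where
  "is_coloop M e \<longleftrightarrow> e \<in> ground M \<and> (\<forall>b \<in> matroid_bases M. e \<in> b)"

text \<open>Cocircuits of the underlying matroid are the minimal sets that meet every basis, i.e. the
  minimal sets contained in no complement of a basis. The signed cocircuits are the signatures of
  these sets orthogonal to all signed circuits.\<close>

definition cocircuit_supports :: "'e om \<Rightarrow> 'e set set" where
  "cocircuit_supports M =
     {D. D \<subseteq> ground M \<and> (\<forall>b \<in> matroid_bases M. D \<inter> b \<noteq> {}) \<and>
         (\<forall>D'. D' \<subset> D \<longrightarrow> (\<exists>b \<in> matroid_bases M. D' \<inter> b = {}))}"

definition cocircuits :: "'e om \<Rightarrow> ('e \<Rightarrow> sign) set" where
  "cocircuits M =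
     {Y. support Y \<in> cocircuit_supports M \<and> (\<forall>X \<in> circuits M. orthogonal_signs X Y)}"

definition om_dual :: "'e om \<Rightarrow> 'e om" where
  "om_dual M = \<lparr>ground = ground M, circuits = cocircuits M\<rparr>"

definition om_delete :: "'e om \<Rightarrow> 'e \<Rightarrow> 'e om" where
  "om_delete M e = \<lparr>ground = ground M - {e}, circuits = {X \<in> circuits M. X e = Zero}\<rparr>"

text \<open>The circuits of a contraction are the nonzero restrictions of circuits that have minimal
  support.\<close>

definition om_contract :: "'e om \<Rightarrow> 'e \<Rightarrow> 'e om" where
  "om_contract M e =
     (let R = {Y. (\<exists>X \<in> circuits M. Y = X(e := Zero)) \<and> support Y \<noteq> {}}
      in \<lparr>ground = ground M - {e}, circuits = {Y \<in> R. \<forall>Y' \<in> R. \<not> support Y' \<subset> support Y}\<rparr>)"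

inductive_set covectors :: "'e om \<Rightarrow> ('e \<Rightarrow> sign) set" for M where
  zero: "(\<lambda>_. Zero) \<in> covectors M"
| compose: "Y \<in> cocircuits M \<Longrightarrow> Z \<in> covectors M \<Longrightarrow> Y \<circ>\<^sub>s Z \<in> covectors M"

definition topes :: "'e om \<Rightarrow> ('e \<Rightarrow> sign) set" where
  "topes M = {T \<in> covectors M. \<forall>Z \<in> covectors M. face_of T Z \<longrightarrow> Z = T}"

definition zero_set :: "'e om \<Rightarrow> ('e \<Rightarrow> sign) \<Rightarrow> 'e set" where
  "zero_set M Z = ground M - support Z"


section \<open>Oriented matroid programs\<close>

record 'e program =
  prog_om :: "'e om"
  prog_g :: 'e
  prog_f :: 'e

definition om_program :: "'e program \<Rightarrow> bool" where
  "om_program P \<longleftrightarrow>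
     oriented_matroid (prog_om P) \<and>
     prog_g P \<in> ground (prog_om P) \<and> prog_f P \<in> ground (prog_om P) \<and> prog_g P \<noteq> prog_f P \<and>
     \<not> is_loop (prog_om P) (prog_g P) \<and> \<not> is_coloop (prog_om P) (prog_f P)"

definition prog_E :: "'e program \<Rightarrow> 'e set" where
  "prog_E P = ground (prog_om P) - {prog_g P, prog_f P}"

definition prog_N :: "'e program \<Rightarrow> 'e om" where
  "prog_N P = om_delete (prog_om P) (prog_f P)"

definition prog_M :: "'e program \<Rightarrow> 'e om" where
  "prog_M P = om_contract (prog_N P) (prog_g P)"

definition prog_rank :: "'e program \<Rightarrow> nat" where
  "prog_rank P = matroid_rank (prog_M P)"

definition generic_program :: "'e program \<Rightarrow> bool" where
  "generic_program P \<longleftrightarrow>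
     (\<forall>Y \<in> cocircuits (prog_N P).
        card (zero_set (prog_N P) Y) > prog_rank P \<longrightarrow> Y (prog_g P) = Zero) \<and>
     (\<forall>X \<in> circuits (om_contract (prog_om P) (prog_g P)).
        card (zero_set (om_contract (prog_om P) (prog_g P)) X) > card (prog_E P) - prog_rank P \<longrightarrow>
        X (prog_f P) = Zero)"

definition dual_program :: "'e program \<Rightarrow> 'e program" where
  "dual_program P = \<lparr>prog_om = om_dual (prog_om P), prog_g = prog_f P, prog_f = prog_g P\<rparr>"

definition feasible_topes :: "'e program \<Rightarrow> ('e \<Rightarrow> sign) set" where
  "feasible_topes P = {T(prog_g P := Zero) | T. T \<in> topes (prog_N P) \<and> T (prog_g P) = Pos}"

definition unbounded :: "'e program \<Rightarrow> ('e \<Rightarrow> sign) \<Rightarrow> bool" where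
  "unbounded P \<alpha> \<longleftrightarrow>
     (\<exists>Z \<in> covectors (prog_om P). Z (prog_g P) = Zero \<and> Z (prog_f P) = Pos \<and>
        (\<forall>i \<in> prog_E P. Z i \<in> {Zero, \<alpha> i}))"

definition bounded_signs :: "'e program \<Rightarrow> ('e \<Rightarrow> sign) set" where
  "bounded_signs P = {\<alpha>. support \<alpha> = prog_E P \<and> \<not> unbounded P \<alpha>}"

definition bounded_feasible :: "'e program \<Rightarrow> ('e \<Rightarrow> sign) set" where
  "bounded_feasible P = feasible_topes P \<inter> bounded_signs P"

definition adjacent :: "('e \<Rightarrow> sign) \<Rightarrow> ('e \<Rightarrow> sign) \<Rightarrow> bool" where
  "adjacent \<alpha> \<beta> \<longleftrightarrow> (\<exists>!i. \<alpha> i \<noteq> \<beta> i)"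

definition flip :: "('e \<Rightarrow> sign) \<Rightarrow> 'e \<Rightarrow> 'e \<Rightarrow> sign" where
  "flip \<alpha> i = \<alpha>(i := opp (\<alpha> i))"


section \<open>Parameter spaces\<close>

text \<open>The space \<open>k\<^sup>E\<close> consists of the functions vanishing outside \<open>E\<close>; the dual space is identified
  with it through the dual bases.\<close>

definition coord_space :: "'e set \<Rightarrow> ('e \<Rightarrow> 'k::field) set" where
  "coord_space E = {v. \<forall>i. i \<notin> E \<longrightarrow> v i = 0}"

definition is_subspace :: "('e \<Rightarrow> 'k::field) set \<Rightarrow> bool" where
  "is_subspace = Modules.module.subspace (\<lambda>c v i. c * v i)"

definition coord_proj :: "'e set \<Rightarrow> ('e \<Rightarrow> 'k::field) \<Rightarrow> 'e \<Rightarrow> 'k" where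
  "coord_proj b v = (\<lambda>i. if i \<in> b then v i else 0)"

definition parameter_space :: "'e om \<Rightarrow> ('e \<Rightarrow> 'k::field) set \<Rightarrow> bool" where
  "parameter_space M U \<longleftrightarrow>
     U \<subseteq> coord_space (ground M) \<and> is_subspace U \<and>
     (\<forall>b \<in> matroid_bases M. bij_betw (coord_proj b) U (coord_space b))"

definition annihilator :: "'e set \<Rightarrow> ('e \<Rightarrow> 'k::field) set \<Rightarrow> ('e \<Rightarrow> 'k) set" where
  "annihilator E U = {x \<in> coord_space E. \<forall>v \<in> U. (\<Sum>i\<in>E. x i * v i) = 0}"


section \<open>Graded algebras over a field\<close>

record ('k, 'a) galg = "('k, 'a) module" +
  hcomp :: "nat \<Rightarrow> 'a set"

definition graded_algebra :: "('k::field, 'a) galg \<Rightarrow> bool" where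
  "graded_algebra A \<longleftrightarrow>
     Ring.ring A \<and> Module.module (ring_of_type_algebra :: 'k ring) A \<and>
     (\<forall>c. \<forall>x \<in> carrier A. \<forall>y \<in> carrier A.
        (c \<odot>\<^bsub>A\<^esub> x) \<otimes>\<^bsub>A\<^esub> y = c \<odot>\<^bsub>A\<^esub> (x \<otimes>\<^bsub>A\<^esub> y) \<and> x \<otimes>\<^bsub>A\<^esub> (c \<odot>\<^bsub>A\<^esub> y) = c \<odot>\<^bsub>A\<^esub> (x \<otimes>\<^bsub>A\<^esub> y)) \<and>
     (\<forall>n. submodule (hcomp A n) (ring_of_type_algebra :: 'k ring) A) \<and>
     \<one>\<^bsub>A\<^esub> \<in> hcomp A 0 \<and>
     (\<forall>m n. \<forall>x \<in> hcomp A m. \<forall>y \<in> hcomp A n. x \<otimes>\<^bsub>A\<^esub> y \<in> hcomp A (m + n)) \<and>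
     (\<forall>x \<in> carrier A. \<exists>!c. (\<forall>n. c n \<in> hcomp A n) \<and> finite {n. c n \<noteq> \<zero>\<^bsub>A\<^esub>} \<and>
        x = (\<Oplus>\<^bsub>A\<^esub>n\<in>{n. c n \<noteq> \<zero>\<^bsub>A\<^esub>}. c n))"

definition galg_quot :: "('k, 'a) galg \<Rightarrow> 'a set \<Rightarrow> ('k, 'a set) galg" where
  "galg_quot A I =
     \<lparr>carrier = carrier (A Quot I), monoid.mult = monoid.mult (A Quot I), one = monoid.one (A Quot I),
      ring.zero = ring.zero (A Quot I), add = ring.add (A Quot I),
      module.smult = (\<lambda>c X. \<Union>x\<in>X. I +>\<^bsub>A\<^esub> (c \<odot>\<^bsub>A\<^esub> x)),
      hcomp = (\<lambda>n. (\<lambda>x. I +>\<^bsub>A\<^esub> x) ` hcomp A n)\<rparr>"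

definition galg_isomorphic :: "('k, 'a) galg \<Rightarrow> ('k, 'b) galg \<Rightarrow> bool" where
  "galg_isomorphic A B \<longleftrightarrow>
     (\<exists>h \<in> ring_iso A B.
        (\<forall>c. \<forall>x \<in> carrier A. h (c \<odot>\<^bsub>A\<^esub> x) = c \<odot>\<^bsub>B\<^esub> h x) \<and>
        (\<forall>n. h ` hcomp A n = hcomp B n))"


section \<open>Tensor algebras and quadratic duality\<close>

text \<open>The free algebra on a set \<open>S\<close> of letters, graded by a degree function on the letters; its
  elements are finitely supported functions on words.\<close>

definition free_algebra :: "'x set \<Rightarrow> ('x \<Rightarrow> nat) \<Rightarrow> ('k::field, 'x list \<Rightarrow>\<^sub>0 'k) galg" where
  "free_algebra S dg =
     \<lparr>carrier = {x. \<forall>w \<in> Poly_Mapping.keys x. set w \<subseteq> S},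
      monoid.mult = (\<lambda>x y. \<Sum>v\<in>Poly_Mapping.keys x. \<Sum>w\<in>Poly_Mapping.keys y.
         Poly_Mapping.single (v @ w) (Poly_Mapping.lookup x v * Poly_Mapping.lookup y w)),
      one = Poly_Mapping.single [] 1, ring.zero = 0, add = (+),
      module.smult = (\<lambda>c. Poly_Mapping.map ((*) c)),
      hcomp = (\<lambda>n. {x. \<forall>w \<in> Poly_Mapping.keys x. set w \<subseteq> S \<and> sum_list (map dg w) = n})\<rparr>"

text \<open>A bimodule over a \<open>k\<close>-algebra, on which the two induced actions of \<open>k\<close> agree.\<close>

record ('k, 'r, 'v) bimodule = "'v partial_object" +
  badd :: "'v \<Rightarrow> 'v \<Rightarrow> 'v"
  bscale :: "'k \<Rightarrow> 'v \<Rightarrow> 'v"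
  lact :: "'r \<Rightarrow> 'v \<Rightarrow> 'v"
  ract :: "'v \<Rightarrow> 'r \<Rightarrow> 'v"

text \<open>The tensor algebra \<open>T\<^sub>R(V) = R \<oplus> V \<oplus> (V \<otimes>\<^sub>R V) \<oplus> \<dots>\<close> is constructed by generators and
  relations as the universal \<open>k\<close>-algebra with an algebra map from \<open>R\<close> and an \<open>R\<close>-bimodule map
  from \<open>V\<close>. The letters are the elements of \<open>R\<close> (in degree 0) and of \<open>V\<close> (in degree 1).\<close>

abbreviation rgen :: "'r \<Rightarrow> ('r + 'v) list \<Rightarrow>\<^sub>0 'k::field" where
  "rgen r \<equiv> Poly_Mapping.single [Inl r] 1"

abbreviation vgen :: "'v \<Rightarrow> ('r + 'v) list \<Rightarrow>\<^sub>0 'k::field" where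
  "vgen v \<equiv> Poly_Mapping.single [Inr v] 1"

definition tensor_free :: "('k::field, 'r, 'z) module_scheme \<Rightarrow> ('k, 'r, 'v) bimodule \<Rightarrow>
    ('k, ('r + 'v) list \<Rightarrow>\<^sub>0 'k) galg" where
  "tensor_free R V = free_algebra (Inl ` carrier R \<union> Inr ` carrier V) (case_sum (\<lambda>_. 0) (\<lambda>_. 1))"

definition tensor_relations :: "('k::field, 'r, 'z) module_scheme \<Rightarrow> ('k, 'r, 'v) bimodule \<Rightarrow>
    (('r + 'v) list \<Rightarrow>\<^sub>0 'k) set" where
  "tensor_relations R V =
     {rgen (r \<oplus>\<^bsub>R\<^esub> s) - (rgen r + rgen s) | r s. r \<in> carrier R \<and> s \<in> carrier R} \<union>
     {rgen (c \<odot>\<^bsub>R\<^esub> r) - Poly_Mapping.single [Inl r] c | c r. r \<in> carrier R} \<union>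
     {rgen (r \<otimes>\<^bsub>R\<^esub> s) - Poly_Mapping.single [Inl r, Inl s] 1 | r s. r \<in> carrier R \<and> s \<in> carrier R} \<union>
     {rgen \<one>\<^bsub>R\<^esub> - Poly_Mapping.single [] 1} \<union>
     {vgen (badd V v w) - (vgen v + vgen w) | v w. v \<in> carrier V \<and> w \<in> carrier V} \<union>
     {vgen (bscale V c v) - Poly_Mapping.single [Inr v] c | c v. v \<in> carrier V} \<union>
     {vgen (lact V r v) - Poly_Mapping.single [Inl r, Inr v] 1 | r v. r \<in> carrier R \<and> v \<in> carrier V} \<union>
     {vgen (ract V v r) - Poly_Mapping.single [Inr v, Inl r] 1 | r v. r \<in> carrier R \<and> v \<in> carrier V}"

definition tensor_ideal :: "('k::field, 'r, 'z) module_scheme \<Rightarrow> ('k, 'r, 'v) bimodule \<Rightarrow>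
    (('r + 'v) list \<Rightarrow>\<^sub>0 'k) set" where
  "tensor_ideal R V = Idl\<^bsub>tensor_free R V\<^esub> (tensor_relations R V)"

definition tensor_algebra :: "('k::field, 'r, 'z) module_scheme \<Rightarrow> ('k, 'r, 'v) bimodule \<Rightarrow>
    ('k, (('r + 'v) list \<Rightarrow>\<^sub>0 'k) set) galg" where
  "tensor_algebra R V = galg_quot (tensor_free R V) (tensor_ideal R V)"

text \<open>The element \<open>v\<^sub>1 \<otimes> w\<^sub>1 + \<dots> + v\<^sub>m \<otimes> w\<^sub>m\<close> of \<open>V \<otimes>\<^sub>R V\<close>, the degree 2 part of \<open>T\<^sub>R(V)\<close>.\<close>

definition tensor_sum :: "('k::field, 'r, 'z) module_scheme \<Rightarrow> ('k, 'r, 'v) bimodule \<Rightarrow>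
    ('v \<times> 'v) list \<Rightarrow> (('r + 'v) list \<Rightarrow>\<^sub>0 'k) set" where
  "tensor_sum R V ys =
     tensor_ideal R V +>\<^bsub>tensor_free R V\<^esub>
       (\<Sum>(v, w)\<leftarrow>ys. Poly_Mapping.single [Inr v, Inr w] 1)"

definition degree_zero :: "('k, 'a) galg \<Rightarrow> ('k, 'a) galg" where
  "degree_zero A = A\<lparr>carrier := hcomp A 0\<rparr>"

definition degree_one :: "('k, 'a) galg \<Rightarrow> ('k, 'a, 'a) bimodule" where
  "degree_one A =
     \<lparr>carrier = hcomp A 1, badd = ring.add A, bscale = module.smult A,
      lact = monoid.mult A, ract = monoid.mult A\<rparr>"

definition eval_word :: "('k, 'a) galg \<Rightarrow> ('a + 'a) list \<Rightarrow> 'a" where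
  "eval_word A w = foldr (\<lambda>s x. case_sum id id s \<otimes>\<^bsub>A\<^esub> x) w \<one>\<^bsub>A\<^esub>"

definition eval_free :: "('k::field, 'a) galg \<Rightarrow> (('a + 'a) list \<Rightarrow>\<^sub>0 'k) \<Rightarrow> 'a" where
  "eval_free A x = (\<Oplus>\<^bsub>A\<^esub>w\<in>Poly_Mapping.keys x. Poly_Mapping.lookup x w \<odot>\<^bsub>A\<^esub> eval_word A w)"

text \<open>The natural map \<open>T\<^bsub>A_0\<^esub>(A\<^sub>1) \<rightarrow> A\<close>, on the cosets that make up the tensor algebra.\<close>

definition natural_map :: "('k::field, 'a) galg \<Rightarrow> (('a + 'a) list \<Rightarrow>\<^sub>0 'k) set \<Rightarrow> 'a" where
  "natural_map A X = the_elem (eval_free A ` X)"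

definition sub_bimodule_deg2 :: "('k, 'a) galg \<Rightarrow> 'a set \<Rightarrow> bool" where
  "sub_bimodule_deg2 T W \<longleftrightarrow>
     W \<subseteq> hcomp T 2 \<and> subgroup W (add_monoid T) \<and>
     (\<forall>a \<in> hcomp T 0. \<forall>x \<in> W. a \<otimes>\<^bsub>T\<^esub> x \<in> W \<and> x \<otimes>\<^bsub>T\<^esub> a \<in> W)"

text \<open>\<open>A\<close> is quadratic, and \<open>W \<subseteq> A\<^sub>1 \<otimes> A\<^sub>1\<close> is its bimodule of relations.\<close>

definition quadratic_with :: "('k::field, 'a) galg \<Rightarrow> (('a + 'a) list \<Rightarrow>\<^sub>0 'k) set set \<Rightarrow> bool" where
  "quadratic_with A W \<longleftrightarrow>
     (let T = tensor_algebra (degree_zero A) (degree_one A)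
      in graded_algebra A \<and>
         natural_map A ` carrier T = carrier A \<and>
         sub_bimodule_deg2 T W \<and>
         a_kernel T A (natural_map A) = Idl\<^bsub>T\<^esub> W)"

definition quadratic :: "('k::field, 'a) galg \<Rightarrow> bool" where
  "quadratic A \<longleftrightarrow> (\<exists>W. quadratic_with A W)"

definition dual_bimodule :: "('k::field, 'r, 'v) bimodule \<Rightarrow> ('k, 'r, 'v \<Rightarrow> 'k) bimodule" where
  "dual_bimodule V =
     \<lparr>carrier = {\<phi>. (\<forall>v \<in> carrier V. \<forall>w \<in> carrier V. \<phi> (badd V v w) = \<phi> v + \<phi> w) \<and>
                    (\<forall>c. \<forall>v \<in> carrier V. \<phi> (bscale V c v) = c * \<phi> v) \<and>
                    (\<forall>v. v \<notin> carrier V \<longrightarrow> \<phi> v = 0)},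
      badd = (\<lambda>\<phi> \<psi> v. \<phi> v + \<psi> v),
      bscale = (\<lambda>c \<phi> v. c * \<phi> v),
      lact = (\<lambda>a \<phi> v. if v \<in> carrier V then \<phi> (ract V v a) else 0),
      ract = (\<lambda>\<phi> a v. if v \<in> carrier V then \<phi> (lact V a v) else 0)\<rparr>"

text \<open>For \<open>A\<^sub>0 = \<Oplus>\<^sub>\<alpha> k e\<^sub>\<alpha>\<close> with orthogonal idempotents \<open>e\<^sub>\<alpha>\<close>, the isomorphism of
  \<open>A\<^sub>1\<^sup>* \<otimes> A\<^sub>1\<^sup>*\<close> with \<open>(A\<^sub>1 \<otimes> A\<^sub>1)\<^sup>*\<close> (tensor products over \<open>A\<^sub>0\<close>) sends \<open>\<phi> \<otimes> \<psi>\<close> to the functional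
  \<open>v \<otimes> w \<mapsto> \<Sum>\<^sub>\<alpha> \<psi>(v e\<^sub>\<alpha>) \<phi>(e\<^sub>\<alpha> w)\<close>. The two factors are swapped because the \<open>k\<close>-dual of
  \<open>e\<^sub>\<alpha> A\<^sub>1 e\<^sub>\<beta>\<close> is \<open>e\<^sub>\<beta> A\<^sub>1\<^sup>* e\<^sub>\<alpha>\<close>.\<close>

definition dual_pairing :: "('k::field, 'a) galg \<Rightarrow> 'v set \<Rightarrow> ('v \<Rightarrow> 'a) \<Rightarrow>
    (('a \<Rightarrow> 'k) \<times> ('a \<Rightarrow> 'k)) list \<Rightarrow> ('a \<times> 'a) list \<Rightarrow> 'k" where
  "dual_pairing A V e xs ys =
     (\<Sum>(\<phi>, \<psi>)\<leftarrow>xs. \<Sum>(v, w)\<leftarrow>ys. \<Sum>\<alpha>\<in>V. \<psi> (v \<otimes>\<^bsub>A\<^esub> e \<alpha>) * \<phi> (e \<alpha> \<otimes>\<^bsub>A\<^esub> w))"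

definition perp :: "('k::field, 'a) galg \<Rightarrow> 'v set \<Rightarrow> ('v \<Rightarrow> 'a) \<Rightarrow>
    (('a + 'a) list \<Rightarrow>\<^sub>0 'k) set set \<Rightarrow> (('a + ('a \<Rightarrow> 'k)) list \<Rightarrow>\<^sub>0 'k) set set" where
  "perp A V e W =
     (let A1 = degree_one A; D1 = dual_bimodule A1
      in {tensor_sum (degree_zero A) D1 xs | xs.
            set xs \<subseteq> carrier D1 \<times> carrier D1 \<and>
            (\<forall>ys. set ys \<subseteq> carrier A1 \<times> carrier A1 \<and> tensor_sum (degree_zero A) A1 ys \<in> W \<longrightarrow>
               dual_pairing A V e xs ys = 0)})"

definition quadratic_dual :: "('k::field, 'a) galg \<Rightarrow> 'v set \<Rightarrow> ('v \<Rightarrow> 'a) \<Rightarrow>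
    (('a + 'a) list \<Rightarrow>\<^sub>0 'k) set set \<Rightarrow> ('k, (('a + ('a \<Rightarrow> 'k)) list \<Rightarrow>\<^sub>0 'k) set set) galg" where
  "quadratic_dual A V e W =
     (let T = tensor_algebra (degree_zero A) (dual_bimodule (degree_one A))
      in galg_quot T (Idl\<^bsub>T\<^esub> (perp A V e W)))"


section \<open>The algebra of a program\<close>

text \<open>Polynomials over \<open>k\<close> in variables indexed by \<open>'e\<close>.\<close>

type_synonym ('e, 'k) mpoly = "('e \<Rightarrow>\<^sub>0 nat) \<Rightarrow>\<^sub>0 'k"

abbreviation pconst :: "'k::field \<Rightarrow> ('e, 'k) mpoly" where
  "pconst c \<equiv> Poly_Mapping.single 0 c"

definition pvar :: "'e \<Rightarrow> ('e, 'k::field) mpoly" where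
  "pvar i = Poly_Mapping.single (Poly_Mapping.single i 1) 1"

definition monom_degree :: "('e \<Rightarrow>\<^sub>0 nat) \<Rightarrow> nat" where
  "monom_degree m = (\<Sum>i\<in>Poly_Mapping.keys m. Poly_Mapping.lookup m i)"

text \<open>A path in a quiver with at most one arrow between two vertices is the nonempty list of the
  vertices it passes through. The algebra \<open>P(Q) \<otimes> k[u\<^sub>i : i \<in> E]\<close> is the free module over the
  polynomial ring on the set of paths.\<close>

definition quiver_path :: "'v set \<Rightarrow> ('v \<Rightarrow> 'v \<Rightarrow> bool) \<Rightarrow> 'v list \<Rightarrow> bool" where
  "quiver_path V adj p \<longleftrightarrow> p \<noteq> [] \<and> set p \<subseteq> V \<and> successively adj p"

definition quiver_algebra :: "'v set \<Rightarrow> ('v \<Rightarrow> 'v \<Rightarrow> bool) \<Rightarrow> 'e set \<Rightarrow>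
    ('k::field, 'v list \<Rightarrow>\<^sub>0 ('e, 'k) mpoly) galg" where
  "quiver_algebra V adj E =
     (let S = {x. \<forall>p \<in> Poly_Mapping.keys x. quiver_path V adj p \<and>
                    (\<forall>m \<in> Poly_Mapping.keys (Poly_Mapping.lookup x p). Poly_Mapping.keys m \<subseteq> E)}
      in \<lparr>carrier = S,
          monoid.mult = (\<lambda>x y. \<Sum>p\<in>Poly_Mapping.keys x. \<Sum>q\<in>Poly_Mapping.keys y.
             if last p = hd q
             then Poly_Mapping.single (p @ tl q) (Poly_Mapping.lookup x p * Poly_Mapping.lookup y q)
             else 0),
          one = (\<Sum>v\<in>V. Poly_Mapping.single [v] 1), ring.zero = 0, add = (+),
          module.smult = (\<lambda>c. Poly_Mapping.map ((*) (pconst c))),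
          hcomp = (\<lambda>n. {x \<in> S. \<forall>p \<in> Poly_Mapping.keys x. \<forall>m \<in> Poly_Mapping.keys (Poly_Mapping.lookup x p).
             (length p - 1) + 2 * monom_degree m = n})\<rparr>)"

definition prog_quiver_algebra ::
    "'e program \<Rightarrow> ('k::field, ('e \<Rightarrow> sign) list \<Rightarrow>\<^sub>0 ('e, 'k) mpoly) galg" where
  "prog_quiver_algebra P = quiver_algebra (feasible_topes P) adjacent (prog_E P)"

abbreviation qpath :: "'v list \<Rightarrow> 'v list \<Rightarrow>\<^sub>0 ('e, 'k::field) mpoly" where
  "qpath p \<equiv> Poly_Mapping.single p 1"

definition rel_A1 :: "'e program \<Rightarrow> (('e \<Rightarrow> sign) list \<Rightarrow>\<^sub>0 ('e, 'k::field) mpoly) set" where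
  "rel_A1 P = {qpath [\<alpha>] | \<alpha>. \<alpha> \<in> feasible_topes P - bounded_feasible P}"

definition rel_A2 :: "'e program \<Rightarrow> (('e \<Rightarrow> sign) list \<Rightarrow>\<^sub>0 ('e, 'k::field) mpoly) set" where
  "rel_A2 P = {qpath [\<alpha>, \<gamma>, \<beta>] - qpath [\<alpha>, \<delta>, \<beta>] | \<alpha> \<beta> \<gamma> \<delta>.
     {\<alpha>, \<beta>, \<gamma>, \<delta>} \<subseteq> feasible_topes P \<and> distinct [\<alpha>, \<beta>, \<gamma>, \<delta>] \<and>
     adjacent \<alpha> \<gamma> \<and> adjacent \<alpha> \<delta> \<and> adjacent \<beta> \<gamma> \<and> adjacent \<beta> \<delta>}"

definition rel_A3 :: "'e program \<Rightarrow> (('e \<Rightarrow> sign) list \<Rightarrow>\<^sub>0 ('e, 'k::field) mpoly) set" where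
  "rel_A3 P = {qpath [\<alpha>, flip \<alpha> i, \<alpha>] - Poly_Mapping.single [\<alpha>] (pvar i) | \<alpha> i.
     i \<in> prog_E P \<and> \<alpha> \<in> feasible_topes P \<and> flip \<alpha> i \<in> feasible_topes P}"

text \<open>A linear form \<open>x = \<Sum>\<^sub>i x\<^sub>i u\<^sub>i\<close> corresponds to the element \<open>\<Sum>\<^sub>\<alpha> e\<^sub>\<alpha> x\<close> of
  \<open>P(Q) \<otimes> k[u\<^sub>i]\<close>.\<close>

definition rel_A4 :: "'e program \<Rightarrow> ('e \<Rightarrow> 'k) set \<Rightarrow>
    (('e \<Rightarrow> sign) list \<Rightarrow>\<^sub>0 ('e, 'k::field) mpoly) set" where
  "rel_A4 P U = {(\<Sum>\<alpha>\<in>feasible_topes P.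
       Poly_Mapping.single [\<alpha>] (\<Sum>i\<in>prog_E P. pconst (x i) * pvar i)) | x.
     x \<in> annihilator (prog_E P) U}"

text \<open>The relations in \<open>rel_A1\<close>, \<open>rel_A2\<close>, \<open>rel_A3\<close> and the further relations
  \<open>rel_A4\<close> are imposed in a single quotient. For the dual program with parameter space
  \<open>U\<^sup>\<bottom>\<close>, the linear forms in \<open>rel_A4\<close> are those in \<open>(U\<^sup>\<bottom>)\<^sup>\<bottom> = U\<close>.\<close>

definition prog_ideal :: "'e program \<Rightarrow> ('e \<Rightarrow> 'k) set \<Rightarrow>
    (('e \<Rightarrow> sign) list \<Rightarrow>\<^sub>0 ('e, 'k::field) mpoly) set" where
  "prog_ideal P U =
     Idl\<^bsub>prog_quiver_algebra P\<^esub> (rel_A1 P \<union> rel_A2 P \<union> rel_A3 P \<union> rel_A4 P U)"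

definition prog_algebra :: "'e program \<Rightarrow> ('e \<Rightarrow> 'k) set \<Rightarrow>
    ('k::field, (('e \<Rightarrow> sign) list \<Rightarrow>\<^sub>0 ('e, 'k) mpoly) set) galg" where
  "prog_algebra P U = galg_quot (prog_quiver_algebra P) (prog_ideal P U)"

definition prog_idem :: "'e program \<Rightarrow> ('e \<Rightarrow> 'k) set \<Rightarrow> ('e \<Rightarrow> sign) \<Rightarrow>
    (('e \<Rightarrow> sign) list \<Rightarrow>\<^sub>0 ('e, 'k::field) mpoly) set" where
  "prog_idem P U \<alpha> = prog_ideal P U +>\<^bsub>prog_quiver_algebra P\<^esub> qpath [\<alpha>]"

end

(* Next to a feasible tope there is a vertex of the arrangement, given by a basis of M. There the
   parameter space condition writes every u_i, modulo (A4), as a linear combination of loops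
   p(alpha, alpha^j, alpha). Vertices common to adjacent topes show that these combinations are
   compatible with the arrows. So the variables can be eliminated, and what remains are quadratic
   relations in the arrows: those along squares, and linear relations between the loops at a tope.

   By the Farkas lemma for oriented matroids the bounded feasible topes of P are the topes that are
   feasible both for P and for its dual, and a neighbour of such a tope is feasible for one of the
   two. Hence the relations of A(P, U) and of the dual algebra are orthogonal complements, one pair
   (alpha, beta) of end points at a time. For alpha different from beta there are at most two paths
   of length 2. If both are bounded, each algebra identifies them, and signs on the arrows turn one
   of these relations into the annihilator of the other. If only one is bounded, it vanishes in
   exactly one of the two algebras. For alpha = beta the linear relations between loops on the two
   sides annihilate each other, again because of the vertex next to alpha. *)
theory Submission
  imports Defs
begin

text \<open>Everything is checked on generators; no basis of the algebra beyond degree 1 is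
  computed. Kernels are identified by two maps that are inverse on letters: \<open>phi\<close> from
  the free algebra behind a tensor algebra to the quiver algebra, and \<open>Theta\<close> back,
  each respecting relations only modulo an ideal. \<open>Theta\<close> is built once, in the locale
  \<open>quad_rep\<close>, and used twice: modulo the ideal generated by the degree 2 kernel, which
  gives quadraticity, and modulo the ideal generated by the annihilator of the quadratic relations,
  which gives the dual. Two features of the formulation shape the rest. Oriented matroids are given
  by circuits, and cocircuits are defined by orthogonality, so the existence of signed cocircuits,
  the painting lemma and the axioms for duals and minors have to be derived. And the dual is claimed
  for every relation space \<open>W\<close>, so \<open>W\<close> has to be recognised as the whole
  degree 2 part of the ideal it generates. Linear functionals vanishing on the quiver ideal give the
  coordinates in degrees 0 and 1 and also the elements of the annihilator of
  \<open>W\<close>.\<close>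

abbreviation (input) "single \<equiv> Poly_Mapping.single"
abbreviation (input) "lookup \<equiv> Poly_Mapping.lookup"
abbreviation (input) "keys \<equiv> Poly_Mapping.keys"

section \<open>Signs and orthogonality of sign vectors\<close>

lemma opp_simps [simp]: "opp (opp s) = s" "opp s = Zero \<longleftrightarrow> s = Zero" "opp s = s \<longleftrightarrow> s = Zero"
 "s = opp s \<longleftrightarrow> s = Zero" "opp s = opp t \<longleftrightarrow> s = t"
 by (cases s; cases t; simp)+

lemma sign_cases: "s ~= Zero ==> t ~= Zero ==> s = t | s = opp t"
 by (cases s; cases t; simp)

lemma opp_opp_comp [simp]: "opp \<circ> (opp \<circ> X) = X"
 by (simp add: fun_eq_iff)

lemma support_opp [simp]: "support (opp \<circ> X) = support X"
 by (simp add: support_def)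

lemma mem_support: "i : support X \<longleftrightarrow> X i ~= Zero"
 by (simp add: support_def)

lemma orthogonal_signs_sym: "orthogonal_signs X Y ==> orthogonal_signs Y X"
 unfolding orthogonal_signs_def by (metis Int_commute opp_simps(1))

lemma orthogonal_signs_opp [simp]: "orthogonal_signs (opp \<circ> X) Y \<longleftrightarrow> orthogonal_signs X Y"
proof -
 have "orthogonal_signs X Y ==> orthogonal_signs (opp \<circ> X) Y" for X
  unfolding orthogonal_signs_def by (simp, metis opp_simps(1))
 from this[of X] this[of "opp \<circ> X"] show ?thesis by auto
qed

lemma orthogonal_signs_opp2 [simp]: "orthogonal_signs X (opp \<circ> Y) \<longleftrightarrow> orthogonal_signs X Y"
 using orthogonal_signs_opp orthogonal_signs_sym by metis

lemma not_orthogonal_conformal: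
 assumes "X e = Y e" "X e ~= Zero" "!!i. X i ~= Zero ==> Y i ~= Zero ==> X i = Y i"
 shows "~ orthogonal_signs X Y"
proof
 assume "orthogonal_signs X Y"
 moreover have "e : support X \<inter> support Y" using assms by (auto simp: mem_support)
 ultimately obtain j where "X j ~= Zero" "Y j ~= Zero" "X j = opp (Y j)"
  unfolding orthogonal_signs_def by (auto simp: mem_support)
 then show False using assms(3)[of j] by simp
qed

lemma orthogonal_signsI:
 assumes "!!i. X i ~= Zero ==> Y i ~= Zero ==> \<exists>j. X j ~= Zero & X j = opp (Y j)"
  and "!!i. X i ~= Zero ==> Y i ~= Zero ==> \<exists>j. X j ~= Zero & X j = Y j"
 shows "orthogonal_signs X Y"
proof (cases "support X \<inter> support Y = {}")
 case False
 then obtain i where i: "X i ~= Zero" "Y i ~= Zero" by (auto simp: mem_support)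
 obtain j where "X j ~= Zero" "X j = opp (Y j)" using assms(1)[OF i] by auto
 moreover obtain l where "X l ~= Zero" "X l = Y l" using assms(2)[OF i] by auto
 ultimately show ?thesis unfolding orthogonal_signs_def
  by (metis IntI mem_support opp_simps(2))
qed (simp add: orthogonal_signs_def)

text \<open>The second case is the first one for \<open>opp \<circ> X\<close>. Later proofs settle
  the conformal case and reduce the other to it, as all sets of vectors involved are closed under
  \<open>opp\<close>.\<close>

lemma not_orthogonal_cases:
 assumes "~ orthogonal_signs X Y"
 obtains "!!i. X i ~= Zero ==> Y i ~= Zero ==> X i = Y i" "\<exists>i. X i ~= Zero & Y i ~= Zero"
 | "!!i. X i ~= Zero ==> Y i ~= Zero ==> X i = opp (Y i)" "\<exists>i. X i ~= Zero & Y i ~= Zero"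
proof -
 have 1: "\<exists>i. X i ~= Zero & Y i ~= Zero"
  using assms by (auto simp: orthogonal_signs_def mem_support)
 show ?thesis
 proof (cases "\<exists>i. X i ~= Zero & Y i ~= Zero & X i = opp (Y i)")
  case True
  then have "~ (\<exists>i. X i ~= Zero & Y i ~= Zero & X i = Y i)"
   using assms unfolding orthogonal_signs_def mem_support Bex_def Int_iff by metis
  then show ?thesis using 1 that(2) sign_cases by metis
 next
  case False
  then show ?thesis using 1 that(1) sign_cases by metis
 qed
qed

lemma finite_minimal_subset:
 assumes "finite S" "P S"
 obtains T where "T \<subseteq> S" "P T" "!!T'. T' \<subset> T ==> ~ P T'"
 using assms
proof (induction S arbitrary: thesis rule: finite_psubset_induct)
 case (psubset S)
 show ?case
 proof (cases "\<exists>T'. T' \<subset> S & P T'")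
  case True
  then obtain T' where T': "T' \<subset> S" "P T'" by blast
  show ?thesis
   by (rule psubset.IH[OF T'(1) _ T'(2)]) (use psubset.prems(1) T'(1) in blast)
 next
  case False
  show ?thesis
   by (rule psubset.prems(1)[OF subset_refl psubset.prems(2)]) (use False in blast)
 qed
qed

section \<open>Independent sets, bases and unsigned cocircuits of an oriented matroid\<close>

locale om =
 fixes M :: "'e om"
 assumes om: "oriented_matroid M"
begin

lemma finite_ground: "finite (ground M)"
 using om by (simp add: oriented_matroid_def)

lemma circuit_ground: "X : circuits M ==> support X \<subseteq> ground M"
 using om by (simp add: oriented_matroid_def)

lemma circuit_nonempty: "X : circuits M ==> support X ~= {}"
 using om by (simp add: oriented_matroid_def)

lemma circuit_opp: "X : circuits M ==> opp \<circ> X : circuits M"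
 using om by (simp add: oriented_matroid_def)

lemma circuit_incomparable:
 "X : circuits M ==> Y : circuits M ==> support X \<subseteq> support Y ==> X = Y | X = opp \<circ> Y"
 using om unfolding oriented_matroid_def by blast

text \<open>Symmetric form of the elimination axiom: it no longer matters which of the two circuits
  is positive at \<open>e\<close>.\<close>

lemma circuit_elim:
 assumes "X : circuits M" "Y : circuits M" "X e = opp (Y e)" "X e ~= Zero" "X ~= opp \<circ> Y"
 obtains Z where "Z : circuits M" "Z e = Zero" "!!i. Z i ~= Zero ==> Z i = X i | Z i = Y i"
proof -
 have *: "\<exists>Z \<in> circuits M. Z e = Zero &
      (\<forall>i. Z i = Pos --> X i = Pos | Y i = Pos) &
      (\<forall>i. Z i = Neg --> X i = Neg | Y i = Neg)"
  if "X : circuits M" "Y : circuits M" "X e = Pos" "Y e = Neg" "X ~= opp \<circ> Y" for X Y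
  using om that unfolding oriented_matroid_def by blast
 have "Y ~= opp \<circ> X" using assms(5) by auto
 moreover have "X e = Pos & Y e = Neg | Y e = Pos & X e = Neg"
  using assms(3,4) by (cases "X e"; cases "Y e"; simp)
 ultimately have "\<exists>Z \<in> circuits M. Z e = Zero &
      (\<forall>i. Z i = Pos --> X i = Pos | Y i = Pos) &
      (\<forall>i. Z i = Neg --> X i = Neg | Y i = Neg)"
  using *[of X Y] *[of Y X] assms by metis
 then obtain Z where Z: "Z : circuits M" "Z e = Zero"
      "\<forall>i. Z i = Pos --> X i = Pos | Y i = Pos"
      "\<forall>i. Z i = Neg --> X i = Neg | Y i = Neg" by blast
 show ?thesis
 proof (rule that[OF Z(1,2)])
  fix i assume "Z i ~= Zero" then show "Z i = X i | Z i = Y i"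
   using Z(3,4) by (cases "Z i") auto
 qed
qed

abbreviation indep :: "'e set => bool" where "indep I \<equiv> I : indep_sets M"
abbreviation basis :: "'e set => bool" where "basis I \<equiv> I : matroid_bases M"

lemma indep_ground: "indep I ==> I \<subseteq> ground M"
 by (simp add: indep_sets_def)

lemma indep_finite: "indep I ==> finite I"
 by (rule finite_subset[OF indep_ground finite_ground])

lemma indep_subset: "indep I ==> J \<subseteq> I ==> indep J"
 unfolding indep_sets_def by blast

lemma indep_no_circuit: "indep I ==> X : circuits M ==> ~ support X \<subseteq> I"
 by (simp add: indep_sets_def)

lemma not_indep_circuit:
 assumes "~ indep I" "I \<subseteq> ground M"
 shows "\<exists>X \<in> circuits M. support X \<subseteq> I"
 using assms unfolding indep_sets_def by blast

lemma indep_empty: "indep {}"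
 using circuit_nonempty by (auto simp: indep_sets_def)

lemma fundamental_circuit:
 assumes "indep I" "a : ground M" "~ indep (insert a I)"
 obtains X where "X : circuits M" "support X \<subseteq> insert a I" "X a ~= Zero"
proof -
 have "insert a I \<subseteq> ground M" using assms indep_ground by blast
 then obtain X where X: "X : circuits M" "support X \<subseteq> insert a I"
  using not_indep_circuit[OF assms(3)] by blast
 have "X a ~= Zero"
  using X indep_no_circuit[OF assms(1) X(1)] by (auto simp: mem_support)
 then show ?thesis using that X by blast
qed

text \<open>Both circuits contain \<open>a\<close>. If they were neither equal nor opposite,
  eliminating \<open>a\<close> would leave a circuit inside the independent set
  \<open>I\<close>.\<close>

lemma fundamental_circuit_unique:
 assumes "indep I" "X : circuits M" "Y : circuits M"
  "support X \<subseteq> insert a I" "support Y \<subseteq> insert a I"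
 shows "X = Y | X = opp \<circ> Y"
proof -
 have nz: "X a ~= Zero" "Y a ~= Zero"
  using assms(4,5) indep_no_circuit[OF assms(1) assms(2)] indep_no_circuit[OF assms(1) assms(3)]
  by (auto simp: support_def)
 have *: "X = opp \<circ> Y" if Y: "Y : circuits M" "support Y \<subseteq> insert a I" "X a = opp (Y a)" for Y
 proof (rule ccontr)
  assume "X ~= opp \<circ> Y"
  then obtain Z where Z: "Z : circuits M" "Z a = Zero" "!!i. Z i ~= Zero ==> Z i = X i | Z i = Y i"
   using circuit_elim[OF assms(2) Y(1,3) nz(1)] by blast
  have "support Z \<subseteq> I"
  proof
   fix i assume "i : support Z"
   then have "i ~= a" "X i ~= Zero | Y i ~= Zero" using Z(2) Z(3)[of i] by (auto simp: mem_support)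
   then show "i : I" using assms(4) Y(2) by (auto simp: mem_support)
  qed
  then show False using indep_no_circuit[OF assms(1) Z(1)] by blast
 qed
 consider "X a = opp (Y a)" | "X a = Y a" using nz sign_cases by blast
 then show ?thesis
 proof cases
  case 1 then show ?thesis using * assms by blast
 next
  case 2 then show ?thesis using *[of "opp \<circ> Y"] assms circuit_opp by simp
 qed
qed

text \<open>Basis exchange with \<open>I\<close> fixed and \<open>J\<close> moved towards it. An
  element \<open>e\<close> of \<open>I\<close> outside \<open>J\<close> is either added to
  \<open>J\<close> or swapped for an element of its fundamental circuit outside \<open>I\<close>.
  The cardinality of \<open>J\<close> never drops, no new elements outside \<open>I\<close> appear,
  and \<open>I - J\<close> shrinks.\<close>

lemma indep_card_le:
 assumes "indep I" "indep J" "!!x. x : J - I ==> ~ indep (insert x I)"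
 shows "card J \<le> card I"
 using assms(2,3)
proof (induction "card (I - J)" arbitrary: J rule: less_induct)
 case less
 note finI = indep_finite[OF assms(1)]
 note finJ = indep_finite[OF less.prems(1)]
 show ?case
 proof (cases "I \<subseteq> J")
  case True
  have "J \<subseteq> I"
  proof
   fix x assume "x : J"
   then show "x : I" using less.prems True indep_subset[of J "insert x I"] by blast
  qed
  then show ?thesis using True by simp
 next
  case False
  then obtain e where e: "e : I" "e ~: J" by blast
  show ?thesis
  proof (cases "indep (insert e J)")
   case True
   have "I - insert e J \<subset> I - J" using e by blast
   then have "card (I - insert e J) < card (I - J)" using finI by (simp add: psubset_card_mono)
   from less.hyps[OF this True] have "card (insert e J) \<le> card I" using less.prems e by blast
   then show ?thesis using e finJ by simp
  next
   case False
   obtain X where X: "X : circuits M" "support X \<subseteq> insert e J" "X e ~= Zero"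
    using fundamental_circuit[OF less.prems(1) _ False] e indep_ground[OF assms(1)] by blast
   \<comment> \<open>The circuit cannot lie inside \<open>I\<close>; its element outside
     \<open>I\<close> is different from \<open>e\<close>, hence belongs to \<open>J\<close>.\<close>
   obtain f where f: "f : support X" "f ~: I" using indep_no_circuit[OF assms(1) X(1)] by blast
   have fJ: "f : J" "f ~= e" using f X e by auto
   let ?J = "insert e (J - {f})"
   have "indep ?J"
   proof (rule ccontr)
    assume "~ indep ?J"
    moreover have "?J \<subseteq> ground M"
     using e indep_ground[OF assms(1)] indep_ground[OF less.prems(1)] by blast
    ultimately obtain Y where Y: "Y : circuits M" "support Y \<subseteq> ?J"
     using not_indep_circuit by blast
    have "X = Y | X = opp \<circ> Y"
     using fundamental_circuit_unique[OF less.prems(1) X(1) Y(1) X(2)] Y(2) by blast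
    then have "support X \<subseteq> ?J" using Y by auto
    then show False using f fJ by blast
   qed
   have "I - ?J \<subset> I - J" using e f by blast
   then have "card (I - ?J) < card (I - J)" using finI by (simp add: psubset_card_mono)
   from less.hyps[OF this \<open>indep ?J\<close>] have "card ?J \<le> card I" using less.prems e by blast
   moreover have "card ?J = card J" using e fJ finJ card_Suc_Diff1[OF finJ fJ(1)] by simp
   ultimately show ?thesis by simp
  qed
 qed
qed

lemma extend_indep:
 assumes "indep I" "I \<subseteq> S" "S \<subseteq> ground M"
 obtains J where "indep J" "I \<subseteq> J" "J \<subseteq> S" "!!x. x : S - J ==> ~ indep (insert x J)"
proof -
 have fin: "finite S" by (rule finite_subset[OF assms(3) finite_ground])
 define F where "F = {J. indep J & I \<subseteq> J & J \<subseteq> S}"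
 have "F \<subseteq> Pow S" unfolding F_def by blast
 then have "finite F" by (rule finite_subset) (simp add: fin)
 moreover have "I : F" using assms F_def by blast
 ultimately obtain J where J: "J : F" "\<forall>K\<in>F. J \<subseteq> K --> J = K"
  using finite_has_maximal2[of F I] by auto
 show ?thesis
 proof (rule that[of J])
  fix x assume x: "x : S - J"
  have "insert x J ~: F" using J(2) x by blast
  then show "~ indep (insert x J)" using J(1) x unfolding F_def by blast
 qed (use J(1) F_def in auto)
qed

lemma basis_iff: "basis b \<longleftrightarrow> indep b & (\<forall>x \<in> ground M - b. ~ indep (insert x b))"
proof
 assume "basis b" then show "indep b & (\<forall>x \<in> ground M - b. ~ indep (insert x b))"
  unfolding matroid_bases_def by blast
next
 assume a: "indep b & (\<forall>x \<in> ground M - b. ~ indep (insert x b))"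
 have "I = b" if I: "indep I" "b \<subseteq> I" for I
 proof (rule ccontr)
  assume "I ~= b"
  then obtain x where "x : I" "x ~: b" using I by blast
  then show False using a I indep_subset[OF I(1), of "insert x b"] indep_ground[OF I(1)] by blast
 qed
 then show "basis b" using a unfolding matroid_bases_def by blast
qed

lemma basis_indep: "basis b ==> indep b"
 by (simp add: basis_iff)

lemma extend_basis:
 assumes "indep I"
 obtains b where "basis b" "I \<subseteq> b"
proof -
 obtain J where "indep J" "I \<subseteq> J" "!!x. x : ground M - J ==> ~ indep (insert x J)"
  by (rule extend_indep[OF assms indep_ground[OF assms] subset_refl]) auto
 then show ?thesis using that[of J] basis_iff[of J] by blast
qed

lemma basis_exists: obtains b where "basis b"
 using extend_basis indep_empty by metis

lemma indep_card_basis: "indep I ==> basis b ==> card I \<le> card b"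
 using indep_card_le[of b I] basis_iff[of b] indep_ground[of I] by blast

lemma basis_card: "basis b ==> basis b' ==> card b = card b'"
 by (intro le_antisym indep_card_basis basis_indep)

lemma basisI: "indep I ==> basis b ==> card b \<le> card I ==> basis I"
proof -
 assume a: "indep I" "basis b" "card b \<le> card I"
 obtain c where c: "basis c" "I \<subseteq> c" using extend_basis[OF a(1)] .
 have "card c \<le> card I" using a(3) basis_card[OF a(2) c(1)] by simp
 then have "I = c" by (rule card_seteq[OF indep_finite[OF basis_indep[OF c(1)]] c(2)])
 then show "basis I" using c by simp
qed

lemma rank_eq: assumes "basis b" shows "matroid_rank M = card b"
 unfolding matroid_rank_def
proof (rule Max_eqI)
 have "indep_sets M \<subseteq> Pow (ground M)" using indep_ground by blast
 then have "finite (indep_sets M)" by (rule finite_subset) (simp add: finite_ground)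
 then show "finite (card ` indep_sets M)" by simp
qed (use assms indep_card_basis basis_indep in auto)

text \<open>Each element of the set completes \<open>B - {e}\<close> to a basis that meets the set
  in this element alone, which gives minimality. Every basis meets the set because
  \<open>B - {e}\<close> is too small to absorb a whole basis in its span.\<close>

lemma fundamental_cocircuit:
 assumes "basis B" "e : B"
 shows "{x \<in> ground M. x ~: B - {e} & indep (insert x (B - {e}))} : cocircuit_supports M"
  (is "?D : _")
proof -
 have indB: "indep (B - {e})" using indep_subset[OF basis_indep[OF assms(1)]] by blast
 have cB: "card B = Suc (card (B - {e}))"
  by (rule card.remove[OF indep_finite[OF basis_indep[OF assms(1)]] assms(2)])
 have basx: "basis (insert x (B - {e}))" if "x : ?D" for x
  using that cB basisI[OF _ assms(1)] indep_finite[OF indB] by auto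
 have meet: "?D \<inter> b ~= {}" if b: "basis b" for b
 proof -
  have "~ card b \<le> card (B - {e})" using basis_card[OF b assms(1)] cB by simp
  then obtain x where "x : b - (B - {e})" "indep (insert x (B - {e}))"
   using indep_card_le[OF indB basis_indep[OF b]] by blast
  then have "x : ?D \<inter> b" using indep_ground[OF basis_indep[OF b]] by blast
  then show ?thesis by blast
 qed
 have "\<exists>b\<in>matroid_bases M. D' \<inter> b = {}" if D': "D' \<subset> ?D" for D'
 proof -
  obtain x where x: "x : ?D" "x ~: D'" using D' by blast
  have "D' \<inter> insert x (B - {e}) = {}" using x D' by blast
  then show ?thesis using basx[OF x(1)] by blast
 qed
 then show ?thesis using meet unfolding cocircuit_supports_def by blast
qed

lemma cocircuit_ground: "D : cocircuit_supports M ==> D \<subseteq> ground M"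
 by (simp add: cocircuit_supports_def)

lemma cocircuit_minimal:
 "D : cocircuit_supports M ==> D' \<subset> D ==> \<exists>b \<in> matroid_bases M. D' \<inter> b = {}"
 by (simp add: cocircuit_supports_def)

text \<open>The complement of a cocircuit is a hyperplane. By minimality of \<open>D\<close> some
  basis meets \<open>D\<close> only in \<open>a\<close>, and comparing its size with that of
  \<open>I\<close> shows that \<open>I\<close> has exactly one element fewer than a basis.\<close>

lemma cocircuit_complement_basis:
 assumes "D : cocircuit_supports M" "indep I" "I \<subseteq> ground M - D"
  "!!x. x : ground M - D - I ==> ~ indep (insert x I)" "a : D"
 shows "basis (insert a I)"
proof -
 obtain J where J: "basis J" "I \<subseteq> J" using extend_basis[OF assms(2)] .
 have "D \<inter> J ~= {}" using J assms(1) by (simp add: cocircuit_supports_def)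
 then have "I \<subset> J" using J assms(3) by blast
 then have lt: "card I < card J" by (rule psubset_card_mono[OF indep_finite[OF basis_indep[OF J(1)]]])
 have "D - {a} \<subset> D" using assms(5) by blast
 then obtain b where b: "basis b" "(D - {a}) \<inter> b = {}" using cocircuit_minimal[OF assms(1)] by blast
 have bg: "b \<subseteq> ground M" using b basis_indep indep_ground by blast
 have aI: "a ~: I" using assms by blast
 have ind: "indep (insert a I)"
 proof (rule ccontr)
  assume "~ indep (insert a I)"
  then have "card b \<le> card I"
   using assms(4) b(2) bg by (intro indep_card_le[OF assms(2) basis_indep[OF b(1)]]) blast
  then show False using lt basis_card[OF b(1) J(1)] by simp
 qed
 have "card (b - {a}) \<le> card I"
  using assms(4) b(2) bg indep_subset[OF basis_indep[OF b(1)]]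
  by (intro indep_card_le[OF assms(2)]) blast+
 then have "card b \<le> card (insert a I)"
  using aI indep_finite[OF assms(2)] by (auto simp: card_Diff_singleton_if split: if_splits)
 then show ?thesis using basisI[OF ind b(1)] by blast
qed

text \<open>If a circuit met \<open>D\<close> only in \<open>a\<close>, its remaining elements would
  be independent and extend to a maximal independent set \<open>I\<close> off \<open>D\<close>; the
  basis \<open>insert a I\<close> would then contain the circuit.\<close>

lemma circuit_cocircuit_inter_not_singleton:
 assumes "D : cocircuit_supports M" "X : circuits M"
 shows "support X \<inter> D ~= {a}"
proof
 assume a: "support X \<inter> D = {a}"
 have "indep (support X - {a})"
 proof (rule ccontr)
  assume "~ indep (support X - {a})"
  moreover have "support X - {a} \<subseteq> ground M" using circuit_ground[OF assms(2)] by blast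
  ultimately obtain Y where Y: "Y : circuits M" "support Y \<subseteq> support X - {a}"
   using not_indep_circuit by blast
  then have "Y = X | Y = opp \<circ> X" using circuit_incomparable[OF Y(1) assms(2)] by blast
  then have "support Y = support X" by auto
  then show False using Y a by auto
 qed
 moreover have "support X - {a} \<subseteq> ground M - D" using a circuit_ground[OF assms(2)] by blast
 ultimately obtain I where I: "indep I" "support X - {a} \<subseteq> I" "I \<subseteq> ground M - D"
  "!!x. x : ground M - D - I ==> ~ indep (insert x I)"
  by (rule extend_indep[of "support X - {a}" "ground M - D"]) auto
 have "basis (insert a I)" using cocircuit_complement_basis[OF assms(1) I(1,3,4)] a by blast
 then have "indep (insert a I)" by (rule basis_indep)
 from indep_no_circuit[OF this assms(2)] show False using I(2) by blast
qed

end

section \<open>Every unsigned cocircuit carries an orthogonal signature\<close>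

context om
begin

text \<open>When \<open>D\<close> is a cocircuit, these are the bases of the complementary
  hyperplane.\<close>

definition complement_basis :: "'e set => 'e set => bool" where
 "complement_basis D I \<longleftrightarrow> indep I & I \<subseteq> ground M - D & (\<forall>x \<in> ground M - D - I. ~ indep (insert x I))"

lemma complement_basis_insert:
 "D : cocircuit_supports M ==> complement_basis D I ==> a : D ==> basis (insert a I)"
 by (rule cocircuit_complement_basis) (auto simp: complement_basis_def)

lemma complement_basis_extend:
 assumes "indep J" "J \<subseteq> ground M - D"
 shows "\<exists>I. complement_basis D I & J \<subseteq> I"
proof -
 have "ground M - D \<subseteq> ground M" by blast
 from extend_indep[OF assms this] obtain I where "indep I" "J \<subseteq> I" "I \<subseteq> ground M - D"
   "!!x. x : ground M - D - I ==> ~ indep (insert x I)" by auto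
 then show ?thesis unfolding complement_basis_def by blast
qed

lemma circuit_proper_subset_indep:
 assumes "X : circuits M" "J \<subset> support X"
 shows "indep J"
proof (rule ccontr)
 assume "~ indep J"
 moreover have "J \<subseteq> ground M" using circuit_ground[OF assms(1)] assms(2) by blast
 ultimately obtain Y where Y: "Y : circuits M" "support Y \<subseteq> J"
  using not_indep_circuit by blast
 then have "Y = X | Y = opp \<circ> X" using circuit_incomparable[OF Y(1) assms(1)] assms(2) by blast
 then have "support Y = support X" by auto
 then show False using Y assms(2) by auto
qed

lemma complement_basis_circuit:
 assumes "X : circuits M" "support X \<inter> D ~= {}"
 shows "\<exists>I. complement_basis D I & support X - D \<subseteq> I"
proof (rule complement_basis_extend)
 show "indep (support X - D)" by (rule circuit_proper_subset_indep[OF assms(1)]) (use assms(2) in blast)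
qed (use circuit_ground[OF assms(1)] in blast)

text \<open>\<open>insert a I\<close> and \<open>insert b I\<close> are both bases, so the
  fundamental circuit of \<open>b\<close> over the first contains \<open>a\<close> as well. It meets
  \<open>D\<close> exactly in \<open>a\<close> and \<open>b\<close>, and negation adjusts its sign
  at \<open>a\<close>.\<close>

lemma cocircuit_pair_circuit:
 assumes "D : cocircuit_supports M" "complement_basis D I" "a : D" "b : D" "a ~= b" "s ~= Zero"
 obtains X where "X : circuits M" "support X \<subseteq> insert a (insert b I)" "X a = s" "X b ~= Zero"
proof -
 have ba: "basis (insert a I)" "basis (insert b I)" using complement_basis_insert assms by blast+
 have nin: "a ~: I" "b ~: I" using assms by (auto simp: complement_basis_def)
 have "~ indep (insert b (insert a I))"
  using assms cocircuit_ground ba nin unfolding basis_iff by blast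
 moreover have "b : ground M" using assms cocircuit_ground by blast
 ultimately obtain X where X: "X : circuits M" "support X \<subseteq> insert b (insert a I)" "X b ~= Zero"
  using fundamental_circuit[OF basis_indep[OF ba(1)], of b] by blast
 have "X a ~= Zero"
  using indep_no_circuit[OF basis_indep[OF ba(2)] X(1)] X(2) by (auto simp: mem_support)
 then have "X a = s | X a = opp s" using assms(6) sign_cases by blast
 then show ?thesis
 proof
  assume "X a = s" then show ?thesis using X that[of X] by blast
 next
  assume "X a = opp s"
  then have "(opp \<circ> X) a = s" "(opp \<circ> X) b ~= Zero" "support (opp \<circ> X) \<subseteq> insert a (insert b I)"
   using X by auto
  then show ?thesis using that[of "opp \<circ> X"] circuit_opp[OF X(1)] by blast
 qed
qed

lemma complement_basis_nz:
 assumes "D : cocircuit_supports M" "complement_basis D I" "a : D" "b : D"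
  "X : circuits M" "support X \<subseteq> insert a (insert b I)"
 shows "X a ~= Zero & X b ~= Zero"
proof -
 have "basis (insert a I)" "basis (insert b I)" using complement_basis_insert assms by blast+
 then show ?thesis
  using indep_no_circuit[OF basis_indep assms(5)] assms(6) by (metis insert_commute mem_support subset_insert)
qed

text \<open>The relative sign of \<open>a\<close> and \<open>b\<close> does not depend on the
  hyperplane basis through which they are joined. The basis \<open>I\<close> is moved to
  \<open>I'\<close> by exchanges, and in each exchange the circuit through \<open>a\<close> and
  \<open>b\<close> is corrected by a circuit that avoids \<open>D\<close>, so its signs at
  \<open>a\<close> and \<open>b\<close> survive.\<close>

lemma cocircuit_pair_consistent_aux:
 assumes D: "D : cocircuit_supports M" and ab: "a : D" "b : D" and I': "complement_basis D I'"
  and X': "X' : circuits M" "support X' \<subseteq> insert a (insert b I')"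
  and I: "complement_basis D I" and X: "X : circuits M" "support X \<subseteq> insert a (insert b I)"
 shows "X a = X b \<longleftrightarrow> X' a = X' b"
 using I X
proof (induction "card (I' - I)" arbitrary: I X rule: less_induct)
 case less
 note I = less.prems(1) and X = less.prems(2,3)
 have indI: "indep I" "indep I'" using I I' by (auto simp: complement_basis_def)
 have aI: "a ~: I" "b ~: I" "a ~: I'" "b ~: I'" using I I' ab by (auto simp: complement_basis_def)
 note finI = indep_finite[OF indI(1)] and finI' = indep_finite[OF indI(2)]
 show ?case
 proof (cases "I' \<subseteq> I")
  case True
  have "I \<subseteq> I'"
  proof
   fix x assume x: "x : I"
   show "x : I'"
   proof (rule ccontr)
    assume "x ~: I'"
    moreover have "indep (insert x I')" using indep_subset[OF indI(1), of "insert x I'"] x True by blast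
    ultimately show False using I I' x unfolding complement_basis_def by blast
   qed
  qed
  then have "I = I'" using True by blast
  then have "X = X' | X = opp \<circ> X'"
   using fundamental_circuit_unique[OF basis_indep[OF complement_basis_insert[OF D I' ab(2)]] X(1) X'(1)]
    X(2) X'(2) by blast
  then show ?thesis by auto
 next
  case False
  then obtain q where q: "q : I'" "q ~: I" by blast
  have qg: "q : ground M - D - I" using q I' by (auto simp: complement_basis_def)
  then have "~ indep (insert q I)" using I by (auto simp: complement_basis_def)
  then obtain C where C: "C : circuits M" "support C \<subseteq> insert q I" "C q ~= Zero"
   using fundamental_circuit[OF indI(1), of q] qg by blast
  obtain p where p: "p : support C" "p ~: I'" using indep_no_circuit[OF indI(2) C(1)] by blast
  have pI: "p : I" "p ~= q" using p q C(2) by auto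
  let ?J = "insert q (I - {p})"
  have Jg: "?J \<subseteq> ground M - D" using I qg by (auto simp: complement_basis_def)
  have indJ: "indep ?J"
  proof (rule ccontr)
   assume "~ indep ?J"
   then obtain Y where Y: "Y : circuits M" "support Y \<subseteq> ?J"
    using not_indep_circuit Jg by blast
   have "C = Y | C = opp \<circ> Y"
    using fundamental_circuit_unique[OF indI(1) C(1) Y(1) C(2)] Y(2) by blast
   then have "support C \<subseteq> ?J" using Y by auto
   then show False using p pI by blast
  qed
  have cJ: "card ?J = card I" using q finI card_Suc_Diff1[OF finI pI(1)] by simp
  have J: "complement_basis D ?J"
   unfolding complement_basis_def
  proof (intro conjI ballI notI indJ Jg)
   fix x assume x: "x : ground M - D - ?J" "indep (insert x ?J)"
   have "card (insert x ?J) \<le> card I"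
    by (rule indep_card_le[OF indI(1) x(2)]) (use I x(1) Jg in \<open>auto simp: complement_basis_def\<close>)
   moreover have "card (insert x ?J) = Suc (card ?J)"
    using x(1) indep_finite[OF indJ] by (intro card_insert_disjoint) auto
   ultimately show False using cJ by simp
  qed
  have lt: "card (I' - ?J) < card (I' - I)"
  proof (rule psubset_card_mono)
   show "I' - ?J \<subset> I' - I" using q p by blast
  qed (use finI' in simp)
  obtain Z where Z: "Z : circuits M" "support Z \<subseteq> insert a (insert b ?J)" "Z a = X a" "Z b = X b"
  proof (cases "X p = Zero")
   case True
   then have "support X \<subseteq> insert a (insert b ?J)" using X(2) by (auto simp: mem_support)
   then show ?thesis using that X(1) by blast
  next
   case Xp: False
   \<comment> \<open>The circuit in \<open>insert q I\<close>, negated if necessary so that it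
     cancels \<open>X\<close> at \<open>p\<close>. It vanishes on \<open>D\<close>, so the
     elimination keeps the signs at \<open>a\<close> and \<open>b\<close>.\<close>
   obtain C' where C': "C' : circuits M" "X p = opp (C' p)" "support C' \<subseteq> insert q I"
   proof -
    have "X p = C p | X p = opp (C p)" using sign_cases Xp p(1) by (simp add: mem_support)
    then show ?thesis
    proof
     assume "X p = C p" then show ?thesis using that[of "opp \<circ> C"] circuit_opp[OF C(1)] C(2) by simp
    next
     assume "X p = opp (C p)" then show ?thesis using that[of C] C by simp
    qed
   qed
   have C'0: "C' a = Zero" "C' b = Zero" using C'(3) aI qg ab by (auto simp: support_def)
   have "X a ~= Zero" using complement_basis_nz[OF D I ab X] by blast
   then have "X ~= opp \<circ> C'" using C'0 by auto
   then obtain Z where Z: "Z : circuits M" "Z p = Zero" "!!i. Z i ~= Zero ==> Z i = X i | Z i = C' i"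
    using circuit_elim[OF X(1) C'(1,2) Xp] by blast
   have supp: "support Z \<subseteq> insert a (insert b ?J)"
   proof
    fix i assume "i : support Z"
    then have "i ~= p" "X i ~= Zero | C' i ~= Zero" using Z(2) Z(3)[of i] by (auto simp: mem_support)
    then show "i : insert a (insert b ?J)" using X(2) C'(3) by (auto simp: mem_support)
   qed
   have "Z a ~= Zero & Z b ~= Zero" by (rule complement_basis_nz[OF D J ab Z(1) supp])
   then have "Z a = X a" "Z b = X b" using Z(3) C'0 by metis+
   then show ?thesis using that Z(1) supp by blast
  qed
  show ?thesis using less.hyps[OF lt J Z(1,2)] Z by simp
 qed
qed

lemma cocircuit_pair_consistent:
 assumes "D : cocircuit_supports M"
  and "X : circuits M" "X' : circuits M" "support X \<inter> D = {a, b}" "support X' \<inter> D = {a, b}"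
 shows "X a = X b \<longleftrightarrow> X' a = X' b"
proof -
 obtain I where I: "complement_basis D I" "support X - D \<subseteq> I"
  using complement_basis_circuit[OF assms(2), of D] assms(4) by auto
 obtain I' where I': "complement_basis D I'" "support X' - D \<subseteq> I'"
  using complement_basis_circuit[OF assms(3), of D] assms(5) by auto
 show ?thesis
  by (rule cocircuit_pair_consistent_aux[OF assms(1) _ _ I'(1) assms(3) _ I(1) assms(2)])
   (use I I' assms(4,5) in blast)+
qed

text \<open>Circuits that meet \<open>D\<close> in two elements dictate the relative signs.
  Orthogonality to an arbitrary circuit follows by induction on the number of its elements in
  \<open>D\<close>: a circuit that violates it could be shortened on \<open>D\<close> and would
  still violate it.\<close>

lemma cocircuit_signature:
 assumes D: "D : cocircuit_supports M"
 shows "\<exists>Y \<in> cocircuits M. support Y = D"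
proof -
 have "D ~= {}"
  using D basis_exists unfolding cocircuit_supports_def by blast
 then obtain a0 where a0: "a0 : D" by blast
 \<comment> \<open>The sign at \<open>a0\<close> is chosen as \<open>Pos\<close>. A circuit with
   trace \<open>{a0, b}\<close> on \<open>D\<close> is orthogonal to \<open>Y\<close> only if
   unequal signs in the circuit go with equal signs in \<open>Y\<close>, which fixes
   \<open>Y b\<close>.\<close>
 define Y where "Y = (%b. if b ~: D then Zero
  else if b = a0 | (\<exists>X\<in>circuits M. support X \<inter> D = {a0, b} & X a0 ~= X b) then Pos else Neg)"
 have suppY: "support Y = D" unfolding Y_def support_def by auto
 have Ynz: "Y a ~= Zero" if "a : D" for a using suppY that by (auto simp: support_def)
 have base: "X a0 = X b \<longleftrightarrow> Y b ~= Pos"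
  if X: "X : circuits M" "support X \<inter> D = {a0, b}" "b ~= a0" for X b
 proof -
  have "b : D" using X by blast
  show ?thesis
  proof (cases "X a0 = X b")
   case True
   then have "~ (\<exists>X\<in>circuits M. support X \<inter> D = {a0, b} & X a0 ~= X b)"
    using cocircuit_pair_consistent[OF D X(1) _ X(2)] by blast
   then show ?thesis using True X(3) \<open>b \<in> D\<close> by (simp add: Y_def)
  next
   case False
   then show ?thesis using X \<open>b \<in> D\<close> by (auto simp: Y_def)
  qed
 qed
 have Ya0: "Y a0 = Pos" using a0 by (simp add: Y_def)
 have pair: "X a = X b \<longleftrightarrow> Y a ~= Y b"
  if X: "X : circuits M" "support X \<inter> D = {a, b}" "a ~= b" for X a b
 proof -
  have ab: "a : D" "b : D" using X by blast+
  consider "a = a0" | "b = a0" | "a ~= a0" "b ~= a0" by blast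
  then show ?thesis
  proof cases
   case 1 then show ?thesis using base[OF X(1), of b] X Ya0 by auto
  next
   case 2 then show ?thesis using base[OF X(1), of a] X Ya0 by (auto simp: insert_commute)
  next
   case 3
   obtain I where I: "complement_basis D I" "support X - D \<subseteq> I"
    using complement_basis_circuit[OF X(1), of D] X(2) by auto
   have ID: "I \<inter> D = {}" using I by (auto simp: complement_basis_def)
   obtain Xa where Xa: "Xa : circuits M" "support Xa \<subseteq> insert a0 (insert a I)" "Xa a0 = Pos" "Xa a ~= Zero"
    by (rule cocircuit_pair_circuit[OF D I(1) a0 ab(1), of Pos]) (use 3 in auto)
   obtain Xb where Xb: "Xb : circuits M" "support Xb \<subseteq> insert a0 (insert b I)" "Xb a0 = Neg" "Xb b ~= Zero"
    by (rule cocircuit_pair_circuit[OF D I(1) a0 ab(2), of Neg]) (use 3 in auto)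
   have z: "Xa b = Zero" "Xb a = Zero" using Xa(2) Xb(2) 3 X(3) ID ab by (auto simp: support_def)
   have "Xa ~= opp \<circ> Xb" using z Xa by auto
   moreover have "Xa a0 = opp (Xb a0)" "Xa a0 ~= Zero" using Xa Xb by auto
   \<comment> \<open>Eliminating the base point \<open>a0\<close> from the circuits that join it to
     \<open>a\<close> and to \<open>b\<close> gives a circuit with trace \<open>{a, b}\<close>; this
     carries the sign rule over to pairs that avoid \<open>a0\<close>.\<close>
   ultimately obtain Z where Z: "Z : circuits M" "Z a0 = Zero" "!!i. Z i ~= Zero ==> Z i = Xa i | Z i = Xb i"
    using circuit_elim[OF Xa(1) Xb(1)] by blast
   have supp: "support Z \<subseteq> insert a (insert b I)"
   proof
    fix i assume "i : support Z"
    then have "i ~= a0" "Xa i ~= Zero | Xb i ~= Zero" using Z(2) Z(3)[of i] by (auto simp: mem_support)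
    then show "i : insert a (insert b I)" using Xa(2) Xb(2) by (auto simp: mem_support)
   qed
   have nz: "Z a ~= Zero & Z b ~= Zero" by (rule complement_basis_nz[OF D I(1) ab Z(1) supp])
   then have Zab: "Z a = Xa a" "Z b = Xb b" using Z(3) z by metis+
   have sD: "support Z \<inter> D = {a, b}" using supp nz ab ID by (auto simp: mem_support)
   have sa: "support Xa \<inter> D = {a0, a}" using Xa ID ab a0 by (auto simp: mem_support)
   have sb: "support Xb \<inter> D = {a0, b}" using Xb ID ab a0 by (auto simp: mem_support)
   have "X a = X b \<longleftrightarrow> Xa a = Xb b"
    using cocircuit_pair_consistent[OF D X(1) Z(1) X(2) sD] Zab by simp
   moreover have "Xa a = Pos \<longleftrightarrow> Y a ~= Pos" using base[OF Xa(1) sa] 3 Xa by auto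
   moreover have "Xb b = Neg \<longleftrightarrow> Y b ~= Pos" using base[OF Xb(1) sb] 3 Xb by auto
   ultimately show ?thesis using Ynz[OF ab(1)] Ynz[OF ab(2)] Xa(4) Xb(4)
    by (cases "Xa a"; cases "Xb b"; cases "Y a"; cases "Y b"; simp)
  qed
 qed
 have orth: "orthogonal_signs X Y" if "X : circuits M" for X
  using that
 proof (induction "card (support X \<inter> D)" arbitrary: X rule: less_induct)
  case less
  have step: "~ (\<forall>i. X i ~= Zero --> Y i ~= Zero --> X i = Y i)"
   if X: "X : circuits M" "\<exists>i. X i ~= Zero & Y i ~= Zero"
    "!!X'. card (support X' \<inter> D) < card (support X \<inter> D) ==> X' : circuits M ==> orthogonal_signs X' Y"
   for X
  proof
   assume agr: "\<forall>i. X i ~= Zero --> Y i ~= Zero --> X i = Y i"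
   obtain a where a: "a : support X \<inter> D" using X(2) suppY by (auto simp: mem_support)
   obtain b where b: "b : support X \<inter> D" "b ~= a"
    using circuit_cocircuit_inter_not_singleton[OF D X(1), of a] a by blast
   have Xab: "X a = Y a" "X b = Y b" "X a ~= Zero" "X b ~= Zero"
    using agr a b Ynz by (auto simp: mem_support)
   show False
   proof (cases "support X \<inter> D = {a, b}")
    case True then show False using pair[OF X(1) True] b Xab by simp
   next
    case False
    \<comment> \<open>A circuit \<open>X1\<close> with trace \<open>{a, b}\<close>, opposite to
      \<open>X\<close> at \<open>a\<close>, necessarily agrees with \<open>Y\<close> at
      \<open>b\<close>. Eliminating \<open>a\<close> between \<open>X\<close> and \<open>X1\<close>
      gives a circuit that still agrees with \<open>Y\<close> on \<open>D\<close>, meets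
      \<open>D\<close> in fewer elements, and does meet \<open>D\<close> because it cannot lie
      inside \<open>I\<close>.\<close>
    obtain I where I: "complement_basis D I" "support X - D \<subseteq> I"
     using complement_basis_circuit[OF X(1), of D] a by auto
    have ID: "I \<inter> D = {}" using I by (auto simp: complement_basis_def)
    have "opp (X a) ~= Zero" "a : D" "b : D" "a ~= b" using Xab a b by auto
    then obtain X1 where X1: "X1 : circuits M" "support X1 \<subseteq> insert a (insert b I)"
      "X1 a = opp (X a)" "X1 b ~= Zero"
     using cocircuit_pair_circuit[OF D I(1), of a b "opp (X a)"] by blast
    have "support X1 \<inter> D = {a, b}" using X1 ID a b Xab by (auto simp: mem_support)
    then have "X1 a = X1 b \<longleftrightarrow> Y a ~= Y b" using pair[OF X1(1)] b by blast
    then have X1b: "X1 b = Y b" using X1(3,4) Xab Ynz[of a] Ynz[of b] a b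
     by (cases "X1 b"; cases "Y a"; cases "Y b"; simp)
    have "X ~= opp \<circ> X1"
    proof
     assume "X = opp \<circ> X1"
     then have "X b = opp (X1 b)" by simp
     then show False using X1b Xab X1(4) by simp
    qed
    then obtain Z where Z: "Z : circuits M" "Z a = Zero" "!!i. Z i ~= Zero ==> Z i = X i | Z i = X1 i"
     using circuit_elim[OF X(1) X1(1) _ Xab(3)] X1(3) by auto
    have ZD: "Z i = Y i & i : support X & i ~= a" if "Z i ~= Zero" "i : D" for i
    proof -
     have ia: "i ~= a" using that Z by auto
     show ?thesis
     proof (cases "i = b")
      case True
      then show ?thesis using Z(3)[OF that(1)] X1b Xab b ia by auto
     next
      case False
      then have "X1 i = Zero" using X1(2) ia that(2) ID by (auto simp: support_def)
      then have "Z i = X i" using Z(3)[OF that(1)] that(1) by auto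
      then show ?thesis using that agr Ynz[OF that(2)] ia by (auto simp: mem_support)
     qed
    qed
    have "support Z \<inter> D \<subset> support X \<inter> D"
    proof
     show "support Z \<inter> D \<subseteq> support X \<inter> D" using ZD by (auto simp: mem_support)
     show "support Z \<inter> D ~= support X \<inter> D" using a Z(2) by (auto simp: support_def)
    qed
    moreover have "finite (support X \<inter> D)"
     using circuit_ground[OF X(1)] finite_ground by (meson finite_Int finite_subset)
    ultimately have "card (support Z \<inter> D) < card (support X \<inter> D)" by (rule psubset_card_mono[rotated])
    then have oZ: "orthogonal_signs Z Y" using X(3) Z(1) by blast
    have "~ support Z \<subseteq> I" using indep_no_circuit[OF _ Z(1)] I(1) by (simp add: complement_basis_def)
    then obtain i where "i : support Z" "i ~: I" by blast
    then have i: "Z i ~= Zero" "i ~: I" by (auto simp: mem_support)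
    have "i : D"
    proof (rule ccontr)
     assume "i ~: D"
     moreover have "X i ~= Zero | X1 i ~= Zero" using Z(3)[OF i(1)] i(1) by auto
     ultimately show False using i I(2) X1(2) a b by (auto simp: mem_support)
    qed
    then have "~ orthogonal_signs Z Y"
     using i ZD suppY by (intro not_orthogonal_conformal[of _ i]) (auto simp: mem_support)
    then show False using oZ by blast
   qed
  qed
  show ?case
  proof (rule ccontr)
   assume "~ orthogonal_signs X Y"
   then show False
   proof (cases rule: not_orthogonal_cases)
    case 1
    then show False using step[OF less.prems] less.hyps by blast
   next
    case 2
    have "(opp \<circ> X) i = Y i" if "(opp \<circ> X) i ~= Zero" "Y i ~= Zero" for i
    proof -
     have "X i = opp (Y i)" using 2(1)[of i] that by simp
     then show ?thesis by simp
    qed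
    moreover have "\<exists>i. (opp \<circ> X) i ~= Zero & Y i ~= Zero" using 2(2) by simp
    ultimately show False using step[OF circuit_opp[OF less.prems]] less.hyps by (metis support_opp)
   qed
  qed
 qed
 then have "Y : cocircuits M" using suppY D by (simp add: cocircuits_def)
 then show ?thesis using suppY by blast
qed

end

section \<open>The painting lemma, covectors, and elimination for cocircuits\<close>

context om
begin

lemma cocircuit_orthogonal: "Y : cocircuits M ==> X : circuits M ==> orthogonal_signs X Y"
 by (simp add: cocircuits_def)

lemma cocircuit_support_ground: "Y : cocircuits M ==> support Y \<subseteq> ground M"
 using cocircuit_ground by (auto simp: cocircuits_def)

lemma cocircuit_nonempty: "Y : cocircuits M ==> support Y ~= {}"
proof -
 assume "Y : cocircuits M"
 moreover obtain b where "basis b" by (rule basis_exists)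
 ultimately have "support Y \<inter> b ~= {}" by (simp add: cocircuits_def cocircuit_supports_def)
 then show "support Y ~= {}" by blast
qed

lemma cocircuit_opp: "Y : cocircuits M ==> opp \<circ> Y : cocircuits M"
 by (simp add: cocircuits_def)

text \<open>If \<open>e\<close> is not spanned by \<open>R\<close>, a maximal independent subset of
  \<open>R\<close> together with \<open>e\<close> extends to a basis, and the fundamental cocircuit
  of \<open>e\<close> in that basis avoids \<open>R\<close>.\<close>

lemma painting_base:
 assumes "e : ground M" "e ~: R"
 shows "(\<exists>X \<in> circuits M. X e ~= Zero & support X \<subseteq> insert e R) |
  (\<exists>Y \<in> cocircuits M. Y e ~= Zero & support Y \<inter> R = {})"
proof (cases "\<exists>X \<in> circuits M. X e ~= Zero & support X \<subseteq> insert e R")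
 case False
 have "R \<inter> ground M \<subseteq> ground M" by blast
 from extend_indep[OF indep_empty _ this]
 obtain I where I: "indep I" "I \<subseteq> R \<inter> ground M" "!!x. x : R \<inter> ground M - I ==> ~ indep (insert x I)"
  by auto
 have "indep (insert e I)"
 proof (rule ccontr)
  assume "~ indep (insert e I)"
  then obtain X where X: "X : circuits M" "support X \<subseteq> insert e I" "X e ~= Zero"
   by (rule fundamental_circuit[OF I(1) assms(1)])
  have "support X \<subseteq> insert e R" using X(2) I(2) by blast
  then show False using False X by blast
 qed
 then obtain B where B: "basis B" "insert e I \<subseteq> B" by (rule extend_basis)
 let ?D = "{x \<in> ground M. x ~: B - {e} & indep (insert x (B - {e}))}"
 have "?D : cocircuit_supports M" using fundamental_cocircuit[OF B(1)] B(2) by blast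
 then obtain Y where Y: "Y : cocircuits M" "support Y = ?D" using cocircuit_signature by blast
 have "insert e (B - {e}) = B" using B(2) by blast
 then have "e : ?D" using assms(1) basis_indep[OF B(1)] by simp
 moreover have "?D \<inter> R = {}"
 proof -
  have False if x: "x : ?D" "x : R" for x
  proof -
   have eI: "I \<subseteq> B - {e}" using B(2) I(2) assms(2) by blast
   then have "x ~: I" using x by blast
   then have "~ indep (insert x I)" using I(3) x by blast
   moreover have "indep (insert x I)"
    using x(1) eI by (intro indep_subset[of "insert x (B - {e})" "insert x I"]) auto
   ultimately show False by blast
  qed
  then show ?thesis by blast
 qed
 ultimately show ?thesis using Y by (metis (no_types, lifting) mem_support)
qed blast

text \<open>Painting lemma with four colours. Circuits are free on \<open>R\<close> and vanish on
  \<open>G\<close>, cocircuits are free on \<open>G\<close> and vanish on \<open>R\<close>, and the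
  remaining elements carry the sign \<open>s\<close>. The induction moves one signed element
  \<open>p\<close> into \<open>R\<close> and into \<open>G\<close>. If neither outcome is what is
  wanted, the circuit and the cocircuit obtained are both wrong at \<open>p\<close>, hence agree
  there and on the rest of their common support, against orthogonality.\<close>

lemma painting:
 assumes "e : ground M" "s e ~= Zero" "e ~: R" "e ~: G" "R \<inter> G = {}"
  "\<forall>i \<in> ground M - R - G. s i ~= Zero"
 shows "(\<exists>X \<in> circuits M. X e = s e & (\<forall>i. X i ~= Zero --> i ~: R --> i ~: G & X i = s i)) |
  (\<exists>Y \<in> cocircuits M. Y e = s e & (\<forall>i. Y i ~= Zero --> i ~: G --> i ~: R & Y i = s i))"
 using assms(3-6)
proof (induction "card (ground M - R - G - {e})" arbitrary: R G)
 case 0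
 then have *: "ground M \<subseteq> insert e (R \<union> G)" using finite_ground by auto
 from painting_base[OF assms(1) \<open>e \<notin> R\<close>] show ?case
 proof
  assume "\<exists>X \<in> circuits M. X e ~= Zero & support X \<subseteq> insert e R"
  then obtain X where X: "X : circuits M" "X e ~= Zero" "support X \<subseteq> insert e R" by blast
  obtain X' where X': "X' : circuits M" "X' e = s e" "support X' \<subseteq> insert e R"
  proof (cases "X e = s e")
   case True then show ?thesis using X that by blast
  next
   case False
   then have "(opp \<circ> X) e = s e" using sign_cases[OF X(2) assms(2)] by auto
   then show ?thesis using that[of "opp \<circ> X"] circuit_opp[OF X(1)] X(3) by simp
  qed
  then show ?thesis using \<open>e \<notin> G\<close> by (auto simp: support_def)
 next
  assume "\<exists>Y \<in> cocircuits M. Y e ~= Zero & support Y \<inter> R = {}"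
  then obtain X where X: "X : cocircuits M" "X e ~= Zero" "support X \<inter> R = {}" by blast
  obtain X' where X': "X' : cocircuits M" "X' e = s e" "support X' \<inter> R = {}"
  proof (cases "X e = s e")
   case True then show ?thesis using X that by blast
  next
   case False
   then have "(opp \<circ> X) e = s e" using sign_cases[OF X(2) assms(2)] by auto
   then show ?thesis using that[of "opp \<circ> X"] cocircuit_opp[OF X(1)] X(3) by simp
  qed
  have "i : insert e G" if "X' i ~= Zero" for i
   using cocircuit_support_ground[OF X'(1)] X'(3) * that by (auto simp: support_def)
  then show ?thesis using X' \<open>e \<notin> R\<close> by blast
 qed
next
 case (Suc n)
 obtain p where p: "p : ground M - R - G - {e}"
  using Suc.hyps(2) by (metis card.empty ex_in_conv old.nat.distinct(1))
 have fin: "finite (ground M - R - G - {e})" using finite_ground by simp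
 have c: "n = card (ground M - insert p R - G - {e})" "n = card (ground M - R - insert p G - {e})"
 proof -
  have "ground M - insert p R - G - {e} = (ground M - R - G - {e}) - {p}"
   "ground M - R - insert p G - {e} = (ground M - R - G - {e}) - {p}" by auto
  then show "n = card (ground M - insert p R - G - {e})" "n = card (ground M - R - insert p G - {e})"
   using card_Diff_singleton[OF p] Suc.hyps(2) by simp_all
 qed
 have sp: "s p ~= Zero" using p Suc.prems by blast
 have IH1: "(\<exists>X \<in> circuits M. X e = s e & (\<forall>i. X i ~= Zero --> i ~: insert p R --> i ~: G & X i = s i)) |
  (\<exists>Y \<in> cocircuits M. Y e = s e & (\<forall>i. Y i ~= Zero --> i ~: G --> i ~: insert p R & Y i = s i))"
  using Suc.hyps(1)[OF c(1)] Suc.prems p by auto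
 have IH2: "(\<exists>X \<in> circuits M. X e = s e & (\<forall>i. X i ~= Zero --> i ~: R --> i ~: insert p G & X i = s i)) |
  (\<exists>Y \<in> cocircuits M. Y e = s e & (\<forall>i. Y i ~= Zero --> i ~: insert p G --> i ~: R & Y i = s i))"
  using Suc.hyps(1)[OF c(2)] Suc.prems p by auto
 show ?case
 proof (rule ccontr)
  assume neg: "~ ?case"
  have "~ (\<exists>Y \<in> cocircuits M. Y e = s e & (\<forall>i. Y i ~= Zero --> i ~: G --> i ~: insert p R & Y i = s i))"
   using neg by blast
  then obtain X where X: "X : circuits M" "X e = s e"
   "!!i. X i ~= Zero ==> i ~: insert p R ==> i ~: G & X i = s i" using IH1 by blast
  have "~ (\<exists>X \<in> circuits M. X e = s e & (\<forall>i. X i ~= Zero --> i ~: R --> i ~: insert p G & X i = s i))"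
   using neg by blast
  then obtain Y where Y: "Y : cocircuits M" "Y e = s e"
   "!!i. Y i ~= Zero ==> i ~: insert p G ==> i ~: R & Y i = s i" using IH2 by blast
  \<comment> \<open>A circuit that vanishes or has the right sign at \<open>p\<close> would already
    satisfy the claim for the original colouring.\<close>
  have "X p ~= Zero & X p ~= s p"
  proof (rule ccontr)
   assume a: "~ (X p ~= Zero & X p ~= s p)"
   have "\<forall>i. X i ~= Zero --> i ~: R --> i ~: G & X i = s i"
    using X(3) a p by (metis DiffD2 Diff_iff insert_iff)
   then show False using neg X by blast
  qed
  then have Xp: "X p = opp (s p)" using sign_cases sp by blast
  have "Y p ~= Zero & Y p ~= s p"
  proof (rule ccontr)
   assume a: "~ (Y p ~= Zero & Y p ~= s p)"
   have "\<forall>i. Y i ~= Zero --> i ~: G --> i ~: R & Y i = s i"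
    using Y(3) a p by (metis DiffD2 Diff_iff insert_iff)
   then show False using neg Y by blast
  qed
  then have Yp: "Y p = opp (s p)" using sign_cases sp by blast
  have "~ orthogonal_signs X Y"
  proof (rule not_orthogonal_conformal)
   show "X e = Y e" "X e ~= Zero" using X(2) Y(2) assms(2) by simp_all
   fix i assume i: "X i ~= Zero" "Y i ~= Zero"
   show "X i = Y i"
   proof (cases "i = p")
    case True then show ?thesis using Xp Yp by simp
   next
    case False
    then have "i ~: R ==> i ~: G & X i = s i" "i ~: G ==> i ~: R & Y i = s i"
     using X(3)[OF i(1)] Y(3)[OF i(2)] by auto
    then show ?thesis using Suc.prems(3) by (cases "i : R") auto
   qed
  qed
  then show False using cocircuit_orthogonal X Y by blast
 qed
qed

text \<open>Painting with the zeros of \<open>Z\<close> coloured \<open>R\<close> and with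
  \<open>G\<close> empty: the circuit of the other alternative would agree with \<open>Z\<close> on
  a common support that contains \<open>e\<close>.\<close>

lemma conformal_cocircuit:
 assumes "support Z \<subseteq> ground M" "!!X. X : circuits M ==> orthogonal_signs X Z" "Z e ~= Zero"
 obtains Y where "Y : cocircuits M" "Y e = Z e" "!!i. Y i ~= Zero ==> Y i = Z i"
proof -
 have e: "e : ground M" using assms(1,3) by (auto simp: support_def)
 have "(\<exists>X \<in> circuits M. X e = Z e & (\<forall>i. X i ~= Zero --> i ~: ground M - support Z --> i ~: {} & X i = Z i)) |
  (\<exists>Y \<in> cocircuits M. Y e = Z e & (\<forall>i. Y i ~= Zero --> i ~: {} --> i ~: ground M - support Z & Y i = Z i))"
  by (rule painting[where s = Z, OF e assms(3)]) (use assms(3) in \<open>auto simp: support_def\<close>)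
 then show ?thesis
 proof
  assume "\<exists>X \<in> circuits M. X e = Z e & (\<forall>i. X i ~= Zero --> i ~: ground M - support Z --> i ~: {} & X i = Z i)"
  then obtain X where X: "X : circuits M" "X e = Z e"
   "!!i. X i ~= Zero ==> i ~: ground M - support Z ==> X i = Z i" by blast
  have "~ orthogonal_signs X Z"
  proof (rule not_orthogonal_conformal[of _ e])
   show "X e = Z e" "X e ~= Zero" using X(2) assms(3) by auto
   show "X i = Z i" if "X i ~= Zero" "Z i ~= Zero" for i
    using X(3)[OF that(1)] that(2) by (simp add: mem_support)
  qed
  then show ?thesis using assms(2) X(1) by blast
 next
  assume "\<exists>Y \<in> cocircuits M. Y e = Z e & (\<forall>i. Y i ~= Zero --> i ~: {} --> i ~: ground M - support Z & Y i = Z i)"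
  then obtain Y where Y: "Y : cocircuits M" "Y e = Z e" "\<forall>i. Y i ~= Zero --> Y i = Z i" by auto
  show ?thesis by (rule that[OF Y(1,2)]) (use Y(3) in blast)
 qed
qed

lemma orthogonal_comp:
 assumes "orthogonal_signs X Y" "orthogonal_signs X Z"
 shows "orthogonal_signs X (Y \<circ>\<^sub>s Z)"
proof (cases "support X \<inter> support Y = {}")
 case False
 then obtain i j where "X i ~= Zero" "Y i ~= Zero" "X i = Y i" "X j ~= Zero" "Y j ~= Zero" "X j = opp (Y j)"
  using assms(1) unfolding orthogonal_signs_def by (auto simp: mem_support)
 then have "X i ~= Zero & X i = (Y \<circ>\<^sub>s Z) i" "X j ~= Zero & X j = opp ((Y \<circ>\<^sub>s Z) j)"
  by (auto simp: sv_comp_def)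
 then show ?thesis by (intro orthogonal_signsI) blast+
next
 case True
 then have eq: "(Y \<circ>\<^sub>s Z) i = Z i" if "X i ~= Zero" for i
  using that by (auto simp: sv_comp_def support_def)
 then have "support X \<inter> support (Y \<circ>\<^sub>s Z) = support X \<inter> support Z"
  by (auto simp: support_def)
 then show ?thesis using assms(2) eq unfolding orthogonal_signs_def
  by (metis IntD1 mem_support)
qed

text \<open>A vector orthogonal to all circuits is composed from conformal cocircuits, one through
  each element of its support. From here on covectors are handled by orthogonality alone.\<close>

lemma covectors_iff:
 "Z : covectors M \<longleftrightarrow> support Z \<subseteq> ground M & (\<forall>X \<in> circuits M. orthogonal_signs X Z)"
proof
 assume "Z : covectors M"
 then show "support Z \<subseteq> ground M & (\<forall>X \<in> circuits M. orthogonal_signs X Z)"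
 proof induction
  case zero then show ?case by (simp add: orthogonal_signs_def support_def)
 next
  case (compose Y Z)
  have "support (Y \<circ>\<^sub>s Z) \<subseteq> support Y \<union> support Z" by (auto simp: sv_comp_def support_def)
  then show ?case using compose cocircuit_support_ground[OF compose(1)]
    cocircuit_orthogonal[OF compose(1)] orthogonal_comp by blast
 qed
next
 assume Z: "support Z \<subseteq> ground M & (\<forall>X \<in> circuits M. orthogonal_signs X Z)"
 have fin: "finite (support Z)" by (rule finite_subset[OF conjunct1[OF Z] finite_ground])
 have "\<exists>W \<in> covectors M. S \<subseteq> support W & (\<forall>i. W i ~= Zero --> W i = Z i)"
  if "finite S" "S \<subseteq> support Z" for S
  using that
 proof induction
  case empty then show ?case using covectors.zero by (intro bexI[of _ "%_. Zero"]) auto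
 next
  case (insert e S)
  then obtain W where W: "W : covectors M" "S \<subseteq> support W" "\<forall>i. W i ~= Zero --> W i = Z i" by blast
  have "Z e ~= Zero" using insert by (auto simp: support_def)
  then obtain Y where Y: "Y : cocircuits M" "Y e = Z e" "!!i. Y i ~= Zero ==> Y i = Z i"
   using conformal_cocircuit[of Z e] Z by blast
  have "Y \<circ>\<^sub>s W : covectors M" using Y(1) W(1) by (rule covectors.compose)
  moreover have "insert e S \<subseteq> support (Y \<circ>\<^sub>s W)"
   using W(2) Y(2) \<open>Z e \<noteq> Zero\<close> by (auto simp: support_def sv_comp_def)
  moreover have "\<forall>i. (Y \<circ>\<^sub>s W) i ~= Zero --> (Y \<circ>\<^sub>s W) i = Z i"
   using W(3) Y(3) by (auto simp: sv_comp_def)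
  ultimately show ?case by blast
 qed
 from this[OF fin] obtain W where W: "W : covectors M" "support Z \<subseteq> support W"
  "\<forall>i. W i ~= Zero --> W i = Z i" by blast
 have "W = Z"
 proof
  fix i show "W i = Z i"
  proof (cases "W i = Zero")
   case True
   then have "i ~: support Z" using W(2) by (auto simp: mem_support)
   then show ?thesis using True by (simp add: mem_support)
  qed (use W(3) in blast)
 qed
 then show "Z : covectors M" using W by simp
qed

text \<open>Minimality makes the supports equal. For two elements \<open>a\<close>, \<open>b\<close>
  of the support there is a circuit with trace \<open>{a, b}\<close>, and orthogonality to it
  determines the relative sign in both vectors alike.\<close>

lemma cocircuit_incomparable:
 assumes "Y : cocircuits M" "Z : cocircuits M" "support Y \<subseteq> support Z"
 shows "Y = Z | Y = opp \<circ> Z"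
proof -
 have D: "support Y : cocircuit_supports M" "support Z : cocircuit_supports M"
  using assms by (auto simp: cocircuits_def)
 have eq: "support Y = support Z"
 proof (rule ccontr)
  assume "support Y ~= support Z"
  then have "support Y \<subset> support Z" using assms(3) by blast
  then obtain b where "b : matroid_bases M" "support Y \<inter> b = {}" using cocircuit_minimal[OF D(2)] by blast
  then show False using D(1) by (auto simp: cocircuit_supports_def)
 qed
 obtain a where a: "a : support Y" using cocircuit_nonempty[OF assms(1)] by blast
 have ag: "(Y b = Y a) = (Z b = Z a)" if bY: "b : support Y" for b
 proof (cases "a = b")
  case False
  obtain I where I: "complement_basis (support Y) I"
   using complement_basis_extend[OF indep_empty, of "support Y"] by blast
  obtain X where X: "X : circuits M" "support X \<subseteq> insert a (insert b I)" "X a = Pos" "X b ~= Zero"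
   by (rule cocircuit_pair_circuit[OF D(1) I a bY False, of Pos]) auto
  have int: "X i ~= Zero ==> Y i ~= Zero ==> i = a | i = b" for i
   using X(2) I by (auto simp: complement_basis_def support_def)
  have *: "(W b = W a) = (X b ~= X a)" if W: "orthogonal_signs X W" "support W = support Y" for W
  proof -
   have s: "support X \<inter> support W = {a, b}"
   proof
    show "{a, b} \<subseteq> support X \<inter> support W" using W(2) X(3,4) a bY by (simp add: mem_support)
    show "support X \<inter> support W \<subseteq> {a, b}"
    proof
     fix i assume "i : support X \<inter> support W"
     then have "i : support X" "i : support Y" using W(2) by auto
     then show "i : {a, b}" using int[of i] by (simp add: mem_support)
    qed
   qed
   then have nz: "X a ~= Zero" "X b ~= Zero" "W a ~= Zero" "W b ~= Zero" by (auto simp: support_def)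
   show ?thesis using W(1) s nz unfolding orthogonal_signs_def
    by (cases "X a"; cases "X b"; cases "W a"; cases "W b"; simp)
  qed
  show ?thesis using *[of Y] *[of Z] eq cocircuit_orthogonal[OF assms(1) X(1)]
    cocircuit_orthogonal[OF assms(2) X(1)] by simp
 qed simp
 have nz: "Y b ~= Zero \<longleftrightarrow> Z b ~= Zero" for b using eq by (auto simp: support_def)
 have "Y a ~= Zero" using a by (simp add: mem_support)
 then consider "Y a = Z a" | "Y a = opp (Z a)" using sign_cases nz by blast
 then show ?thesis
 proof cases
  case 1
  have "Y b = Z b" for b
   using ag[of b] nz[of b] nz[of a] 1 \<open>Y a \<noteq> Zero\<close> by (cases "Y b"; cases "Z b"; cases "Y a"; cases "Z a"; simp add: mem_support)
  then show ?thesis by blast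
 next
  case 2
  have "Y b = opp (Z b)" for b
   using ag[of b] nz[of b] nz[of a] 2 \<open>Y a \<noteq> Zero\<close> by (cases "Y b"; cases "Z b"; cases "Y a"; cases "Z a"; simp add: mem_support)
  then show ?thesis by (auto simp: fun_eq_iff)
 qed
qed

text \<open>Painting at an element \<open>h\<close> where \<open>X\<close> is nonzero and not
  cancelled by \<open>Y\<close>; such an element exists because \<open>X\<close> is not opposite to
  \<open>Y\<close>. The colours are chosen so that the cocircuit alternative is the desired vector
  and the circuit alternative violates orthogonality to \<open>X\<close> or to
  \<open>Y\<close>.\<close>

lemma cocircuit_elim:
 assumes "X : cocircuits M" "Y : cocircuits M" "X ~= opp \<circ> Y" "X e = opp (Y e)" "X e ~= Zero"
 obtains Z where "Z : cocircuits M" "Z e = Zero" "!!i. Z i ~= Zero ==> Z i = X i | Z i = Y i"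
proof -
 have "\<exists>h. X h ~= Zero & X h ~= opp (Y h)"
 proof (rule ccontr)
  assume "~ ?thesis"
  then have *: "X h = opp (Y h)" if "X h ~= Zero" for h using that by blast
  have "support X \<subseteq> support Y"
  proof
   fix h assume "h : support X"
   then show "h : support Y" using *[of h] by (auto simp: mem_support)
  qed
  then have "X = Y" using cocircuit_incomparable[OF assms(1,2)] assms(3) by blast
  then show False using *[OF assms(5)] assms(5) by simp
 qed
 then obtain h where h: "X h ~= Zero" "X h ~= opp (Y h)" by blast
 \<comment> \<open>On \<open>G\<close> the two vectors have opposite nonzero signs, so any nonzero
   sign agrees with one of them and no constraint is imposed. On \<open>R\<close>, that is at
   \<open>e\<close> and outside both supports, the cocircuit has to vanish.\<close>
 define G where "G = {i. X i ~= Zero & X i = opp (Y i)} - {e}"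
 define R where "R = insert e {i. X i = Zero & Y i = Zero}"
 let ?s = "X \<circ>\<^sub>s Y"
 have hg: "h : ground M" using h cocircuit_support_ground[OF assms(1)] by (auto simp: support_def)
 have sh: "?s h = X h" using h by (simp add: sv_comp_def)
 have "(\<exists>C \<in> circuits M. C h = ?s h & (\<forall>i. C i ~= Zero --> i ~: R --> i ~: G & C i = ?s i)) |
  (\<exists>Z \<in> cocircuits M. Z h = ?s h & (\<forall>i. Z i ~= Zero --> i ~: G --> i ~: R & Z i = ?s i))"
 proof (rule painting[OF hg])
  show "?s h ~= Zero" using sh h by simp
  show "h ~: R" "h ~: G" using h assms(4,5) by (auto simp: R_def G_def)
  show "R \<inter> G = {}" by (auto simp: R_def G_def)
  show "\<forall>i\<in>ground M - R - G. ?s i ~= Zero" by (auto simp: R_def G_def sv_comp_def)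
 qed
 then show ?thesis
 proof
  assume "\<exists>C \<in> circuits M. C h = ?s h & (\<forall>i. C i ~= Zero --> i ~: R --> i ~: G & C i = ?s i)"
  then obtain C where C: "C : circuits M" "C h = X h"
   "!!i. C i ~= Zero ==> i ~: R ==> i ~: G & C i = ?s i" using sh by auto
  have conf: "C i = X i | X i = Zero" "C i = Y i | Y i = Zero" if "C i ~= Zero" "i ~= e" for i
  proof -
   have "i : R ==> X i = Zero & Y i = Zero" using that by (simp add: R_def)
   moreover have "i ~: G ==> X i = Zero | Y i = Zero | X i = Y i"
    using that(2) sign_cases[of "X i" "Y i"] by (auto simp: G_def)
   moreover have "i ~: R ==> i ~: G & C i = (if X i ~= Zero then X i else Y i)"
    using C(3)[OF that(1)] by (simp add: sv_comp_def)
   ultimately show "C i = X i | X i = Zero" "C i = Y i | Y i = Zero"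
    by (metis)+
  qed
  \<comment> \<open>Away from \<open>e\<close> the circuit conforms to both vectors. Orthogonality
    to \<open>X\<close> must therefore be achieved at \<open>e\<close>, so that
    \<open>C e = Y e\<close>, and now orthogonality to \<open>Y\<close> fails.\<close>
  have "C e ~= Zero & C e ~= X e"
  proof (rule ccontr)
   assume a: "~ ?thesis"
   have "~ orthogonal_signs C X"
    by (rule not_orthogonal_conformal[of _ h]) (use C h conf(1) a in auto)
   then show False using cocircuit_orthogonal[OF assms(1) C(1)] by blast
  qed
  then have Ce: "C e ~= Zero" "C e = Y e" using sign_cases[of "C e" "X e"] assms(4,5) by auto
  have "~ orthogonal_signs C Y"
   by (rule not_orthogonal_conformal[of _ e]) (use Ce conf(2) in auto)
  then show ?thesis using cocircuit_orthogonal[OF assms(2) C(1)] by blast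
 next
  assume "\<exists>Z \<in> cocircuits M. Z h = ?s h & (\<forall>i. Z i ~= Zero --> i ~: G --> i ~: R & Z i = ?s i)"
  then obtain Z where Z: "Z : cocircuits M" "!!i. Z i ~= Zero ==> i ~: G ==> i ~: R & Z i = ?s i" by blast
  have "Z e = Zero" using Z(2)[of e] by (auto simp: R_def G_def)
  moreover have "Z i = X i | Z i = Y i" if "Z i ~= Zero" for i
  proof (cases "i : G")
   case True
   then have "X i ~= Zero" "X i = opp (Y i)" by (auto simp: G_def)
   then show ?thesis using sign_cases[OF that, of "X i"] by auto
  next
   case False then show ?thesis using Z(2)[OF that] by (auto simp: sv_comp_def)
  qed
  ultimately show ?thesis using that Z(1) by blast
 qed
qed

section \<open>Duality of oriented matroids\<close>

lemma om_dual_om: "om (om_dual M)"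
proof
 have elim: "\<exists>Z \<in> cocircuits M. Z e = Zero &
      (\<forall>i. Z i = Pos --> X i = Pos | Y i = Pos) &
      (\<forall>i. Z i = Neg --> X i = Neg | Y i = Neg)"
  if a: "X : cocircuits M" "Y : cocircuits M" "X ~= opp \<circ> Y" "X e = Pos" "Y e = Neg" for X Y e
 proof -
  obtain Z where "Z : cocircuits M" "Z e = Zero" "!!i. Z i ~= Zero ==> Z i = X i | Z i = Y i"
   using cocircuit_elim[OF a(1-3), of e] a(4,5) by auto
  then show ?thesis by (metis sign.distinct(1) sign.distinct(3))
 qed
 show "oriented_matroid (om_dual M)"
  unfolding oriented_matroid_def om_dual_def
  using finite_ground cocircuit_support_ground cocircuit_nonempty cocircuit_opp cocircuit_incomparable elim
  by simp
qed

lemma ground_om_dual [simp]: "ground (om_dual M) = ground M"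
 by (simp add: om_dual_def)

lemma circuits_om_dual [simp]: "circuits (om_dual M) = cocircuits M"
 by (simp add: om_dual_def)

text \<open>A set that meets every basis contains a minimal one of this kind, and that one supports
  a signed cocircuit.\<close>

lemma indep_om_dual: "I : indep_sets (om_dual M) \<longleftrightarrow> I \<subseteq> ground M & (\<exists>b. basis b & I \<inter> b = {})"
proof -
 have "(\<exists>b. basis b & I \<inter> b = {})" if I: "I \<subseteq> ground M" "\<forall>Y \<in> cocircuits M. ~ support Y \<subseteq> I"
 proof (rule ccontr)
  assume "~ ?thesis"
  then have m: "\<forall>b \<in> matroid_bases M. I \<inter> b ~= {}" by blast
  have "finite I" by (rule finite_subset[OF I(1) finite_ground])
  then obtain T where T: "T \<subseteq> I" "\<forall>b \<in> matroid_bases M. T \<inter> b ~= {}"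
   "!!T'. T' \<subset> T ==> ~ (\<forall>b \<in> matroid_bases M. T' \<inter> b ~= {})"
   using finite_minimal_subset[of I "%T. \<forall>b \<in> matroid_bases M. T \<inter> b ~= {}"] m by blast
  have "T : cocircuit_supports M" using T I(1) unfolding cocircuit_supports_def by auto
  then obtain Y where "Y : cocircuits M" "support Y = T" using cocircuit_signature by blast
  then show False using I(2) T(1) by blast
 qed
 moreover have "~ support Y \<subseteq> I" if "basis b" "I \<inter> b = {}" "Y : cocircuits M" for b Y
 proof -
  have "support Y \<inter> b ~= {}" using that by (simp add: cocircuits_def cocircuit_supports_def)
  then show ?thesis using that(2) by blast
 qed
 ultimately show ?thesis unfolding indep_sets_def by auto
qed

lemma bases_om_dual: "c : matroid_bases (om_dual M) \<longleftrightarrow> c \<subseteq> ground M & basis (ground M - c)"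
proof -
 interpret D: om "om_dual M" by (rule om_dual_om)
 show ?thesis
 proof
  assume c: "c : matroid_bases (om_dual M)"
  then have "c : indep_sets (om_dual M)" by (rule D.basis_indep)
  then obtain b where b: "c \<subseteq> ground M" "basis b" "c \<inter> b = {}" unfolding indep_om_dual by blast
  have "ground M - b : indep_sets (om_dual M)" using b unfolding indep_om_dual by blast
  moreover have "c \<subseteq> ground M - b" using b by blast
  ultimately have "ground M - b = c" using c unfolding matroid_bases_def by blast
  then have "ground M - c = b" using b indep_ground[OF basis_indep[OF b(2)]] by blast
  then show "c \<subseteq> ground M & basis (ground M - c)" using b by simp
 next
  assume c: "c \<subseteq> ground M & basis (ground M - c)"
  have "c : indep_sets (om_dual M)" using c unfolding indep_om_dual by blast
  moreover have "I = c" if I: "I : indep_sets (om_dual M)" "c \<subseteq> I" for I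
  proof -
   obtain b where b: "I \<subseteq> ground M" "basis b" "I \<inter> b = {}" using I(1) unfolding indep_om_dual by blast
   have "b \<subseteq> ground M - c" using b I indep_ground[OF basis_indep[OF b(2)]] by blast
   then have "b = ground M - c" using b(2) c by (simp add: matroid_bases_def)
   then show ?thesis using b I by blast
  qed
  ultimately show "c : matroid_bases (om_dual M)" unfolding matroid_bases_def by blast
 qed
qed

lemma cocircuit_supports_om_dual: "cocircuit_supports (om_dual M) = support ` circuits M"
proof -
 have meets: "(\<forall>b \<in> matroid_bases (om_dual M). D \<inter> b ~= {}) \<longleftrightarrow> ~ indep D" if D: "D \<subseteq> ground M" for D
 proof
  assume a: "\<forall>b \<in> matroid_bases (om_dual M). D \<inter> b ~= {}"
  show "~ indep D"
  proof
   assume "indep D"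
   then obtain b where b: "basis b" "D \<subseteq> b" by (rule extend_basis)
   have "ground M - (ground M - b) = b" using indep_ground[OF basis_indep[OF b(1)]] by blast
   then have "ground M - b : matroid_bases (om_dual M)" using b unfolding bases_om_dual by simp
   then show False using a b by blast
  qed
 next
  assume a: "~ indep D"
  show "\<forall>b \<in> matroid_bases (om_dual M). D \<inter> b ~= {}"
  proof (intro ballI notI)
   fix b assume b: "b : matroid_bases (om_dual M)" "D \<inter> b = {}"
   then have "D \<subseteq> ground M - b" using D by blast
   then show False using a b(1) indep_subset basis_indep unfolding bases_om_dual by blast
  qed
 qed
 show ?thesis
 proof
  show "cocircuit_supports (om_dual M) \<subseteq> support ` circuits M"
  proof
   fix D assume D: "D : cocircuit_supports (om_dual M)"
   then have g: "D \<subseteq> ground M" "~ indep D" using meets[of D] by (auto simp: cocircuit_supports_def)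
   then obtain X where X: "X : circuits M" "support X \<subseteq> D" using not_indep_circuit by blast
   have "support X = D"
   proof (rule ccontr)
    assume "support X ~= D"
    then have "support X \<subset> D" using X by blast
    then have "\<exists>b\<in>matroid_bases (om_dual M). support X \<inter> b = {}"
     using om.cocircuit_minimal[OF om_dual_om D] by blast
    then have "indep (support X)" using meets[OF circuit_ground[OF X(1)]] by blast
    from indep_no_circuit[OF this X(1)] show False by blast
   qed
   then show "D : support ` circuits M" using X by blast
  qed
  show "support ` circuits M \<subseteq> cocircuit_supports (om_dual M)"
  proof
   fix D assume "D : support ` circuits M"
   then obtain X where X: "X : circuits M" "D = support X" by blast
   have g: "D \<subseteq> ground M" using X circuit_ground by blast
   have "~ indep D" using X indep_no_circuit by blast
   then have "\<forall>b \<in> matroid_bases (om_dual M). D \<inter> b ~= {}" using meets[OF g] by blast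
   moreover have "\<exists>b\<in>matroid_bases (om_dual M). D' \<inter> b = {}" if "D' \<subset> D" for D'
   proof -
    have "indep D'" using circuit_proper_subset_indep[OF X(1)] X(2) that by blast
    then show ?thesis using meets[of D'] that g by blast
   qed
   ultimately show "D : cocircuit_supports (om_dual M)" using g by (simp add: cocircuit_supports_def)
  qed
 qed
qed

text \<open>The supports agree by \<open>cocircuit_supports_om_dual\<close>, and on a given support
  the orthogonal signature is unique up to sign, by incomparability in the dual.\<close>

lemma cocircuits_om_dual: "cocircuits (om_dual M) = circuits M"
proof
 interpret D: om "om_dual M" by (rule om_dual_om)
 show sub: "circuits M \<subseteq> cocircuits (om_dual M)"
 proof
  fix X assume X: "X : circuits M"
  then have "support X : cocircuit_supports (om_dual M)" by (simp add: cocircuit_supports_om_dual)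
  moreover have "orthogonal_signs Y X" if "Y : cocircuits M" for Y
   using cocircuit_orthogonal[OF that X] orthogonal_signs_sym by blast
  ultimately show "X : cocircuits (om_dual M)" unfolding cocircuits_def[of "om_dual M"] by simp
 qed
 show "cocircuits (om_dual M) \<subseteq> circuits M"
 proof
  fix X assume X: "X : cocircuits (om_dual M)"
  then have "support X : support ` circuits M"
   unfolding cocircuit_supports_om_dual[symmetric] by (simp add: cocircuits_def)
  then obtain X' where X': "X' : circuits M" "support X = support X'" by blast
  then have "X = X' | X = opp \<circ> X'" using D.cocircuit_incomparable[OF X, of X'] sub by blast
  then show "X : circuits M" using X' circuit_opp by blast
 qed
qed

end

lemma om_dual_dual: "oriented_matroid M ==> om_dual (om_dual (M :: 'e om)) = M"
proof -
 assume "oriented_matroid M"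
 then interpret om M by unfold_locales
 show ?thesis unfolding om_dual_def[of "om_dual M"] by (simp add: cocircuits_om_dual)
qed

section \<open>Deletion and contraction\<close>

lemma orthogonal_signs_upd:
 assumes "X e = Zero"
 shows "orthogonal_signs X (Y(e := s)) \<longleftrightarrow> orthogonal_signs X Y"
proof -
 have "support X \<inter> support (Y(e := s)) = support X \<inter> support Y"
  using assms by (auto simp: support_def)
 moreover have "i ~= e" if "i : support X \<inter> support Y" for i
  using that assms by (auto simp: support_def)
 ultimately show ?thesis unfolding orthogonal_signs_def by (metis fun_upd_apply)
qed

lemma ground_om_delete [simp]: "ground (om_delete M e) = ground M - {e}"
 by (simp add: om_delete_def)

lemma circuits_om_delete: "circuits (om_delete M e) = {X \<in> circuits M. X e = Zero}"
 by (simp add: om_delete_def)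

lemma ground_om_contract [simp]: "ground (om_contract M e) = ground M - {e}"
 by (simp add: om_contract_def Let_def)

definition contract_vectors :: "'e om => 'e => ('e => sign) set" where
 "contract_vectors M e = {Y. (\<exists>X \<in> circuits M. Y = X(e := Zero)) & support Y ~= {}}"

lemma circuits_om_contract:
 "circuits (om_contract M e) =
   {Y \<in> contract_vectors M e. \<forall>Y' \<in> contract_vectors M e. ~ support Y' \<subset> support Y}"
 by (simp add: om_contract_def Let_def contract_vectors_def)

lemma om_contract_delete_commute:
 assumes "a ~= b"
 shows "om_contract (om_delete M a) b = om_delete (om_contract M b) a"
proof -
 have cv: "contract_vectors (om_delete M a) b = {Y \<in> contract_vectors M b. Y a = Zero}"
  using assms by (auto simp: contract_vectors_def circuits_om_delete)
 have "circuits (om_contract (om_delete M a) b) = circuits (om_delete (om_contract M b) a)"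
 proof -
  have *: "Y' a = Zero" if "support Y' \<subset> support Y" "Y a = Zero" for Y Y' :: "'a => sign"
   using that by (auto simp: support_def)
  have "(\<forall>Y' \<in> {Y \<in> contract_vectors M b. Y a = Zero}. ~ support Y' \<subset> support Y) \<longleftrightarrow>
   (\<forall>Y' \<in> contract_vectors M b. ~ support Y' \<subset> support Y)" if "Y a = Zero" for Y
   using *[where Y = Y] that by blast
  then show ?thesis unfolding circuits_om_delete circuits_om_contract cv by blast
 qed
 moreover have "ground (om_contract (om_delete M a) b) = ground (om_delete (om_contract M b) a)"
  by auto
 ultimately show ?thesis by simp
qed

context om
begin

lemma om_delete_om: "om (om_delete M e)"
proof
 have elim: "\<exists>Z \<in> circuits M. Z e = Zero & Z e' = Zero &
      (\<forall>i. Z i = Pos --> X i = Pos | Y i = Pos) &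
      (\<forall>i. Z i = Neg --> X i = Neg | Y i = Neg)"
  if a: "X : circuits M" "Y : circuits M" "X e = Zero" "Y e = Zero" "X ~= opp \<circ> Y" "X e' = Pos" "Y e' = Neg" for X Y e'
 proof -
  obtain Z where Z: "Z : circuits M" "Z e' = Zero" "!!i. Z i ~= Zero ==> Z i = X i | Z i = Y i"
   using circuit_elim[OF a(1,2) _ _ a(5), of e'] a(6,7) by auto
  have "Z e = Zero" using Z(3)[of e] a(3,4) by auto
  then show ?thesis using Z by (metis sign.distinct(1) sign.distinct(3))
 qed
 show "oriented_matroid (om_delete M e)"
  unfolding oriented_matroid_def ground_om_delete circuits_om_delete
 proof (intro conjI ballI impI allI)
  fix X Y e' assume "X : {X \<in> circuits M. X e = Zero}" "Y : {X \<in> circuits M. X e = Zero}"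
   "X ~= opp \<circ> Y & X e' = Pos & Y e' = Neg"
  then have "\<exists>Z \<in> circuits M. Z e = Zero & Z e' = Zero &
      (\<forall>i. Z i = Pos --> X i = Pos | Y i = Pos) &
      (\<forall>i. Z i = Neg --> X i = Neg | Y i = Neg)" by (intro elim) auto
  then show "\<exists>Z\<in>{X \<in> circuits M. X e = Zero}. Z e' = Zero &
      (\<forall>i. Z i = Pos --> X i = Pos | Y i = Pos) &
      (\<forall>i. Z i = Neg --> X i = Neg | Y i = Neg)" by blast
 next
  fix X assume X: "X : {X \<in> circuits M. X e = Zero}"
  then have "support X \<subseteq> ground M" "e ~: support X" using circuit_ground by (auto simp: mem_support)
  then show "support X \<subseteq> ground M - {e}" by blast
 qed (use finite_ground circuit_nonempty circuit_opp circuit_incomparable in auto)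
qed

lemma contract_vectors_dual_orthogonal:
 assumes "Y : contract_vectors (om_dual M) e"
 shows "support Y \<subseteq> ground (om_delete M e)"
  and "X : circuits (om_delete M e) ==> orthogonal_signs X Y"
proof -
 obtain Y' where Y': "Y' : cocircuits M" "Y = Y'(e := Zero)"
  using assms by (auto simp: contract_vectors_def)
 show "support Y \<subseteq> ground (om_delete M e)"
  using cocircuit_support_ground[OF Y'(1)] Y'(2) by (auto simp: support_def)
 show "X : circuits (om_delete M e) ==> orthogonal_signs X Y"
  using cocircuit_orthogonal[OF Y'(1)] Y'(2) by (auto simp: circuits_om_delete orthogonal_signs_upd)
qed

text \<open>Painting with \<open>e\<close> as the only element of \<open>G\<close>: the cocircuit
  may take any value at \<open>e\<close>, and erasing this value gives the required vector.\<close>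

lemma conformal_contract_vector:
 assumes "support Z \<subseteq> ground (om_delete M e)"
  "!!X. X : circuits (om_delete M e) ==> orthogonal_signs X Z" "Z h ~= Zero"
 obtains Y where "Y : contract_vectors (om_dual M) e" "Y h = Z h" "!!i. Y i ~= Zero ==> Y i = Z i"
proof -
 have h: "h : ground M" "h ~= e" and Ze: "Z e = Zero" using assms(1,3) by (auto simp: support_def)
 define R where "R = ground M - support Z - {e}"
 have "(\<exists>X \<in> circuits M. X h = Z h & (\<forall>i. X i ~= Zero --> i ~: R --> i ~: {e} & X i = Z i)) |
  (\<exists>Y \<in> cocircuits M. Y h = Z h & (\<forall>i. Y i ~= Zero --> i ~: {e} --> i ~: R & Y i = Z i))"
  by (rule painting[where s = Z, OF h(1) assms(3)]) (use h assms(3) in \<open>auto simp: support_def R_def\<close>)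
 then show ?thesis
 proof
  assume "\<exists>X \<in> circuits M. X h = Z h & (\<forall>i. X i ~= Zero --> i ~: R --> i ~: {e} & X i = Z i)"
  then obtain X where X: "X : circuits M" "X h = Z h"
   "\<forall>i. X i ~= Zero --> i ~: R --> i ~: {e} & X i = Z i" by blast
  have "X e = Zero" using X(3) by (auto simp: R_def)
  then have "X : circuits (om_delete M e)" using X(1) by (simp add: circuits_om_delete)
  moreover have "~ orthogonal_signs X Z"
  proof (rule not_orthogonal_conformal[of _ h])
   show "X h = Z h" "X h ~= Zero" using X(2) assms(3) by simp_all
   show "X i = Z i" if "X i ~= Zero" "Z i ~= Zero" for i
    using X(3) that by (auto simp: R_def mem_support)
  qed
  ultimately show ?thesis using assms(2) by blast
 next
  assume "\<exists>Y \<in> cocircuits M. Y h = Z h & (\<forall>i. Y i ~= Zero --> i ~: {e} --> i ~: R & Y i = Z i)"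
  then obtain Y where Y: "Y : cocircuits M" "Y h = Z h"
   "\<forall>i. Y i ~= Zero --> i ~: {e} --> i ~: R & Y i = Z i" by blast
  have "h : support (Y(e := Zero))" using Y(2) h assms(3) by (simp add: mem_support)
  then have "Y(e := Zero) : contract_vectors (om_dual M) e"
   using Y(1) by (auto simp: contract_vectors_def)
  then show ?thesis
  proof (rule that)
   show "(Y(e := Zero)) h = Z h" using Y(2) h by simp
   show "(Y(e := Zero)) i = Z i" if "(Y(e := Zero)) i ~= Zero" for i
    using Y(3) that by (auto split: if_splits)
  qed
 qed
qed

lemma conformal_eq:
 assumes "!!i. Y i ~= Zero ==> Y i = Z i" "support Z \<subseteq> support Y"
 shows "Y = Z"
proof
 fix i show "Y i = Z i"
 proof (cases "Y i = Zero")
  case True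
  then have "i ~: support Z" using assms(2) by (auto simp: mem_support)
  then show ?thesis using True by (simp add: mem_support)
 qed (use assms(1) in blast)
qed

lemma conformal_support: "(!!i. Y i ~= Zero ==> Y i = Z i) ==> support Y \<subseteq> support Z"
 by (metis mem_support subsetI)

text \<open>Below every restricted cocircuit lies a cocircuit of the deletion, and below every
  cocircuit of the deletion lies a restricted cocircuit, in both cases conformally. Hence the two
  families have the same elements of minimal support.\<close>

lemma cocircuits_om_delete: "cocircuits (om_delete M e) = circuits (om_contract (om_dual M) e)"
proof -
 interpret N: om "om_delete M e" by (rule om_delete_om)
 have low: "\<exists>Y \<in> cocircuits (om_delete M e). (\<forall>i. Y i ~= Zero --> Y i = y i)"
  if y: "y : contract_vectors (om_dual M) e" for y
 proof -
  obtain h where "y h ~= Zero" using y by (auto simp: contract_vectors_def support_def)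
  from N.conformal_cocircuit[OF contract_vectors_dual_orthogonal[OF y] this]
  show ?thesis by metis
 qed
 have supeq: "support Y = support Y'"
  if "Y : cocircuits (om_delete M e)" "Y' : cocircuits (om_delete M e)" "support Y \<subseteq> support Y'" for Y Y'
  using N.cocircuit_incomparable[OF that] by auto
 have inR: "Y : contract_vectors (om_dual M) e" if Y: "Y : cocircuits (om_delete M e)" for Y
 proof -
  obtain h where h: "Y h ~= Zero" using N.cocircuit_nonempty[OF Y] by (auto simp: support_def)
  obtain y where y: "y : contract_vectors (om_dual M) e" "y h = Y h" "!!i. y i ~= Zero ==> y i = Y i"
   by (rule conformal_contract_vector[OF N.cocircuit_support_ground[OF Y] N.cocircuit_orthogonal[OF Y] h]) auto
  obtain Y2 where Y2: "Y2 : cocircuits (om_delete M e)" "\<forall>i. Y2 i ~= Zero --> Y2 i = y i"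
   using low[OF y(1)] by blast
  have s: "support Y2 \<subseteq> support y" "support y \<subseteq> support Y"
   using Y2(2) y(3) by (auto intro!: conformal_support)
  have "support Y2 \<subseteq> support Y" using s by (rule subset_trans)
  then have "support Y \<subseteq> support y" using supeq[OF Y2(1) Y] s by blast
  then have "y = Y" by (intro conformal_eq y(3))
  then show ?thesis using y(1) by simp
 qed
 show ?thesis
 proof
  show "cocircuits (om_delete M e) \<subseteq> circuits (om_contract (om_dual M) e)"
  proof
   fix Y assume Y: "Y : cocircuits (om_delete M e)"
   have False if Y': "Y' : contract_vectors (om_dual M) e" "support Y' \<subset> support Y" for Y'
   proof -
    obtain Y2 where Y2: "Y2 : cocircuits (om_delete M e)" "\<forall>i. Y2 i ~= Zero --> Y2 i = Y' i"
     using low[OF Y'(1)] by blast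
    have "support Y2 \<subseteq> support Y'" using Y2(2) by (auto intro!: conformal_support)
    then show False using supeq[OF Y2(1) Y] Y'(2) by blast
   qed
   then show "Y : circuits (om_contract (om_dual M) e)"
    unfolding circuits_om_contract using inR[OF Y] by blast
  qed
  show "circuits (om_contract (om_dual M) e) \<subseteq> cocircuits (om_delete M e)"
  proof
   fix y assume "y : circuits (om_contract (om_dual M) e)"
   then have y: "y : contract_vectors (om_dual M) e"
    "!!Y'. Y' : contract_vectors (om_dual M) e ==> ~ support Y' \<subset> support y"
    unfolding circuits_om_contract by blast+
   obtain Y2 where Y2: "Y2 : cocircuits (om_delete M e)" "\<forall>i. Y2 i ~= Zero --> Y2 i = y i"
    using low[OF y(1)] by blast
   have "support Y2 \<subseteq> support y" using Y2(2) by (auto intro!: conformal_support)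
   then have "support y \<subseteq> support Y2" using y(2)[OF inR[OF Y2(1)]] by blast
   then have "Y2 = y" using conformal_eq[of Y2 y] Y2(2) by blast
   then show "y : cocircuits (om_delete M e)" using Y2(1) by simp
  qed
 qed
qed

lemma om_dual_delete: "om_dual (om_delete M e) = om_contract (om_dual M) e"
 unfolding om_dual_def[of "om_delete M e"] cocircuits_om_delete
 by (rule om.equality) auto

text \<open>Turns claims about contractions, in particular the circuit axioms, into claims about
  deletions in the dual.\<close>

lemma om_contract_eq: "om_contract M e = om_dual (om_delete (om_dual M) e)"
 using om.om_dual_delete[OF om_dual_om, of e] om_dual_dual[OF om] by simp

lemma om_contract_om: "om (om_contract M e)"
 unfolding om_contract_eq by (intro om.om_dual_om om.om_delete_om om_dual_om)

lemma rank_om_dual: "matroid_rank (om_dual M) = card (ground M) - matroid_rank M"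
 and rank_le_ground: "matroid_rank M \<le> card (ground M)"
proof -
 obtain b where b: "basis b" by (rule basis_exists)
 have bg: "b \<subseteq> ground M" by (rule indep_ground[OF basis_indep[OF b]])
 have "ground M - (ground M - b) = b" using bg by blast
 then have "ground M - b : matroid_bases (om_dual M)" using b unfolding bases_om_dual by simp
 then have "matroid_rank (om_dual M) = card (ground M - b)" by (rule om.rank_eq[OF om_dual_om])
 then show "matroid_rank (om_dual M) = card (ground M) - matroid_rank M"
  using card_Diff_subset[OF finite_subset[OF bg finite_ground] bg] rank_eq[OF b] by simp
 show "matroid_rank M \<le> card (ground M)" using rank_eq[OF b] card_mono[OF finite_ground bg] by simp
qed

text \<open>A circuit inside \<open>insert g I\<close> has a nonzero restriction because
  \<open>g\<close> is not a loop; below this restriction lies one of minimal support, which is a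
  circuit of the contraction.\<close>

lemma indep_contract:
 assumes "g : ground M" "~ is_loop M g"
 shows "I : indep_sets (om_contract M g) \<longleftrightarrow> g ~: I & indep (insert g I)"
proof
 assume I: "I : indep_sets (om_contract M g)"
 then have g: "I \<subseteq> ground M - {g}" "!!Y. Y : circuits (om_contract M g) ==> ~ support Y \<subseteq> I"
  by (auto simp: indep_sets_def)
 have "indep (insert g I)"
 proof (rule ccontr)
  assume "~ indep (insert g I)"
  moreover have "insert g I \<subseteq> ground M" using g assms by blast
  ultimately obtain X where X: "X : circuits M" "support X \<subseteq> insert g I"
   using not_indep_circuit by blast
  have s: "support (X(g := Zero)) = support X - {g}" by (auto simp: support_def)
  have "support X ~= {g}" using assms(2) X(1) by (auto simp: is_loop_def)
  then have ne: "support (X(g := Zero)) ~= {}" using s circuit_nonempty[OF X(1)] by blast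
  then have "X(g := Zero) : contract_vectors M g" using X(1) by (auto simp: contract_vectors_def)
  then have ex: "\<exists>Y \<in> contract_vectors M g. support Y = support (X(g := Zero))" by blast
  have fin: "finite (support (X(g := Zero)))" 
   by (rule finite_subset[OF _ finite_ground]) (use s circuit_ground[OF X(1)] in blast)
  obtain T where T: "T \<subseteq> support (X(g := Zero))" "\<exists>Y \<in> contract_vectors M g. support Y = T"
   "!!T'. T' \<subset> T ==> ~ (\<exists>Y \<in> contract_vectors M g. support Y = T')"
   by (rule finite_minimal_subset[OF fin, where P = "%T. \<exists>Y \<in> contract_vectors M g. support Y = T", OF ex]) auto
  obtain Y where Y: "Y : contract_vectors M g" "support Y = T" using T(2) by blast
  have "Y : circuits (om_contract M g)" using Y T(3) by (auto simp: circuits_om_contract)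
  moreover have "support Y \<subseteq> I" using Y(2) T(1) s X(2) by blast
  ultimately show False using g(2) by blast
 qed
 then show "g ~: I & indep (insert g I)" using g by blast
next
 assume I: "g ~: I & indep (insert g I)"
 have "~ support Y \<subseteq> I" if Y: "Y : circuits (om_contract M g)" for Y
 proof
  assume s: "support Y \<subseteq> I"
  obtain X where X: "X : circuits M" "Y = X(g := Zero)"
   using Y unfolding circuits_om_contract contract_vectors_def by blast
  have "support X \<subseteq> insert g (support Y)" using X(2) by (auto simp: support_def)
  then have "support X \<subseteq> insert g I" using s by blast
  then show False using I indep_no_circuit[OF _ X(1)] by blast
 qed
 then show "I : indep_sets (om_contract M g)"
  using I indep_ground[of "insert g I"] by (auto simp: indep_sets_def[of "om_contract M g"])
qed

lemma bases_contract:
 assumes "g : ground M" "~ is_loop M g"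
 shows "b : matroid_bases (om_contract M g) \<longleftrightarrow> g ~: b & basis (insert g b)"
proof -
 interpret C: om "om_contract M g" by (rule om_contract_om)
 show ?thesis unfolding C.basis_iff basis_iff indep_contract[OF assms]
  by (auto simp: insert_commute)
qed

end

section \<open>Generic programs: duality, vertices and feasible topes\<close>

locale om_prog =
 fixes P :: "'e program"
 assumes program: "om_program P" and generic: "generic_program P"
begin

abbreviation "g \<equiv> prog_g P"
abbreviation "f \<equiv> prog_f P"
abbreviation "E \<equiv> prog_E P"

sublocale Mt: om "prog_om P"
 by unfold_locales (use program in \<open>simp add: om_program_def\<close>)

sublocale N: om "prog_N P"
 unfolding prog_N_def by (rule Mt.om_delete_om)

sublocale M: om "prog_M P"
 unfolding prog_M_def by (rule N.om_contract_om)

lemma gf: "g : ground (prog_om P)" "f : ground (prog_om P)" "g ~= f"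
 using program by (auto simp: om_program_def)

lemma ground_N: "ground (prog_N P) = insert g E"
 using gf by (auto simp: prog_N_def prog_E_def)

lemma ground_M: "ground (prog_M P) = E"
 by (auto simp: prog_M_def prog_N_def prog_E_def)

lemma gfE: "g ~: E" "f ~: E"
 by (auto simp: prog_E_def)

lemma finite_E: "finite E"
 using M.finite_ground by (simp add: ground_M)

lemma circuits_N: "circuits (prog_N P) = {X \<in> circuits (prog_om P). X f = Zero}"
 by (simp add: prog_N_def circuits_om_delete)

lemma not_loop_N: "~ is_loop (prog_N P) g"
 using program by (auto simp: om_program_def is_loop_def circuits_N)

lemma bases_M: "b : matroid_bases (prog_M P) \<longleftrightarrow> g ~: b & N.basis (insert g b)"
 unfolding prog_M_def using N.bases_contract[OF _ not_loop_N] by (simp add: ground_N)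

lemma prog_M_alt: "prog_M P = om_delete (om_contract (prog_om P) g) f"
 unfolding prog_M_def prog_N_def using om_contract_delete_commute gf by metis

lemma dual_simps [simp]: "prog_om (dual_program P) = om_dual (prog_om P)"
 "prog_g (dual_program P) = f" "prog_f (dual_program P) = g"
 by (simp_all add: dual_program_def)

lemma prog_E_dual [simp]: "prog_E (dual_program P) = E"
 by (auto simp: prog_E_def)

text \<open>Dualising exchanges the deletion of \<open>f\<close> with a contraction and the
  contraction of \<open>g\<close> with a deletion, and operations at different elements
  commute.\<close>

lemma prog_M_dual: "prog_M (dual_program P) = om_dual (prog_M P)"
proof -
 have "prog_M (dual_program P) = om_delete (om_contract (om_dual (prog_om P)) f) g"
  unfolding prog_M_def prog_N_def using om_contract_delete_commute gf by (metis dual_simps)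
 also have "... = om_delete (om_dual (prog_N P)) g"
  unfolding prog_N_def Mt.om_dual_delete ..
 also have "... = om_dual (om_dual (om_delete (om_dual (prog_N P)) g))"
  using om_dual_dual[OF om.om[OF om.om_delete_om[OF N.om_dual_om]]] by simp
 also have "... = om_dual (prog_M P)"
  unfolding prog_M_def N.om_contract_eq ..
 finally show ?thesis .
qed

lemma rank_dual: "prog_rank (dual_program P) = card E - prog_rank P"
 unfolding prog_rank_def prog_M_dual M.rank_om_dual by (simp add: ground_M)

lemma rank_le: "prog_rank P \<le> card E"
 using M.rank_le_ground by (simp add: prog_rank_def ground_M)

lemma cocircuits_N_dual: "cocircuits (prog_N (dual_program P)) = circuits (om_contract (prog_om P) g)"
 unfolding prog_N_def by (simp add: om.cocircuits_om_delete[OF Mt.om_dual_om] om_dual_dual[OF Mt.om])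

lemma circuits_N_dual: "circuits (prog_N (dual_program P)) = {Y \<in> cocircuits (prog_om P). Y g = Zero}"
 by (simp add: prog_N_def circuits_om_delete)

lemma om_program_dual: "om_program (dual_program P)"
 unfolding om_program_def
proof (intro conjI)
 show "oriented_matroid (prog_om (dual_program P))" using om.om[OF Mt.om_dual_om] by simp
 show "~ is_loop (prog_om (dual_program P)) (prog_g (dual_program P))"
 proof
  assume "is_loop (prog_om (dual_program P)) (prog_g (dual_program P))"
  then obtain Y where "Y : cocircuits (prog_om P)" "support Y = {f}" by (auto simp: is_loop_def)
  then have "\<forall>b \<in> matroid_bases (prog_om P). f : b"
   by (auto simp: cocircuits_def cocircuit_supports_def)
  then show False using program gf by (auto simp: om_program_def is_coloop_def)
 qed
 show "~ is_coloop (prog_om (dual_program P)) (prog_f (dual_program P))"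
 proof
  assume "is_coloop (prog_om (dual_program P)) (prog_f (dual_program P))"
  then have c: "\<forall>c \<in> matroid_bases (om_dual (prog_om P)). g : c" by (simp add: is_coloop_def)
  have gnb: "g ~: b" if "Mt.basis b" for b
  proof -
   have "ground (prog_om P) - (ground (prog_om P) - b) = b"
    using Mt.indep_ground[OF Mt.basis_indep[OF that]] by blast
   then have "ground (prog_om P) - b : matroid_bases (om_dual (prog_om P))"
    using that unfolding Mt.bases_om_dual by simp
   then show ?thesis using c by blast
  qed
  have "~ Mt.indep {g}"
  proof
   assume "Mt.indep {g}"
   then obtain b where "Mt.basis b" "{g} \<subseteq> b" by (rule Mt.extend_basis)
   then show False using gnb by blast
  qed
  then obtain X where X: "X : circuits (prog_om P)" "support X \<subseteq> {g}"
   using Mt.not_indep_circuit gf by blast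
  then have "support X = {g}" using Mt.circuit_nonempty[OF X(1)] by blast
  then show False using X(1) program by (auto simp: om_program_def is_loop_def)
 qed
qed (use gf in auto)

lemma dual_dual: "dual_program (dual_program P) = P"
 by (simp add: dual_program_def om_dual_dual[OF Mt.om])

text \<open>Duality exchanges the two conditions, because the cocircuits of one
  \<open>prog_N\<close> are the circuits of the other program's contraction. The bound
  \<open>prog_rank P\<close> becomes \<open>card E - prog_rank P\<close>, and \<open>rank_le\<close>
  lets the subtraction of natural numbers be undone.\<close>

lemma generic_dual: "generic_program (dual_program P)"
 unfolding generic_program_def
proof (intro conjI ballI impI)
 fix Y assume Y: "Y : cocircuits (prog_N (dual_program P))"
  "card (zero_set (prog_N (dual_program P)) Y) > prog_rank (dual_program P)"
 have "zero_set (prog_N (dual_program P)) Y = zero_set (om_contract (prog_om P) g) Y"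
  by (simp add: zero_set_def prog_N_def)
 then show "Y (prog_g (dual_program P)) = Zero"
  using generic Y unfolding generic_program_def cocircuits_N_dual rank_dual by simp
next
 fix X assume X: "X : circuits (om_contract (prog_om (dual_program P)) (prog_g (dual_program P)))"
  "card (zero_set (om_contract (prog_om (dual_program P)) (prog_g (dual_program P))) X)
   > card (prog_E (dual_program P)) - prog_rank (dual_program P)"
 have 1: "X : cocircuits (prog_N P)" using X(1) by (simp add: prog_N_def Mt.cocircuits_om_delete)
 have "zero_set (om_contract (prog_om (dual_program P)) (prog_g (dual_program P))) X = zero_set (prog_N P) X"
  by (simp add: zero_set_def prog_N_def)
 then have "card (zero_set (prog_N P) X) > prog_rank P"
  using X(2) rank_dual rank_le by simp
 then show "X (prog_f (dual_program P)) = Zero" using generic 1 unfolding generic_program_def by simp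
qed

lemma om_prog_dual: "om_prog (dual_program P)"
 by unfold_locales (rule om_program_dual, rule generic_dual)

text \<open>A conformal cocircuit \<open>Y\<close> through \<open>g\<close> is a vertex of the face
  \<open>Z\<close>. Its zero set contains a basis of the contraction by \<open>g\<close>, and
  genericity bounds the size of the zero set by the rank, so the zero set is that basis.\<close>

lemma vertex:
 assumes "support Z \<subseteq> ground (prog_N P)" "!!X. X : circuits (prog_N P) ==> orthogonal_signs X Z"
  "Z g = Pos"
 obtains Y b where "Y : cocircuits (prog_N P)" "Y g = Pos" "!!i. Y i ~= Zero ==> Y i = Z i"
  "b = insert g E - support Y" "b : matroid_bases (prog_M P)"
proof -
 have "Z g ~= Zero" using assms(3) by simp
 from N.conformal_cocircuit[OF assms(1,2) this]
 obtain Y where Y: "Y : cocircuits (prog_N P)" "Y g = Pos" "\<forall>i. Y i ~= Zero --> Y i = Z i"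
  using assms(3) by metis
 have D: "support Y : cocircuit_supports (prog_N P)" using Y(1) by (simp add: cocircuits_def)
 obtain I where I: "N.complement_basis (support Y) I"
  using N.complement_basis_extend[OF N.indep_empty, of "support Y"] by blast
 have Ig: "I \<subseteq> ground (prog_N P) - support Y" using I by (simp add: N.complement_basis_def)
 have gY: "g : support Y" using Y(2) by (simp add: mem_support)
 then have IM: "I : matroid_bases (prog_M P)"
  using N.complement_basis_insert[OF D I gY] Ig unfolding bases_M by blast
 have "~ card (zero_set (prog_N P) Y) > prog_rank P"
  using generic Y(1,2) unfolding generic_program_def by force
 then have "card (zero_set (prog_N P) Y) \<le> card I"
  using M.rank_eq[OF IM] by (simp add: prog_rank_def)
 then have "I = zero_set (prog_N P) Y"
  using Ig N.finite_ground unfolding zero_set_def by (intro card_seteq) auto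
 then show ?thesis
  by (intro that[OF Y(1,2) _ refl]) (use Y(3) IM in \<open>auto simp: zero_set_def ground_N\<close>)
qed

lemma M_basis_no_circuit:
 assumes "b : matroid_bases (prog_M P)" "X : circuits (prog_N P)"
 shows "~ support X \<subseteq> insert g b"
proof -
 have "N.basis (insert g b)" using assms(1) unfolding bases_M by blast
 then show ?thesis using N.indep_no_circuit[OF N.basis_indep assms(2)] by blast
qed

text \<open>Replaces maximality among covectors by full support. A tope that vanished at
  \<open>i\<close> could be enlarged by composing it with a cocircuit through \<open>i\<close>, and
  such a cocircuit exists unless \<open>i\<close> is a loop.\<close>

lemma feasible_iff:
 "al : feasible_topes P \<longleftrightarrow>
  support al = E & (\<forall>X \<in> circuits (prog_N P). orthogonal_signs X (al(g := Pos)))"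
proof
 assume "al : feasible_topes P"
 then obtain T where T: "al = T(g := Zero)" "T : topes (prog_N P)" "T g = Pos"
  by (auto simp: feasible_topes_def)
 have cov: "T : covectors (prog_N P)" and
  max: "!!Z. Z : covectors (prog_N P) ==> face_of T Z ==> Z = T"
  using T(2) by (auto simp: topes_def)
 have Ts: "support T \<subseteq> ground (prog_N P)" and To: "!!X. X : circuits (prog_N P) ==> orthogonal_signs X T"
  using cov unfolding N.covectors_iff by auto
 \<comment> \<open>The vertex serves to exclude loops: a loop is off every cocircuit, so it would
   lie in the basis \<open>b\<close> of zeros.\<close>
 obtain Y b where Y: "Y : cocircuits (prog_N P)" "Y g = Pos"
  "b = insert g E - support Y" "b : matroid_bases (prog_M P)"
  by (rule vertex[OF Ts To T(3)]) auto
 have full: "i : support T" if i: "i : ground (prog_N P)" for i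
 proof (rule ccontr)
  assume iT: "i ~: support T"
  have noloop: "support X ~= {i}" if X: "X : circuits (prog_N P)" for X
  proof
   assume s: "support X = {i}"
   have "support Y : cocircuit_supports (prog_N P)" using Y(1) by (simp add: cocircuits_def)
   from N.circuit_cocircuit_inter_not_singleton[OF this X, of i]
   have "i ~: support Y" using s by blast
   then have "support X \<subseteq> insert g b" using s i Y(3) by (auto simp: ground_N)
   then show False using M_basis_no_circuit[OF Y(4) X] by blast
  qed
  have "(\<exists>X \<in> circuits (prog_N P). X i ~= Zero & support X \<subseteq> insert i {}) |
   (\<exists>Y \<in> cocircuits (prog_N P). Y i ~= Zero & support Y \<inter> {} = {})"
   by (rule N.painting_base[OF i]) simp
  moreover have "~ (\<exists>X \<in> circuits (prog_N P). X i ~= Zero & support X \<subseteq> insert i {})"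
  proof
   assume "\<exists>X \<in> circuits (prog_N P). X i ~= Zero & support X \<subseteq> insert i {}"
   then obtain X where X: "X : circuits (prog_N P)" "support X \<subseteq> {i}" by blast
   then have "support X = {i}" using N.circuit_nonempty[OF X(1)] by blast
   then show False using noloop[OF X(1)] by blast
  qed
  ultimately obtain W where W: "W : cocircuits (prog_N P)" "W i ~= Zero" by blast
  have "T \<circ>\<^sub>s W : covectors (prog_N P)"
   unfolding N.covectors_iff
  proof (intro conjI ballI)
   have "support (T \<circ>\<^sub>s W) \<subseteq> support T \<union> support W" by (auto simp: sv_comp_def support_def)
   then show "support (T \<circ>\<^sub>s W) \<subseteq> ground (prog_N P)"
    using Ts N.cocircuit_support_ground[OF W(1)] by blast
   show "orthogonal_signs X (T \<circ>\<^sub>s W)" if "X : circuits (prog_N P)" for X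
    by (rule N.orthogonal_comp[OF To[OF that] N.cocircuit_orthogonal[OF W(1) that]])
  qed
  moreover have "face_of T (T \<circ>\<^sub>s W)" by (auto simp: face_of_def sv_comp_def)
  ultimately have "T \<circ>\<^sub>s W = T" by (rule max)
  then have "(T \<circ>\<^sub>s W) i = T i" by simp
  then show False using iT W(2) by (auto simp: sv_comp_def mem_support)
 qed
 have "support al = support T - {g}" using T(1) by (auto simp: support_def)
 also have "support T = insert g E" using full Ts by (auto simp: ground_N)
 finally have "support al = E" using gfE by auto
 moreover have "al(g := Pos) = T" using T by (auto simp: fun_eq_iff)
 ultimately show "support al = E & (\<forall>X \<in> circuits (prog_N P). orthogonal_signs X (al(g := Pos)))"
  using To by simp
next
 assume a: "support al = E & (\<forall>X \<in> circuits (prog_N P). orthogonal_signs X (al(g := Pos)))"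
 let ?T = "al(g := Pos)"
 have s: "support ?T = ground (prog_N P)" using a by (auto simp: support_def ground_N)
 have ag: "al g = Zero" using a gfE by (auto simp: support_def)
 have cov: "?T : covectors (prog_N P)" unfolding N.covectors_iff using a s by simp
 have "Z = ?T" if Z: "Z : covectors (prog_N P)" "face_of ?T Z" for Z
 proof -
  have "support Z \<subseteq> support ?T" using Z(1) s unfolding N.covectors_iff by simp
  moreover have "?T i = Z i" if "?T i ~= Zero" for i
  proof -
   have "(?T \<circ>\<^sub>s Z) i = Z i" using Z(2) by (simp add: face_of_def)
   then show ?thesis using that unfolding sv_comp_def by presburger
  qed
  ultimately show ?thesis using N.conformal_eq[of ?T Z] by simp
 qed
 then have "?T : topes (prog_N P)" using cov by (simp add: topes_def)
 moreover have "al = ?T(g := Zero)" using ag by (auto simp: fun_eq_iff)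
 ultimately show "al : feasible_topes P" unfolding feasible_topes_def by (metis (mono_tags, lifting) fun_upd_same mem_Collect_eq)
qed

lemma feasible_support: "al : feasible_topes P ==> support al = E"
 by (simp add: feasible_iff)

text \<open>A circuit of \<open>prog_N P\<close> is not contained in \<open>insert g b\<close>, so
  it meets the support of the vertex \<open>Y\<close>, and orthogonality to \<open>Y\<close>
  supplies both an agreement and a disagreement there. These witnesses remain whatever signs are put
  on \<open>b\<close>: near a generic vertex the arrangement is a full set of orthants.\<close>

lemma feasible_cone:
 assumes "support al = E" "support Z \<subseteq> ground (prog_N P)"
  "!!X. X : circuits (prog_N P) ==> orthogonal_signs X Z" "Z g = Pos"
  "!!i. i : E ==> Z i ~= Zero ==> Z i = al i"
 shows "\<exists>b \<in> matroid_bases (prog_M P). E - support Z \<subseteq> b &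
  (\<forall>c. support c = E & (\<forall>i. i ~: b --> c i = al i) --> c : feasible_topes P)"
proof -
 obtain Y b where Y: "Y : cocircuits (prog_N P)" "Y g = Pos" "!!i. Y i ~= Zero ==> Y i = Z i"
  "b = insert g E - support Y" "b : matroid_bases (prog_M P)"
  by (rule vertex[OF assms(2-4)]) auto
 have "c : feasible_topes P" if c: "support c = E" "!!i. i ~: b ==> c i = al i" for c
  unfolding feasible_iff
 proof (intro conjI ballI c(1))
  fix X assume X: "X : circuits (prog_N P)"
  have eq: "(c(g := Pos)) i = Y i" if "Y i ~= Zero" for i
  proof (cases "i = g")
   case False
   have "i : E" using N.cocircuit_support_ground[OF Y(1)] that False by (auto simp: ground_N support_def)
   moreover have "i ~: b" using that Y(4) by (simp add: mem_support)
   ultimately show ?thesis using c(2) assms(5) Y(3)[OF that] that False by auto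
  qed (use Y(2) in simp)
  have "~ support X \<subseteq> insert g b" by (rule M_basis_no_circuit[OF Y(5) X])
  then have "support X \<inter> support Y ~= {}"
   using Y(4) N.circuit_ground[OF X] by (auto simp: ground_N)
  then obtain i j where ij: "X i ~= Zero" "Y i ~= Zero" "X i = Y i" "X j ~= Zero" "Y j ~= Zero" "X j = opp (Y j)"
   using N.cocircuit_orthogonal[OF Y(1) X] unfolding orthogonal_signs_def by (auto simp: mem_support)
  then show "orthogonal_signs X (c(g := Pos))"
   using eq[OF ij(2)] eq[OF ij(5)] by (intro orthogonal_signsI) metis+
 qed
 moreover have "E - support Z \<subseteq> b"
  using Y(3,4) by (auto simp: mem_support)
 ultimately show ?thesis using Y(5) by blast
qed

lemma feasible_vertex:
 assumes "al : feasible_topes P"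
 shows "\<exists>b \<in> matroid_bases (prog_M P).
  (\<forall>c. support c = E & (\<forall>i. i ~: b --> c i = al i) --> c : feasible_topes P)"
proof -
 have a: "support al = E" "\<forall>X \<in> circuits (prog_N P). orthogonal_signs X (al(g := Pos))"
  using assms by (auto simp: feasible_iff)
 have "\<exists>b \<in> matroid_bases (prog_M P). E - support (al(g := Pos)) \<subseteq> b &
  (\<forall>c. support c = E & (\<forall>i. i ~: b --> c i = al i) --> c : feasible_topes P)"
 proof (rule feasible_cone[OF a(1)])
  show "support (al(g := Pos)) \<subseteq> ground (prog_N P)" using a(1) by (auto simp: support_def ground_N)
 qed (use a(2) gfE in auto)
 then show ?thesis by blast
qed

text \<open>The wall between \<open>al\<close> and its flip is a covector, since a circuit conformal
  to it would be conformal to one of the two topes, depending on its sign at \<open>j\<close>. A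
  vertex of the wall is then a vertex of both topes, and \<open>j\<close> is among its
  zeros.\<close>

lemma feasible_edge_vertex:
 assumes "al : feasible_topes P" "flip al j : feasible_topes P" "j : E"
 shows "\<exists>b \<in> matroid_bases (prog_M P). j : b &
  (\<forall>c. support c = E & (\<forall>i. i ~: b --> c i = al i) --> c : feasible_topes P)"
proof -
 have a: "support al = E" "\<forall>X \<in> circuits (prog_N P). orthogonal_signs X (al(g := Pos))"
  "\<forall>X \<in> circuits (prog_N P). orthogonal_signs X ((flip al j)(g := Pos))"
  using assms by (auto simp: feasible_iff)
 have jg: "j ~= g" using assms(3) gfE by blast
 have aj: "al j ~= Zero" using a(1) assms(3) by (auto simp: support_def)
 \<comment> \<open>The common wall: \<open>al\<close> with the coordinate \<open>j\<close>
   erased.\<close>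
 let ?Z = "(al(g := Pos))(j := Zero)"
 have "\<exists>b \<in> matroid_bases (prog_M P). E - support ?Z \<subseteq> b &
  (\<forall>c. support c = E & (\<forall>i. i ~: b --> c i = al i) --> c : feasible_topes P)"
 proof (rule feasible_cone[OF a(1)])
  show "support ?Z \<subseteq> ground (prog_N P)" using a(1) by (auto simp: support_def ground_N)
  show "?Z g = Pos" using jg by simp
  show "?Z i = al i" if "i : E" "?Z i ~= Zero" for i
   using that gfE by (auto split: if_splits)
  fix X assume X: "X : circuits (prog_N P)"
  have o: "orthogonal_signs X (al(g := Pos))" "orthogonal_signs X ((flip al j)(g := Pos))"
   using a X by auto
  have agr: "~ orthogonal_signs X' (al(g := Pos)) | ~ orthogonal_signs X' ((flip al j)(g := Pos))"
   if X': "!!i. X' i ~= Zero ==> ?Z i ~= Zero ==> X' i = ?Z i" "X' i ~= Zero" "?Z i ~= Zero" for X' i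
  proof -
   have rest: "X' h = (al(g := Pos)) h" "X' h = ((flip al j)(g := Pos)) h"
    if "X' h ~= Zero" "(al(g := Pos)) h ~= Zero" "h ~= j" for h
    using X'(1)[of h] that by (auto simp: flip_def)
   have ij: "i ~= j" "(al(g := Pos)) i ~= Zero" using X'(3) by (auto split: if_splits)
   have nz: "(al(g := Pos)) h ~= Zero" if "((flip al j)(g := Pos)) h ~= Zero" for h
    using that by (auto simp: flip_def split: if_splits)
   have "X' j = al j | X' j = opp (al j) | X' j = Zero" using sign_cases aj by blast
   then consider "X' j = al j | X' j = Zero" | "X' j = opp (al j)" by blast
   then show ?thesis
   proof cases
    case 1
    have "~ orthogonal_signs X' (al(g := Pos))"
    proof (rule not_orthogonal_conformal[of _ i])
     show "X' h = (al(g := Pos)) h" if "X' h ~= Zero" "(al(g := Pos)) h ~= Zero" for h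
      using rest(1)[OF that] 1 that jg by (cases "h = j") auto
    qed (use rest(1)[OF X'(2) ij(2,1)] X'(2) in auto)
    then show ?thesis by blast
   next
    case 2
    have "~ orthogonal_signs X' ((flip al j)(g := Pos))"
    proof (rule not_orthogonal_conformal[of _ i])
     show "X' h = ((flip al j)(g := Pos)) h" if "X' h ~= Zero" "((flip al j)(g := Pos)) h ~= Zero" for h
      using rest(2)[OF that(1) nz[OF that(2)]] 2 jg by (cases "h = j") (auto simp: flip_def)
    qed (use rest(2)[OF X'(2) ij(2,1)] X'(2) in auto)
    then show ?thesis by blast
   qed
  qed
  show "orthogonal_signs X ?Z"
  proof (rule ccontr)
   assume "~ orthogonal_signs X ?Z"
   then show False
   proof (cases rule: not_orthogonal_cases)
    case 1
    then obtain i where "X i ~= Zero" "?Z i ~= Zero" by blast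
    from agr[OF 1(1) this] show False using o by blast
   next
    case 2
    then obtain i where i: "X i ~= Zero" "?Z i ~= Zero" by blast
    have c: "(opp \<circ> X) h = ?Z h" if "(opp \<circ> X) h ~= Zero" "?Z h ~= Zero" for h
    proof -
     have "X h = opp (?Z h)" by (rule 2(1)[OF _ that(2)]) (use that(1) in simp)
     then show ?thesis by simp
    qed
    have "(opp \<circ> X) i ~= Zero" using i by simp
    from agr[OF c this i(2)] show False using o unfolding orthogonal_signs_opp by blast
   qed
  qed
 qed
 then obtain b where b: "b : matroid_bases (prog_M P)" "E - support ?Z \<subseteq> b"
  "\<forall>c. support c = E & (\<forall>i. i ~: b --> c i = al i) --> c : feasible_topes P" by blast
 have "j : E - support ?Z" using assms(3) by (simp add: support_def)
 then have "j : b" using b(2) by blast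
 then show ?thesis using b by blast
qed

end

section \<open>Bounded sign vectors as feasible topes of the dual program\<close>

context om_prog
begin

lemma feasible_dual_iff:
 "al : feasible_topes (dual_program P) \<longleftrightarrow>
  support al = E & (\<forall>Y \<in> cocircuits (prog_om P). Y g = Zero --> orthogonal_signs Y (al(f := Pos)))"
 using om_prog.feasible_iff[OF om_prog_dual, of al] by (auto simp: circuits_N_dual)

text \<open>If a cocircuit conformal to \<open>\<alpha>\<close> avoids both \<open>g\<close> and \<open>f\<close>, then by genericity it extends to
 a covector through \<open>f\<close> with one more element in its support.\<close>

lemma cocircuit_through_f:
 assumes "Y : cocircuits (prog_om P)" "Y g = Zero" "Y f = Zero"
 shows "\<exists>Y' \<in> cocircuits (prog_om P). Y' f = Pos & support Y' \<subseteq> insert f (support Y)"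
proof -
 define R where "R = ground (prog_om P) - support Y - {f}"
 have "(\<exists>X \<in> circuits (prog_om P). X f ~= Zero & support X \<subseteq> insert f R) |
  (\<exists>Y \<in> cocircuits (prog_om P). Y f ~= Zero & support Y \<inter> R = {})"
  by (rule Mt.painting_base[OF gf(2)]) (simp add: R_def)
 then show ?thesis
 proof
  assume "\<exists>Y \<in> cocircuits (prog_om P). Y f ~= Zero & support Y \<inter> R = {}"
  then obtain Y' where Y': "Y' : cocircuits (prog_om P)" "Y' f ~= Zero" "support Y' \<inter> R = {}" by blast
  have s: "support Y' \<subseteq> insert f (support Y)"
   using Mt.cocircuit_support_ground[OF Y'(1)] Y'(3) by (auto simp: R_def)
  show ?thesis
  proof (cases "Y' f = Pos")
   case True then show ?thesis using Y'(1) s by blast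
  next
   case False
   then have "(opp \<circ> Y') f = Pos" using Y'(2) by (cases "Y' f") auto
   moreover have "support (opp \<circ> Y') \<subseteq> insert f (support Y)" using s by simp
   ultimately show ?thesis using Mt.cocircuit_opp[OF Y'(1)] by blast
  qed
 next
  assume "\<exists>X \<in> circuits (prog_om P). X f ~= Zero & support X \<subseteq> insert f R"
  \<comment> \<open>This alternative is impossible. A circuit \<open>X'\<close> of the contraction
    by \<open>g\<close> that passes through \<open>f\<close> has at least
    \<open>prog_rank P + 1\<close> elements by genericity. Without \<open>f\<close> it is therefore
    a basis \<open>J\<close> of \<open>prog_M P\<close> off the support of \<open>Y\<close>. The
    fundamental circuit of an element \<open>y\<close> of that support over
    \<open>insert g J\<close> would meet the support in \<open>y\<close> alone.\<close>
  then obtain X where X: "X : circuits (prog_om P)" "X f ~= Zero" "support X \<subseteq> insert f R" by blast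
  interpret D: om "om_dual (prog_om P)" by (rule Mt.om_dual_om)
  interpret C: om "om_delete (om_dual (prog_om P)) g" by (rule D.om_delete_om)
  have cC: "cocircuits (om_delete (om_dual (prog_om P)) g) = circuits (om_contract (prog_om P) g)"
   using D.cocircuits_om_delete om_dual_dual[OF Mt.om] by simp
  have gX: "support (X(g := Zero)) \<subseteq> ground (om_delete (om_dual (prog_om P)) g)"
   using Mt.circuit_ground[OF X(1)] by (auto simp: support_def)
  have oX: "orthogonal_signs W (X(g := Zero))"
   if "W : circuits (om_delete (om_dual (prog_om P)) g)" for W
   using that Mt.cocircuit_orthogonal[OF _ X(1)]
   by (auto simp: circuits_om_delete orthogonal_signs_upd intro: orthogonal_signs_sym)
  have Xf: "(X(g := Zero)) f ~= Zero" using X(2) gf by simp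
  obtain X' where X': "X' : circuits (om_contract (prog_om P) g)" "X' f ~= Zero"
   "\<forall>i. X' i ~= Zero --> X' i = (X(g := Zero)) i"
   using C.conformal_cocircuit[OF gX oX Xf] cC Xf by metis
  have sX': "support X' \<subseteq> insert f (E - support Y)"
  proof
   fix i assume "i : support X'"
   then have "(X(g := Zero)) i ~= Zero" using X'(3) by (metis mem_support)
   then have "X i ~= Zero" "i ~= g" by (auto split: if_splits)
   then show "i : insert f (E - support Y)"
    using X(3) by (auto simp: mem_support R_def prog_E_def)
  qed
  have gr: "ground (om_contract (prog_om P) g) = insert f E" using gf by (auto simp: prog_E_def)
  have "~ card (zero_set (om_contract (prog_om P) g) X') > card E - prog_rank P"
   using generic X'(1,2) unfolding generic_program_def by blast
  moreover have "card (zero_set (om_contract (prog_om P) g) X') = Suc (card E) - card (support X')"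
  proof -
   have sub: "support X' \<subseteq> insert f E" using sX' by blast
   have "finite (support X')" by (rule finite_subset[OF sub]) (simp add: finite_E)
   then have "card (insert f E - support X') = card (insert f E) - card (support X')"
    by (rule card_Diff_subset[OF _ sub])
   then show ?thesis using finite_E gfE unfolding zero_set_def gr by simp
  qed
  ultimately have c1: "card (support X') \<ge> Suc (prog_rank P)" using rank_le by linarith
  define J where "J = support X' - {f}"
  have JE: "J \<subseteq> E - support Y" using sX' by (auto simp: J_def)
  have finX': "finite (support X')" by (rule finite_subset[OF sX']) (simp add: finite_E)
  have "f : support X'" using X'(2) by (simp add: mem_support)
  then have cJ: "card J \<ge> prog_rank P" using c1 finX' unfolding J_def by simp
  have JM: "J : indep_sets (prog_M P)"
  proof (rule ccontr)
   assume "J ~: indep_sets (prog_M P)"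
   moreover have "J \<subseteq> ground (prog_M P)" using JE by (auto simp: ground_M)
   ultimately obtain X'' where X'': "X'' : circuits (prog_M P)" "support X'' \<subseteq> J"
    using M.not_indep_circuit by blast
   then have X''2: "X'' : circuits (om_contract (prog_om P) g)"
    by (simp add: prog_M_alt circuits_om_delete)
   have "support X'' \<subset> support X'" using X''(2) \<open>f \<in> support X'\<close> by (auto simp: J_def)
   then show False using X'(1) X''2 unfolding circuits_om_contract by blast
  qed
  obtain b0 where b0: "M.basis b0" by (rule M.basis_exists)
  have "M.basis J" by (rule M.basisI[OF JM b0]) (use M.rank_eq[OF b0] cJ in \<open>simp add: prog_rank_def\<close>)
  then have bN: "N.basis (insert g J)" using bases_M by blast
  obtain y where y: "y : support Y" using Mt.cocircuit_nonempty[OF assms(1)] by blast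
  have yE: "y : E" using y Mt.cocircuit_support_ground[OF assms(1)] assms(2,3)
   by (auto simp: prog_E_def support_def)
  have yn: "y ~: insert g J" using y JE yE gfE by auto
  have "~ N.indep (insert y (insert g J))" using bN yn yE unfolding N.basis_iff by (auto simp: ground_N)
  then obtain C where C: "C : circuits (prog_N P)" "support C \<subseteq> insert y (insert g J)" "C y ~= Zero"
   using N.fundamental_circuit[OF N.basis_indep[OF bN], of y] yE by (auto simp: ground_N)
  have "C : circuits (prog_om P)" using C(1) by (simp add: circuits_N)
  moreover have "support C \<inter> support Y = {y}"
   using C(2,3) y JE assms(2) by (auto simp: mem_support)
  moreover have "support Y : cocircuit_supports (prog_om P)" using assms(1) by (simp add: cocircuits_def)
  ultimately show ?thesis using Mt.circuit_cocircuit_inter_not_singleton by blast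
 qed
qed

text \<open>A cocircuit avoiding \<open>g\<close> that is conformal to \<open>al\<close> with
  \<open>Pos\<close> at \<open>f\<close> obstructs dual feasibility. If it is nonzero at
  \<open>f\<close>, it is itself an unbounded direction; otherwise composing it with the cocircuit
  from \<open>cocircuit_through_f\<close> makes it one without new elements of \<open>E\<close>.
  Conversely, an unbounded direction contains a conformal cocircuit that is positive at
  \<open>f\<close>.\<close>

lemma bounded_eq_feasible_dual: "bounded_signs P = feasible_topes (dual_program P)"
proof (intro equalityI subsetI)
 fix al assume "al : bounded_signs P"
 then have al: "support al = E" and bd: "~ unbounded P al" by (auto simp: bounded_signs_def)
 have conf: False
  if Y: "Y : cocircuits (prog_om P)" "Y g = Zero" "!!i. Y i ~= Zero ==> Y i = (al(f := Pos)) i" for Y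
 proof (cases "Y f = Zero")
  case False
  have "Y : covectors (prog_om P)"
   using Mt.cocircuit_support_ground[OF Y(1)] Mt.cocircuit_orthogonal[OF Y(1)]
   unfolding Mt.covectors_iff by blast
  moreover have "Y f = Pos" using Y(3)[OF False] by simp
  moreover have "Y i : {Zero, al i}" if "i : E" for i
  proof -
   have "i ~= f" using that gfE by blast
   then show ?thesis using Y(3)[of i] by (cases "Y i = Zero") auto
  qed
  ultimately show False using bd Y(2) unfolding unbounded_def by blast
 next
  case True
  obtain Y' where Y': "Y' : cocircuits (prog_om P)" "Y' f = Pos" "support Y' \<subseteq> insert f (support Y)"
   using cocircuit_through_f[OF Y(1,2) True] by blast
  have "support (Y \<circ>\<^sub>s Y') \<subseteq> ground (prog_om P)"
   using Mt.cocircuit_support_ground[OF Y(1)] Mt.cocircuit_support_ground[OF Y'(1)]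
   by (auto simp: sv_comp_def support_def)
  moreover have "orthogonal_signs X (Y \<circ>\<^sub>s Y')" if "X : circuits (prog_om P)" for X
   by (rule Mt.orthogonal_comp[OF Mt.cocircuit_orthogonal[OF Y(1) that] Mt.cocircuit_orthogonal[OF Y'(1) that]])
  ultimately have "Y \<circ>\<^sub>s Y' : covectors (prog_om P)" unfolding Mt.covectors_iff by blast
  moreover have Y'0: "Y' i = Zero" if "Y i = Zero" "i ~= f" for i
   using Y'(3) that by (auto simp: support_def)
  have "(Y \<circ>\<^sub>s Y') g = Zero" using Y(2) Y'0[OF Y(2) gf(3)] by (simp add: sv_comp_def)
  moreover have "(Y \<circ>\<^sub>s Y') f = Pos" using True Y'(2) by (simp add: sv_comp_def)
  moreover have "(Y \<circ>\<^sub>s Y') i : {Zero, al i}" if "i : E" for i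
  proof (cases "Y i = Zero")
   case True
   have "i ~= f" using that gfE by blast
   then show ?thesis using Y'0[OF True] True by (simp add: sv_comp_def)
  next
   case False
   then show ?thesis using Y(3)[OF False] that gfE by (auto simp: sv_comp_def)
  qed
  ultimately show False using bd unfolding unbounded_def by blast
 qed
 show "al : feasible_topes (dual_program P)"
  unfolding feasible_dual_iff
 proof (intro conjI ballI impI al)
  fix Y assume Y: "Y : cocircuits (prog_om P)" "Y g = Zero"
  have nz: "(al(f := Pos)) i ~= Zero" if "Y i ~= Zero" for i
  proof -
   have "i : insert f E"
    using that Mt.cocircuit_support_ground[OF Y(1)] Y(2) by (auto simp: prog_E_def support_def)
   then show ?thesis using al by (auto simp: support_def)
  qed
  show "orthogonal_signs Y (al(f := Pos))"
  proof (rule ccontr)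
   assume "~ orthogonal_signs Y (al(f := Pos))"
   then show False
   proof (cases rule: not_orthogonal_cases)
    case 1
    then show False using conf[OF Y] nz by blast
   next
    case 2
    have "(opp \<circ> Y) i = (al(f := Pos)) i" if "(opp \<circ> Y) i ~= Zero" for i
    proof -
     have "Y i ~= Zero" using that by simp
     then have "Y i = opp ((al(f := Pos)) i)" by (intro 2(1) nz)
     then show ?thesis by simp
    qed
    then show False using conf[OF Mt.cocircuit_opp[OF Y(1)]] Y(2) by simp
   qed
  qed
 qed
next
 fix al assume a: "al : feasible_topes (dual_program P)"
 have "~ unbounded P al"
 proof
  assume "unbounded P al"
  then obtain Z where Z: "Z : covectors (prog_om P)" "Z g = Zero" "Z f = Pos"
   "\<forall>i \<in> E. Z i : {Zero, al i}" unfolding unbounded_def by blast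
  have Zs: "support Z \<subseteq> ground (prog_om P)" "!!X. X : circuits (prog_om P) ==> orthogonal_signs X Z"
   using Z(1) unfolding Mt.covectors_iff by blast+
  have "Z f ~= Zero" using Z(3) by simp
  from Mt.conformal_cocircuit[OF Zs this]
  obtain Y where Y: "Y : cocircuits (prog_om P)" "Y f = Z f" "\<forall>i. Y i ~= Zero --> Y i = Z i" by metis
  have "Y g = Zero" using Y(3) Z(2) by metis
  then have "orthogonal_signs Y (al(f := Pos))" using a Y(1) by (simp add: feasible_dual_iff)
  moreover have "~ orthogonal_signs Y (al(f := Pos))"
  proof (rule not_orthogonal_conformal[of _ f])
   show "Y f = (al(f := Pos)) f" "Y f ~= Zero" using Y(2) Z(3) by simp_all
   fix i assume i: "Y i ~= Zero"
   show "Y i = (al(f := Pos)) i"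
   proof (cases "i = f")
    case False
    have "i : E" using i False Mt.cocircuit_support_ground[OF Y(1)] \<open>Y g = Zero\<close>
     by (auto simp: prog_E_def support_def)
    then show ?thesis using Y(3) Z(4) i False by (metis empty_iff fun_upd_other insert_iff)
   qed (use Y(2) Z(3) in simp)
  qed
  ultimately show False by blast
 qed
 then show "al : bounded_signs P" using a by (simp add: bounded_signs_def feasible_dual_iff)
qed

lemma bounded_feasible_eq: "bounded_feasible P = feasible_topes P \<inter> feasible_topes (dual_program P)"
 by (simp add: bounded_feasible_def bounded_eq_feasible_dual)

lemma bounded_feasible_dual: "bounded_feasible (dual_program P) = bounded_feasible P"
 using om_prog.bounded_feasible_eq[OF om_prog_dual] bounded_feasible_eq dual_dual by auto

lemma flip_support: "support (flip al i) = support al"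
 by (auto simp: support_def flip_def)

text \<open>A circuit excluding the flipped tope from \<open>\<F>\<close> and a cocircuit excluding it from the
 feasible topes of the dual program would agree on their common support.\<close>

lemma flip_feasible_or_dual:
 assumes "al : bounded_feasible P" "i : E"
 shows "flip al i : feasible_topes P | flip al i : feasible_topes (dual_program P)"
proof (rule ccontr)
 assume neg: "~ ?thesis"
 have al: "al : feasible_topes P" "al : feasible_topes (dual_program P)"
  using assms by (auto simp: bounded_feasible_eq)
 have s: "support (flip al i) = E" using al(1) by (simp add: flip_support feasible_iff)
 \<comment> \<open>Stated for a set \<open>C\<close> closed under \<open>opp\<close> and for
   unspecified \<open>h\<close>, \<open>h'\<close>, so that it serves for circuits with
   \<open>g\<close> as \<open>h'\<close> and for cocircuits with \<open>f\<close> as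
   \<open>h'\<close>. A vector that excludes only the flipped tope is nonzero at \<open>i\<close>
   and up to sign agrees with the flip on \<open>E\<close>.\<close>
 have norm: "\<exists>X' \<in> C. X' h = Zero & X' i ~= Zero & (\<forall>j. X' j ~= Zero --> j : E --> X' j = flip al i j)"
  if X: "X : C" "!!X. X : C ==> opp \<circ> X : C" "X h = Zero" "h' ~: E"
   "support X \<subseteq> insert h' (insert h E)"
   "orthogonal_signs X (al(h' := Pos))" "~ orthogonal_signs X ((flip al i)(h' := Pos))" for X C h h'
 proof -
  have Xi: "X i ~= Zero"
  proof
   assume "X i = Zero"
   then have "orthogonal_signs X ((al(h' := Pos))(i := opp (al i)))" using X(6) by (simp add: orthogonal_signs_upd)
   moreover have "(al(h' := Pos))(i := opp (al i)) = (flip al i)(h' := Pos)"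
    using assms(2) X(4) by (auto simp: flip_def)
   ultimately show False using X(7) by simp
  qed
  have nz: "((flip al i)(h' := Pos)) j ~= Zero" if "j : E" for j
   using that s by (auto simp: support_def)
  have eq: "((flip al i)(h' := Pos)) j = flip al i j" if "j : E" for j using that X(4) by auto
  from X(7) show ?thesis
  proof (cases rule: not_orthogonal_cases)
   case 1
   have "\<forall>j. X j ~= Zero --> j : E --> X j = flip al i j"
    using 1(1) nz eq by metis
   then show ?thesis using X(1,3) Xi by blast
  next
   case 2
   have "\<forall>j. (opp \<circ> X) j ~= Zero --> j : E --> (opp \<circ> X) j = flip al i j"
   proof (intro allI impI)
    fix j assume j: "(opp \<circ> X) j ~= Zero" "j : E"
    have "X j = opp (((flip al i)(h' := Pos)) j)" by (rule 2(1)[OF _ nz[OF j(2)]]) (use j(1) in simp)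
    then show "(opp \<circ> X) j = flip al i j" using eq[OF j(2)] by simp
   qed
   moreover have "(opp \<circ> X) h = Zero" "(opp \<circ> X) i ~= Zero" using X(3) Xi by simp_all
   ultimately show ?thesis using X(2)[OF X(1)] by blast
  qed
 qed
 obtain X where X: "X : circuits (prog_om P)" "X f = Zero" "~ orthogonal_signs X ((flip al i)(g := Pos))"
  using neg s by (auto simp: feasible_iff circuits_N)
 have "support X \<subseteq> insert g (insert f E)" using Mt.circuit_ground[OF X(1)] by (auto simp: prog_E_def)
 moreover have "orthogonal_signs X (al(g := Pos))" using al(1) X by (simp add: feasible_iff circuits_N)
 ultimately obtain X' where X': "X' : circuits (prog_om P)" "X' f = Zero" "X' i ~= Zero"
  "\<forall>j. X' j ~= Zero --> j : E --> X' j = flip al i j"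
  using norm[OF X(1) Mt.circuit_opp X(2) gfE(1) _ _ X(3)] by blast
 obtain Y where Y: "Y : cocircuits (prog_om P)" "Y g = Zero" "~ orthogonal_signs Y ((flip al i)(f := Pos))"
  using neg s by (auto simp: feasible_dual_iff)
 have "support Y \<subseteq> insert f (insert g E)" using Mt.cocircuit_support_ground[OF Y(1)] by (auto simp: prog_E_def)
 moreover have "orthogonal_signs Y (al(f := Pos))" using al(2) Y by (simp add: feasible_dual_iff)
 ultimately obtain Y' where Y': "Y' : cocircuits (prog_om P)" "Y' g = Zero" "Y' i ~= Zero"
  "\<forall>j. Y' j ~= Zero --> j : E --> Y' j = flip al i j"
  using norm[OF Y(1) Mt.cocircuit_opp Y(2) gfE(2) _ _ Y(3)] by blast
 have "~ orthogonal_signs X' Y'"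
 proof (rule not_orthogonal_conformal[of _ i])
  show "X' i = Y' i" using X'(3,4) Y'(3,4) assms(2) by metis
  show "X' i ~= Zero" by fact
  fix j assume j: "X' j ~= Zero" "Y' j ~= Zero"
  then have "j : E" using X'(2) Y'(2) Mt.circuit_ground[OF X'(1)] by (auto simp: prog_E_def support_def)
  then show "X' j = Y' j" using X'(4) Y'(4) j by metis
 qed
 then show False using Mt.cocircuit_orthogonal[OF Y'(1) X'(1)] by blast
qed

end

subsection \<open>Parameter spaces\<close>

definition unit_form :: "'e => 'e => 'k::field" where
 "unit_form i = (%j. if j = i then 1 else 0)"

text \<open>\<open>b\<close> indexes a basis of the quotient of \<open>k\<^sup>E\<close> by the annihilator of \<open>U\<close>.\<close>

definition form_basis :: "'e set => ('e => 'k::field) set => 'e set => bool" where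
 "form_basis E U b \<longleftrightarrow> b \<subseteq> E &
  (\<forall>i \<in> E. \<exists>c \<in> coord_space b. (%j. unit_form i j - c j) : annihilator E U) &
  (\<forall>x \<in> annihilator E U. (\<forall>i. i ~: b --> x i = 0) --> (\<forall>i. x i = 0))"

lemma sum_unit_form: "finite E ==> i : E ==> (\<Sum>j\<in>E. unit_form i j * v j) = (v i :: 'k::field)"
 by (simp add: unit_form_def sum.delta' if_distrib[of "%x. x * _"] cong: if_cong)

lemma annihilator_zero: "x : annihilator E U ==> i ~: E ==> x i = 0"
 by (simp add: annihilator_def coord_space_def)

lemma annihilator_sum: "x : annihilator E U ==> v : U ==> (\<Sum>i\<in>E. x i * v i) = 0"
 by (simp add: annihilator_def)

lemma annihilator_lincomb:
 assumes "finite I" "!!i. i : I ==> x i : annihilator E U"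
 shows "(%j. \<Sum>i\<in>I. (a i :: 'k::field) * x i j) : annihilator E U"
 unfolding annihilator_def coord_space_def mem_Collect_eq
proof (intro conjI allI impI ballI)
 show "(\<Sum>i\<in>I. a i * x i j) = 0" if "j ~: E" for j
 proof (intro sum.neutral ballI)
  show "a i * x i j = 0" if "i : I" for i
   using annihilator_zero[OF assms(2)[OF that] \<open>j \<notin> E\<close>] by simp
 qed
 fix v assume v: "v : U"
 have "(\<Sum>j\<in>E. (\<Sum>i\<in>I. a i * x i j) * v j) = (\<Sum>i\<in>I. a i * (\<Sum>j\<in>E. x i j * v j))"
  by (simp add: sum_distrib_left sum_distrib_right sum.swap[of _ I E] mult.assoc)
 also have "... = 0" using annihilator_sum[OF assms(2) v] by simp
 finally show "(\<Sum>j\<in>E. (\<Sum>i\<in>I. a i * x i j) * v j) = 0" .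
qed

lemma annihilator_diff:
 assumes "x : annihilator E U" "y : annihilator E U"
 shows "(%j. x j - (y j :: 'k::field)) : annihilator E U"
 using assms by (simp add: annihilator_def coord_space_def left_diff_distrib sum_subtractf)

lemma subset_annihilator_annihilator:
 assumes "U \<subseteq> coord_space E"
 shows "U \<subseteq> annihilator E (annihilator E (U :: ('e => 'k::field) set))"
 using assms by (auto simp: annihilator_def mult.commute)

text \<open>Both parts come from the basis \<open>x l\<close> of \<open>U\<close> that restricts to
  unit vectors on \<open>b\<close>. Its entries express every coordinate form on \<open>U\<close>
  through the forms in \<open>b\<close>; the vectors \<open>x l\<close> themselves lie in the double
  annihilator and express the unit vectors in \<open>b\<close> through those outside
  \<open>b\<close>.\<close>

lemma parameter_space_form_basis:
 fixes U :: "('e => 'k::field) set"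
 assumes M: "oriented_matroid M" and U: "parameter_space M U" and b: "b : matroid_bases M"
 shows "form_basis (ground M) U b" "form_basis (ground M) (annihilator (ground M) U) (ground M - b)"
proof -
 interpret om M by unfold_locales (rule M)
 let ?E = "ground M"
 note fin = finite_ground
 have bE: "b \<subseteq> ?E" by (rule indep_ground[OF basis_indep[OF b]])
 then have finb: "finite b" by (rule finite_subset[OF _ fin])
 have UE: "U \<subseteq> coord_space ?E" and bij: "bij_betw (coord_proj b) U (coord_space b)"
  using U b by (auto simp: parameter_space_def)
 have sub: "module.subspace (%(c::'k) (v::'e => 'k) i. c * v i) U"
  using U by (simp add: parameter_space_def is_subspace_def)
 have mod: "Modules.module (%(c::'k) (v::'e => 'k) i. c * v i)"
  by unfold_locales (auto simp: fun_eq_iff algebra_simps)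
 interpret V: Modules.module "%(c::'k) (v::'e => 'k) i. c * v i" by (rule mod)
 have ex: "\<exists>x \<in> U. \<forall>j \<in> b. x j = unit_form l j" if "l : b" for l
 proof -
  have "unit_form l : coord_space b" using that by (simp add: coord_space_def unit_form_def)
  then obtain x where "x : U" "coord_proj b x = unit_form l"
   using bij by (metis bij_betw_imp_surj_on imageE)
  then have "\<forall>j \<in> b. x j = unit_form l j" by (metis coord_proj_def)
  then show ?thesis using \<open>x \<in> U\<close> by blast
 qed
 then obtain x where x: "!!l. l : b ==> x l : U" "!!l j. l : b ==> j : b ==> x l j = unit_form l j"
  by metis
 have expand: "v i = (\<Sum>l\<in>b. v l * x l i)" if v: "v : U" for v i
 proof -
  define w where "w = (%i. \<Sum>l\<in>b. v l * x l i)"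
  have "(\<Sum>l\<in>b. (%i. v l * x l i)) : U"
   by (intro V.subspace_sum[OF sub] V.subspace_scale[OF sub] x(1))
  moreover have "(\<Sum>l\<in>b. (%i. v l * x l i)) = w"
   unfolding w_def by (induction rule: finite_induct[OF finb]) (auto simp: fun_eq_iff)
  ultimately have "w : U" by simp
  moreover have "coord_proj b w = coord_proj b v"
   using x(2) finb by (auto simp: coord_proj_def w_def unit_form_def fun_eq_iff if_distrib[of "%y. _ * y"] cong: if_cong)
  ultimately have "w = v" using bij v by (auto simp: bij_betw_def inj_on_def)
  then show ?thesis unfolding w_def by metis
 qed
 \<comment> \<open>By \<open>expand\<close>, the coordinate \<open>i\<close> of a vector in
   \<open>U\<close> is the combination of its coordinates in \<open>b\<close> with coefficients
   \<open>x l i\<close>.\<close>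
 define c where "c i l = (if l : b then x l i else 0)" for i l
 have cb: "c i : coord_space b" for i by (simp add: c_def coord_space_def)
 have dc: "(%j. unit_form i j - c i j) : annihilator ?E U" if i: "i : ?E" for i
  unfolding annihilator_def mem_Collect_eq
 proof (intro conjI ballI)
  show "(%j. unit_form i j - c i j) : coord_space ?E"
   using i bE by (auto simp: coord_space_def unit_form_def c_def)
  fix v assume v: "v : U"
  have "(\<Sum>j\<in>?E. c i j * v j) = (\<Sum>j\<in>b. x j i * v j)"
   using bE fin by (simp add: c_def if_distrib[of "%y. y * _"] sum.If_cases Int_absorb1 cong: if_cong)
  also have "... = v i" using expand[OF v, of i] by (simp add: mult.commute)
  finally show "(\<Sum>j\<in>?E. (unit_form i j - c i j) * v j) = 0"
   using sum_unit_form[OF fin i, of v] by (simp add: left_diff_distrib sum_subtractf)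
 qed
 show "form_basis ?E U b"
  unfolding form_basis_def
 proof (intro conjI ballI impI bE allI)
  show "\<exists>c\<in>coord_space b. (%j. unit_form i j - c j) : annihilator ?E U" if "i : ?E" for i
   using dc[OF that] cb by blast
  fix y i assume y: "y : annihilator ?E U" "\<forall>i. i ~: b --> y i = 0"
  show "y i = 0"
  proof (cases "i : b")
   case True
   have "0 = (\<Sum>j\<in>?E. y j * x i j)" using annihilator_sum[OF y(1) x(1)[OF True]] by simp
   also have "... = (\<Sum>j\<in>b. y j * x i j)" by (rule sum.mono_neutral_right[OF fin bE]) (use y(2) in simp)
   also have "... = (\<Sum>j\<in>b. unit_form i j * y j)" using x(2)[OF True] by (simp add: mult.commute)
   also have "... = y i" by (rule sum_unit_form[OF finb True])
   finally show ?thesis by simp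
  qed (use y(2) in blast)
 qed
 have sub2: "U \<subseteq> annihilator ?E (annihilator ?E U)" by (rule subset_annihilator_annihilator[OF UE])
 show "form_basis ?E (annihilator ?E U) (?E - b)"
  unfolding form_basis_def
 proof (intro conjI ballI impI allI)
  fix i assume i: "i : ?E"
  show "\<exists>c\<in>coord_space (?E - b). (%j. unit_form i j - c j) : annihilator ?E (annihilator ?E U)"
  proof (cases "i : b")
   case True
   \<comment> \<open>Subtracting \<open>x i\<close> from the unit vector cancels all entries on
     \<open>b\<close> and changes it only by an element of the double annihilator.\<close>
   have "(%j. unit_form i j - x i j) : coord_space (?E - b)"
    using x(1)[OF True] x(2)[OF True] UE i by (auto simp: coord_space_def unit_form_def)
   moreover have "(%j. unit_form i j - (unit_form i j - x i j)) : annihilator ?E (annihilator ?E U)"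
    using x(1)[OF True] sub2 by auto
   ultimately show ?thesis by (intro bexI[of _ "%j. unit_form i j - x i j"])
  next
   case False
   have "(unit_form i :: 'e => 'k) : coord_space (?E - b)" using i False by (simp add: coord_space_def unit_form_def)
   moreover have "(%j. unit_form i j - unit_form i j :: 'k) : annihilator ?E (annihilator ?E U)"
    by (simp add: annihilator_def coord_space_def)
   ultimately show ?thesis by (intro bexI[of _ "unit_form i"])
  qed
 next
  fix y i assume y: "y : annihilator ?E (annihilator ?E U)" "\<forall>i. i ~: ?E - b --> y i = 0"
  show "y i = 0"
  proof (cases "i : ?E - b")
   case True
   have "0 = (\<Sum>j\<in>?E. y j * (unit_form i j - c i j))" using annihilator_sum[OF y(1) dc] True by simp
   also have "... = (\<Sum>j\<in>?E. unit_form i j * y j)"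
    using y(2) by (intro sum.cong refl) (auto simp: c_def algebra_simps)
   also have "... = y i" using True by (intro sum_unit_form[OF fin]) blast
   finally show ?thesis by simp
  qed (use y(2) in blast)
 qed blast
qed

text \<open>This makes the quadratic relations at a vertex of the quiver orthogonal complements of one
 another.\<close>

lemma form_basis_extend:
 fixes U :: "('e => 'k::field) set" and m :: "'e => 'k"
 assumes fin: "finite E" and fb: "form_basis E U b" and S: "b \<subseteq> S" "S \<subseteq> E" "S \<union> S' = E"
  and m: "!!y. y : annihilator E U ==> (\<forall>i. i ~: S --> y i = 0) ==> (\<Sum>i\<in>S \<inter> S'. m i * y i) = 0"
 shows "\<exists>x \<in> annihilator E (annihilator E U). (\<forall>i \<in> S \<inter> S'. x i = m i) & (\<forall>i. i ~: S' --> x i = 0)"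
proof -
 have bE: "b \<subseteq> E" using fb by (simp add: form_basis_def)
 then have finb: "finite b" by (rule finite_subset[OF _ fin])
 have finS: "finite S" by (rule finite_subset[OF S(2) fin])
 have "\<forall>i \<in> E. \<exists>c. c : coord_space b & (%j. unit_form i j - c j) : annihilator E U"
  using fb unfolding form_basis_def by blast
 then obtain c where c: "!!i. i : E ==> c i : coord_space b"
  "!!i. i : E ==> (%j. unit_form i j - c i j) : annihilator E U" by metis
 have cb: "c i j = 0" if "i : E" "j ~: b" for i j using c(1)[OF that(1)] that(2) by (simp add: coord_space_def)
 define m' where "m' i = (if i : S \<inter> S' then m i else 0)" for i
 \<comment> \<open>The vector of the double annihilator with entries \<open>m'\<close> on
   \<open>b\<close>: the relations \<open>unit_form i - c i\<close> in the annihilator force its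
   remaining entries.\<close>
 define x where "x i = (if i : E then \<Sum>l\<in>b. m' l * c i l else 0)" for i
 have "x : annihilator E (annihilator E U)"
  unfolding annihilator_def[of E "annihilator E U"] mem_Collect_eq
 proof (intro conjI ballI)
  show "x : coord_space E" by (simp add: coord_space_def x_def)
  fix y assume y: "y : annihilator E U"
  have "(%j. \<Sum>i\<in>E. y i * (unit_form i j - c i j)) : annihilator E U"
   by (rule annihilator_lincomb[OF fin]) (rule c(2))
  from annihilator_diff[OF y this]
  have z: "(%j. y j - (\<Sum>i\<in>E. y i * (unit_form i j - c i j))) : annihilator E U" .
  have eq: "y j - (\<Sum>i\<in>E. y i * (unit_form i j - c i j)) = (\<Sum>i\<in>E. y i * c i j)" for j
  proof -
   have "(\<Sum>i\<in>E. y i * unit_form i j) = y j"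
    using fin annihilator_zero[OF y, of j]
    by (simp add: unit_form_def if_distrib[of "%y. _ * y"] cong: if_cong)
   then show ?thesis by (simp add: right_diff_distrib sum_subtractf)
  qed
  have "\<forall>j. j ~: b --> (\<Sum>i\<in>E. y i * c i j) = 0" using cb by simp
  then have 0: "(\<Sum>i\<in>E. y i * c i j) = 0" for j
   using fb z unfolding form_basis_def eq by blast
  have "(\<Sum>i\<in>E. x i * y i) = (\<Sum>i\<in>E. \<Sum>l\<in>b. m' l * (y i * c i l))"
   by (rule sum.cong) (simp_all add: x_def sum_distrib_left sum_distrib_right mult_ac)
  also have "... = (\<Sum>l\<in>b. m' l * (\<Sum>i\<in>E. y i * c i l))"
   by (subst sum.swap) (simp add: sum_distrib_left)
  finally show "(\<Sum>i\<in>E. x i * y i) = 0" using 0 by simp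
 qed
 moreover have xS: "x i = m' i" if i: "i : S" for i
 proof -
  have iE: "i : E" using i S by blast
  \<comment> \<open>For \<open>i\<close> in \<open>S\<close> the relation that expresses
    \<open>i\<close> through \<open>b\<close> is supported on \<open>S\<close>, so the hypothesis on
    \<open>m\<close> applies to it. What it says is that the forced entry at \<open>i\<close> equals
    \<open>m' i\<close>.\<close>
  have "\<forall>j. j ~: S --> unit_form i j - c i j = 0"
  proof (intro allI impI)
   fix j assume "j ~: S"
   then have "j ~= i" "j ~: b" using i S(1) by auto
   then show "unit_form i j - c i j = 0" using cb[OF iE] by (simp add: unit_form_def)
  qed
  from m[OF c(2)[OF iE] this]
  have "0 = (\<Sum>j\<in>S \<inter> S'. m j * (unit_form i j - c i j))" by simp
  also have "... = (\<Sum>j\<in>S. m' j * (unit_form i j - c i j))"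
   by (rule sum.mono_neutral_cong_left[OF finS]) (auto simp: m'_def)
  also have "... = m' i - (\<Sum>j\<in>S. m' j * c i j)"
   using sum_unit_form[OF finS i, of m'] by (simp add: right_diff_distrib sum_subtractf mult.commute)
  also have "(\<Sum>j\<in>S. m' j * c i j) = (\<Sum>j\<in>b. m' j * c i j)"
   by (rule sum.mono_neutral_right[OF finS S(1)]) (use cb[OF iE] in simp)
  finally show ?thesis using iE by (simp add: x_def)
 qed
 moreover have "x i = 0" if "i ~: S'" for i
 proof (cases "i : E")
  case True
  then have "i : S" using that S by blast
  then show ?thesis using xS that by (simp add: m'_def)
 qed (simp add: x_def)
 ultimately show ?thesis by (intro bexI[of _ x]) (auto simp: m'_def)
qed

subsection \<open>Algebras over a field and their quotients\<close>

locale kalg = Ring.ring A for A :: "('k::field, 'a) galg" (structure) +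
 assumes smult_closed [simp, intro]: "x : carrier A ==> c \<odot> x : carrier A"
  and smult_l_distr: "x : carrier A ==> (c + d) \<odot> x = c \<odot> x \<oplus> d \<odot> x"
  and smult_r_distr: "x : carrier A ==> y : carrier A ==> c \<odot> (x \<oplus> y) = c \<odot> x \<oplus> c \<odot> y"
  and smult_assoc: "x : carrier A ==> (c * d) \<odot> x = c \<odot> (d \<odot> x)"
  and smult_one: "x : carrier A ==> 1 \<odot> x = x"
  and smult_mult_l: "x : carrier A ==> y : carrier A ==> (c \<odot> x) \<otimes> y = c \<odot> (x \<otimes> y)"
  and smult_mult_r: "x : carrier A ==> y : carrier A ==> x \<otimes> (c \<odot> y) = c \<odot> (x \<otimes> y)"

text \<open>\<open>galg_quot\<close> copies the operations of \<open>A Quot I\<close> into another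
  record type; this carries the ring axioms over field by field.\<close>

lemma ring_cong:
 assumes "Ring.ring R" "carrier S = carrier R" "monoid.mult S = monoid.mult R" "monoid.one S = monoid.one R"
  "ring.zero S = ring.zero R" "ring.add S = ring.add R"
 shows "Ring.ring S"
proof -
 interpret R: Ring.ring R by fact
 note s = assms(2-)
 show ?thesis
 proof (rule ringI)
  show "abelian_group S"
  proof (rule abelian_groupI)
   show "\<exists>y\<in>carrier S. y \<oplus>\<^bsub>S\<^esub> x = \<zero>\<^bsub>S\<^esub>" if "x : carrier S" for x
    using that R.a_inv_closed[of x] R.l_neg[of x] by (auto simp: s)
  qed (auto simp: s R.a_ac)
  show "Group.monoid S"
   by (rule monoidI) (auto simp: s R.m_assoc)
 qed (auto simp: s R.l_distr R.r_distr)
qed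

context kalg
begin

lemma ideal_smult:
 assumes "ideal I A" "x : I"
 shows "c \<odot> x : I"
proof -
 interpret I: ideal I A by fact
 have x: "x : carrier A" using assms(2) I.Icarr by blast
 have "(c \<odot> \<one>) \<otimes> x : I" by (rule I.I_l_closed[OF assms(2)]) simp
 then show ?thesis using x by (simp add: smult_mult_l)
qed

lemma smult_minus:
 assumes "x : carrier A" "y : carrier A"
 shows "c \<odot> (x \<ominus> y) = c \<odot> x \<ominus> c \<odot> y"
proof -
 have "c \<odot> (x \<ominus> y) \<oplus> c \<odot> y = c \<odot> x"
  using assms by (simp add: smult_r_distr[symmetric] minus_eq a_assoc l_neg)
 then show ?thesis using assms
  by (metis add.inv_solve_right minus_closed minus_eq smult_closed)
qed

lemma proj_eq_iff:
 assumes "ideal I A" "x : carrier A" "y : carrier A"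
 shows "I +> x = I +> y \<longleftrightarrow> x \<ominus> y : I"
 using quotient_eq_iff_same_a_r_cos[OF assms] by auto

lemma quot_carrier: "carrier (galg_quot A I) = (%x. I +> x) ` carrier A"
 by (auto simp: galg_quot_def FactRing_def A_RCOSETS_def RCOSETS_def a_r_coset_def)

lemma quot_hcomp: "hcomp (galg_quot A I) n = (%x. I +> x) ` hcomp A n"
 by (simp add: galg_quot_def)

lemma quot_one: "\<one>\<^bsub>galg_quot A I\<^esub> = I +> \<one>"
 by (simp add: galg_quot_def FactRing_def)

lemma quot_zero: "ideal I A ==> \<zero>\<^bsub>galg_quot A I\<^esub> = I +> \<zero>"
 using a_rcos_zero[of I \<zero>] additive_subgroup.zero_closed[OF ideal.axioms(1)[of I A]]
 by (simp add: galg_quot_def FactRing_def)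

lemma quot_add:
 assumes "ideal I A" "x : carrier A" "y : carrier A"
 shows "(I +> x) \<oplus>\<^bsub>galg_quot A I\<^esub> (I +> y) = I +> (x \<oplus> y)"
 using ideal.a_rcos_sum[OF assms] by (simp add: galg_quot_def FactRing_def)

lemma quot_mult:
 assumes "ideal I A" "x : carrier A" "y : carrier A"
 shows "(I +> x) \<otimes>\<^bsub>galg_quot A I\<^esub> (I +> y) = I +> (x \<otimes> y)"
 using ideal.rcoset_mult_add[OF assms] by (simp add: galg_quot_def FactRing_def)

lemma quot_smult:
 assumes "ideal I A" "x : carrier A"
 shows "c \<odot>\<^bsub>galg_quot A I\<^esub> (I +> x) = I +> (c \<odot> x)"
proof -
 interpret I: ideal I A by fact
 \<comment> \<open>All cosets in the union that defines scalar multiplication on the quotient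
   coincide.\<close>
 have eq: "I +> (c \<odot> y) = I +> (c \<odot> x)" if "y : I +> x" for y
 proof -
  have y: "y : carrier A" by (rule I.a_elemrcos_carrier[OF assms(2) that])
  have "y \<ominus> x : I" using I.a_rcos_module_imp[OF assms(2) that] by (simp add: minus_eq)
  then have "c \<odot> (y \<ominus> x) : I" by (rule ideal_smult[OF assms(1)])
  then show ?thesis using proj_eq_iff[OF assms(1) smult_closed[OF y] smult_closed[OF assms(2)]]
   by (simp add: smult_minus y assms(2))
 qed
 have "x : I +> x" by (rule I.a_rcos_self[OF assms(2)])
 then have "I +> x ~= {}" by blast
 then have "(\<Union>y\<in>I +> x. I +> (c \<odot> y)) = I +> (c \<odot> x)"
  by (rule SUP_eq_const) (rule eq)
 then show ?thesis by (simp add: galg_quot_def)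
qed

lemma quot_ring: "ideal I A ==> Ring.ring (galg_quot A I)"
 by (rule ring_cong[OF ideal.quotient_is_ring]) (auto simp: galg_quot_def)

lemmas quot_simps = quot_one quot_zero quot_add quot_mult quot_smult

lemma quot_kalg:
 assumes "ideal I A" shows "kalg (galg_quot A I)"
proof -
 interpret Q: Ring.ring "galg_quot A I" by (rule quot_ring[OF assms])
 note s = quot_simps[where I = I] assms
 show ?thesis
 proof
  fix x c assume "x : carrier (galg_quot A I)"
  then obtain x' where x: "x = I +> x'" "x' : carrier A" by (auto simp: quot_carrier)
  show "c \<odot>\<^bsub>galg_quot A I\<^esub> x : carrier (galg_quot A I)"
   using x by (simp add: s quot_carrier)
  show "1 \<odot>\<^bsub>galg_quot A I\<^esub> x = x" using x by (simp add: s smult_one)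
  fix d
  show "(c + d) \<odot>\<^bsub>galg_quot A I\<^esub> x = c \<odot>\<^bsub>galg_quot A I\<^esub> x \<oplus>\<^bsub>galg_quot A I\<^esub> d \<odot>\<^bsub>galg_quot A I\<^esub> x"
   using x by (simp add: s smult_l_distr)
  show "(c * d) \<odot>\<^bsub>galg_quot A I\<^esub> x = c \<odot>\<^bsub>galg_quot A I\<^esub> (d \<odot>\<^bsub>galg_quot A I\<^esub> x)"
   using x by (simp add: s smult_assoc)
  fix y assume "y : carrier (galg_quot A I)"
  then obtain y' where y: "y = I +> y'" "y' : carrier A" by (auto simp: quot_carrier)
  show "c \<odot>\<^bsub>galg_quot A I\<^esub> (x \<oplus>\<^bsub>galg_quot A I\<^esub> y) =
   c \<odot>\<^bsub>galg_quot A I\<^esub> x \<oplus>\<^bsub>galg_quot A I\<^esub> c \<odot>\<^bsub>galg_quot A I\<^esub> y"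
   using x y by (simp add: s smult_r_distr)
  show "(c \<odot>\<^bsub>galg_quot A I\<^esub> x) \<otimes>\<^bsub>galg_quot A I\<^esub> y = c \<odot>\<^bsub>galg_quot A I\<^esub> (x \<otimes>\<^bsub>galg_quot A I\<^esub> y)"
   using x y by (simp add: s smult_mult_l)
  show "x \<otimes>\<^bsub>galg_quot A I\<^esub> (c \<odot>\<^bsub>galg_quot A I\<^esub> y) = c \<odot>\<^bsub>galg_quot A I\<^esub> (x \<otimes>\<^bsub>galg_quot A I\<^esub> y)"
   using x y by (simp add: s smult_mult_r)
 qed
qed

end

text \<open>Algebras whose addition is that of an ambient type, graded by projections \<open>hp n\<close> to the
 homogeneous components.\<close>

locale graded_kalg = kalg A for A :: "('k::field, 'a::ab_group_add) galg" (structure) +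
 fixes hp :: "nat => 'a => 'a"
 assumes add_eq: "x \<oplus> y = x + y" and zero_eq: "\<zero> = 0"
  and hp_add: "hp n (x + y) = hp n x + hp n y"
  and hp_smult: "x : carrier A ==> hp n (c \<odot> x) = c \<odot> hp n x"
  and hp_closed: "x : carrier A ==> hp n x : carrier A"
  and hp_hp: "hp m (hp n x) = (if m = n then hp n x else 0)"
  and hp_finite: "finite {n. hp n x ~= 0}"
  and hp_total: "(\<Sum>n | hp n x ~= 0. hp n x) = x"
  and hcomp_eq: "hcomp A n = {x \<in> carrier A. hp n x = x}"
  and hp_one: "hp 0 \<one> = \<one>"
  and hp_mult: "x : carrier A ==> y : carrier A ==> hp m x = x ==> hp n y = y ==>
   hp (m + n) (x \<otimes> y) = x \<otimes> y"
begin

lemma uminus_eq: "x : carrier A ==> \<ominus> x = - x"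
 using l_neg[of x] by (simp add: add_eq zero_eq eq_neg_iff_add_eq_0)

lemma minus_eq_diff: "x : carrier A ==> y : carrier A ==> x \<ominus> y = x - y"
 by (simp add: minus_eq uminus_eq add_eq)

lemma plus_closed: "x : carrier A ==> y : carrier A ==> x + y : carrier A"
 using a_closed[of x y] by (simp add: add_eq)

lemma diff_closed: "x : carrier A ==> y : carrier A ==> x - y : carrier A"
 using minus_closed[of x y] by (simp add: minus_eq_diff)

lemma zero_in: "0 : carrier A"
 using zero_closed by (simp add: zero_eq)

lemma sum_closed: "(!!i. i : I ==> f i : carrier A) ==> sum f I : carrier A"
 by (induction I rule: infinite_finite_induct) (auto simp: zero_in plus_closed)

lemma hp_zero: "hp n 0 = 0"
 using hp_add[of n 0 0] by simp

lemma hp_diff: "hp n (x - y) = hp n x - hp n y"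
 using hp_add[of n "x - y" y] by (simp add: algebra_simps)

lemma hp_sum: "hp n (sum f I) = (\<Sum>i\<in>I. hp n (f i))"
 by (induction I rule: infinite_finite_induct) (auto simp: hp_zero hp_add)

lemma hp_other: "hp n x = x ==> m ~= n ==> hp m x = 0"
 using hp_hp[of m n x] by simp

lemma mult_sum_l: "(!!i. i : I ==> f i : carrier A) ==> y : carrier A ==>
  sum f I \<otimes> y = (\<Sum>i\<in>I. f i \<otimes> y)"
proof (induction I rule: infinite_finite_induct)
 case (insert i I)
 then show ?case using l_distr[of "f i" "sum f I" y] by (simp add: add_eq sum_closed)
qed (use l_null[of y] in \<open>auto simp: zero_eq\<close>)

lemma mult_sum_r: "(!!i. i : I ==> f i : carrier A) ==> y : carrier A ==>
  y \<otimes> sum f I = (\<Sum>i\<in>I. y \<otimes> f i)"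
proof (induction I rule: infinite_finite_induct)
 case (insert i I)
 then show ?case using r_distr[of "f i" "sum f I" y] by (simp add: add_eq sum_closed)
qed (use r_null[of y] in \<open>auto simp: zero_eq\<close>)

lemma hp_bound: "\<exists>N. \<forall>M\<ge>N. (\<Sum>n<M. hp n x) = x"
proof -
 obtain N where N: "\<forall>n \<in> {n. hp n x ~= 0}. n < N"
  using hp_finite finite_nat_set_iff_bounded by blast
 have "(\<Sum>n<M. hp n x) = x" if "M \<ge> N" for M
 proof -
  have "(\<Sum>n | hp n x ~= 0. hp n x) = (\<Sum>n<M. hp n x)"
   by (rule sum.mono_neutral_left) (use N that in auto)
  then show ?thesis by (simp add: hp_total)
 qed
 then show ?thesis by blast
qed

lemma hp_mult_sum:
 assumes "x : carrier A" "y : carrier A"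
 shows "hp n (x \<otimes> y) = (\<Sum>i\<le>n. hp i x \<otimes> hp (n - i) y)"
proof -
 obtain N1 N2 where N: "\<forall>M\<ge>N1. (\<Sum>n<M. hp n x) = x" "\<forall>M\<ge>N2. (\<Sum>n<M. hp n y) = y"
  using hp_bound by meson
 \<comment> \<open>The last two summands make both expansions complete; \<open>Suc n\<close> keeps
   the index \<open>n - i\<close> below the common cut-off.\<close>
 define M where "M = Suc n + N1 + N2"
 have "M \<ge> N1" "M \<ge> N2" by (auto simp: M_def)
 then have x: "x = (\<Sum>i<M. hp i x)" and y: "y = (\<Sum>j<M. hp j y)" using N by simp_all
 have "x \<otimes> y = (\<Sum>i<M. hp i x) \<otimes> (\<Sum>j<M. hp j y)" using x y by simp
 also have "... = (\<Sum>i<M. hp i x \<otimes> (\<Sum>j<M. hp j y))"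
  by (rule mult_sum_l) (use assms in \<open>auto intro: hp_closed sum_closed\<close>)
 also have "... = (\<Sum>i<M. \<Sum>j<M. hp i x \<otimes> hp j y)"
  by (intro sum.cong refl mult_sum_r) (use assms in \<open>auto intro: hp_closed\<close>)
 finally have "hp n (x \<otimes> y) = (\<Sum>i<M. \<Sum>j<M. hp n (hp i x \<otimes> hp j y))" by (simp add: hp_sum)
 also have "... = (\<Sum>i<M. \<Sum>j<M. if i + j = n then hp i x \<otimes> hp j y else 0)"
 proof (intro sum.cong refl)
  fix i j
  have "hp (i + j) (hp i x \<otimes> hp j y) = hp i x \<otimes> hp j y"
   using assms by (intro hp_mult) (auto simp: hp_closed hp_hp)
  then show "hp n (hp i x \<otimes> hp j y) = (if i + j = n then hp i x \<otimes> hp j y else 0)"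
   using hp_other by auto
 qed
 also have "... = (\<Sum>i<M. if i \<le> n then hp i x \<otimes> hp (n - i) y else 0)"
 proof (intro sum.cong refl)
  fix i
  show "(\<Sum>j<M. if i + j = n then hp i x \<otimes> hp j y else 0) = (if i \<le> n then hp i x \<otimes> hp (n - i) y else 0)"
  proof (cases "i \<le> n")
   case True
   have "(\<Sum>j<M. if i + j = n then hp i x \<otimes> hp j y else 0) = (\<Sum>j<M. if j = n - i then hp i x \<otimes> hp j y else 0)"
    using True by (intro sum.cong) auto
   also have "n - i < M" by (simp add: M_def)
   then have "(\<Sum>j<M. if j = n - i then hp i x \<otimes> hp j y else 0) = hp i x \<otimes> hp (n - i) y" by simp
   finally show ?thesis using True by simp
  qed simp
 qed
 also have "... = (\<Sum>i\<le>n. hp i x \<otimes> hp (n - i) y)"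
  by (rule sum.mono_neutral_cong_right) (auto simp: M_def)
 finally show ?thesis .
qed

lemma ideal_facts:
 assumes "ideal I A"
 shows "0 : I" "!!x y. x : I ==> y : I ==> x + y : I" "!!x y. x : I ==> y : I ==> x - y : I"
  "!!x. x : I ==> x : carrier A" "!!x y. x : I ==> y : carrier A ==> x \<otimes> y : I"
  "!!x y. x : I ==> y : carrier A ==> y \<otimes> x : I"
  "!!f K. (!!i. i : K ==> f i : I) ==> sum f K : I"
proof -
 interpret I: ideal I A by fact
 show z: "0 : I" using I.zero_closed by (simp add: zero_eq)
 show p: "x + y : I" if "x : I" "y : I" for x y using I.a_closed that by (simp add: add_eq)
 show c: "x : carrier A" if "x : I" for x using I.Icarr that by blast
 show "x - y : I" if "x : I" "y : I" for x y
  using I.a_closed[OF that(1) I.a_inv_closed[OF that(2)]] c that by (simp add: add_eq uminus_eq)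
 show "x : I ==> y : carrier A ==> x \<otimes> y : I" for x y by (rule I.I_r_closed)
 show "x : I ==> y : carrier A ==> y \<otimes> x : I" for x y by (rule I.I_l_closed)
 show "sum f K : I" if "!!i. i : K ==> f i : I" for f :: "'b => 'a" and K
  using that by (induction K rule: infinite_finite_induct) (auto simp: z p)
qed

lemma ideal_ab_I:
 assumes "I \<subseteq> carrier A" "0 : I" "!!x y. x : I ==> y : I ==> x + y : I"
  "!!x y. x : I ==> y : carrier A ==> x \<otimes> y : I" "!!x y. x : I ==> y : carrier A ==> y \<otimes> x : I"
 shows "ideal I A"
proof (rule idealI)
 show "Ring.ring A" by (rule ring_axioms)
 show "subgroup I (add_monoid A)"
 proof
  show "I \<subseteq> carrier (add_monoid A)" using assms(1) by simp
  show "x \<otimes>\<^bsub>add_monoid A\<^esub> y : I" if "x : I" "y : I" for x y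
   using assms(3)[OF that] by (simp add: add_eq)
  show "\<one>\<^bsub>add_monoid A\<^esub> : I" using assms(2) by (simp add: zero_eq)
  show "inv\<^bsub>add_monoid A\<^esub> x : I" if "x : I" for x
  proof -
   have x: "x : carrier A" using that assms(1) by blast
   have "(\<ominus> \<one>) \<otimes> x : I" by (rule assms(5)[OF that]) simp
   then have "\<ominus> x : I" using x by (simp add: l_minus)
   then show ?thesis by (simp add: a_inv_def)
  qed
 qed
qed (use assms in auto)

definition graded_ideal :: "'a set => bool" where
 "graded_ideal I \<longleftrightarrow> ideal I A & (\<forall>x \<in> I. \<forall>n. hp n x : I)"

text \<open>The elements all of whose homogeneous components lie in \<open>Idl X\<close> form an
  ideal, by the product formula for components, and this ideal contains \<open>X\<close>.\<close>

lemma graded_Idl: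
 assumes "!!x. x : X ==> \<exists>n. x : hcomp A n"
 shows "graded_ideal (Idl X)"
proof -
 have Xc: "X \<subseteq> carrier A" using assms by (auto simp: hcomp_eq)
 note I = genideal_ideal[OF Xc]
 note f = ideal_facts[OF I]
 have "ideal {x \<in> Idl X. \<forall>n. hp n x : Idl X} A"
 proof (rule ideal_ab_I)
  fix x y assume x: "x : {x \<in> Idl X. \<forall>n. hp n x : Idl X}" and y: "y : carrier A"
  then have xc: "x : carrier A" using f by blast
  show "x \<otimes> y : {x \<in> Idl X. \<forall>n. hp n x : Idl X}"
   using x y by (auto simp: hp_mult_sum[OF xc y] intro!: f(5,7) hp_closed)
  show "y \<otimes> x : {x \<in> Idl X. \<forall>n. hp n x : Idl X}"
   using x y by (auto simp: hp_mult_sum[OF y xc] intro!: f(6,7) hp_closed)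
 qed (use f in \<open>auto simp: hp_zero hp_add\<close>)
 moreover have "X \<subseteq> {x \<in> Idl X. \<forall>n. hp n x : Idl X}"
 proof
  fix x assume x: "x : X"
  then obtain n where "hp n x = x" using assms by (auto simp: hcomp_eq)
  then have "hp m x = (if m = n then x else 0)" for m using hp_other by simp
  then show "x : {x \<in> Idl X. \<forall>n. hp n x : Idl X}"
   using x genideal_self[OF Xc] f(1) by auto
 qed
 ultimately have "Idl X \<subseteq> {x \<in> Idl X. \<forall>n. hp n x : Idl X}" by (rule genideal_minimal)
 then show ?thesis using I unfolding graded_ideal_def by blast
qed

lemma quot_finsum:
 assumes "ideal I A" "finite K" "!!i. i : K ==> f i : carrier A"
 shows "(\<Oplus>\<^bsub>galg_quot A I\<^esub>i\<in>K. I +> f i) = I +> sum f K"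
proof -
 interpret Q: Ring.ring "galg_quot A I" by (rule quot_ring[OF assms(1)])
 show ?thesis using assms(2,3)
 proof (induction K rule: finite_induct)
  case empty
  then show ?case using quot_zero[OF assms(1)] by (simp add: zero_eq)
 next
  case (insert i K)
  have "(%i. I +> f i) : K \<rightarrow> carrier (galg_quot A I)" "I +> f i : carrier (galg_quot A I)"
   using insert by (auto simp: quot_carrier)
  then have "(\<Oplus>\<^bsub>galg_quot A I\<^esub>i\<in>insert i K. I +> f i) = (I +> f i) \<oplus>\<^bsub>galg_quot A I\<^esub> (I +> sum f K)"
   using insert by (simp add: Q.finsum_insert)
  also have "... = I +> (f i + sum f K)"
   using insert by (subst quot_add[OF assms(1)]) (auto simp: sum_closed add_eq)
  finally show ?case using insert by simp
 qed
qed

lemma quot_eq_iff: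
 "ideal I A ==> x : carrier A ==> y : carrier A ==> I +> x = I +> y \<longleftrightarrow> x - y : I"
 by (simp add: proj_eq_iff minus_eq_diff)

lemma graded_algebra_quot:
 assumes "graded_ideal I"
 shows "graded_algebra (galg_quot A I)"
proof -
 let ?Q = "galg_quot A I"
 have I: "ideal I A" and hI: "!!x n. x : I ==> hp n x : I" using assms by (auto simp: graded_ideal_def)
 interpret Q: kalg ?Q by (rule quot_kalg[OF I])
 note f = ideal_facts[OF I]
 have hq: "hcomp ?Q n = {I +> x | x. x : carrier A & hp n x = x}" for n
  by (auto simp: quot_hcomp hcomp_eq)
 have mod: "Module.module (ring_of_type_algebra :: 'k ring) ?Q"
 proof (rule moduleI)
  show "cring (ring_of_type_algebra :: 'k ring)" by (rule cring_from_type_algebra)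
  show "abelian_group ?Q" by (rule Q.abelian_group_axioms)
 qed (auto simp: ring_of_type_algebra_def Q.smult_l_distr Q.smult_r_distr Q.smult_assoc Q.smult_one)
 have smul: "submodule (hcomp ?Q n) (ring_of_type_algebra :: 'k ring) ?Q" for n
 proof
  show "hcomp ?Q n \<subseteq> carrier (add_monoid ?Q)" by (auto simp: hq quot_carrier)
  show "\<one>\<^bsub>add_monoid ?Q\<^esub> : hcomp ?Q n"
   using quot_zero[OF I] by (auto simp: hq zero_eq intro!: exI[of _ 0] zero_in hp_zero)
  fix x assume "x : hcomp ?Q n"
  then obtain x' where x: "x = I +> x'" "x' : carrier A" "hp n x' = x'" by (auto simp: hq)
  have xq: "x : carrier ?Q" using x by (auto simp: quot_carrier)
  have sm: "c \<odot>\<^bsub>?Q\<^esub> x : hcomp ?Q n" for c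
   using x by (auto simp: hq quot_smult[OF I] hp_smult intro!: exI[of _ "c \<odot> x'"])
  then show "c \<odot>\<^bsub>?Q\<^esub> x : hcomp ?Q n" for c .
  have "x \<oplus>\<^bsub>?Q\<^esub> ((- 1) \<odot>\<^bsub>?Q\<^esub> x) = (1 + (- 1)) \<odot>\<^bsub>?Q\<^esub> x"
   by (simp only: Q.smult_l_distr[OF xq] Q.smult_one[OF xq])
  also have "... = \<zero>\<^bsub>?Q\<^esub>"
  proof -
   have "0 \<odot>\<^bsub>?Q\<^esub> x \<oplus>\<^bsub>?Q\<^esub> 0 \<odot>\<^bsub>?Q\<^esub> x = 0 \<odot>\<^bsub>?Q\<^esub> x"
    using xq Q.smult_l_distr[of x 0 0] by simp
   then show ?thesis using xq by simp
  qed
  finally have "\<ominus>\<^bsub>?Q\<^esub> x = (- 1) \<odot>\<^bsub>?Q\<^esub> x"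
   using xq by (metis Q.minus_equality Q.a_comm Q.smult_closed)
  then show "inv\<^bsub>add_monoid ?Q\<^esub> x : hcomp ?Q n" using sm[of "- 1"] by (simp add: a_inv_def)
  fix y assume "y : hcomp ?Q n"
  then obtain y' where y: "y = I +> y'" "y' : carrier A" "hp n y' = y'" by (auto simp: hq)
  show "x \<otimes>\<^bsub>add_monoid ?Q\<^esub> y : hcomp ?Q n"
   using x y by (auto simp: hq quot_add[OF I] hp_add add_eq intro!: exI[of _ "x' + y'"] plus_closed)
 qed
 have dec: "\<exists>!c. (\<forall>n. c n : hcomp ?Q n) & finite {n. c n ~= \<zero>\<^bsub>?Q\<^esub>} &
    x = (\<Oplus>\<^bsub>?Q\<^esub>n\<in>{n. c n ~= \<zero>\<^bsub>?Q\<^esub>}. c n)" if xQ: "x : carrier ?Q" for x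
 proof -
  obtain x' where x: "x = I +> x'" "x' : carrier A" using xQ by (auto simp: quot_carrier)
  define c where "c n = I +> hp n x'" for n
  have c0: "c n = \<zero>\<^bsub>?Q\<^esub> \<longleftrightarrow> hp n x' : I" for n
   using x by (simp add: c_def quot_zero[OF I] zero_eq quot_eq_iff[OF I] hp_closed zero_in)
  show ?thesis
  proof (rule ex1I[of _ c])
   have sub: "{n. c n ~= \<zero>\<^bsub>?Q\<^esub>} \<subseteq> {n. hp n x' ~= 0}" using c0 f(1) by auto
   have fin: "finite {n. c n ~= \<zero>\<^bsub>?Q\<^esub>}" by (rule finite_subset[OF sub hp_finite])
   have "(\<Oplus>\<^bsub>?Q\<^esub>n\<in>{n. c n ~= \<zero>\<^bsub>?Q\<^esub>}. c n) = I +> (\<Sum>n | c n ~= \<zero>\<^bsub>?Q\<^esub>. hp n x')"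
    unfolding c_def by (rule quot_finsum[OF I fin[unfolded c_def]]) (simp add: hp_closed x)
   also have "... = I +> x'"
   proof -
    have "x' - (\<Sum>n | c n ~= \<zero>\<^bsub>?Q\<^esub>. hp n x') = (\<Sum>n \<in> {n. hp n x' ~= 0} - {n. c n ~= \<zero>\<^bsub>?Q\<^esub>}. hp n x')"
     using sum_diff[OF hp_finite sub, of "%n. hp n x'"] by (simp add: hp_total)
    also have "... : I" by (rule f(7)) (auto simp: c0)
    finally show ?thesis
     using quot_eq_iff[OF I x(2), of "\<Sum>n | c n ~= \<zero>\<^bsub>?Q\<^esub>. hp n x'"] x(2) by (auto simp: sum_closed hp_closed)
   qed
   finally show "(\<forall>n. c n : hcomp ?Q n) & finite {n. c n ~= \<zero>\<^bsub>?Q\<^esub>} &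
    x = (\<Oplus>\<^bsub>?Q\<^esub>n\<in>{n. c n ~= \<zero>\<^bsub>?Q\<^esub>}. c n)"
    using fin x by (auto simp: c_def hq hp_closed hp_hp)
  next
   fix d assume d: "(\<forall>n. d n : hcomp ?Q n) & finite {n. d n ~= \<zero>\<^bsub>?Q\<^esub>} &
    x = (\<Oplus>\<^bsub>?Q\<^esub>n\<in>{n. d n ~= \<zero>\<^bsub>?Q\<^esub>}. d n)"
   let ?S = "{n. d n ~= \<zero>\<^bsub>?Q\<^esub>}"
   have "\<forall>n. \<exists>y. d n = I +> y & y : carrier A & hp n y = y" using d by (auto simp: hq)
   then obtain y where y: "!!n. d n = I +> y n" "!!n. y n : carrier A" "!!n. hp n (y n) = y n" by metis
   have fin: "finite ?S" using d by blast
   have "x = (\<Oplus>\<^bsub>?Q\<^esub>n\<in>?S. I +> y n)" using d y(1) by simp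
   also have "... = I +> (\<Sum>n\<in>?S. y n)" by (rule quot_finsum[OF I fin y(2)])
   finally have "x' - (\<Sum>n\<in>?S. y n) : I"
    using x quot_eq_iff[OF I x(2)] y(2) by (simp add: sum_closed)
   \<comment> \<open>The ideal is closed under taking components, so two representatives of the same
     class have congruent components in each degree; this gives uniqueness of the
     decomposition.\<close>
   from hI[OF this] have *: "hp n x' - (\<Sum>m\<in>?S. hp n (y m)) : I" for n by (simp add: hp_diff hp_sum)
   have "hp n (y m) = (if m = n then y n else 0)" for m n using y(3) hp_other by metis
   then have **: "hp n x' - (if n : ?S then y n else 0) : I" for n
    using *[of n] fin by (simp add: sum.delta)
   show "d = c"
   proof
    fix n
    show "d n = c n"
    proof (cases "n : ?S")
     case True
     then have "hp n x' - y n : I" using **[of n] by simp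
     then have "I +> hp n x' = I +> y n" using quot_eq_iff[OF I] x y(2) hp_closed by blast
     then show ?thesis using y(1) by (simp add: c_def)
    next
     case False
     then have "c n = \<zero>\<^bsub>?Q\<^esub>" "d n = \<zero>\<^bsub>?Q\<^esub>" using **[of n] c0[of n] by simp_all
     then show ?thesis by simp
    qed
   qed
  qed
 qed
 show ?thesis
  unfolding graded_algebra_def
 proof (intro conjI allI ballI)
  show "\<one>\<^bsub>?Q\<^esub> : hcomp ?Q 0" by (auto simp: hq quot_one hp_one)
  fix m n x y assume "x : hcomp ?Q m" "y : hcomp ?Q n"
  then obtain x' y' where "x = I +> x'" "x' : carrier A" "hp m x' = x'"
   "y = I +> y'" "y' : carrier A" "hp n y' = y'" by (auto simp: hq)
  then show "x \<otimes>\<^bsub>?Q\<^esub> y : hcomp ?Q (m + n)"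
   by (auto simp: hq quot_mult[OF I] intro!: exI[of _ "x' \<otimes> y'"] hp_mult)
 qed (use Q.ring_axioms mod smul dec Q.smult_mult_l Q.smult_mult_r in auto)
qed

end

lemma ring_abI:
 fixes R :: "('a::ab_group_add, 'm) ring_scheme"
 assumes "!!x y. x \<oplus>\<^bsub>R\<^esub> y = x + y" "\<zero>\<^bsub>R\<^esub> = 0" "0 : carrier R"
  "!!x y. x : carrier R ==> y : carrier R ==> x + y : carrier R"
  "!!x. x : carrier R ==> - x : carrier R" "\<one>\<^bsub>R\<^esub> : carrier R"
  "!!x y. x : carrier R ==> y : carrier R ==> x \<otimes>\<^bsub>R\<^esub> y : carrier R"
  "!!x y z. x : carrier R ==> y : carrier R ==> z : carrier R ==>
   (x \<otimes>\<^bsub>R\<^esub> y) \<otimes>\<^bsub>R\<^esub> z = x \<otimes>\<^bsub>R\<^esub> (y \<otimes>\<^bsub>R\<^esub> z)"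
  "!!x. x : carrier R ==> \<one>\<^bsub>R\<^esub> \<otimes>\<^bsub>R\<^esub> x = x" "!!x. x : carrier R ==> x \<otimes>\<^bsub>R\<^esub> \<one>\<^bsub>R\<^esub> = x"
  "!!x y z. (x + y) \<otimes>\<^bsub>R\<^esub> z = x \<otimes>\<^bsub>R\<^esub> z + y \<otimes>\<^bsub>R\<^esub> z"
  "!!x y z. z \<otimes>\<^bsub>R\<^esub> (x + y) = z \<otimes>\<^bsub>R\<^esub> x + z \<otimes>\<^bsub>R\<^esub> y"
 shows "Ring.ring R"
proof (rule ringI)
 show "abelian_group R"
 proof (rule abelian_groupI)
  show "\<exists>y\<in>carrier R. y \<oplus>\<^bsub>R\<^esub> x = \<zero>\<^bsub>R\<^esub>" if "x : carrier R" for x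
   using assms(5)[OF that] by (auto simp: assms(1,2) intro!: bexI[of _ "- x"])
 qed (simp_all add: assms(1-4) add_ac)
 show "Group.monoid R" by (rule monoidI) (simp_all add: assms(6-10))
qed (simp_all add: assms(1,11,12))

subsection \<open>Finitely supported functions\<close>

text \<open>The condition under which \<open>pm_sum\<close>, linear extension from single terms, is
  additive even though keys may cancel in a sum.\<close>

definition coeff_additive :: "('a => 'b::ab_group_add => 'c::ab_group_add) => bool" where
 "coeff_additive h \<longleftrightarrow> (\<forall>p a b. h p (a + b) = h p a + h p b)"

definition pm_sum :: "('a => 'b::ab_group_add => 'c::ab_group_add) => ('a \<Rightarrow>\<^sub>0 'b) => 'c" where
 "pm_sum h x = (\<Sum>p\<in>keys x. h p (lookup x p))"

lemma coeff_additiveI: "(!!p a b. h p (a + b) = h p a + h p b) ==> coeff_additive h"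
 by (simp add: coeff_additive_def)

lemma coeff_additive_zero: "coeff_additive h ==> h p 0 = 0"
 unfolding coeff_additive_def by (metis add_cancel_right_left)

lemma pm_sum_zero [simp]: "pm_sum h 0 = 0"
 by (simp add: pm_sum_def)

lemma pm_sum_single [simp]: "coeff_additive h ==> pm_sum h (single p a) = h p a"
 by (cases "a = 0") (auto simp: pm_sum_def coeff_additive_zero)

lemma pm_sum_add: "coeff_additive h ==> pm_sum h (x + y) = pm_sum h x + pm_sum h y"
 unfolding pm_sum_def
 by (rule setsum_keys_plus_distrib) (auto simp: coeff_additive_zero, simp_all add: coeff_additive_def)

lemma pm_sum_diff: "coeff_additive h ==> pm_sum h (x - y) = pm_sum h x - pm_sum h y"
 using pm_sum_add[of h "x - y" y] by (simp add: algebra_simps)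

lemma pm_sum_sum: "coeff_additive h ==> pm_sum h (sum f I) = (\<Sum>i\<in>I. pm_sum h (f i))"
 by (induction I rule: infinite_finite_induct) (auto simp: pm_sum_add)

lemma pm_expand: "(\<Sum>p\<in>keys x. single p (lookup x p)) = (x :: 'a \<Rightarrow>\<^sub>0 'b::ab_group_add)"
proof (rule poly_mapping_eqI)
 fix k
 show "lookup (\<Sum>p\<in>keys x. single p (lookup x p)) k = lookup x k"
  by (cases "k : keys x") (auto simp: lookup_sum lookup_single when_def in_keys_iff)
qed

lemma pm_induct [consumes 1, case_names zero single add]:
 fixes x :: "'a \<Rightarrow>\<^sub>0 'b::ab_group_add"
 assumes "\<forall>p. lookup x p ~= 0 --> Q p (lookup x p)" "P 0" "!!p a. Q p a ==> P (single p a)"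
  "!!x y. P x ==> P y ==> P (x + y)"
 shows "P x"
proof -
 have "P (\<Sum>p\<in>K. single p (lookup x p))" if "finite K" "K \<subseteq> keys x" for K
  using that
 proof (induction K rule: finite_induct)
  case (insert p K)
  then have "lookup x p ~= 0" by (auto simp: in_keys_iff)
  then show ?case using insert assms by simp
 qed (use assms in simp)
 from this[of "keys x"] show ?thesis by (simp add: pm_expand)
qed

lemma pm_induct_all [case_names zero single add]:
 fixes x :: "'a \<Rightarrow>\<^sub>0 'b::ab_group_add"
 assumes "P 0" "!!p a. P (single p a)" "!!x y. P x ==> P y ==> P (x + y)"
 shows "P x"
 by (rule pm_induct[where Q = "%_ _. True"]) (use assms in auto)

lemma lookup_scale:
 "lookup (Poly_Mapping.map ((*) s) x) p = (s :: 'b::ring) * lookup x p"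
 by (simp add: Poly_Mapping.map.rep_eq when_def)

definition pm_restrict :: "('a => bool) => ('a \<Rightarrow>\<^sub>0 'b::ab_group_add) => 'a \<Rightarrow>\<^sub>0 'b" where
 "pm_restrict Q = pm_sum (%w c. if Q w then single w c else 0)"

lemma pm_restrict_additive: "coeff_additive (%w c. if Q w then single w c else 0)"
 by (rule coeff_additiveI) (simp add: single_add)

lemma lookup_pm_restrict: "lookup (pm_restrict Q x) w = (if Q w then lookup x w else 0)"
proof (induction x rule: pm_induct_all)
 case (single p a)
 then show ?case by (simp add: pm_restrict_def pm_restrict_additive lookup_single when_def)
next
 case (add x y)
 then show ?case by (simp add: pm_restrict_def pm_restrict_additive pm_sum_add lookup_add)
qed (auto simp: pm_restrict_def)

lemma pm_restrict_add: "pm_restrict Q (x + y) = pm_restrict Q x + pm_restrict Q y"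
 by (simp add: pm_restrict_def pm_restrict_additive pm_sum_add)

lemma pm_restrict_single:
 "pm_restrict Q (single w c) = (if Q w then single w c else 0)"
 by (simp add: pm_restrict_def pm_restrict_additive)

lemma pm_restrict_zero [simp]: "pm_restrict Q 0 = 0"
 by (simp add: pm_restrict_def)

subsection \<open>The free algebra\<close>

text \<open>With concatenation as addition of words, the multiplication of \<open>free_algebra\<close> is that of the
 type of finitely supported functions.\<close>

instantiation list :: (type) monoid_add
begin
definition zero_list :: "'a list" where "zero_list = []"
definition plus_list :: "'a list => 'a list => 'a list" where "plus_list = (@)"
instance by standard (auto simp: zero_list_def plus_list_def)
end

type_synonym ('x, 'k) freealg = "'x list \<Rightarrow>\<^sub>0 'k"

definition fconst :: "'k::field => ('x, 'k) freealg" where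
 "fconst c = single [] c"

definition letter :: "'x => ('x, 'k::field) freealg" where
 "letter a = single [a] 1"

lemma single_word_mult: "single v (a::'k::field) * single w b = single (v @ w) (a * b)"
 by (simp add: mult_single plus_list_def)

lemma one_freealg: "(1 :: ('x, 'k::field) freealg) = single [] 1"
 using single_one[where 'a = "'x list" and 'b = 'k] by (simp add: zero_list_def)

lemma fconst_mult: "fconst c * x = Poly_Mapping.map ((*) c) x"
 by (simp add: fconst_def mult_map_scale_conv_mult zero_list_def)

lemma fconst_commute: "x * fconst c = fconst c * x"
proof (induction x rule: pm_induct_all)
 case (single p a)
 then show ?case by (simp add: fconst_def single_word_mult mult.commute)
qed (auto simp: algebra_simps)

lemma fconst_left_commute: "x * (fconst c * y) = fconst c * (x * y)"
 by (simp only: mult.assoc[symmetric] fconst_commute[of x c])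

lemma fconst_simps [simp]: "fconst 0 = 0" "fconst 1 = 1" "fconst (a + b) = fconst a + fconst b"
 "fconst (a * b) = fconst a * fconst b" "fconst (- a) = - fconst a" "fconst (a - b) = fconst a - fconst b"
 by (simp_all add: fconst_def one_freealg single_add single_word_mult single_uminus single_diff)

lemma single_word: "single w c = fconst c * prod_list (map letter w)"
proof (induction w arbitrary: c)
 case Nil
 then show ?case by (simp add: fconst_def)
next
 case (Cons a w)
 have "single (a # w) c = single [a] 1 * single w c"
  by (simp add: single_word_mult)
 also have "... = letter a * single w c" by (simp add: letter_def)
 also have "... = letter a * (fconst c * prod_list (map letter w))" by (simp only: Cons)
 also have "... = fconst c * (letter a * prod_list (map letter w))" by (rule fconst_left_commute)
 finally show ?case by simp
qed

lemma freealg_induct [case_names const letter add mult]: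
 fixes x :: "('x, 'k::field) freealg"
 assumes "!!c. P (fconst c)" "!!a. P (letter a)" "!!x y. P x ==> P y ==> P (x + y)"
  "!!x y. P x ==> P y ==> P (x * y)"
 shows "P x"
proof (induction x rule: pm_induct_all)
 case zero
 then show ?case using assms(1)[of 0] by simp
next
 case (single w a)
 have "P (prod_list (map letter w))"
  using assms(1)[of 1] assms(2,4) by (induction w) auto
 then show ?case unfolding single_word using assms by blast
qed (use assms in auto)

definition word_degree :: "('x => nat) => 'x list => nat" where
 "word_degree dg w = sum_list (map dg w)"

lemma word_degree_append [simp]: "word_degree dg (v @ w) = word_degree dg v + word_degree dg w"
 "word_degree dg [] = 0"
 by (simp_all add: word_degree_def)

definition free_part :: "('x => nat) => nat => ('x, 'k::field) freealg => ('x, 'k) freealg" where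
 "free_part dg n = pm_restrict (%w. word_degree dg w = n)"

lemma free_carrier: "x : carrier (free_algebra S dg) \<longleftrightarrow> (\<forall>w. lookup x w ~= 0 --> set w \<subseteq> S)"
 by (auto simp: free_algebra_def in_keys_iff)

lemma free_mult: "x \<otimes>\<^bsub>free_algebra S dg\<^esub> y = x * y"
proof -
 have "x * y = (\<Sum>v\<in>keys x. single v (lookup x v)) *
   (\<Sum>w\<in>keys y. single w (lookup y w))"
  by (simp add: pm_expand)
 also have "... = (\<Sum>v\<in>keys x. \<Sum>w\<in>keys y.
     single (v @ w) (lookup x v * lookup y w))"
  by (simp add: sum_product single_word_mult)
 finally show ?thesis by (simp add: free_algebra_def)
qed

lemma free_simps: "x \<oplus>\<^bsub>free_algebra S dg\<^esub> y = x + y" "\<zero>\<^bsub>free_algebra S dg\<^esub> = 0"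
 "\<one>\<^bsub>free_algebra S dg\<^esub> = 1" "c \<odot>\<^bsub>free_algebra S dg\<^esub> x = fconst c * x"
 by (simp_all add: free_algebra_def one_freealg fconst_mult)

lemma free_hcomp: "hcomp (free_algebra S dg) n =
  {x \<in> carrier (free_algebra S dg). free_part dg n x = x}"
proof -
 have "(\<forall>w \<in> keys x. set w \<subseteq> S & sum_list (map dg w) = n) \<longleftrightarrow>
  x : carrier (free_algebra S dg) & free_part dg n x = x" for x
 proof -
  have "free_part dg n x = x \<longleftrightarrow> (\<forall>w. lookup x w ~= 0 --> sum_list (map dg w) = n)"
  proof
   assume a: "free_part dg n x = x"
   show "\<forall>w. lookup x w ~= 0 --> sum_list (map dg w) = n"
   proof (intro allI impI)
    fix w assume "lookup x w ~= 0"
    then have "lookup (free_part dg n x) w ~= 0" using a by simp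
    then show "sum_list (map dg w) = n"
     by (simp add: free_part_def lookup_pm_restrict word_degree_def split: if_splits)
   qed
  next
   assume a: "\<forall>w. lookup x w ~= 0 --> sum_list (map dg w) = n"
   show "free_part dg n x = x"
   proof (rule poly_mapping_eqI)
    fix w show "lookup (free_part dg n x) w = lookup x w"
     using a[rule_format, of w] unfolding free_part_def lookup_pm_restrict word_degree_def by auto
   qed
  qed
  then show ?thesis unfolding ball_conj_distrib free_carrier unfolding Ball_def in_keys_iff by simp
 qed
 then show ?thesis by (auto simp: free_algebra_def)
qed

lemma free_mult_closed:
 assumes "x : carrier (free_algebra S dg)" "y : carrier (free_algebra S dg)"
 shows "x * y : carrier (free_algebra S dg)"
proof -
 have *: "0 : carrier (free_algebra S dg)" "a : carrier (free_algebra S dg) ==> b : carrier (free_algebra S dg) ==>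
  a + b : carrier (free_algebra S dg)" for a b :: "('a, 'b) freealg"
  by (auto simp: free_carrier lookup_add) (metis add.right_neutral add_0 subsetD)
 have "\<forall>w. lookup x w ~= 0 --> set w \<subseteq> S" using assms(1) by (simp add: free_carrier)
 then show ?thesis
 proof (induction x rule: pm_induct[where Q = "%w _. set w \<subseteq> S"])
  case (single v a)
  have "\<forall>w. lookup y w ~= 0 --> set w \<subseteq> S" using assms(2) by (simp add: free_carrier)
  then show ?case
  proof (induction y rule: pm_induct[where Q = "%w _. set w \<subseteq> S"])
   case (single w b)
   then show ?case using \<open>set v \<subseteq> S\<close>
    by (auto simp: single_word_mult free_carrier lookup_single when_def)
  qed (auto simp: * distrib_left)
 qed (auto simp: * distrib_right)
qed

lemma free_part_degree:
 assumes "free_part dg n x = x" "lookup x w ~= 0"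
 shows "word_degree dg w = n"
proof -
 have "lookup (free_part dg n x) w ~= 0" using assms by simp
 then show ?thesis by (simp add: free_part_def lookup_pm_restrict split: if_splits)
qed

lemma free_part_mult:
 assumes "free_part dg m x = x" "free_part dg n y = y"
 shows "free_part dg (m + n) (x * y) = x * y"
proof -
 have "\<forall>w. lookup x w ~= 0 --> word_degree dg w = m"
  using free_part_degree[OF assms(1)] by blast
 then show ?thesis
 proof (induction x rule: pm_induct[where Q = "%w _. word_degree dg w = m"])
  case (single v a)
  have "\<forall>w. lookup y w ~= 0 --> word_degree dg w = n"
   using free_part_degree[OF assms(2)] by blast
  then show ?case
  proof (induction y rule: pm_induct[where Q = "%w _. word_degree dg w = n"])
   case (single w b)
   then show ?case using \<open>word_degree dg v = m\<close> by (simp add: single_word_mult free_part_def pm_restrict_single)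
  qed (auto simp: distrib_left free_part_def pm_restrict_add)
 qed (auto simp: distrib_right free_part_def pm_restrict_add)
qed

lemma graded_kalg_free: "graded_kalg (free_algebra S dg :: ('k::field, 'x list \<Rightarrow>\<^sub>0 'k) galg) (free_part dg)"
proof -
 let ?F = "free_algebra S dg :: ('k::field, 'x list \<Rightarrow>\<^sub>0 'k) galg"
 have add: "a : carrier ?F ==> b : carrier ?F ==> a + b : carrier ?F" for a b
  by (auto simp: free_carrier lookup_add) (metis add.right_neutral add_0 subsetD)
 have sm: "a : carrier ?F ==> fconst c * a : carrier ?F" for a c
  by (auto simp: free_carrier fconst_mult lookup_scale)
 have neg: "a : carrier ?F ==> - a : carrier ?F" for a by (simp add: free_carrier)
 have one: "1 : carrier ?F" by (auto simp: free_carrier one_freealg lookup_single when_def)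
 have lk: "lookup (free_part dg n x) w = (if word_degree dg w = n then lookup x w else 0)"
  for n w and x :: "('x, 'k) freealg" by (simp add: free_part_def lookup_pm_restrict)
 have fin: "finite {n. free_part dg n x ~= 0}" for x :: "('x, 'k) freealg"
 proof (rule finite_subset)
  show "{n. free_part dg n x ~= 0} \<subseteq> word_degree dg ` keys x"
  proof
   fix n assume "n : {n. free_part dg n x ~= 0}"
   then obtain w where "lookup (free_part dg n x) w ~= 0"
    by (auto simp: poly_mapping_eq_iff fun_eq_iff)
   then show "n : word_degree dg ` keys x"
    by (auto simp: lk in_keys_iff split: if_splits)
  qed
 qed simp
 have R: "Ring.ring ?F"
  by (rule ring_abI, unfold free_simps free_mult)
   (use add neg one free_mult_closed in \<open>simp_all add: distrib_left distrib_right mult.assoc free_carrier[of 0]\<close>)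
 have K: "kalg ?F"
 proof (rule kalg.intro[OF R], rule kalg_axioms.intro, unfold free_simps free_mult)
  show "x * (fconst c * y) = fconst c * (x * y)" for x y :: "('x, 'k) freealg" and c
   by (rule fconst_left_commute)
 qed (simp_all add: sm distrib_left distrib_right mult.assoc)
 show ?thesis
 proof (intro graded_kalg.intro[OF K] graded_kalg_axioms.intro, unfold free_simps free_mult)
  fix x :: "('x, 'k) freealg" and n
  show "(\<Sum>n | free_part dg n x ~= 0. free_part dg n x) = x"
  proof (rule poly_mapping_eqI)
   fix w
   have "lookup (\<Sum>n | free_part dg n x ~= 0. free_part dg n x) w =
    (\<Sum>n | free_part dg n x ~= 0. if word_degree dg w = n then lookup x w else 0)"
    by (simp add: lookup_sum lk)
   also have "... = (if free_part dg (word_degree dg w) x ~= 0 then lookup x w else 0)"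
    using fin[of x] by (simp add: sum.delta)
   also have "... = lookup x w" using lk[of "word_degree dg w" x w] by auto
   finally show "lookup (\<Sum>n | free_part dg n x ~= 0. free_part dg n x) w = lookup x w" .
  qed
  show "free_part dg m (free_part dg n x) = (if m = n then free_part dg n x else 0)" for m
   by (rule poly_mapping_eqI) (simp add: lk)
 next
  fix x :: "('x, 'k) freealg" and n c
  assume "x : carrier ?F"
  then show "free_part dg n x : carrier ?F" by (auto simp: free_carrier lk)
  show "free_part dg n (fconst c * x) = fconst c * free_part dg n x"
   by (rule poly_mapping_eqI) (simp add: lk fconst_mult lookup_scale)
 next
  show "free_part dg 0 1 = (1 :: ('x, 'k) freealg)" by (simp add: one_freealg free_part_def pm_restrict_single)
 qed (use fin in \<open>auto simp: free_hcomp free_part_def pm_restrict_add intro: free_part_mult[unfolded free_part_def]\<close>)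
qed

subsection \<open>The algebra of a quiver\<close>

type_synonym ('v, 'e, 'k) qalg = "'v list \<Rightarrow>\<^sub>0 ('e, 'k) mpoly"

definition cf :: "('v, 'e, 'k::field) qalg => 'v list => ('e \<Rightarrow>\<^sub>0 nat) => 'k" where
 "cf x p m = lookup (lookup x p) m"

definition qterm :: "'v list => ('e \<Rightarrow>\<^sub>0 nat) => 'k::field => ('v, 'e, 'k) qalg" where
 "qterm p m c = single p (single m c)"

lemma cf_eqI: "(!!p m. cf x p m = cf y p m) ==> x = y"
 by (intro poly_mapping_eqI) (simp add: cf_def)

lemma cf_simps [simp]: "cf 0 p m = 0" "cf (x + y) p m = cf x p m + cf y p m" "cf (x - y) p m = cf x p m - cf y p m"
 "cf (- x) p m = - cf x p m"
 by (simp_all add: cf_def lookup_add lookup_minus)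

lemma cf_sum: "cf (sum f I) p m = (\<Sum>i\<in>I. cf (f i) p m)"
 by (induction I rule: infinite_finite_induct) auto

lemma cf_qterm: "cf (qterm p m c) p' m' = (if p = p' & m = m' then c else 0)"
 by (simp add: cf_def qterm_def lookup_single when_def)

lemma qterm_add: "qterm p m (a + b) = qterm p m a + qterm p m b"
 by (simp add: qterm_def single_add)

lemma qterm_induct [consumes 1, case_names zero single add]:
 fixes x :: "('v, 'e, 'k::field) qalg"
 assumes "\<forall>p m. cf x p m ~= 0 --> Q p m" "P 0" "!!p m c. Q p m ==> P (qterm p m c)"
  "!!x y. P x ==> P y ==> P (x + y)"
 shows "P x"
proof -
 have "\<forall>p. lookup x p ~= 0 --> (\<forall>m. lookup (lookup x p) m ~= 0 --> Q p m)"
  using assms(1) by (simp add: cf_def)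
 then show ?thesis
 proof (induction x rule: pm_induct[where Q = "%p f. \<forall>m. lookup f m ~= 0 --> Q p m"])
  case (single p f)
  then have "\<forall>m. lookup f m ~= 0 --> Q p m" by blast
  then show ?case
  proof (induction f rule: pm_induct[where Q = "%m _. Q p m"])
   case (single m c)
   then show ?case using assms(3)[of p m c] by (simp add: qterm_def)
  qed (use assms in \<open>auto simp: single_add\<close>)
 qed (use assms in auto)
qed

lemma qterm_induct_all [case_names zero single add]:
 fixes x :: "('v, 'e, 'k::field) qalg"
 assumes "P 0" "!!p m c. P (qterm p m c)" "!!x y. P x ==> P y ==> P (x + y)"
 shows "P x"
 by (rule qterm_induct[where Q = "%_ _. True"]) (use assms in auto)

text \<open>For empty lists the formula refers to \<open>last []\<close> and \<open>hd []\<close>;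
  associativity and the unit laws are therefore proved on the carrier, where paths are
  nonempty.\<close>

definition qmul :: "('v, 'e, 'k::field) qalg => ('v, 'e, 'k) qalg => ('v, 'e, 'k) qalg" where
 "qmul x y = pm_sum (%p a. pm_sum (%q b.
   if last p = hd q then single (p @ tl q) (a * b) else 0) y) x"

lemma qmul_additive1: "coeff_additive (%q b. if last p = hd q then single (p @ tl q) ((a :: ('e, 'k::field) mpoly) * b) else 0)"
 by (rule coeff_additiveI) (simp add: single_add distrib_left)

lemma qmul_additive2: "coeff_additive (%p a. pm_sum (%q b.
   if last p = hd q then single (p @ tl q) ((a :: ('e, 'k::field) mpoly) * b) else 0) y)"
proof (rule coeff_additiveI)
 fix p :: "'a list" and a b :: "('e, 'k) mpoly"
 show "pm_sum (%q c. if last p = hd q then single (p @ tl q) ((a + b) * c) else 0) y =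
  pm_sum (%q c. if last p = hd q then single (p @ tl q) (a * c) else 0) y +
  pm_sum (%q c. if last p = hd q then single (p @ tl q) (b * c) else 0) y"
  unfolding pm_sum_def sum.distrib[symmetric]
  by (rule sum.cong) (auto simp: single_add distrib_right)
qed

lemma qmul_additive3: "coeff_additive (%p a. if last p = hd q then single (p @ tl q) (a * (b :: ('e, 'k::field) mpoly)) else 0)"
 by (rule coeff_additiveI) (simp add: single_add distrib_right)

lemma qmul_add_l: "qmul (x + y) z = qmul x z + qmul y z"
 unfolding qmul_def by (rule pm_sum_add[OF qmul_additive2])

lemma qmul_add_r: "qmul z (x + y) = qmul z x + qmul z y"
 unfolding qmul_def pm_sum_add[OF qmul_additive1] by (simp add: pm_sum_def sum.distrib)

lemma qmul_zero [simp]: "qmul 0 x = 0" "qmul x 0 = 0"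
 by (simp_all add: qmul_def) (simp add: pm_sum_def)

lemma qmul_diff_l: "qmul (x - y) z = qmul x z - qmul y z"
 using qmul_add_l[of "x - y" y z] by (simp add: algebra_simps)

lemma qmul_diff_r: "qmul z (x - y) = qmul z x - qmul z y"
 using qmul_add_r[of z "x - y" y] by (simp add: algebra_simps)

lemma qmul_sum_l: "qmul (sum f I) z = (\<Sum>i\<in>I. qmul (f i) z)"
 by (induction I rule: infinite_finite_induct) (auto simp: qmul_add_l)

lemma qmul_sum_r: "qmul z (sum f I) = (\<Sum>i\<in>I. qmul z (f i))"
 by (induction I rule: infinite_finite_induct) (auto simp: qmul_add_r)

lemma qmul_single: "qmul (single p a) (single q b) =
  (if last p = hd q then single (p @ tl q) (a * b) else 0)"
 unfolding qmul_def pm_sum_single[OF qmul_additive1] pm_sum_single[OF qmul_additive3] ..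

lemma qmul_qterm: "qmul (qterm p m c) (qterm q n d) = (if last p = hd q then qterm (p @ tl q) (m + n) (c * d) else 0)"
 by (simp add: qterm_def qmul_single mult_single)

definition qscale :: "'k::field => ('v, 'e, 'k) qalg => ('v, 'e, 'k) qalg" where
 "qscale c = Poly_Mapping.map ((*) (pconst c))"

lemma cf_qscale [simp]: "cf (qscale c x) p m = c * cf x p m"
 using mult_map_scale_conv_mult[of c "lookup x p"]
 by (simp add: qscale_def cf_def lookup_scale) (metis lookup_scale)

lemma qscale_simps: "qscale c (x + y) = qscale c x + qscale c y" "qscale c (x - y) = qscale c x - qscale c y"
 "qscale (c + d) x = qscale c x + qscale d x"
 "qscale (c * d) x = qscale c (qscale d x)" "qscale 1 x = x" "qscale c 0 = 0" "qscale 0 x = 0"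
 "qscale c (qterm p m a) = qterm p m (c * a)" "qscale (- 1) x = - x"
 by (auto intro!: cf_eqI simp: cf_qterm algebra_simps)

lemma qscale_sum: "qscale c (sum f I) = (\<Sum>i\<in>I. qscale c (f i))"
 by (induction I rule: infinite_finite_induct) (auto simp: qscale_simps)

lemma qscale_qmul: "qmul (qscale c x) y = qscale c (qmul x y)" "qmul x (qscale c y) = qscale c (qmul x y)"
proof -
 have 1: "qmul (qscale c x) y = qscale c (qmul x y) & qmul x (qscale c y) = qscale c (qmul x y)"
 proof (induction x rule: qterm_induct_all)
  case (single p m a)
  show ?case
   by (induction y rule: qterm_induct_all)
    (auto simp: qscale_simps qmul_qterm qmul_add_r mult_ac)
 qed (auto simp: qscale_simps qmul_add_l)
 then show "qmul (qscale c x) y = qscale c (qmul x y)" "qmul x (qscale c y) = qscale c (qmul x y)" by auto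
qed

lemma monom_degree_add [simp]: "monom_degree (m + n) = monom_degree m + monom_degree n"
 unfolding monom_degree_def by (rule setsum_keys_plus_distrib) auto

lemma monom_degree_simps [simp]: "monom_degree 0 = 0" "monom_degree (single i k) = k"
 by (auto simp: monom_degree_def)

definition qdeg :: "'v list => ('e \<Rightarrow>\<^sub>0 nat) => nat" where
 "qdeg p m = (length p - 1) + 2 * monom_degree m"

definition qpart :: "nat => ('v, 'e, 'k::field) qalg => ('v, 'e, 'k) qalg" where
 "qpart n = pm_sum (%p f. single p (pm_restrict (%m. qdeg p m = n) f))"

lemma qpart_additive: "coeff_additive (%p f. single p (pm_restrict (%m. qdeg p m = n) f))"
 by (rule coeff_additiveI) (simp add: single_add pm_restrict_add)

lemma qpart_simps: "qpart n (x + y) = qpart n x + qpart n y" "qpart n 0 = 0"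
 "qpart n (qterm p m c) = (if qdeg p m = n then qterm p m c else 0)"
 by (auto simp: qpart_def pm_sum_add qpart_additive qterm_def pm_restrict_single)

lemma cf_qpart: "cf (qpart n x) p m = (if qdeg p m = n then cf x p m else 0)"
 by (induction x rule: qterm_induct_all) (auto simp: qpart_simps cf_qterm)

lemma qpart_degree:
 assumes "qpart n x = x" "cf x p m ~= 0"
 shows "qdeg p m = n"
proof -
 have "cf (qpart n x) p m ~= 0" using assms by simp
 then show ?thesis by (simp add: cf_qpart split: if_splits)
qed

locale quiver =
 fixes V :: "'v set" and adj :: "'v => 'v => bool" and E :: "'e set"
 assumes finite_V: "finite V"
begin

definition QA :: "('k::field, 'v list \<Rightarrow>\<^sub>0 ('e, 'k) mpoly) galg" where
 "QA = quiver_algebra V adj E"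

lemma QA_carrier: "x : carrier QA \<longleftrightarrow> (\<forall>p m. cf x p m ~= 0 --> quiver_path V adj p & keys m \<subseteq> E)"
 (is "?L \<longleftrightarrow> ?R")
proof
 show "?L ==> ?R"
 proof -
  assume L: ?L
  show ?R
  proof (intro allI impI)
   fix p m assume nz: "cf x p m ~= 0"
   then have "p : keys x" "m : keys (lookup x p)"
    by (auto simp: cf_def in_keys_iff)
   then show "quiver_path V adj p & keys m \<subseteq> E"
    using L unfolding QA_def quiver_algebra_def Let_def by simp
  qed
 qed
next
 assume r: ?R
 have "quiver_path V adj p" if "lookup x p ~= 0" for p
 proof -
  obtain m where "lookup (lookup x p) m ~= 0"
   using \<open>lookup x p \<noteq> 0\<close> by (auto simp: poly_mapping_eq_iff fun_eq_iff)
  then show ?thesis using r by (auto simp: cf_def)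
 qed
 then show ?L using r by (auto simp: QA_def quiver_algebra_def Let_def cf_def in_keys_iff)
qed

lemma QA_simps: "x \<oplus>\<^bsub>QA\<^esub> y = x + y" "\<zero>\<^bsub>QA\<^esub> = 0" "x \<otimes>\<^bsub>QA\<^esub> y = qmul x y" "c \<odot>\<^bsub>QA\<^esub> x = qscale c x"
 "\<one>\<^bsub>QA\<^esub> = (\<Sum>v\<in>V. qterm [v] 0 1)"
 by (simp_all add: QA_def quiver_algebra_def Let_def qmul_def pm_sum_def qscale_def qterm_def)

lemma QA_hcomp: "hcomp QA n = {x \<in> carrier QA. qpart n x = x}"
proof -
 have "(\<forall>p \<in> keys x. \<forall>m \<in> keys (lookup x p).
   (length p - 1) + 2 * monom_degree m = n) \<longleftrightarrow> qpart n x = x" for x :: "('v, 'e, 'k::field) qalg"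
 proof
  assume a: "\<forall>p \<in> keys x. \<forall>m \<in> keys (lookup x p).
   (length p - 1) + 2 * monom_degree m = n"
  have d: "qdeg p m = n" if nz: "cf x p m ~= 0" for p m
  proof -
   have "p : keys x" "m : keys (lookup x p)"
    using nz by (auto simp: cf_def in_keys_iff)
   then show ?thesis using a by (auto simp: qdeg_def)
  qed
  show "qpart n x = x"
  proof (rule cf_eqI)
   fix p m show "cf (qpart n x) p m = cf x p m" using d[of p m] by (auto simp: cf_qpart)
  qed
 next
  assume a: "qpart n x = x"
  show "\<forall>p \<in> keys x. \<forall>m \<in> keys (lookup x p).
   (length p - 1) + 2 * monom_degree m = n"
  proof (intro ballI)
   fix p m assume "m : keys (lookup x p)"
   then have "cf (qpart n x) p m ~= 0" using a by (simp add: cf_def in_keys_iff)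
   then show "(length p - 1) + 2 * monom_degree m = n" by (auto simp: cf_qpart qdeg_def split: if_splits)
  qed
 qed
 then show ?thesis by (auto simp: QA_def quiver_algebra_def Let_def)
qed

lemma quiver_path_simps: "quiver_path V adj [v] \<longleftrightarrow> v : V"
 "quiver_path V adj (v # w # p) \<longleftrightarrow> v : V & adj v w & quiver_path V adj (w # p)"
 by (auto simp: quiver_path_def)

lemma quiver_path_nonempty: "quiver_path V adj p ==> p ~= []"
 by (simp add: quiver_path_def)

lemma quiver_path_append:
 assumes "quiver_path V adj p" "quiver_path V adj q" "last p = hd q"
 shows "quiver_path V adj (p @ tl q)"
proof -
 obtain w q' where q: "q = w # q'" using quiver_path_nonempty[OF assms(2)] by (cases q) auto
 show ?thesis using assms unfolding q quiver_path_def
  by (cases q') (auto simp: successively_append_iff)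
qed

lemma QA_zero: "0 : carrier QA"
 by (simp add: QA_carrier)

lemma QA_plus: "x : carrier QA ==> y : carrier QA ==> x + y : carrier QA"
 by (auto simp: QA_carrier) (metis add_0 add.right_neutral subsetD)+

lemma QA_sum: "(!!i. i : I ==> f i : carrier QA) ==> sum f I : carrier QA"
 by (induction I rule: infinite_finite_induct) (auto simp: QA_zero QA_plus)

lemma QA_qterm: "quiver_path V adj p ==> keys m \<subseteq> E ==> qterm p m c : carrier QA"
 by (auto simp: QA_carrier cf_qterm)

lemma keys_add_subset: "keys m \<subseteq> E ==> keys n \<subseteq> E ==> keys (m + n :: 'e \<Rightarrow>\<^sub>0 nat) \<subseteq> E"
 by (rule order_trans[OF keys_add]) blast

lemma QA_induct [consumes 1, case_names zero single add]:
 assumes "x : carrier QA" "P 0"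
  "!!p m c. quiver_path V adj p ==> keys m \<subseteq> E ==> P (qterm p m c)"
  "!!x y. P x ==> P y ==> P (x + y)"
 shows "P x"
proof -
 have "\<forall>p m. cf x p m ~= 0 --> quiver_path V adj p & keys m \<subseteq> E"
  using assms(1) by (simp add: QA_carrier)
 then show ?thesis by (induction x rule: qterm_induct) (use assms(2-4) in auto)
qed

lemma QA_mult: "x : carrier QA ==> y : carrier QA ==> qmul x y : carrier QA"
proof (induction x rule: QA_induct)
 case (single p m c)
 from single(3) show ?case
 proof (induction y rule: QA_induct)
  case (single q n d)
  show ?case
  proof (cases "last p = hd q")
   case True
   have "qterm (p @ tl q) (m + n) (c * d) : carrier QA"
    by (intro QA_qterm quiver_path_append keys_add_subset) (use single True \<open>quiver_path V adj p\<close> \<open>keys m \<subseteq> E\<close> in auto)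
   then show ?thesis using True by (simp add: qmul_qterm)
  qed (simp add: qmul_qterm QA_zero)
 qed (auto simp: QA_zero qmul_add_r intro: QA_plus)
qed (auto simp: QA_zero qmul_add_l intro: QA_plus)

lemma QA_one: "(\<Sum>v\<in>V. qterm [v] 0 1) : carrier QA"
 by (intro QA_sum QA_qterm) (auto simp: quiver_path_simps)

lemma QA_assoc:
 assumes "x : carrier QA" "y : carrier QA" "z : carrier QA"
 shows "qmul (qmul x y) z = qmul x (qmul y z)"
 using assms(1)
proof (induction x rule: QA_induct)
 case x: (single p m c)
 show ?case using assms(2)
 proof (induction y rule: QA_induct)
  case y: (single q n d)
  show ?case using assms(3)
  proof (induction z rule: QA_induct)
   case z: (single r l e)
   have q: "q ~= []" "p ~= []" "r ~= []" using x y z quiver_path_nonempty by auto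
   then have "last (p @ tl q) = last q" if "last p = hd q"
    using that by (cases q) auto
   then show ?case using q by (auto simp: qmul_qterm mult.assoc add.assoc)
  qed (auto simp: qmul_add_r)
 qed (auto simp: qmul_add_r qmul_add_l)
qed (auto simp: qmul_add_l)

lemma QA_lone: "x : carrier QA ==> qmul (\<Sum>v\<in>V. qterm [v] 0 1) x = x"
proof (induction x rule: QA_induct)
 case (single p m c)
 have p: "p ~= []" "hd p : V" using single by (auto simp: quiver_path_def)
 have "qmul (\<Sum>v\<in>V. qterm [v] 0 1) (qterm p m c) = (\<Sum>v\<in>V. if v = hd p then qterm p m c else 0)"
  unfolding qmul_sum_l by (rule sum.cong) (use p in \<open>auto simp: qmul_qterm\<close>)
 then show ?case using finite_V p by simp
qed (auto simp: qmul_add_r)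

lemma QA_rone: "x : carrier QA ==> qmul x (\<Sum>v\<in>V. qterm [v] 0 1) = x"
proof (induction x rule: QA_induct)
 case (single p m c)
 have p: "p ~= []" "last p : V" using single by (auto simp: quiver_path_def)
 have "qmul (qterm p m c) (\<Sum>v\<in>V. qterm [v] 0 1) = (\<Sum>v\<in>V. if v = last p then qterm p m c else 0)"
  unfolding qmul_sum_r by (rule sum.cong) (use p in \<open>auto simp: qmul_qterm\<close>)
 then show ?case using finite_V p by simp
qed (auto simp: qmul_add_l)

lemma qpart_mult:
 assumes "x : carrier QA" "y : carrier QA" "qpart m x = x" "qpart n y = y"
 shows "qpart (m + n) (qmul x y) = qmul x y"
proof -
 have "\<forall>p l. cf x p l ~= 0 --> p ~= [] & qdeg p l = m"
  using assms(1) qpart_degree[OF assms(3)] quiver_path_nonempty by (auto simp: QA_carrier)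
 then show ?thesis
 proof (induction x rule: qterm_induct)
  case x: (single p l c)
  have "\<forall>p l. cf y p l ~= 0 --> p ~= [] & qdeg p l = n"
   using assms(2) qpart_degree[OF assms(4)] quiver_path_nonempty by (auto simp: QA_carrier)
  then show ?case
  proof (induction y rule: qterm_induct)
   case y: (single q l' d)
   have "qdeg (p @ tl q) (l + l') = m + n"
    using x y by (cases p; cases q) (auto simp: qdeg_def)
   then show ?case by (simp add: qmul_qterm qpart_simps)
  qed (auto simp: qpart_simps qmul_add_r)
 qed (auto simp: qpart_simps qmul_add_l)
qed

lemma graded_kalg_QA: "graded_kalg QA qpart"
proof -
 have fin: "finite {n. qpart n x ~= 0}" for x :: "('v, 'e, 'k::field) qalg"
 proof (induction x rule: qterm_induct_all)
  case (single p m c)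
  have "{n. qpart n (qterm p m c) ~= 0} \<subseteq> {qdeg p m}" by (auto simp: qpart_simps)
  then show ?case by (rule finite_subset) simp
 next
  case (add x y)
  have "{n. qpart n (x + y) ~= 0} \<subseteq> {n. qpart n x ~= 0} \<union> {n. qpart n y ~= 0}" by (auto simp: qpart_simps)
  then show ?case by (rule finite_subset) (simp add: add)
 qed (simp add: qpart_simps)
 have R: "Ring.ring QA"
  by (rule ring_abI, unfold QA_simps)
   (simp_all add: QA_zero QA_plus QA_one QA_mult QA_assoc QA_lone QA_rone qmul_add_l qmul_add_r, simp add: QA_carrier)
 have K: "kalg QA"
 proof (rule kalg.intro[OF R], rule kalg_axioms.intro, unfold QA_simps)
  show "x : carrier QA ==> qscale c x : carrier QA" for x :: "('v, 'e, 'k::field) qalg" and c by (auto simp: QA_carrier)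
 qed (auto simp: qscale_simps qscale_qmul)
 show ?thesis
 proof (intro graded_kalg.intro[OF K] graded_kalg_axioms.intro, unfold QA_simps)
  fix x :: "('v, 'e, 'k::field) qalg" and n
  show "(\<Sum>n | qpart n x ~= 0. qpart n x) = x"
  proof (rule cf_eqI)
   fix p m
   have "cf (\<Sum>n | qpart n x ~= 0. qpart n x) p m =
    (\<Sum>n | qpart n x ~= 0. if qdeg p m = n then cf x p m else 0)"
    by (simp add: cf_sum cf_qpart)
   also have "... = (if qpart (qdeg p m) x ~= 0 then cf x p m else 0)"
    using fin[of x] by (simp add: sum.delta)
   also have "... = cf x p m" using cf_qpart[of "qdeg p m" x p m] by auto
   finally show "cf (\<Sum>n | qpart n x ~= 0. qpart n x) p m = cf x p m" .
  qed
  show "qpart m (qpart n x) = (if m = n then qpart n x else 0)" for m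
   by (rule cf_eqI) (simp add: cf_qpart)
  show "qpart n (qscale c x) = qscale c (qpart n x)" for c
   by (rule cf_eqI) (simp add: cf_qpart)
  show "qpart 0 (\<Sum>v\<in>V. qterm [v] 0 1) = (\<Sum>v\<in>V. qterm [v] 0 1)"
   by (rule cf_eqI) (auto simp: cf_qpart cf_sum cf_qterm qdeg_def intro!: sum.neutral)
 next
  show "hcomp QA n = {x \<in> carrier QA. qpart n x = x}" for n by (rule QA_hcomp)
 next
  fix x :: "('v, 'e, 'k::field) qalg" assume x: "x : carrier QA"
  show "qpart n x : carrier QA" for n using x by (auto simp: QA_carrier cf_qpart)
 qed (use fin qpart_mult in \<open>auto simp: qpart_simps\<close>)
qed



end

subsection \<open>Homomorphisms out of the algebra of a program\<close>

lemma flip_flip [simp]: "flip (flip al i) i = al"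
 by (auto simp: flip_def)

lemma flip_commute: "flip (flip al i) j = flip (flip al j) i"
 by (cases "i = j") (auto simp: flip_def fun_upd_twist)

lemma flip_apply: "flip al i j = (if j = i then opp (al i) else al j)"
 by (simp add: flip_def)

lemma support_flip: "support (flip al i) = support al"
 by (auto simp: support_def flip_def)

lemma adjacent_sym: "adjacent al be ==> adjacent be al"
 by (simp add: adjacent_def eq_commute)

lemma adjacent_flip: "al i ~= Zero ==> adjacent al (flip al i)"
 unfolding adjacent_def by (rule ex1I[of _ i]) (auto simp: flip_apply split: if_splits)

lemma adjacentE:
 assumes "adjacent al be" "support al = E" "support be = E"
 obtains i where "i : E" "be = flip al i"
proof -
 obtain i where i: "al i ~= be i" "!!j. al j ~= be j ==> j = i"
  using assms(1) unfolding adjacent_def by blast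
 have nz: "al j ~= Zero \<longleftrightarrow> j : E" "be j ~= Zero \<longleftrightarrow> j : E" for j using assms(2,3) by (auto simp: support_def)
 have iE: "i : E" using nz(1)[of i] nz(2)[of i] i(1) by auto
 then have "be i = opp (al i)" using nz[of i] i(1) sign_cases[of "be i" "al i"] by auto
 then have "be k = flip al i k" for k
 proof (cases "k = i")
  case False
  then have "al k = be k" using i(2) by blast
  then show ?thesis using False by (simp add: flip_apply)
 qed (simp add: flip_apply)
 then have "be = flip al i" by (rule ext)
 then show ?thesis using that iE by blast
qed

lemma single_psum: "single p (sum f J) = (\<Sum>i\<in>J. single p (f i :: 'b::ab_group_add))"
 by (induction J rule: infinite_finite_induct) (auto simp: single_add)

text \<open>All that the algebra has to know about the program. Near a vertex with basis
  \<open>b\<close> every choice of signs on \<open>b\<close> is feasible, so all loops in directions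
  \<open>b\<close> exist there, and by \<open>form_basis\<close> they suffice to express the
  variables. The interface is the same for a program and for its dual.\<close>

locale vprog =
 fixes P :: "'e program" and U :: "('e => 'k::field) set"
 assumes finite_E: "finite (prog_E P)"
  and feasible_supp: "al : feasible_topes P ==> support al = prog_E P"
  and vertex_ex: "al : feasible_topes P ==> \<exists>b. form_basis (prog_E P) U b &
   (\<forall>c. support c = prog_E P & (\<forall>i. i ~: b --> c i = al i) --> c : feasible_topes P)"
  and edge_vertex_ex: "al : feasible_topes P ==> flip al j : feasible_topes P ==> j : prog_E P ==>
   \<exists>b. form_basis (prog_E P) U b & j : b &
   (\<forall>c. support c = prog_E P & (\<forall>i. i ~: b --> c i = al i) --> c : feasible_topes P)"
begin

abbreviation Q :: "('k, ('e => sign) list \<Rightarrow>\<^sub>0 ('e, 'k) mpoly) galg" where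
 "Q \<equiv> quiver.QA (feasible_topes P) adjacent (prog_E P)"
abbreviation "E \<equiv> prog_E P"
abbreviation "F \<equiv> feasible_topes P"
abbreviation "B \<equiv> bounded_feasible P"
abbreviation "U0 \<equiv> annihilator E U"

lemma BF: "B \<subseteq> F"
 by (simp add: bounded_feasible_def)

lemma finite_F: "finite F"
proof (rule finite_subset)
 show "F \<subseteq> (%S i. if i : E then (if i : S then Pos else Neg) else Zero) ` Pow E"
 proof
  fix al assume "al : F"
  then have s: "support al = E" by (rule feasible_supp)
  then have z: "al i = Zero \<longleftrightarrow> i ~: E" for i by (auto simp: support_def)
  have "al i = (if i : E then (if i : {i \<in> E. al i = Pos} then Pos else Neg) else Zero)" for i
   using z[of i] by (cases "al i") auto
  then have "al = (%i. if i : E then (if i : {i \<in> E. al i = Pos} then Pos else Neg) else Zero)" by (rule ext)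
  moreover have "{i \<in> E. al i = Pos} : Pow E" by auto
  ultimately show "al : (%S i. if i : E then (if i : S then Pos else Neg) else Zero) ` Pow E"
   by (rule image_eqI)
 qed
qed (simp add: finite_E)

sublocale quiver F adjacent E
 by unfold_locales (rule finite_F)

sublocale QA: graded_kalg "QA :: ('k, ('e => sign) list \<Rightarrow>\<^sub>0 ('e, 'k) mpoly) galg" qpart
 by (rule graded_kalg_QA)

lemma F_nz: "al : F ==> i : E ==> al i ~= Zero"
 using feasible_supp by (auto simp: support_def)

lemma F_adj: "al : F ==> i : E ==> adjacent al (flip al i) & adjacent (flip al i) al"
 using adjacent_flip[of al i] F_nz[of al i] adjacent_sym[of al "flip al i"] by simp

lemma F_adjE:
 assumes "al : F" "be : F" "adjacent al be"
 obtains i where "i : E" "be = flip al i"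
 using adjacentE[OF assms(3) feasible_supp[OF assms(1)] feasible_supp[OF assms(2)]] by blast

text \<open>Through \<open>ga\<close> the tope \<open>be\<close> differs from \<open>al\<close> in
  the directions \<open>i\<close> and \<open>a\<close>, through \<open>de\<close> in
  \<open>j\<close> and \<open>b\<close>. Comparing the two pairs leaves only
  \<open>a = j\<close>.\<close>

lemma square_cases:
 assumes "{al, be, ga, de} \<subseteq> F" "distinct [al, be, ga, de]"
  "adjacent al ga" "adjacent al de" "adjacent be ga" "adjacent be de"
 obtains i j where "i : E" "j : E" "i ~= j" "ga = flip al i" "de = flip al j" "be = flip (flip al i) j"
proof -
 have F4: "al : F" "be : F" "ga : F" "de : F" using assms(1) by auto
 obtain i where i: "i : E" "ga = flip al i" by (rule F_adjE[OF F4(1,3) assms(3)])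
 obtain j where j: "j : E" "de = flip al j" by (rule F_adjE[OF F4(1,4) assms(4)])
 obtain a where a: "a : E" "be = flip ga a" by (rule F_adjE[OF F4(3,2) adjacent_sym[OF assms(5)]])
 obtain b where b: "b : E" "be = flip de b" by (rule F_adjE[OF F4(4,2) adjacent_sym[OF assms(6)]])
 have ij: "i ~= j" using i j assms(2) by auto
 have ai: "a ~= i" using a i assms(2) by auto
 have bj: "b ~= j" using b j assms(2) by auto
 have "be a ~= al a" using a i ai F_nz[OF F4(1) a(1)] by (simp add: flip_apply)
 then have "a = j | a = b" using b(2) j(2) by (auto simp: flip_apply split: if_splits)
 moreover have "a ~= b"
 proof
  assume ab: "a = b"
  have "be i ~= al i" using a i ai F_nz[OF F4(1) i(1)] by (simp add: flip_apply)
  then have "i = j | i = b" using b(2) j(2) by (auto simp: flip_apply split: if_splits)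
  then show False using ij ai ab by blast
 qed
 ultimately have "a = j" by blast
 then show ?thesis using that[of i j] i j a ij by blast
qed

definition ideal_rels :: "(('e => sign) list \<Rightarrow>\<^sub>0 ('e, 'k) mpoly) set" where
 "ideal_rels = rel_A1 P \<union> rel_A2 P \<union> rel_A3 P \<union> rel_A4 P U"

abbreviation "I \<equiv> prog_ideal P U"

lemma QA_eq: "prog_quiver_algebra P = Q"
 by (simp add: prog_quiver_algebra_def QA_def)

lemma I_eq: "I = genideal Q ideal_rels"
 by (simp add: prog_ideal_def QA_eq ideal_rels_def)

lemma A_eq: "prog_algebra P U = galg_quot Q I"
 by (simp add: prog_algebra_def QA_eq)

lemma qpath_qterm: "qpath p = qterm p 0 1"
 by (simp add: qterm_def)

lemma pvar_qterm: "single p (pvar i) = qterm p (single i 1) 1"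
 by (simp add: qterm_def pvar_def)



lemma form_qterm: "single p (\<Sum>i\<in>E. pconst (x i) * pvar i) =
  (\<Sum>i\<in>E. qterm p (single i 1) (x i))"
 by (simp add: single_psum pvar_def mult_single qterm_def del: One_nat_def)

lemma rels_A1: "al : F - B ==> qterm [al] 0 1 : ideal_rels"
 unfolding ideal_rels_def rel_A1_def qpath_qterm by blast

lemma rels_A3: "i : E ==> al : F ==> flip al i : F ==>
  qterm [al, flip al i, al] 0 1 - qterm [al] (single i 1) 1 : ideal_rels"
 unfolding ideal_rels_def rel_A3_def qpath_qterm pvar_qterm by blast

lemma rels_A2: "{al, be, ga, de} \<subseteq> F ==> distinct [al, be, ga, de] ==>
   adjacent al ga ==> adjacent al de ==> adjacent be ga ==> adjacent be de ==>
  qterm [al, ga, be] 0 1 - qterm [al, de, be] 0 1 : ideal_rels"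
 unfolding ideal_rels_def rel_A2_def qpath_qterm by blast

lemma rels_A4: "x : U0 ==> (\<Sum>al\<in>F. \<Sum>i\<in>E. qterm [al] (single i 1) (x i)) : ideal_rels"
 unfolding ideal_rels_def rel_A4_def form_qterm by blast

lemma rels_cases:
 assumes "r : ideal_rels"
 obtains (A1) al where "al : F - B" "r = qterm [al] 0 1"
 | (A2) al be ga de where "{al, be, ga, de} \<subseteq> F" "distinct [al, be, ga, de]"
   "adjacent al ga" "adjacent al de" "adjacent be ga" "adjacent be de"
   "r = qterm [al, ga, be] 0 1 - qterm [al, de, be] 0 1"
 | (A3) al i where "i : E" "al : F" "flip al i : F"
   "r = qterm [al, flip al i, al] 0 1 - qterm [al] (single i 1) 1"
 | (A4) x where "x : U0" "r = (\<Sum>al\<in>F. \<Sum>i\<in>E. qterm [al] (single i 1) (x i))"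
 using assms unfolding ideal_rels_def rel_A1_def rel_A2_def rel_A3_def rel_A4_def
  qpath_qterm pvar_qterm form_qterm by blast

lemma rels_homogeneous:
 assumes "r : ideal_rels"
 shows "r : hcomp Q 0 | r : hcomp Q 2"
 using assms
proof (cases rule: rels_cases)
 case (A1 al)
 then show ?thesis by (auto simp: QA_hcomp qpart_simps qdeg_def quiver_path_simps intro!: QA_qterm)
next
 case (A2 al be ga de)
 have "qterm [al, ga, be] 0 1 : carrier Q" "qterm [al, de, be] 0 1 : carrier Q"
  using A2 by (auto simp: quiver_path_simps adjacent_sym intro!: QA_qterm)
 then show ?thesis using A2(7)
  by (simp add: QA_hcomp QA.diff_closed QA.hp_diff qpart_simps qdeg_def)
next
 case (A3 al i)
 have "qterm [al, flip al i, al] 0 1 : carrier Q" "qterm [al] (single i 1) 1 : carrier Q"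
  using A3 F_adj[OF A3(2,1)] by (auto simp: quiver_path_simps intro!: QA_qterm)
 then show ?thesis using A3(4)
  by (simp add: QA_hcomp QA.diff_closed QA.hp_diff qpart_simps qdeg_def)
next
 case (A4 x)
 then show ?thesis
  by (auto simp: QA_hcomp QA.hp_sum qpart_simps qdeg_def quiver_path_simps intro!: QA_sum QA_qterm sum.cong)
qed

lemma rels_carrier: "ideal_rels \<subseteq> carrier Q"
 using rels_homogeneous by (auto simp: QA_hcomp)

lemma graded_I: "QA.graded_ideal I"
 unfolding I_eq by (rule QA.graded_Idl) (use rels_homogeneous in blast)

lemma ideal_I: "ideal I Q"
 using graded_I by (simp add: QA.graded_ideal_def)

lemma rels_I: "ideal_rels \<subseteq> I"
 unfolding I_eq by (rule QA.genideal_self[OF rels_carrier])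

lemma graded_algebra_A: "graded_algebra (prog_algebra P U)"
 unfolding A_eq by (rule QA.graded_algebra_quot[OF graded_I])

end

section \<open>Congruences modulo an ideal, and the map \<open>Theta\<close> built from the images
  of idempotents and arrows\<close>

locale ring_cong =
 fixes K :: "'r::ring_1 set"
 assumes K_zero: "0 : K" and K_add: "x : K ==> y : K ==> x + y : K"
  and K_mult_l: "x : K ==> r * x : K" and K_mult_r: "x : K ==> x * r : K"
begin

definition cg :: "'r => 'r => bool" (infix "\<approx>" 50) where
 "x \<approx> y \<longleftrightarrow> x - y : K"

lemma K_uminus: "x : K ==> - x : K"
 using K_mult_l[of x "- 1"] by simp

lemma cg_refl [simp, intro]: "x \<approx> x"
 by (simp add: cg_def K_zero)

lemma cg_sym: "x \<approx> y ==> y \<approx> x"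
 using K_uminus[of "x - y"] by (simp add: cg_def)

lemma cg_trans [trans]: "x \<approx> y ==> y \<approx> z ==> x \<approx> z"
 using K_add[of "x - y" "y - z"] by (simp add: cg_def)

lemma cg_eq_trans [trans]: "x = y ==> y \<approx> z ==> x \<approx> z" "x \<approx> y ==> y = z ==> x \<approx> z"
 by auto

lemma cg_add: "x \<approx> y ==> x' \<approx> y' ==> x + x' \<approx> y + y'"
 using K_add[of "x - y" "x' - y'"] by (simp add: cg_def algebra_simps)

lemma cg_mult: "x \<approx> y ==> x' \<approx> y' ==> x * x' \<approx> y * y'"
 using K_add[OF K_mult_r[of "x - y" x'] K_mult_l[of "x' - y'" y]] by (simp add: cg_def algebra_simps)

lemma cg_sum: "(!!i. i : J ==> f i \<approx> h i) ==> sum f J \<approx> sum h J"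
 by (induction J rule: infinite_finite_induct) (auto intro: cg_add)

lemma cg_zero_iff: "x \<approx> 0 \<longleftrightarrow> x : K"
 by (simp add: cg_def)

lemma cg_sum_zero: "(!!i. i : J ==> f i \<approx> 0) ==> sum f J \<approx> 0"
 using cg_sum[of J f "%_. 0"] by simp

lemma cg_mult_zero: "x \<approx> 0 ==> x * y \<approx> 0" "x \<approx> 0 ==> y * x \<approx> 0"
 using cg_mult[of x 0 y y] cg_mult[of y y x 0] by auto

lemma cg_sum_single:
 assumes "finite J" "a : J" "!!i. i : J ==> i ~= a ==> f i \<approx> 0"
 shows "sum f J \<approx> f a"
proof -
 have "sum f J = f a + sum f (J - {a})" using assms by (simp add: sum.remove)
 also have "... \<approx> f a + 0" by (intro cg_add cg_refl cg_sum_zero) (use assms(3) in auto)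
 finally show ?thesis by simp
qed

end

text \<open>A representation of the quadratic relations of \<open>A(P, U)\<close> modulo an ideal \<open>K\<close>. The images of
 the variables \<open>u\<^sub>i\<close> are determined by those of the arrows, because at a vertex of the
 arrangement every \<open>u\<^sub>i\<close> is a linear combination of loops modulo \<open>U\<^sup>\<bottom>\<close>; common vertices of
 adjacent topes make these images central.\<close>

locale quad_rep = vprog P U + ring_cong K
 for P :: "'e program" and U :: "('e => 'k::field) set" and K :: "'r::ring_1 set" +
 fixes kc :: "'k => 'r" and eps :: "('e => sign) => 'r" and arr :: "('e => sign) => ('e => sign) => 'r"
 assumes kc: "kc 0 = 0" "kc 1 = 1" "kc (a + b) = kc a + kc b" "kc (a * b) = kc a * kc b"
  and kc_central: "x * kc a = kc a * x"
  and eps_zero: "al : F - B ==> eps al \<approx> 0"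
  and eps_orth: "al : F ==> be : F ==> eps al * eps be \<approx> (if al = be then eps al else 0)"
  and eps_one: "(\<Sum>al\<in>F. eps al) \<approx> 1"
  and arr_eps: "al : F ==> be : F ==> adjacent al be ==> eps al * arr al be \<approx> arr al be"
   "al : F ==> be : F ==> adjacent al be ==> arr al be * eps be \<approx> arr al be"
  and square: "{al, be, ga, de} \<subseteq> F ==> distinct [al, be, ga, de] ==>
   adjacent al ga ==> adjacent al de ==> adjacent be ga ==> adjacent be de ==>
   arr al ga * arr ga be \<approx> arr al de * arr de be"
  and loops: "al : F ==> y : annihilator (prog_E P) U ==> (\<forall>i. flip al i ~: F --> y i = 0) ==>
   (\<Sum>i\<in>prog_E P. kc (y i) * (arr al (flip al i) * arr (flip al i) al)) \<approx> 0"
begin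

lemma kc_diff: "kc (a - b) = kc a - kc b"
proof -
 have "kc (a - b) + kc b = kc a" using kc(3)[of "a - b" b] by simp
 then show ?thesis by (simp add: eq_diff_eq)
qed

lemma kc_sum: "kc (sum f J) = (\<Sum>i\<in>J. kc (f i))"
 by (induction J rule: infinite_finite_induct) (auto simp: kc)

lemma kc_left: "x * (kc a * y) = kc a * (x * y)"
 by (simp only: mult.assoc[symmetric] kc_central[of x a])

definition loop :: "('e => sign) => 'e => 'r" where
 "loop al i = arr al (flip al i) * arr (flip al i) al"

definition comb :: "('e => sign) => ('e => 'k) => 'r" where
 "comb al c = (\<Sum>i\<in>E. kc (c i) * loop al i)"

text \<open>Coefficients that use only loops present in the quiver; the assumptions on
  \<open>arr\<close> concern arrows between feasible topes only.\<close>

definition adm :: "('e => sign) => ('e => 'k) => bool" where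
 "adm al c \<longleftrightarrow> (\<forall>i. c i ~= 0 --> i : E & flip al i : F)"

lemma comb_diff: "comb al (%j. c j - d j) = comb al c - comb al d"
 by (simp add: comb_def kc_diff left_diff_distrib sum_subtractf)

lemma comb_lincomb: "comb al (%j. \<Sum>i\<in>J. a i * c i j) = (\<Sum>i\<in>J. kc (a i) * comb al (c i))"
 by (simp add: comb_def kc_sum kc sum_distrib_right sum_distrib_left sum.swap[of _ J E] mult.assoc)

lemma comb_zero: "al : F ==> c : U0 ==> adm al c ==> comb al c \<approx> 0"
 using loops[of al c] unfolding adm_def comb_def loop_def by blast

text \<open>Coefficients of some expression of \<open>u_i\<close> by loops at \<open>al\<close>; by
  \<open>zl_eq\<close> the choice is immaterial modulo \<open>K\<close>.\<close>

definition uc :: "('e => sign) => 'e => 'e => 'k" where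
 "uc al i = (SOME c. adm al c & (%j. unit_form i j - c j) : U0)"

lemma basis_adm:
 assumes al: "al : F" and fb: "form_basis E U b" and i: "i : E"
  and b: "\<forall>c. support c = E & (\<forall>i. i ~: b --> c i = al i) --> c : F"
 shows "\<exists>c \<in> coord_space b. adm al c & (%j. unit_form i j - c j) : U0"
proof -
 have bE: "b \<subseteq> E" using fb by (simp add: form_basis_def)
 obtain c where c: "c : coord_space b" "(%j. unit_form i j - c j) : U0"
  using fb i unfolding form_basis_def by blast
 have "flip al l : F" if "l : b" for l
  using b that feasible_supp[OF al] by (auto simp: support_flip flip_apply)
 then have "adm al c" using c(1) bE by (auto simp: adm_def coord_space_def)
 then show ?thesis using c by blast
qed

lemma uc:
 assumes "al : F" "i : E"
 shows "adm al (uc al i)" "(%j. unit_form i j - uc al i j) : U0"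
proof -
 obtain b where "form_basis E U b" "\<forall>c. support c = E & (\<forall>i. i ~: b --> c i = al i) --> c : F"
  using vertex_ex[OF assms(1)] by blast
 then have "\<exists>c. adm al c & (%j. unit_form i j - c j) : U0" using basis_adm[OF assms(1) _ assms(2)] by blast
 then have "adm al (uc al i) & (%j. unit_form i j - uc al i j) : U0"
  unfolding uc_def by (rule someI_ex)
 then show "adm al (uc al i)" "(%j. unit_form i j - uc al i j) : U0" by auto
qed

text \<open>The image of \<open>u_i\<close> at the vertex \<open>al\<close> of the quiver.\<close>

definition zl :: "('e => sign) => 'e => 'r" where
 "zl al i = comb al (uc al i)"

text \<open>The difference of two admissible expressions of the same variable is an admissible form
  in \<open>U0\<close>, to which the assumption \<open>loops\<close> applies.\<close>

lemma zl_eq: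
 assumes "al : F" "i : E" "adm al c" "(%j. unit_form i j - c j) : U0"
 shows "zl al i \<approx> comb al c"
proof -
 have "(%j. (unit_form i j - c j) - (unit_form i j - uc al i j)) : U0"
  by (rule annihilator_diff[OF assms(4) uc(2)[OF assms(1,2)]])
 moreover have "(%j. (unit_form i j - c j) - (unit_form i j - uc al i j)) = (%j. uc al i j - c j)"
  by auto
 moreover have "adm al (%j. uc al i j - c j)"
  unfolding adm_def
 proof (intro allI impI)
  fix l assume "uc al i l - c l ~= 0"
  then have "uc al i l ~= 0 | c l ~= 0" by auto
  then show "l : E & flip al l : F" using uc(1)[OF assms(1,2)] assms(3) unfolding adm_def by blast
 qed
 ultimately have "comb al (%j. uc al i j - c j) \<approx> 0" using comb_zero[OF assms(1)] by simp
 then show ?thesis unfolding zl_def comb_diff by (simp add: cg_def)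
qed

lemma zl_loop:
 assumes "al : F" "i : E" "flip al i : F"
 shows "zl al i \<approx> loop al i"
proof -
 have "adm al (unit_form i)" using assms by (auto simp: adm_def unit_form_def)
 moreover have "(%j. unit_form i j - unit_form i j) : U0" by (simp add: annihilator_def coord_space_def)
 ultimately have "zl al i \<approx> comb al (unit_form i)" by (intro zl_eq assms(1,2))
 also have "comb al (unit_form i) = (\<Sum>j\<in>E. if j = i then loop al j else 0)"
  unfolding comb_def by (rule sum.cong) (auto simp: unit_form_def kc)
 also have "... = loop al i" using finite_E assms(2) by simp
 finally show ?thesis .
qed

text \<open>Substituting the expressions \<open>uc\<close> for the variables changes
  \<open>x\<close> by elements of \<open>U0\<close> only, so the resulting combination of loops is
  again a form in \<open>U0\<close>, now an admissible one.\<close>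

lemma zl_form:
 assumes "al : F" "x : U0"
 shows "(\<Sum>i\<in>E. kc (x i) * zl al i) \<approx> 0"
proof -
 let ?w = "%j. \<Sum>i\<in>E. x i * uc al i j"
 have "(%j. x j - (\<Sum>i\<in>E. x i * (unit_form i j - uc al i j))) : U0"
  by (intro annihilator_diff[OF assms(2)] annihilator_lincomb[OF finite_E] uc(2) assms(1))
 moreover have "x j - (\<Sum>i\<in>E. x i * (unit_form i j - uc al i j)) = ?w j" for j
 proof -
  have "(\<Sum>i\<in>E. x i * unit_form i j) = x j"
   using finite_E annihilator_zero[OF assms(2), of j]
   by (simp add: unit_form_def if_distrib[of "%y. _ * y"] cong: if_cong)
  then show ?thesis by (simp add: right_diff_distrib sum_subtractf)
 qed
 ultimately have "?w : U0" by simp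
 moreover have "adm al ?w"
  unfolding adm_def
 proof (intro allI impI)
  fix j assume "?w j ~= 0"
  then obtain i where "i : E" "x i * uc al i j ~= 0" by (meson sum.neutral)
  then show "j : E & flip al j : F" using uc(1)[OF assms(1)] by (auto simp: adm_def)
 qed
 ultimately have "comb al ?w \<approx> 0" by (rule comb_zero[OF assms(1)])
 then show ?thesis unfolding comb_lincomb zl_def .
qed

text \<open>Two applications of \<open>square\<close>, on the four topes spanned by the directions
  \<open>j\<close> and \<open>l\<close>, carry the loop across the arrow. For \<open>l = j\<close>
  both sides are the same product of three arrows.\<close>

lemma loop_arr:
 assumes al: "al : F" and j: "j : E" "flip al j : F" and l: "l : E" "flip al l : F" "flip (flip al j) l : F"
 shows "loop al l * arr al (flip al j) \<approx> arr al (flip al j) * loop (flip al j) l"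
proof (cases "l = j")
 case True
 then show ?thesis by (simp add: loop_def mult.assoc)
next
 case False
 let ?be = "flip al j" let ?ga = "flip al l" let ?de = "flip (flip al j) l"
 have nz: "al j ~= Zero" "al l ~= Zero" using F_nz al j l by auto
 have d: "distinct [?ga, ?be, al, ?de]"
 proof -
  have "?ga l ~= ?be l" "?ga l ~= al l" "?ga j ~= ?de j" "?be j ~= al j" "?be l ~= ?de l" "al j ~= ?de j"
   using False nz by (auto simp: flip_apply)
  then show ?thesis by (metis distinct_length_2_or_more distinct_singleton)
 qed
 have adj: "adjacent ?ga al" "adjacent ?ga ?de" "adjacent ?be al" "adjacent ?be ?de"
  using F_adj[OF al l(1)] F_adj[OF l(2) j(1)] F_adj[OF al j(1)] F_adj[OF j(2) l(1)]
  by (auto simp: flip_commute[of al l j])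
 have s1: "arr ?ga al * arr al ?be \<approx> arr ?ga ?de * arr ?de ?be"
  by (rule square) (use al j l d adj in auto)
 have s2: "arr al ?ga * arr ?ga ?de \<approx> arr al ?be * arr ?be ?de"
  by (rule square) (use al j l d adj adjacent_sym in auto)
 have "loop al l * arr al ?be = arr al ?ga * (arr ?ga al * arr al ?be)" by (simp add: loop_def mult.assoc)
 also have "... \<approx> arr al ?ga * (arr ?ga ?de * arr ?de ?be)" by (intro cg_mult cg_refl s1)
 also have "... = (arr al ?ga * arr ?ga ?de) * arr ?de ?be" by (simp add: mult.assoc)
 also have "... \<approx> (arr al ?be * arr ?be ?de) * arr ?de ?be" by (intro cg_mult cg_refl s2)
 also have "... = arr al ?be * loop ?be l" by (simp add: loop_def mult.assoc)
 finally show ?thesis .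
qed

text \<open>At a vertex common to \<open>al\<close> and \<open>be\<close> one and the same
  combination of loops represents \<open>u_i\<close> at both ends, and \<open>loop_arr\<close> moves
  it across the arrow term by term.\<close>

lemma zl_arr:
 assumes al: "al : F" and be: "be : F" "adjacent al be" and i: "i : E"
 shows "zl al i * arr al be \<approx> arr al be * zl be i"
proof -
 obtain j where j: "j : E" "be = flip al j" by (rule F_adjE[OF al be])
 obtain b where b: "form_basis E U b" "j : b"
  "\<forall>c. support c = E & (\<forall>i. i ~: b --> c i = al i) --> c : F"
  using edge_vertex_ex[OF al _ j(1)] be(1) j(2) by blast
 have s: "support al = E" by (rule feasible_supp[OF al])
 have bE: "b \<subseteq> E" using b(1) by (simp add: form_basis_def)
 obtain c where c: "c : coord_space b" "adm al c" "(%j. unit_form i j - c j) : U0"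
  using basis_adm[OF al b(1) i b(3)] by blast
 have fl: "flip al l : F" "flip be l : F" if "l : b" for l
  using b(2,3) that s unfolding j(2) by (auto simp: support_flip flip_apply)
 have "adm be c" using c(1) fl(2) bE by (auto simp: adm_def coord_space_def)
 have "zl al i * arr al be \<approx> comb al c * arr al be" by (intro cg_mult cg_refl zl_eq al i c)
 also have "... = (\<Sum>l\<in>E. kc (c l) * (loop al l * arr al be))"
  by (simp add: comb_def sum_distrib_right mult.assoc)
 also have "... \<approx> (\<Sum>l\<in>E. kc (c l) * (arr al be * loop be l))"
 proof (rule cg_sum)
  fix l assume l: "l : E"
  show "kc (c l) * (loop al l * arr al be) \<approx> kc (c l) * (arr al be * loop be l)"
  proof (cases "l : b")
   case True
   show ?thesis unfolding j(2)
    by (intro cg_mult cg_refl loop_arr al j(1) l) (use fl[OF True] be(1) j(2) in auto)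
  next
   case False
   then have "c l = 0" using c(1) by (simp add: coord_space_def)
   then show ?thesis by (simp add: kc)
  qed
 qed
 also have "... = arr al be * comb be c" by (simp add: comb_def sum_distrib_left kc_left)
 also have "... \<approx> arr al be * zl be i" by (intro cg_mult cg_refl cg_sym[OF zl_eq] be(1) i c \<open>adm be c\<close>)
 finally show ?thesis .
qed

lemma comb_eps:
 assumes "al : F" "adm al c"
 shows "eps al * comb al c \<approx> comb al c" "comb al c * eps al \<approx> comb al c"
proof -
 have l: "kc (c i) * (eps al * loop al i) \<approx> kc (c i) * loop al i & kc (c i) * (loop al i * eps al) \<approx> kc (c i) * loop al i"
  if i: "i : E" for i
 proof (cases "c i = 0")
  case False
  then have f: "flip al i : F" using assms(2) by (simp add: adm_def)
  have "eps al * loop al i = (eps al * arr al (flip al i)) * arr (flip al i) al" by (simp add: loop_def mult.assoc)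
  also have "... \<approx> loop al i" unfolding loop_def
   by (intro cg_mult cg_refl arr_eps(1)) (use assms(1) f F_adj i in auto)
  finally have 1: "eps al * loop al i \<approx> loop al i" .
  have "loop al i * eps al = arr al (flip al i) * (arr (flip al i) al * eps al)" by (simp add: loop_def mult.assoc)
  also have "... \<approx> loop al i" unfolding loop_def
   by (intro cg_mult cg_refl arr_eps(2)) (use assms(1) f F_adj i in auto)
  finally have 2: "loop al i * eps al \<approx> loop al i" .
  show ?thesis using cg_mult[OF cg_refl 1] cg_mult[OF cg_refl 2] by blast
 qed (simp add: kc)
 show "eps al * comb al c \<approx> comb al c"
  unfolding comb_def sum_distrib_left kc_left by (rule cg_sum) (use l in blast)
 show "comb al c * eps al \<approx> comb al c"
  unfolding comb_def sum_distrib_right mult.assoc by (rule cg_sum) (use l in blast)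
qed

lemma zl_eps:
 assumes "al : F" "i : E" shows "eps al * zl al i \<approx> zl al i" "zl al i * eps al \<approx> zl al i"
 unfolding zl_def by (intro comb_eps assms uc)+

lemma eps_absorb:
 assumes "al : F" "be : F" "eps be * x \<approx> x"
 shows "eps al * x \<approx> (if al = be then x else 0)"
proof -
 have "eps al * x \<approx> eps al * (eps be * x)" by (intro cg_mult cg_refl cg_sym[OF assms(3)])
 also have "... = (eps al * eps be) * x" by (simp add: mult.assoc)
 also have "... \<approx> (if al = be then eps al else 0) * x" by (intro cg_mult cg_refl eps_orth assms)
 also have "... \<approx> (if al = be then x else 0)" using assms(3) by auto
 finally show ?thesis .
qed

lemma eps_absorb_r:
 assumes "al : F" "be : F" "x * eps be \<approx> x"
 shows "x * eps al \<approx> (if al = be then x else 0)"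
proof -
 have "x * eps al \<approx> (x * eps be) * eps al" by (intro cg_mult cg_refl cg_sym[OF assms(3)])
 also have "... = x * (eps be * eps al)" by (simp add: mult.assoc)
 also have "... \<approx> x * (if be = al then eps be else 0)" by (intro cg_mult cg_refl eps_orth assms)
 also have "... \<approx> (if al = be then x else 0)" using assms(3) by auto
 finally show ?thesis .
qed

text \<open>The image of the variable \<open>u_i\<close>, assembled from its parts at all vertices
  of the quiver.\<close>

definition z :: "'e => 'r" where
 "z i = (\<Sum>al\<in>F. zl al i)"

lemma z_left:
 assumes "al : F" "i : E" "eps al * x \<approx> x"
 shows "z i * x \<approx> zl al i * x"
 unfolding z_def sum_distrib_right
proof (rule cg_sum_single[OF finite_F assms(1)])
 fix be assume be: "be : F" "be ~= al"
 have "zl be i * x \<approx> (zl be i * eps be) * x" by (intro cg_mult cg_refl cg_sym[OF zl_eps(2)] be assms)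
 also have "... = zl be i * (eps be * x)" by (simp add: mult.assoc)
 also have "... \<approx> zl be i * (if be = al then x else 0)" by (intro cg_mult cg_refl eps_absorb assms be)
 also have "... = 0" using be by simp
 finally show "zl be i * x \<approx> 0" .
qed

lemma z_right:
 assumes "al : F" "i : E" "x * eps al \<approx> x"
 shows "x * z i \<approx> x * zl al i"
 unfolding z_def sum_distrib_left
proof (rule cg_sum_single[OF finite_F assms(1)])
 fix be assume be: "be : F" "be ~= al"
 have "x * zl be i \<approx> x * (eps be * zl be i)" by (intro cg_mult cg_refl cg_sym[OF zl_eps(1)] be assms)
 also have "... = (x * eps be) * zl be i" by (simp add: mult.assoc)
 also have "... \<approx> (if be = al then x else 0) * zl be i" by (intro cg_mult cg_refl eps_absorb_r assms be)
 also have "... = 0" using be by simp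
 finally show "x * zl be i \<approx> 0" .
qed

lemma eps_eps: "al : F ==> eps al * eps al \<approx> eps al"
 using eps_orth[of al al] by simp

lemma z_eps:
 assumes "al : F" "i : E"
 shows "eps al * z i \<approx> zl al i" "z i * eps al \<approx> zl al i"
 using cg_trans[OF z_right[OF assms eps_eps[OF assms(1)]] zl_eps(1)[OF assms]]
  cg_trans[OF z_left[OF assms eps_eps[OF assms(1)]] zl_eps(2)[OF assms]] by auto

lemma z_arr:
 assumes "al : F" "be : F" "adjacent al be" "i : E"
 shows "z i * arr al be \<approx> arr al be * z i"
proof -
 have "z i * arr al be \<approx> zl al i * arr al be" by (intro z_left assms arr_eps(1))
 also have "... \<approx> arr al be * zl be i" by (intro zl_arr assms)
 also have "... \<approx> arr al be * z i" by (intro cg_sym[OF z_right] assms arr_eps(2))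
 finally show ?thesis .
qed

lemma commutes_mult:
 assumes "w * x \<approx> x * w" "w * y \<approx> y * w" shows "w * (x * y) \<approx> (x * y) * w"
proof -
 have "w * (x * y) = (w * x) * y" by (simp add: mult.assoc)
 also have "... \<approx> (x * w) * y" by (intro cg_mult cg_refl assms)
 also have "... = x * (w * y)" by (simp add: mult.assoc)
 also have "... \<approx> x * (y * w)" by (intro cg_mult cg_refl assms)
 also have "... = (x * y) * w" by (simp add: mult.assoc)
 finally show ?thesis .
qed

text \<open>\<open>z j\<close> is a combination of products of arrows, and \<open>z i\<close>
  commutes with arrows modulo \<open>K\<close>.\<close>

lemma z_comm:
 assumes "i : E" "j : E"
 shows "z i * z j \<approx> z j * z i"
proof -
 have "z i * (kc (uc al j l) * loop al l) \<approx> (kc (uc al j l) * loop al l) * z i" if a: "al : F" "l : E" for al l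
 proof (cases "uc al j l = 0")
  case False
  then have f: "flip al l : F" using uc(1)[OF a(1) assms(2)] by (simp add: adm_def)
  have "z i * loop al l \<approx> loop al l * z i" unfolding loop_def
   by (intro commutes_mult z_arr) (use a f F_adj assms in auto)
  then have "kc (uc al j l) * (z i * loop al l) \<approx> kc (uc al j l) * (loop al l * z i)" by (rule cg_mult[OF cg_refl])
  then show ?thesis by (simp add: kc_left mult.assoc)
 qed (simp add: kc)
 then show ?thesis unfolding z_def[of j] zl_def comb_def sum_distrib_left sum_distrib_right
  by (intro cg_sum) blast
qed

text \<open>Every path ends in the idempotent of its last vertex, so trivial paths need no separate
  treatment. The value at \<open>[]\<close> is a default, since paths are nonempty.\<close>

fun pth :: "('e => sign) list => 'r" where
 "pth [] = 0"
| "pth [v] = eps v"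
| "pth (v # w # p) = arr v w * pth (w # p)"

lemma pth_eps: "quiver_path F adjacent p ==> eps (hd p) * pth p \<approx> pth p"
proof (induction p rule: pth.induct)
 case (3 v w p)
 have "eps v * (arr v w * pth (w # p)) = (eps v * arr v w) * pth (w # p)" by (simp add: mult.assoc)
 also have "... \<approx> arr v w * pth (w # p)"
  by (intro cg_mult cg_refl arr_eps(1)) (use 3 in \<open>auto simp: quiver_path_def\<close>)
 finally show ?case by simp
qed (auto simp: quiver_path_def eps_eps)

lemma pth_mult:
 assumes "quiver_path F adjacent p" "quiver_path F adjacent q"
 shows "pth p * pth q \<approx> (if last p = hd q then pth (p @ tl q) else 0)"
 using assms(1)
proof (induction p rule: pth.induct)
 case (2 v)
 then have v: "v : F" by (simp add: quiver_path_def)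
 obtain w q' where q: "q = w # q'" using assms(2) by (cases q) (auto simp: quiver_path_def)
 have "w : F" using assms(2) q by (simp add: quiver_path_def)
 have "eps v * pth q \<approx> (if v = w then pth q else 0)"
  by (rule eps_absorb[OF v \<open>w \<in> F\<close>]) (use pth_eps[OF assms(2)] q in simp)
 then show ?case using q by auto
next
 case (3 v w p)
 then have IH: "pth (w # p) * pth q \<approx> (if last (w # p) = hd q then pth ((w # p) @ tl q) else 0)"
  by (simp add: quiver_path_simps)
 have "pth (v # w # p) * pth q = arr v w * (pth (w # p) * pth q)" by (simp add: mult.assoc)
 also have "... \<approx> arr v w * (if last (w # p) = hd q then pth ((w # p) @ tl q) else 0)"
  by (intro cg_mult cg_refl IH)
 also have "... = (if last (v # w # p) = hd q then pth ((v # w # p) @ tl q) else 0)" by simp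
 finally show ?case .
qed (simp add: quiver_path_def)

lemma z_pth:
 assumes "quiver_path F adjacent p" "i : E"
 shows "z i * pth p \<approx> pth p * z i"
 using assms(1)
proof (induction p rule: pth.induct)
 case (2 v)
 then have "v : F" by (simp add: quiver_path_def)
 then show ?case using cg_trans[OF z_eps(2)[OF _ assms(2)] cg_sym[OF z_eps(1)[OF _ assms(2)]]] by simp
next
 case (3 v w p)
 then show ?case using assms(2)
  by (auto simp: quiver_path_def intro!: commutes_mult z_arr)
qed simp

text \<open>The elements \<open>z i\<close> commute only modulo \<open>K\<close>, so a monomial has
  to be evaluated in a fixed order of the variables.\<close>

definition enum :: "'e list" where
 "enum = (SOME xs. set xs = E & distinct xs)"

lemma enum: "set enum = E" "distinct enum"
proof -
 have "\<exists>xs. set xs = E & distinct xs" using finite_distinct_list[OF finite_E] .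
 then have "set enum = E & distinct enum" unfolding enum_def by (rule someI_ex)
 then show "set enum = E" "distinct enum" by auto
qed

definition zmon :: "('e \<Rightarrow>\<^sub>0 nat) => 'r" where
 "zmon m = prod_list (map (%i. z i ^ lookup m i) enum)"

lemma commutes_power: "w * x \<approx> x * w ==> w * x ^ n \<approx> x ^ n * w"
 by (induction n) (auto intro: commutes_mult)

lemma commutes_prod_list: "(!!x. x : set xs ==> w * x \<approx> x * w) ==> w * prod_list xs \<approx> prod_list xs * w"
 by (induction xs) (auto intro: commutes_mult)

lemma zmon_pth:
 assumes "quiver_path F adjacent p"
 shows "pth p * zmon m \<approx> zmon m * pth p"
 unfolding zmon_def
 by (rule commutes_prod_list) (auto simp: enum intro!: commutes_power cg_sym[OF z_pth[OF assms]])

lemma zmon_add: "zmon (m + n) \<approx> zmon m * zmon n"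
proof -
 have *: "prod_list (map (%i. z i ^ (lookup m i + lookup n i)) xs) \<approx>
  prod_list (map (%i. z i ^ lookup m i) xs) * prod_list (map (%i. z i ^ lookup n i) xs)"
  if "set xs \<subseteq> E" for xs
  using that
 proof (induction xs)
  case (Cons i xs)
  let ?a = "z i ^ lookup m i" let ?b = "z i ^ lookup n i"
  let ?x = "prod_list (map (%i. z i ^ lookup m i) xs)"
  let ?y = "prod_list (map (%i. z i ^ lookup n i) xs)"
  have comm: "?b * ?x \<approx> ?x * ?b"
  proof (rule commutes_prod_list)
   fix w assume "w : set (map (%i. z i ^ lookup m i) xs)"
   then obtain j where j: "j : set xs" "w = z j ^ lookup m j" by auto
   have "z i * z j \<approx> z j * z i" by (rule z_comm) (use j Cons.prems in auto)
   then have "z i * w \<approx> w * z i" unfolding j(2) by (rule commutes_power)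
   then show "?b * w \<approx> w * ?b" using commutes_power cg_sym by blast
  qed
  have "prod_list (map (%i. z i ^ (lookup m i + lookup n i)) (i # xs)) \<approx>
   (?a * ?b) * (?x * ?y)" using Cons by (auto simp: power_add intro!: cg_mult)
  also have "... = ?a * (?b * ?x) * ?y" by (simp add: mult.assoc)
  also have "... \<approx> ?a * (?x * ?b) * ?y" by (intro cg_mult cg_refl comm)
  also have "... = (?a * ?x) * (?b * ?y)" by (simp add: mult.assoc)
  finally show ?case by simp
 qed simp
 show ?thesis using *[of enum] unfolding zmon_def by (simp add: enum lookup_add)
qed

lemma zmon_zero: "zmon 0 = 1"
 by (simp add: zmon_def map_replicate_const prod_list_replicate)

lemma zmon_var: "i : E ==> zmon (single i 1) = z i"
proof -
 assume i: "i : E"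
 have "prod_list (map (%j. z j ^ lookup (single i 1) j) xs) = (if i : set xs then z i else 1)"
  if "distinct xs" for xs
  using that by (induction xs) (auto simp: lookup_single when_def)
 then show ?thesis using i enum by (simp add: zmon_def)
qed

text \<open>Additive on the nose, but multiplicative only modulo \<open>K\<close> and on the
  carrier; this is enough to send the ideal \<open>I\<close> into \<open>K\<close>.\<close>

definition Theta :: "(('e => sign) list \<Rightarrow>\<^sub>0 ('e, 'k) mpoly) => 'r" where
 "Theta x = pm_sum (%p f. pm_sum (%m c. kc c * (pth p * zmon m)) f) x"

lemma Theta_additive1: "coeff_additive (%m c. kc c * (pth p * zmon m))"
 by (rule coeff_additiveI) (simp add: kc distrib_right)

lemma Theta_additive2: "coeff_additive (%p f. pm_sum (%m c. kc c * (pth p * zmon m)) f)"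
 by (rule coeff_additiveI) (rule pm_sum_add[OF Theta_additive1])

lemma Theta_add: "Theta (x + y) = Theta x + Theta y"
 unfolding Theta_def by (rule pm_sum_add[OF Theta_additive2])

lemma Theta_zero [simp]: "Theta 0 = 0"
 by (simp add: Theta_def)

lemma Theta_diff: "Theta (x - y) = Theta x - Theta y"
 unfolding Theta_def by (rule pm_sum_diff[OF Theta_additive2])

lemma Theta_sum: "Theta (sum f J) = (\<Sum>i\<in>J. Theta (f i))"
 unfolding Theta_def by (rule pm_sum_sum[OF Theta_additive2])

lemma Theta_qterm: "Theta (qterm p m c) = kc c * (pth p * zmon m)"
 unfolding Theta_def qterm_def pm_sum_single[OF Theta_additive2] by (rule pm_sum_single[OF Theta_additive1])

lemma Theta_qscale: "Theta (qscale c x) = kc c * Theta x"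
 by (induction x rule: qterm_induct_all)
  (auto simp: Theta_qterm qscale_simps Theta_add kc mult.assoc distrib_left)

lemma Theta_mult:
 assumes "x : carrier Q" "y : carrier Q"
 shows "Theta (qmul x y) \<approx> Theta x * Theta y"
 using assms(1)
proof (induction x rule: QA_induct)
 case x: (single p m c)
 show ?case using assms(2)
 proof (induction y rule: QA_induct)
  case y: (single q n d)
  have "Theta (qterm p m c) * Theta (qterm q n d) = kc c * ((pth p * zmon m) * (kc d * (pth q * zmon n)))"
   by (simp add: Theta_qterm mult.assoc)
  also have "... = kc c * (kc d * ((pth p * zmon m) * (pth q * zmon n)))"
   by (simp only: kc_left[of "pth p * zmon m"])
  also have "... = kc (c * d) * (pth p * (zmon m * pth q) * zmon n)"
   by (simp add: kc mult.assoc)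
  also have "... \<approx> kc (c * d) * (pth p * (pth q * zmon m) * zmon n)"
   by (intro cg_mult cg_refl cg_sym[OF zmon_pth] y)
  also have "... = kc (c * d) * ((pth p * pth q) * (zmon m * zmon n))" by (simp add: mult.assoc)
  also have "... \<approx> kc (c * d) * ((if last p = hd q then pth (p @ tl q) else 0) * zmon (m + n))"
   by (intro cg_mult cg_refl pth_mult x y cg_sym[OF zmon_add])
  also have "... = Theta (qmul (qterm p m c) (qterm q n d))" by (simp add: qmul_qterm Theta_qterm)
  finally show ?case by (rule cg_sym)
 qed (auto simp: qmul_add_r Theta_add distrib_left intro: cg_add)
qed (auto simp: qmul_add_l Theta_add distrib_right intro: cg_add)

lemma Theta_one: "Theta \<one>\<^bsub>Q\<^esub> \<approx> 1"
 using eps_one by (simp add: QA_simps Theta_sum Theta_qterm kc zmon_zero)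

text \<open>The four families reduce to \<open>eps_zero\<close>, \<open>square\<close>,
  \<open>zl_loop\<close> and \<open>zl_form\<close>; the final \<open>eps\<close> in
  \<open>pth\<close> is absorbed by \<open>arr_eps\<close>.\<close>

lemma Theta_rels:
 assumes "r : ideal_rels"
 shows "Theta r \<approx> 0"
 using assms
proof (cases rule: rels_cases)
 case (A1 al)
 then show ?thesis using eps_zero by (simp add: Theta_qterm kc zmon_zero)
next
 case (A2 al be ga de)
 have "arr al ga * (arr ga be * eps be) \<approx> arr al ga * arr ga be"
  by (intro cg_mult cg_refl arr_eps) (use A2 adjacent_sym in auto)
 also have "... \<approx> arr al de * arr de be" by (rule square) (use A2 in auto)
 also have "... \<approx> arr al de * (arr de be * eps be)"
  by (intro cg_mult cg_refl cg_sym[OF arr_eps(2)]) (use A2 adjacent_sym in auto)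
 finally show ?thesis unfolding A2(7) by (simp add: Theta_diff Theta_qterm kc zmon_zero cg_def)
next
 case (A3 al i)
 have "arr al (flip al i) * (arr (flip al i) al * eps al) \<approx> loop al i" unfolding loop_def
  by (intro cg_mult cg_refl arr_eps) (use A3 F_adj in auto)
 also have "... \<approx> zl al i" by (intro cg_sym[OF zl_loop] A3)
 also have "... \<approx> eps al * z i" by (intro cg_sym[OF z_eps(1)] A3)
 finally show ?thesis unfolding A3(4)
  using A3(1) by (simp add: Theta_diff Theta_qterm kc zmon_zero zmon_var cg_def del: One_nat_def)
next
 case (A4 x)
 have "Theta r = (\<Sum>al\<in>F. \<Sum>i\<in>E. kc (x i) * (eps al * z i))"
  unfolding A4(2) Theta_sum Theta_qterm by (intro sum.cong refl) (simp add: zmon_var del: One_nat_def)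
 also have "... \<approx> (\<Sum>al\<in>F. \<Sum>i\<in>E. kc (x i) * zl al i)"
  by (intro cg_sum cg_mult cg_refl z_eps)
 also have "... \<approx> 0" by (intro cg_sum_zero zl_form A4(1))
 finally show ?thesis .
qed

lemma Theta_ideal:
 assumes "x : I" shows "Theta x \<approx> 0"
proof -
 have "ideal {x \<in> carrier QA. Theta x \<approx> 0} Q"
 proof (rule QA.ideal_ab_I)
  fix x y assume x: "x : {x \<in> carrier QA. Theta x \<approx> 0}" and y: "y : carrier Q"
  have "Theta (qmul x y) \<approx> 0"
   using cg_trans[OF Theta_mult[of x y] cg_mult_zero(1)[of "Theta x" "Theta y"]] x y by blast
  then show "x \<otimes>\<^bsub>Q\<^esub> y : {x \<in> carrier QA. Theta x \<approx> 0}" using x y by (simp add: QA_simps QA_mult)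
  have "Theta (qmul y x) \<approx> 0"
   using cg_trans[OF Theta_mult[of y x] cg_mult_zero(2)[of "Theta x" "Theta y"]] x y by blast
  then show "y \<otimes>\<^bsub>Q\<^esub> x : {x \<in> carrier QA. Theta x \<approx> 0}" using x y by (simp add: QA_simps QA_mult)
 next
  fix x y assume "x : {x \<in> carrier Q. Theta x \<approx> 0}" "y : {x \<in> carrier Q. Theta x \<approx> 0}"
  then show "x + y : {x \<in> carrier Q. Theta x \<approx> 0}"
   using cg_add[of "Theta x" 0 "Theta y" 0] by (simp add: QA_plus Theta_add)
 qed (simp_all add: QA_zero)
 moreover have "ideal_rels \<subseteq> {x \<in> carrier QA. Theta x \<approx> 0}" using Theta_rels rels_carrier by blast
 ultimately have "I \<subseteq> {x \<in> carrier QA. Theta x \<approx> 0}" unfolding I_eq by (rule QA.genideal_minimal)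
 then show ?thesis using assms by blast
qed

end

subsection \<open>Functionals on the algebra of a program\<close>

definition lam :: "('v list => ('e \<Rightarrow>\<^sub>0 nat) => 'k::field) => ('v, 'e, 'k) qalg => 'k" where
 "lam f x = pm_sum (%p h. pm_sum (%m c. c * f p m) h) x"

lemma lam_additive1: "coeff_additive (%m c. c * f p m :: 'k::field)"
 by (rule coeff_additiveI) (simp add: distrib_right)

lemma lam_additive2: "coeff_additive (%p h. pm_sum (%m c. c * f p m :: 'k::field) h)"
 by (rule coeff_additiveI) (rule pm_sum_add[OF lam_additive1])

lemma lam_add: "lam f (x + y) = lam f x + lam f y"
 unfolding lam_def by (rule pm_sum_add[OF lam_additive2])

lemma lam_diff: "lam f (x - y) = lam f x - lam f y"
 unfolding lam_def by (rule pm_sum_diff[OF lam_additive2])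

lemma lam_zero [simp]: "lam f 0 = 0"
 by (simp add: lam_def)

lemma lam_sum: "lam f (sum h J) = (\<Sum>i\<in>J. lam f (h i))"
 unfolding lam_def by (rule pm_sum_sum[OF lam_additive2])

lemma lam_qterm: "lam f (qterm p m c) = c * f p m"
 unfolding lam_def qterm_def pm_sum_single[OF lam_additive2] by (rule pm_sum_single[OF lam_additive1])

lemma lam_qscale: "lam f (qscale c x) = c * lam f x"
 by (induction x rule: qterm_induct_all) (auto simp: lam_qterm qscale_simps lam_add distrib_left mult.assoc)

lemma lam_delta: "lam (%w m. if w = p & m = l then 1 else 0) x = cf x p l"
 by (induction x rule: qterm_induct_all) (auto simp: lam_qterm lam_add cf_qterm)

lemma qterm_scale: "qterm p m c = qscale c (qterm p m 1)"
 by (simp add: qscale_simps)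

lemma monom_degree_eq_0: "monom_degree m = 0 \<longleftrightarrow> m = 0"
proof
 assume "monom_degree m = 0"
 then have "\<forall>i\<in>keys m. lookup m i = 0" by (simp add: monom_degree_def)
 then have "lookup m i = 0" for i by (cases "i : keys m") (auto simp: in_keys_iff)
 then show "m = 0" by (intro poly_mapping_eqI) simp
qed simp

context vprog
begin

lemma qscale_closed: "x : carrier Q ==> qscale c x : carrier Q"
 using QA.smult_closed[of x c] by (simp add: QA_simps)

lemmas I_facts = QA.ideal_facts[OF ideal_I, unfolded QA_simps]

lemma I_qscale: "x : I ==> qscale c x : I"
 using QA.ideal_smult[OF ideal_I, of x c] by (simp add: QA_simps)

definition kills :: "(('e => sign) list => ('e \<Rightarrow>\<^sub>0 nat) => 'k) => bool" where
 "kills f \<longleftrightarrow> (\<forall>x \<in> I. lam f x = 0)"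

text \<open>It suffices to test two-sided multiples of the relations by single terms. The lists
  \<open>p\<close> and \<open>q\<close> are what precedes and follows the relation in a path, and
  \<open>c1\<close> to \<open>c4\<close> correspond to the four families of relations.\<close>

lemma killsI:
 fixes f :: "('e => sign) list => ('e \<Rightarrow>\<^sub>0 nat) => 'k"
 assumes c1: "!!w m v. v : set w ==> v : F - B ==> f w m = 0"
  and c2: "!!p q m al be ga de. p ~= [] ==> last p = al ==> {al, be, ga, de} \<subseteq> F ==> distinct [al, be, ga, de] ==>
   adjacent al ga ==> adjacent al de ==> adjacent be ga ==> adjacent be de ==>
   f (p @ ga # be # q) m = f (p @ de # be # q) m"
  and c3: "!!p q m al i. p ~= [] ==> last p = al ==> i : E ==> al : F ==> flip al i : F ==>
   f (p @ flip al i # al # q) m = f (p @ q) (m + single i 1)"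
  and c4: "!!w m x. w ~= [] ==> x : U0 ==> (\<Sum>i\<in>E. x i * f w (m + single i 1)) = 0"
 shows "kills f"
proof -
 \<comment> \<open>The largest two-sided ideal inside the kernel of the functional.\<close>
 let ?K = "{x \<in> carrier Q. \<forall>a \<in> carrier Q. \<forall>b \<in> carrier Q. lam f (qmul (qmul a x) b) = 0}"
 have "ideal ?K Q"
 proof (rule QA.ideal_ab_I)
  fix x y assume x: "x : ?K" and y: "y : carrier Q"
  have xQ: "x : carrier Q" using x by simp
  have "qmul (qmul a (qmul x y)) b = qmul (qmul a x) (qmul y b)"
   "qmul (qmul a (qmul y x)) b = qmul (qmul (qmul a y) x) b"
   if "a : carrier Q" "b : carrier Q" for a b
   using that xQ y by (simp_all add: QA_assoc QA_mult)
  then show "x \<otimes>\<^bsub>Q\<^esub> y : ?K" "y \<otimes>\<^bsub>Q\<^esub> x : ?K"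
   using x y by (auto simp: QA_simps QA_mult)
 qed (auto simp: QA_zero QA_plus qmul_add_l qmul_add_r lam_add)
 moreover have "ideal_rels \<subseteq> ?K"
 proof
  fix r assume r: "r : ideal_rels"
  have main: "lam f (qmul (qmul (qterm p m 1) r) (qterm q n 1)) = 0"
   if p: "quiver_path F adjacent p" and q: "quiver_path F adjacent q" for p q m n
  proof -
   obtain v q' where q': "q = v # q'" using quiver_path_nonempty[OF q] by (cases q) auto
   have pn: "p ~= []" by (rule quiver_path_nonempty[OF p])
   show ?thesis using r
   proof (cases rule: rels_cases)
    case (A1 al)
    show ?thesis
    proof (cases "last p = al & v = al")
     case True
     then have "al : set (p @ q')" using pn by (metis UnI1 last_in_set set_append)
     then show ?thesis using c1 A1 True q' by (simp add: qmul_qterm lam_qterm)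
    qed (use A1 q' in \<open>auto simp: qmul_qterm\<close>)
   next
    case (A2 al be ga de)
    show ?thesis
    proof (cases "last p = al & v = be")
     case True
     then show ?thesis using c2[OF pn _ A2(1-6), of q' "m + n"] q'
      by (simp add: A2(7) qmul_diff_l qmul_diff_r lam_diff qmul_qterm lam_qterm)
    qed (use q' in \<open>auto simp: A2(7) qmul_diff_l qmul_diff_r lam_diff qmul_qterm\<close>)
   next
    case (A3 al i)
    show ?thesis
    proof (cases "last p = al & v = al")
     case True
     then show ?thesis using c3[OF pn _ A3(1-3), of q' "m + n"] q'
      by (simp add: A3(4) qmul_diff_l qmul_diff_r lam_diff qmul_qterm lam_qterm add.assoc add.commute[of n])
    qed (use q' in \<open>auto simp: A3(4) qmul_diff_l qmul_diff_r lam_diff qmul_qterm\<close>)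
   next
    case (A4 x)
    have "lam f (qmul (qmul (qterm p m 1) r) (qterm q n 1)) =
     (\<Sum>al\<in>F. \<Sum>i\<in>E. lam f (qmul (qmul (qterm p m 1) (qterm [al] (single i 1) (x i))) (qterm q n 1)))"
     unfolding A4(2) qmul_sum_l qmul_sum_r lam_sum ..
    also have "... = 0"
    proof (rule sum.neutral, rule ballI)
     fix al assume "al : F"
     show "(\<Sum>i\<in>E. lam f (qmul (qmul (qterm p m 1) (qterm [al] (single i 1) (x i))) (qterm q n 1))) = 0"
     proof (cases "last p = al & v = al")
      case True
      then show ?thesis using c4[of "p @ q'" x "m + n"] A4(1) pn q'
       by (simp add: qmul_qterm lam_qterm add.assoc add.commute[of n])
     qed (use q' in \<open>auto simp: qmul_qterm intro!: sum.neutral\<close>)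
    qed
    finally show ?thesis .
   qed
  qed
  have "lam f (qmul (qmul a r) b) = 0" if ab: "a : carrier Q" "b : carrier Q" for a b
   using ab(1)
  proof (induction a rule: QA_induct)
   case a: (single p m c)
   show ?case using ab(2)
   proof (induction b rule: QA_induct)
    case b: (single q n d)
    show ?case unfolding qterm_scale[of p m c] qterm_scale[of q n d] qscale_qmul lam_qscale
     using main[OF a(1) b(1)] by simp
   qed (auto simp: qmul_add_r lam_add)
  qed (auto simp: qmul_add_l lam_add)
  then show "r : ?K" using r rels_carrier by auto
 qed
 ultimately have "I \<subseteq> ?K" unfolding I_eq by (rule QA.genideal_minimal)
 moreover have "x = qmul (qmul \<one>\<^bsub>Q\<^esub> x) \<one>\<^bsub>Q\<^esub>" if "x : I" for x
  using I_facts(4)[OF that] QA.l_one[of x] QA.r_one[of x] by (simp add: QA_simps)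
 ultimately show ?thesis unfolding kills_def using QA.one_closed by fastforce
qed

text \<open>Multiples of (A2), (A3) and (A4) involve only terms of degree at least 2, and multiples
  of (A1) only paths through an unbounded tope. Hence coefficients of degree 0 and 1 at bounded
  topes are well defined on the quotient.\<close>

lemma kills_delta:
 assumes "set p \<subseteq> B" "length p \<le> 2"
 shows "kills (%w m. if w = p & m = 0 then 1 else 0)"
proof (rule killsI)
 fix w m v assume "v : set w" "v : F - B"
 then show "(if w = p & m = 0 then 1 else 0) = (0::'k)" using assms(1) by auto
next
 fix q q' :: "('e => sign) list" and m :: "'e \<Rightarrow>\<^sub>0 nat" and be ga de :: "'e => sign" assume "q ~= []"
 then have "length q + length q' + 2 > 2" by simp
 then have "q @ ga # be # q' ~= p" "q @ de # be # q' ~= p" using assms(2) by auto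
 then show "(if q @ ga # be # q' = p & m = 0 then 1 else 0) = (if q @ de # be # q' = p & m = 0 then 1 else (0::'k))"
  by simp
next
 fix q q' :: "('e => sign) list" and m :: "'e \<Rightarrow>\<^sub>0 nat" and al i assume "q ~= []"
 then have "q @ flip al i # al # q' ~= p" using assms(2) by auto
 moreover have "m + single i 1 ~= 0"
  by (metis monom_degree_add monom_degree_simps add_is_0 one_neq_zero)
 ultimately show "(if q @ flip al i # al # q' = p & m = 0 then 1 else 0) =
  (if q @ q' = p & m + single i 1 = 0 then 1 else (0::'k))" by simp
next
 fix w :: "('e => sign) list" and m :: "'e \<Rightarrow>\<^sub>0 nat" and x :: "'e => 'k"
 have "m + single i 1 ~= 0" for i
  by (metis monom_degree_add monom_degree_simps add_is_0 one_neq_zero)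
 then show "(\<Sum>i\<in>E. x i * (if w = p & m + single i 1 = 0 then 1 else 0)) = 0" by simp
qed

text \<open>The functional adds up the coefficients of all paths of length 2 from \<open>al\<close>
  to \<open>be\<close>. Since every common neighbour is bounded, it counts both terms of a relation
  (A2) or neither of them.\<close>

lemma kills_square:
 assumes "al : B" "be : B" "al ~= be"
  and mid: "!!x. x : F ==> adjacent al x ==> adjacent be x ==> x : B"
 shows "kills (%w m. if (\<exists>x \<in> B. w = [al, x, be]) & m = 0 then 1 else 0)"
proof (rule killsI)
 fix w m v assume "v : set w" "v : F - B"
 then show "(if (\<exists>x \<in> B. w = [al, x, be]) & m = 0 then 1 else 0) = (0::'k)" using assms(1,2) by auto
next
 fix q q' :: "('e => sign) list" and m :: "'e \<Rightarrow>\<^sub>0 nat" and al' be' ga de assume q: "q ~= []" "last q = al'"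
  and sq: "{al', be', ga, de} \<subseteq> F" "adjacent al' ga" "adjacent al' de" "adjacent be' ga" "adjacent be' de"
 have one: "q @ y # be' # q' = [al, x, be] \<longleftrightarrow> q = [al] & y = x & be' = be & q' = []" for x y
  using q(1) by (cases q) (auto simp: append_eq_Cons_conv)
 have "(\<exists>x \<in> B. q @ ga # be' # q' = [al, x, be]) \<longleftrightarrow> (\<exists>x \<in> B. q @ de # be' # q' = [al, x, be])"
  unfolding one using mid[of ga] mid[of de] sq q by auto
 then show "(if (\<exists>x \<in> B. q @ ga # be' # q' = [al, x, be]) & m = 0 then 1 else 0) =
  (if (\<exists>x \<in> B. q @ de # be' # q' = [al, x, be]) & m = 0 then 1 else (0::'k))" by simp
next
 fix q q' :: "('e => sign) list" and m :: "'e \<Rightarrow>\<^sub>0 nat" and al' i assume q: "q ~= []" "last q = al'"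
 have "q @ flip al' i # al' # q' ~= [al, x, be]" for x
  using q assms(3) by (cases q) (auto simp: append_eq_Cons_conv)
 moreover have "m + single i 1 ~= 0"
  by (metis monom_degree_add monom_degree_simps add_is_0 one_neq_zero)
 ultimately show "(if (\<exists>x \<in> B. q @ flip al' i # al' # q' = [al, x, be]) & m = 0 then 1 else 0) =
  (if (\<exists>x \<in> B. q @ q' = [al, x, be]) & m + single i 1 = 0 then 1 else (0::'k))" by simp
next
 fix w :: "('e => sign) list" and m :: "'e \<Rightarrow>\<^sub>0 nat" and x :: "'e => 'k"
 have "m + single i 1 ~= 0" for i
  by (metis monom_degree_add monom_degree_simps add_is_0 one_neq_zero)
 then show "(\<Sum>i\<in>E. x i * (if (\<exists>x \<in> B. w = [al, x, be]) & m + single i 1 = 0 then 1 else 0)) = 0" by simp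
qed

lemma flip_inj: "al : F ==> i : E ==> flip al i = flip al j \<longleftrightarrow> i = j"
 using F_nz by (metis flip_apply opp_simps(3))

text \<open>Takes the value \<open>y i\<close> both on the loop at \<open>al\<close> in direction
  \<open>i\<close> and on the variable \<open>u_i\<close> at \<open>al\<close>, as (A3)
  demands.\<close>

definition loop_fun :: "('e => sign) => ('e => 'k) => ('e => sign) list => ('e \<Rightarrow>\<^sub>0 nat) => 'k" where
 "loop_fun al y w m = (\<Sum>i\<in>E. if w = [al, flip al i, al] & m = 0 | w = [al] & m = single i 1 then y i else 0)"

lemma single_monom_eq: "single i (1::nat) = single j 1 \<longleftrightarrow> i = j"
 by (metis lookup_single_eq lookup_single_not_eq one_neq_zero)

lemma add_single_eq: "m + single i (1::nat) = single j 1 \<longleftrightarrow> m = 0 & i = j"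
proof
 assume a: "m + single i (1::nat) = single j 1"
 have "monom_degree (m + single i (1::nat)) = 1" unfolding a by simp
 then have "m = 0" using monom_degree_eq_0[of m] by simp
 then show "m = 0 & i = j" using a single_monom_eq[of i j] by simp
qed simp

text \<open>Compatibility with (A4) is the condition that \<open>y\<close> annihilates
  \<open>U0\<close>; compatibility with (A1) is the vanishing of \<open>y\<close> where the loop
  passes through an unbounded tope.\<close>

lemma kills_loop:
 assumes "al : B" "y : annihilator E U0" "!!i. i : E ==> flip al i : F - B ==> y i = 0"
 shows "kills (loop_fun al y)"
proof (rule killsI)
 have alF: "al : F" using assms(1) BF by blast
 fix w m v assume v: "v : set w" "v : F - B"
 show "loop_fun al y w m = 0" unfolding loop_fun_def
 proof (rule sum.neutral, rule ballI)
  fix i assume "i : E"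
  then show "(if w = [al, flip al i, al] & m = 0 | w = [al] & m = single i 1 then y i else 0) = 0"
   using v assms(1) assms(3)[of i] by auto
 qed
next
 fix q q' :: "('e => sign) list" and m :: "'e \<Rightarrow>\<^sub>0 nat" and al' be' ga de assume q: "q ~= []" "last q = al'"
  and d: "distinct [al', be', ga, de]"
 have "q @ x # be' # q' ~= [al, x', al]" "q @ x # be' # q' ~= [al]" for x x'
  using q d by (cases q; auto simp: append_eq_Cons_conv)+
 then show "loop_fun al y (q @ ga # be' # q') m = loop_fun al y (q @ de # be' # q') m"
  by (simp add: loop_fun_def)
next
 fix q q' :: "('e => sign) list" and m :: "'e \<Rightarrow>\<^sub>0 nat" and al' i assume q: "q ~= []" "last q = al'" "i : E" "al' : F"
 have 1: "q @ flip al' i # al' # q' = [al, flip al j, al] \<longleftrightarrow> q = [al] & al' = al & q' = [] & flip al' i = flip al j" for j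
  using q by (cases q) (auto simp: append_eq_Cons_conv)
 have 2: "q @ flip al' i # al' # q' ~= [al]" using q by (cases q) auto
 have 3: "m + single i 1 ~= 0"
  by (metis monom_degree_add monom_degree_simps add_is_0 one_neq_zero)
 have 4: "q @ q' = [al] \<longleftrightarrow> q = [al] & al' = al & q' = []" using q by (cases q) auto
 show "loop_fun al y (q @ flip al' i # al' # q') m = loop_fun al y (q @ q') (m + single i 1)"
  unfolding loop_fun_def
 proof (rule sum.cong[OF refl])
  fix j assume "j : E"
  show "(if q @ flip al' i # al' # q' = [al, flip al j, al] & m = 0 | q @ flip al' i # al' # q' = [al] & m = single j 1 then y j else 0) =
   (if q @ q' = [al, flip al j, al] & m + single i 1 = 0 | q @ q' = [al] & m + single i 1 = single j 1 then y j else 0)"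
   unfolding 1 4 add_single_eq using 2 3 flip_inj[OF q(4,3), of j] by (cases "al' = al") auto
 qed
next
 fix w :: "('e => sign) list" and m :: "'e \<Rightarrow>\<^sub>0 nat" and x :: "'e => 'k" assume x: "x : U0"
 have 3: "m + single i 1 ~= 0" for i
  by (metis monom_degree_add monom_degree_simps add_is_0 one_neq_zero)
 have lf: "loop_fun al y w (m + single i 1) = (if w = [al] & m = 0 then y i else 0)" if "i : E" for i
 proof -
  have "loop_fun al y w (m + single i 1) = (\<Sum>j\<in>E. if j = i then (if w = [al] & m = 0 then y i else 0) else 0)"
   unfolding loop_fun_def add_single_eq by (rule sum.cong) (use 3 in auto)
  then show ?thesis using finite_E that by simp
 qed
 have "(\<Sum>i\<in>E. x i * y i) = 0" using annihilator_sum[OF assms(2) x] by (simp add: mult.commute)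
 then have "(\<Sum>i\<in>E. x i * (if w = [al] & m = 0 then y i else 0)) = 0"
  by (cases "w = [al] & m = 0") auto
 moreover have "(\<Sum>i\<in>E. x i * loop_fun al y w (m + single i 1)) = (\<Sum>i\<in>E. x i * (if w = [al] & m = 0 then y i else 0))"
  by (intro sum.cong refl) (simp only: lf)
 ultimately show "(\<Sum>i\<in>E. x i * loop_fun al y w (m + single i 1)) = 0" by simp
qed

subsection \<open>Coordinates in degrees 0 and 1\<close>

abbreviation cl :: "(('e => sign) list \<Rightarrow>\<^sub>0 ('e, 'k) mpoly) => (('e => sign) list \<Rightarrow>\<^sub>0 ('e, 'k) mpoly) set" where
 "cl x \<equiv> I +>\<^bsub>Q\<^esub> x"

abbreviation "A \<equiv> prog_algebra P U"

lemma cl_eq_iff: "x : carrier Q ==> y : carrier Q ==> cl x = cl y \<longleftrightarrow> x - y : I"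
 by (rule QA.quot_eq_iff[OF ideal_I])

lemma A_simps:
 "x : carrier Q ==> y : carrier Q ==> cl x \<oplus>\<^bsub>A\<^esub> cl y = cl (x + y)"
 "x : carrier Q ==> y : carrier Q ==> cl x \<otimes>\<^bsub>A\<^esub> cl y = cl (qmul x y)"
 "x : carrier Q ==> c \<odot>\<^bsub>A\<^esub> cl x = cl (qscale c x)"
 "\<zero>\<^bsub>A\<^esub> = cl 0" "\<one>\<^bsub>A\<^esub> = cl \<one>\<^bsub>Q\<^esub>"
 unfolding A_eq by (simp_all add: QA.quot_simps[where I = I] ideal_I QA_simps)

lemma A_carrier: "carrier A = cl ` carrier Q"
 unfolding A_eq by (rule QA.quot_carrier)

lemma A_hcomp: "hcomp A n = cl ` hcomp Q n"
 unfolding A_eq by (rule QA.quot_hcomp)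

sublocale A: kalg A
 unfolding A_eq by (rule QA.quot_kalg[OF ideal_I])

text \<open>A functional on classes through an arbitrary representative; \<open>kills f\<close>
  makes the choice immaterial.\<close>

definition lamA :: "(('e => sign) list => ('e \<Rightarrow>\<^sub>0 nat) => 'k) => (('e => sign) list \<Rightarrow>\<^sub>0 ('e, 'k) mpoly) set => 'k" where
 "lamA f X = lam f (SOME x. x : carrier Q & X = cl x)"

lemma lamA_cl:
 assumes "kills f" "x : carrier Q"
 shows "lamA f (cl x) = lam f x"
proof -
 have "\<exists>y. y : carrier Q & cl x = cl y" using assms(2) by blast
 then have y: "(SOME y. y : carrier Q & cl x = cl y) : carrier Q & cl x = cl (SOME y. y : carrier Q & cl x = cl y)"
  by (rule someI_ex)
 then have "x - (SOME y. y : carrier Q & cl x = cl y) : I" using cl_eq_iff assms(2) by blast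
 then have "lam f (x - (SOME y. y : carrier Q & cl x = cl y)) = 0" using assms(1) by (simp add: kills_def)
 then show ?thesis by (simp add: lamA_def lam_diff)
qed

definition co :: "('e => sign) list => (('e => sign) list \<Rightarrow>\<^sub>0 ('e, 'k) mpoly) set => 'k" where
 "co p = lamA (%w m. if w = p & m = 0 then 1 else 0)"

lemma co_cl: "set p \<subseteq> B ==> length p \<le> 2 ==> x : carrier Q ==> co p (cl x) = cf x p 0"
 unfolding co_def by (simp add: lamA_cl[OF kills_delta] lam_delta)

definition arrows :: "(('e => sign) \<times> ('e => sign)) set" where
 "arrows = {(al, be). al : B & be : B & adjacent al be}"

lemma finite_B: "finite B"
 by (rule finite_subset[OF BF finite_F])

lemma finite_arrows: "finite arrows"
 by (rule finite_subset[of _ "B \<times> B"]) (auto simp: arrows_def finite_B)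

text \<open>The path factors through the idempotent at \<open>v\<close>, which is a relation
  (A1).\<close>

lemma bad_path_I:
 assumes "quiver_path F adjacent p" "keys m \<subseteq> E" "v : set p" "v : F - B"
 shows "qterm p m c : I"
proof -
 obtain p1 p2 where p: "p = p1 @ v # p2" using assms(3) split_list by metis
 have q1: "quiver_path F adjacent (p1 @ [v])" "quiver_path F adjacent (v # p2)"
  using assms(1) unfolding p quiver_path_def by (auto simp: successively_append_iff)
 have "qterm [v] 0 1 : I" using rels_A1[OF assms(4)] rels_I by blast
 then have "qmul (qmul (qterm (p1 @ [v]) m c) (qterm [v] 0 1)) (qterm (v # p2) 0 1) : I"
  using q1 assms(2) by (intro I_facts(5,6)) (auto intro!: QA_qterm)
 then show ?thesis by (simp add: qmul_qterm p)
qed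

lemma hcomp0_expand:
 assumes "x : hcomp Q 0"
 shows "x = (\<Sum>v\<in>F. qterm [v] 0 (cf x [v] 0))"
proof -
 have x: "x : carrier Q" "qpart 0 x = x" using assms by (auto simp: QA_hcomp)
 have nz: "\<exists>v \<in> F. p = [v] & m = 0" if "cf x p m ~= 0" for p m
 proof -
  have "quiver_path F adjacent p" using x(1) that by (simp add: QA_carrier)
  moreover have "qdeg p m = 0" by (rule qpart_degree[OF x(2) that])
  ultimately show ?thesis
   by (cases p) (auto simp: qdeg_def monom_degree_eq_0 quiver_path_def)
 qed
 show ?thesis
 proof (rule cf_eqI)
  fix p and m :: "'e \<Rightarrow>\<^sub>0 nat"
  have "cf (\<Sum>v\<in>F. qterm [v] 0 (cf x [v] 0)) p m = (\<Sum>v\<in>F. if p = [v] & m = 0 then cf x [v] 0 else 0)"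
   unfolding cf_sum by (rule sum.cong) (auto simp: cf_qterm)
  also have "... = cf x p m"
  proof (cases "\<exists>v \<in> F. p = [v] & m = 0")
   case True
   then obtain v where "v : F" "p = [v]" "m = 0" by blast
   then show ?thesis using finite_F by simp
  next
   case False
   then have "cf x p m = 0" using nz by blast
   then show ?thesis using False by (auto intro!: sum.neutral)
  qed
  finally show "cf x p m = cf (\<Sum>v\<in>F. qterm [v] 0 (cf x [v] 0)) p m" ..
 qed
qed

lemma hcomp1_expand:
 assumes "x : hcomp Q 1"
 shows "x = (\<Sum>(v, w)\<in>{(v, w). v : F & w : F & adjacent v w}. qterm [v, w] 0 (cf x [v, w] 0))" (is "_ = sum ?f ?S")
proof -
 have x: "x : carrier Q" "qpart 1 x = x" using assms by (auto simp: QA_hcomp)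
 have finS: "finite ?S" by (rule finite_subset[of _ "F \<times> F"]) (auto simp: finite_F)
 have nz: "\<exists>(v, w) \<in> ?S. p = [v, w] & m = 0" if "cf x p m ~= 0" for p m
 proof -
  have p: "quiver_path F adjacent p" using x(1) that by (simp add: QA_carrier)
  have d: "qdeg p m = 1" by (rule qpart_degree[OF x(2) that])
  then have "monom_degree m = 0" "length p = 2" by (auto simp: qdeg_def) presburger+
  then obtain v w where "p = [v, w]" "m = 0" by (auto simp: monom_degree_eq_0 length_Suc_conv numeral_2_eq_2)
  then show ?thesis using p by (auto simp: quiver_path_simps)
 qed
 show ?thesis
 proof (rule cf_eqI)
  fix p and m :: "'e \<Rightarrow>\<^sub>0 nat"
  have "cf (sum ?f ?S) p m = (\<Sum>(v, w)\<in>?S. if p = [v, w] & m = 0 then cf x [v, w] 0 else 0)"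
   unfolding cf_sum by (rule sum.cong) (auto simp: cf_qterm)
  also have "... = cf x p m"
  proof (cases "\<exists>(v, w) \<in> ?S. p = [v, w] & m = 0")
   case True
   then obtain v w where vw: "(v, w) : ?S" "p = [v, w]" "m = 0" by blast
   have "(\<Sum>(v', w')\<in>?S. if p = [v', w'] & m = 0 then cf x [v', w'] 0 else 0) =
    (\<Sum>s\<in>?S. if s = (v, w) then cf x [v, w] 0 else 0)"
    by (rule sum.cong) (use vw in \<open>auto split: if_splits\<close>)
   then show ?thesis using finS vw by simp
  next
   case False
   then have "cf x p m = 0" using nz by blast
   then show ?thesis using False by (auto intro!: sum.neutral)
  qed
  finally show "cf x p m = cf (sum ?f ?S) p m" ..
 qed
qed

lemma A0_expand:
 assumes "a : hcomp A 0"
 shows "a = cl (\<Sum>v\<in>B. qterm [v] 0 (co [v] a))"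
proof -
 obtain x where x: "x : hcomp Q 0" "a = cl x" using assms by (auto simp: A_hcomp)
 have xQ: "x : carrier Q" using x by (simp add: QA_hcomp)
 have sQ: "(\<Sum>v\<in>B. qterm [v] 0 (cf x [v] 0)) : carrier Q"
  using BF by (auto intro!: QA_sum QA_qterm simp: quiver_path_simps)
 have c: "co [v] a = cf x [v] 0" if "v : B" for v using that xQ x(2) by (simp add: co_cl)
 have "x = (\<Sum>v\<in>F - B. qterm [v] 0 (cf x [v] 0)) + (\<Sum>v\<in>B. qterm [v] 0 (cf x [v] 0))"
  by (rule trans[OF hcomp0_expand[OF x(1)] sum.subset_diff[OF BF finite_F]])
 then have "x - (\<Sum>v\<in>B. qterm [v] 0 (cf x [v] 0)) = (\<Sum>v\<in>F - B. qterm [v] 0 (cf x [v] 0))"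
  unfolding diff_eq_eq .
 also have "... : I" by (intro I_facts(7) bad_path_I[of "[_]"]) (auto simp: quiver_path_simps)
 finally have "cl x = cl (\<Sum>v\<in>B. qterm [v] 0 (cf x [v] 0))"
  using cl_eq_iff[OF xQ sQ] by blast
 then show ?thesis using x(2) c by simp
qed

lemma A1_expand:
 assumes "a : hcomp A 1"
 shows "a = cl (\<Sum>(v, w)\<in>arrows. qterm [v, w] 0 (co [v, w] a))"
proof -
 let ?S = "{(v, w). v : F & w : F & adjacent v w}"
 obtain x where x: "x : hcomp Q 1" "a = cl x" using assms by (auto simp: A_hcomp)
 let ?f = "%(v, w). qterm [v, w] 0 (cf x [v, w] 0)"
 have xQ: "x : carrier Q" using x by (simp add: QA_hcomp)
 have finS: "finite ?S" by (rule finite_subset[of _ "F \<times> F"]) (auto simp: finite_F)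
 have sub: "arrows \<subseteq> ?S" using BF by (auto simp: arrows_def)
 have sQ: "sum ?f arrows : carrier Q"
  using sub by (auto intro!: QA_sum QA_qterm simp: quiver_path_simps)
 have "x = sum ?f (?S - arrows) + sum ?f arrows"
  by (rule trans[OF hcomp1_expand[OF x(1)] sum.subset_diff[OF sub finS]])
 then have "x - sum ?f arrows = sum ?f (?S - arrows)" unfolding diff_eq_eq .
 also have "... : I"
 proof (rule I_facts(7))
  fix s assume s: "s : ?S - arrows"
  then obtain v w where vw: "s = (v, w)" "v : F" "w : F" "adjacent v w" "v ~: B | w ~: B" by (auto simp: arrows_def)
  then obtain u where "u : set [v, w]" "u : F - B" by auto
  then show "?f s : I" using vw by (simp add: bad_path_I[of "[v, w]" 0 u] quiver_path_simps)
 qed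
 finally have "cl x = cl (sum ?f arrows)"
  using cl_eq_iff[OF xQ sQ] by blast
 also have "sum ?f arrows = (\<Sum>(v, w)\<in>arrows. qterm [v, w] 0 (co [v, w] a))"
 proof (rule sum.cong[OF refl])
  fix s assume "s : arrows"
  then obtain v w where s: "s = (v, w)" "v : B" "w : B" by (auto simp: arrows_def)
  have "co [v, w] (cl x) = cf x [v, w] 0" by (rule co_cl) (use s xQ in auto)
  then show "?f s = (case s of (v, w) => qterm [v, w] 0 (co [v, w] a))" using s(1) x(2) by simp
 qed
 finally show ?thesis by (rule trans[OF x(2)])
qed

lemma cf_mult_0:
 assumes "x : hcomp Q 0" "y : carrier Q" "v : F"
 shows "cf (qmul x y) (v # p) 0 = cf x [v] 0 * cf y (v # p) 0"
proof -
 have y: "\<forall>p m. cf y p m ~= 0 --> p ~= []" using assms(2) quiver_path_nonempty by (auto simp: QA_carrier)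
 have one: "cf (qmul (qterm [u] 0 c) y) (v # p) 0 = (if u = v then c * cf y (v # p) 0 else 0)" for u c
  using y
 proof (induction y rule: qterm_induct)
  case (single q m d)
  then obtain w q' where "q = w # q'" by (cases q) auto
  then show ?case by (auto simp: qmul_qterm cf_qterm)
 qed (auto simp: qmul_add_r distrib_left)
 have "qmul x y = (\<Sum>u\<in>F. qmul (qterm [u] 0 (cf x [u] 0)) y)"
  by (subst hcomp0_expand[OF assms(1)]) (simp add: qmul_sum_l)
 then have "cf (qmul x y) (v # p) 0 = (\<Sum>u\<in>F. if u = v then cf x [u] 0 * cf y (v # p) 0 else 0)"
  by (simp add: cf_sum one)
 then show ?thesis using finite_F assms(3) by simp
qed

lemma cf_mult_0r:
 assumes "x : hcomp Q 0" "y : carrier Q" "v : F"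
 shows "cf (qmul y x) (p @ [v]) 0 = cf y (p @ [v]) 0 * cf x [v] 0"
proof -
 have y: "\<forall>p m. cf y p m ~= 0 --> p ~= []" using assms(2) quiver_path_nonempty by (auto simp: QA_carrier)
 have one: "cf (qmul y (qterm [u] 0 c)) (p @ [v]) 0 = (if u = v then cf y (p @ [v]) 0 * c else 0)" for u c
  using y
 proof (induction y rule: qterm_induct)
  case (single q m d)
  then show ?case by (auto simp: qmul_qterm cf_qterm)
 qed (auto simp: qmul_add_l distrib_right)
 have "qmul y x = (\<Sum>u\<in>F. qmul y (qterm [u] 0 (cf x [u] 0)))"
  by (subst hcomp0_expand[OF assms(1)]) (simp add: qmul_sum_r)
 then have "cf (qmul y x) (p @ [v]) 0 = (\<Sum>u\<in>F. if u = v then cf y (p @ [v]) 0 * cf x [u] 0 else 0)"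
  by (simp add: cf_sum one)
 then show ?thesis using finite_F assms(3) by simp
qed

lemma co_mult:
 assumes "a : hcomp A 0" "b : carrier A"
 shows "set (v # p) \<subseteq> B ==> length (v # p) \<le> 2 ==> co (v # p) (a \<otimes>\<^bsub>A\<^esub> b) = co [v] a * co (v # p) b"
  and "set (p @ [v]) \<subseteq> B ==> length (p @ [v]) \<le> 2 ==> co (p @ [v]) (b \<otimes>\<^bsub>A\<^esub> a) = co (p @ [v]) b * co [v] a"
proof -
 obtain x where x: "x : hcomp Q 0" "a = cl x" using assms by (auto simp: A_hcomp)
 obtain y where y: "y : carrier Q" "b = cl y" using assms by (auto simp: A_carrier)
 have xQ: "x : carrier Q" using x by (simp add: QA_hcomp)
 show "co (v # p) (a \<otimes>\<^bsub>A\<^esub> b) = co [v] a * co (v # p) b" if "set (v # p) \<subseteq> B" "length (v # p) \<le> 2"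
  using that x y xQ BF by (auto simp: A_simps co_cl QA_mult cf_mult_0)
 show "co (p @ [v]) (b \<otimes>\<^bsub>A\<^esub> a) = co (p @ [v]) b * co [v] a" if "set (p @ [v]) \<subseteq> B" "length (p @ [v]) \<le> 2"
  using that x y xQ BF by (auto simp: A_simps co_cl QA_mult cf_mult_0r)
qed

lemma co_linear:
 assumes "a : carrier A" "b : carrier A" "set p \<subseteq> B" "length p \<le> 2"
 shows "co p (a \<oplus>\<^bsub>A\<^esub> b) = co p a + co p b" "co p (c \<odot>\<^bsub>A\<^esub> a) = c * co p a"
proof -
 obtain x where x: "x : carrier Q" "a = cl x" using assms by (auto simp: A_carrier)
 obtain y where y: "y : carrier Q" "b = cl y" using assms by (auto simp: A_carrier)
 show "co p (a \<oplus>\<^bsub>A\<^esub> b) = co p a + co p b" "co p (c \<odot>\<^bsub>A\<^esub> a) = c * co p a"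
  using x y assms by (simp_all add: A_simps co_cl QA_plus qscale_closed)
qed

lemma co_one: "v : B ==> co [v] \<one>\<^bsub>A\<^esub> = 1"
 using BF finite_F by (subst A_simps(5), subst co_cl) (auto simp: QA_simps QA_one cf_sum cf_qterm)

end

subsection \<open>Tensor algebras\<close>

text \<open>Closure of the operations places the defining relations in the free algebra on
  \<open>S\<close>, where each of them is homogeneous of degree 0 or 1.\<close>

locale tensor_data =
 fixes R :: "('k::field, 'r, 'z) module_scheme" and V :: "('k, 'r, 'v) bimodule"
 assumes R_closed: "r : carrier R ==> s : carrier R ==> r \<oplus>\<^bsub>R\<^esub> s : carrier R"
   "r : carrier R ==> c \<odot>\<^bsub>R\<^esub> r : carrier R"
   "r : carrier R ==> s : carrier R ==> r \<otimes>\<^bsub>R\<^esub> s : carrier R" "\<one>\<^bsub>R\<^esub> : carrier R"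
  and V_closed: "v : carrier V ==> w : carrier V ==> badd V v w : carrier V"
   "v : carrier V ==> bscale V c v : carrier V"
   "r : carrier R ==> v : carrier V ==> lact V r v : carrier V"
   "r : carrier R ==> v : carrier V ==> ract V v r : carrier V"
begin

definition S :: "('r + 'v) set" where
 "S = Inl ` carrier R \<union> Inr ` carrier V"

definition dg :: "'r + 'v => nat" where
 "dg = case_sum (%_. 0) (%_. 1)"

abbreviation Fr :: "('k, ('r + 'v) list \<Rightarrow>\<^sub>0 'k) galg" where
 "Fr \<equiv> tensor_free R V"

abbreviation T :: "('k, (('r + 'v) list \<Rightarrow>\<^sub>0 'k) set) galg" where
 "T \<equiv> tensor_algebra R V"

abbreviation J :: "(('r + 'v) list \<Rightarrow>\<^sub>0 'k) set" where
 "J \<equiv> tensor_ideal R V"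

abbreviation rels :: "(('r + 'v) list \<Rightarrow>\<^sub>0 'k) set" where
 "rels \<equiv> tensor_relations R V"

lemma Fr_eq: "Fr = free_algebra S dg"
 by (simp add: tensor_free_def S_def dg_def)

sublocale FA: graded_kalg Fr "free_part dg"
 unfolding Fr_eq by (rule graded_kalg_free)

lemma Fr_simps: "x \<otimes>\<^bsub>Fr\<^esub> y = x * y" "x \<oplus>\<^bsub>Fr\<^esub> y = x + y" "\<zero>\<^bsub>Fr\<^esub> = 0" "\<one>\<^bsub>Fr\<^esub> = 1" "c \<odot>\<^bsub>Fr\<^esub> x = fconst c * x"
 unfolding Fr_eq by (simp_all add: free_simps free_mult)

lemma Fr_carrier: "x : carrier Fr \<longleftrightarrow> (\<forall>w. lookup x w ~= 0 --> set w \<subseteq> S)"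
 unfolding Fr_eq by (rule free_carrier)

lemma single_hcomp: "set w \<subseteq> S ==> word_degree dg w = n ==> single w c : hcomp Fr n"
 by (auto simp: FA.hcomp_eq Fr_carrier lookup_single when_def free_part_def pm_restrict_single)

lemma hcomp_plus: "x : hcomp Fr n ==> y : hcomp Fr n ==> x + y : hcomp Fr n"
 by (auto simp: FA.hcomp_eq FA.hp_add FA.plus_closed)

lemma hcomp_diff: "x : hcomp Fr n ==> y : hcomp Fr n ==> x - y : hcomp Fr n"
 by (auto simp: FA.hcomp_eq FA.hp_diff FA.diff_closed)

lemma rels_homogeneous_T: "x : rels ==> \<exists>n. x : hcomp Fr n"
proof -
 assume x: "x : rels"
 have 0: "single [Inl r] c : hcomp Fr 0" if "r : carrier R" for r c
  using that by (intro single_hcomp) (auto simp: S_def dg_def word_degree_def)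
 have 00: "single [Inl r, Inl s] c : hcomp Fr 0" if "r : carrier R" "s : carrier R" for r s c
  using that by (intro single_hcomp) (auto simp: S_def dg_def word_degree_def)
 have n: "single [] c : hcomp Fr 0" for c
  by (intro single_hcomp) (auto simp: word_degree_def)
 have 1: "single [Inr v] c : hcomp Fr (Suc 0)" if "v : carrier V" for v c
  using that by (intro single_hcomp) (auto simp: S_def dg_def word_degree_def)
 have 01: "single [Inl r, Inr v] c : hcomp Fr (Suc 0)" "single [Inr v, Inl r] c : hcomp Fr (Suc 0)"
  if "r : carrier R" "v : carrier V" for r v c
  using that by (intro single_hcomp; auto simp: S_def dg_def word_degree_def)+
 have "x : hcomp Fr 0 | x : hcomp Fr (Suc 0)"
  using x unfolding tensor_relations_def
  by (elim UnE CollectE exE conjE) (simp_all add: hcomp_diff hcomp_plus 0 00 n 1 01 R_closed V_closed)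
 then show ?thesis by blast
qed

lemma rels_carrier_T: "rels \<subseteq> carrier Fr"
 using rels_homogeneous_T by (auto simp: FA.hcomp_eq)

lemma graded_J: "FA.graded_ideal J"
 unfolding tensor_ideal_def by (rule FA.graded_Idl[OF rels_homogeneous_T])

lemma ideal_J: "ideal J Fr"
 using graded_J by (simp add: FA.graded_ideal_def)

lemma J_part: "x : J ==> free_part dg n x : J"
 using graded_J by (simp add: FA.graded_ideal_def)

lemma rels_J: "rels \<subseteq> J"
 unfolding tensor_ideal_def by (rule FA.genideal_self[OF rels_carrier_T])

lemmas J_facts = FA.ideal_facts[OF ideal_J, unfolded Fr_simps]

abbreviation tc :: "(('r + 'v) list \<Rightarrow>\<^sub>0 'k) => (('r + 'v) list \<Rightarrow>\<^sub>0 'k) set" where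
 "tc x \<equiv> J +>\<^bsub>Fr\<^esub> x"

lemma T_eq: "T = galg_quot Fr J"
 by (simp add: tensor_algebra_def)

lemma T_simps:
 "x : carrier Fr ==> y : carrier Fr ==> tc x \<oplus>\<^bsub>T\<^esub> tc y = tc (x + y)"
 "x : carrier Fr ==> y : carrier Fr ==> tc x \<otimes>\<^bsub>T\<^esub> tc y = tc (x * y)"
 "x : carrier Fr ==> c \<odot>\<^bsub>T\<^esub> tc x = tc (fconst c * x)"
 "\<zero>\<^bsub>T\<^esub> = tc 0" "\<one>\<^bsub>T\<^esub> = tc 1"
 unfolding T_eq by (simp_all add: FA.quot_simps[where I = J] ideal_J Fr_simps)

lemma T_carrier: "carrier T = tc ` carrier Fr"
 unfolding T_eq by (rule FA.quot_carrier)

lemma T_hcomp: "hcomp T n = tc ` hcomp Fr n"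
 unfolding T_eq by (rule FA.quot_hcomp)

lemma tc_eq_iff: "x : carrier Fr ==> y : carrier Fr ==> tc x = tc y \<longleftrightarrow> x - y : J"
 by (rule FA.quot_eq_iff[OF ideal_J])

sublocale T: kalg T
 unfolding T_eq by (rule FA.quot_kalg[OF ideal_J])

lemma Fr_mult: "x : carrier Fr ==> y : carrier Fr ==> x * y : carrier Fr"
 using FA.m_closed[of x y] by (simp add: Fr_simps)

text \<open>A generating space of degree 2 that is already a bimodule over degree 0 acquires nothing
  new in degree 2. Consequently the relation space of a quadratic algebra is determined by the
  algebra.\<close>

lemma Idl_deg2:
 assumes W: "sub_bimodule_deg2 T W" and X: "X : genideal T W" "X : hcomp T 2"
 shows "X : W"
proof -
 have W2: "W \<subseteq> hcomp T 2" and Ws: "subgroup W (add_monoid T)"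
  and Wm: "!!a x. a : hcomp T 0 ==> x : W ==> a \<otimes>\<^bsub>T\<^esub> x : W & x \<otimes>\<^bsub>T\<^esub> a : W"
  using W by (auto simp: sub_bimodule_deg2_def)
 have W0: "tc 0 : W" using subgroup.one_closed[OF Ws] by (simp add: T_simps)
 have Wadd: "x \<oplus>\<^bsub>T\<^esub> y : W" if "x : W" "y : W" for x y using subgroup.m_closed[OF Ws that] by simp
 let ?p = "free_part dg"
 \<comment> \<open>An ideal that contains \<open>W\<close> and is transparent in degree 2: products
   with arbitrary elements raise the degree or multiply by degree 0, and \<open>W\<close> is stable
   under the latter.\<close>
 let ?L = "{x \<in> carrier Fr. ?p 0 x : J & ?p 1 x : J & tc (?p 2 x) : W}"
 have JW: "tc x : W" if "x : J" for x
  using that tc_eq_iff[of x 0] J_facts(4) FA.zero_in W0 by simp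
 have pc: "?p n x : carrier Fr" if "x : carrier Fr" for n x using FA.hp_closed that .
 have tplus: "tc (x + y) : W" if "x : carrier Fr" "y : carrier Fr" "tc x : W" "tc y : W" for x y
  using Wadd[OF that(3,4)] that(1,2) by (simp add: T_simps)
 have p0: "tc (?p 0 x) : hcomp T 0" if "x : carrier Fr" for x
  using that by (auto simp: T_hcomp FA.hcomp_eq pc FA.hp_hp)
 have L_add: "x + y : ?L" if "x : ?L" "y : ?L" for x y
  using that by (auto simp: FA.hp_add FA.plus_closed intro!: J_facts(2) tplus pc)
 have pm: "?p 0 (x * y) = ?p 0 x * ?p 0 y" "?p 1 (x * y) = ?p 0 x * ?p 1 y + ?p 1 x * ?p 0 y"
  "?p 2 (x * y) = ?p 0 x * ?p 2 y + ?p 1 x * ?p 1 y + ?p 2 x * ?p 0 y"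
  if "x : carrier Fr" "y : carrier Fr" for x y
  using FA.hp_mult_sum[OF that, of 0] FA.hp_mult_sum[OF that, of 1] FA.hp_mult_sum[OF that, of 2]
  by (simp_all add: Fr_simps numeral_2_eq_2)
 have L_mult: "x * y : ?L & y * x : ?L" if x: "x : ?L" and y: "y : carrier Fr" for x y
 proof -
  have xF: "x : carrier Fr" using x by simp
  have J: "?p 0 x : J" "?p 1 x : J" and X2: "tc (?p 2 x) : W" using x by auto
  have Jm: "?p n x * ?p m y : J & ?p m y * ?p n x : J" if "n = 0 | n = 1" for n m
   using that J pc[OF y] J_facts(5,6) by auto
  have "tc (?p 2 x * ?p 0 y) : W" "tc (?p 0 y * ?p 2 x) : W"
   using Wm[OF p0[OF y] X2] by (simp_all add: T_simps pc xF y)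
  note W2 = this
  have 0: "?p 0 (x * y) : J" "?p 0 (y * x) : J" using pm(1)[OF xF y] pm(1)[OF y xF] Jm[of 0 0] by simp_all
  have 1: "?p 1 (x * y) : J"
   unfolding pm(2)[OF xF y] by (intro J_facts(2)) (use Jm[of 0 1] Jm[of 1 0] in simp_all)
  have m1: "?p 1 (y * x) : J"
   unfolding pm(2)[OF y xF] by (intro J_facts(2)) (use Jm[of 0 1] Jm[of 1 0] in simp_all)
  have 2: "tc (?p 2 (x * y)) : W"
   unfolding pm(3)[OF xF y]
   by (intro tplus FA.plus_closed Fr_mult pc xF y JW W2(1)) (use Jm[of 0 2] Jm[of 1 1] in simp_all)
  have m2: "tc (?p 2 (y * x)) : W"
   unfolding pm(3)[OF y xF] 
   by (intro tplus FA.plus_closed Fr_mult pc xF y JW W2(2)) (use Jm[of 0 2] Jm[of 1 1] in simp_all)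
  show ?thesis using 0 1 m1 2 m2 Fr_mult[OF xF y] Fr_mult[OF y xF] by simp
 qed
 have idL: "ideal (tc ` ?L) T"
 proof (rule idealI)
  show "Ring.ring T" by (rule T.ring_axioms)
  show "subgroup (tc ` ?L) (add_monoid T)"
  proof
   show "tc ` ?L \<subseteq> carrier (add_monoid T)" by (auto simp: T_carrier)
   show "\<one>\<^bsub>add_monoid T\<^esub> : tc ` ?L"
    using W0 by (auto simp: T_simps FA.zero_in FA.hp_zero J_facts(1) intro!: imageI)
   show "x \<otimes>\<^bsub>add_monoid T\<^esub> y : tc ` ?L" if xyL: "x : tc ` ?L" "y : tc ` ?L" for x y
   proof -
    obtain x' where x: "x = tc x'" "x' : ?L" using xyL(1) by (elim imageE)
    obtain y' where y: "y = tc y'" "y' : ?L" using xyL(2) by (elim imageE)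
    note xy = x y
    then have "x \<otimes>\<^bsub>add_monoid T\<^esub> y = tc (x' + y')" by (simp add: T_simps)
    then show ?thesis using L_add[OF xy(2,4)] by blast
   qed
   show "inv\<^bsub>add_monoid T\<^esub> x : tc ` ?L" if xL: "x : tc ` ?L" for x
   proof -
    obtain x' where x: "x = tc x'" "x' : ?L" using xL by (elim imageE)
    have m1: "- 1 : carrier Fr" using FA.a_inv_closed[OF FA.one_closed] FA.uminus_eq[OF FA.one_closed] by (simp add: Fr_simps)
    then have L: "- x' : ?L" using L_mult[OF x(2) m1] by simp
    have "tc (- x') \<oplus>\<^bsub>T\<^esub> x = \<zero>\<^bsub>T\<^esub>" using x L by (simp add: T_simps)
    moreover have "tc (- x') : carrier T" "x : carrier T" using L x by (auto simp: T_carrier)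
    ultimately have "\<ominus>\<^bsub>T\<^esub> x = tc (- x')" by (metis T.minus_equality)
    then show ?thesis using L by (auto simp: a_inv_def)
   qed
  qed
  fix a x assume a: "a : tc ` ?L" and x: "x : carrier T"
  obtain a' x' where ax: "a = tc a'" "a' : ?L" "x = tc x'" "x' : carrier Fr" using a x by (auto simp: T_carrier)
  show "x \<otimes>\<^bsub>T\<^esub> a : tc ` ?L" using L_mult[OF ax(2,4)] ax by (auto simp: T_simps intro!: imageI)
  show "a \<otimes>\<^bsub>T\<^esub> x : tc ` ?L" using L_mult[OF ax(2,4)] ax by (auto simp: T_simps intro!: imageI)
 qed
 have "W \<subseteq> tc ` ?L"
 proof
  fix w assume w: "w : W"
  then obtain x where x: "w = tc x" "x : hcomp Fr 2" using W2 by (auto simp: T_hcomp)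
  then have xF: "x : carrier Fr" "?p 2 x = x" by (auto simp: FA.hcomp_eq)
  have "?p 0 x = 0" "?p 1 x = 0" using FA.hp_other[OF xF(2)] by auto
  then have "x : ?L" using xF w x(1) J_facts(1) by simp
  then show "w : tc ` ?L" using x(1) by blast
 qed
 then have "genideal T W \<subseteq> tc ` ?L" by (rule T.genideal_minimal[OF idL])
 then obtain x where x: "X = tc x" "x : ?L" using X(1) by blast
 obtain y where y: "X = tc y" "y : hcomp Fr 2" using X(2) by (auto simp: T_hcomp)
 have yF: "y : carrier Fr" "?p 2 y = y" using y by (auto simp: FA.hcomp_eq)
 have xF: "x : carrier Fr" using x(2) by simp
 have "x - y : J" using tc_eq_iff[OF xF yF(1)] x(1) y(1) by blast
 then have "?p 2 x - y : J" using J_part[of "x - y" 2] yF by (simp add: FA.hp_diff)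
 then have "tc (?p 2 x) = tc y" using tc_eq_iff x yF pc by simp
 then show ?thesis using x y by simp
qed

text \<open>Ideals of the tensor algebra as ideals of the free algebra on all letters; letters outside
 \<open>S\<close> are sent to 0.\<close>

definition rho :: "(('r + 'v) list \<Rightarrow>\<^sub>0 'k) => (('r + 'v) list \<Rightarrow>\<^sub>0 'k)" where
 "rho = pm_restrict (%w. set w \<subseteq> S)"

lemma rho_add: "rho (x + y) = rho x + rho y"
 by (simp add: rho_def pm_restrict_add)

lemma rho_zero: "rho 0 = 0"
 by (simp add: rho_def)

lemma rho_closed: "rho x : carrier Fr"
 by (auto simp: rho_def Fr_carrier lookup_pm_restrict split: if_splits)

lemma rho_id: "x : carrier Fr ==> rho x = x"
 by (intro poly_mapping_eqI) (auto simp: rho_def Fr_carrier lookup_pm_restrict)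

lemma rho_mult: "rho (x * y) = rho x * rho y"
proof (induction x rule: pm_induct_all)
 case (single v a)
 show ?case
  by (induction y rule: pm_induct_all)
   (auto simp: rho_def single_word_mult pm_restrict_single pm_restrict_add distrib_left)
qed (auto simp: rho_add rho_zero distrib_right)

definition Kt :: "(('r + 'v) list \<Rightarrow>\<^sub>0 'k) set set => (('r + 'v) list \<Rightarrow>\<^sub>0 'k) set" where
 "Kt L = {x. tc (rho x) : L}"

lemma Kt_cong:
 assumes "ideal L T" shows "ring_cong (Kt L)"
proof -
 interpret L: ideal L T by fact
 have c: "tc (rho x) : carrier T" for x using rho_closed by (auto simp: T_carrier)
 show ?thesis
 proof
  show "0 : Kt L" using L.zero_closed by (simp add: Kt_def rho_zero T_simps)
  fix x y r
  show "x : Kt L ==> y : Kt L ==> x + y : Kt L"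
   using L.a_closed[of "tc (rho x)" "tc (rho y)"] by (simp add: Kt_def rho_add T_simps rho_closed)
  show "x : Kt L ==> r * x : Kt L"
   using L.I_l_closed[OF _ c, of "tc (rho x)" r] by (simp add: Kt_def rho_mult T_simps rho_closed)
  show "x : Kt L ==> x * r : Kt L"
   using L.I_r_closed[OF _ c, of "tc (rho x)" r] by (simp add: Kt_def rho_mult T_simps rho_closed)
 qed
qed

lemma J_Kt:
 assumes "ideal L T" "x : J" shows "x : Kt L"
proof -
 interpret L: ideal L T by fact
 have "tc x = tc 0" using tc_eq_iff[of x 0] J_facts(4)[OF assms(2)] FA.zero_in assms(2) by simp
 then show ?thesis using L.zero_closed rho_id[OF J_facts(4)[OF assms(2)]] by (simp add: Kt_def T_simps)
qed

lemma rels_mem: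
 "r : carrier R ==> s : carrier R ==> letter (Inl (r \<oplus>\<^bsub>R\<^esub> s)) - (letter (Inl r) + letter (Inl s)) : rels"
 "r : carrier R ==> letter (Inl (c \<odot>\<^bsub>R\<^esub> r)) - fconst c * letter (Inl r) : rels"
 "r : carrier R ==> s : carrier R ==> letter (Inl (r \<otimes>\<^bsub>R\<^esub> s)) - letter (Inl r) * letter (Inl s) : rels"
 "letter (Inl \<one>\<^bsub>R\<^esub>) - 1 : rels"
 "v : carrier V ==> w : carrier V ==> letter (Inr (badd V v w)) - (letter (Inr v) + letter (Inr w)) : rels"
 "v : carrier V ==> letter (Inr (bscale V c v)) - fconst c * letter (Inr v) : rels"
 "r : carrier R ==> v : carrier V ==> letter (Inr (lact V r v)) - letter (Inl r) * letter (Inr v) : rels"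
 "r : carrier R ==> v : carrier V ==> letter (Inr (ract V v r)) - letter (Inr v) * letter (Inl r) : rels"
 unfolding tensor_relations_def letter_def fconst_def single_word_mult one_freealg mult_1 mult_1_right append.simps
 by blast+

lemma rels_cases_T:
 assumes "x : rels"
 obtains r s where "r : carrier R" "s : carrier R" "x = letter (Inl (r \<oplus>\<^bsub>R\<^esub> s)) - (letter (Inl r) + letter (Inl s))"
 | r c where "r : carrier R" "x = letter (Inl (c \<odot>\<^bsub>R\<^esub> r)) - fconst c * letter (Inl r)"
 | r s where "r : carrier R" "s : carrier R" "x = letter (Inl (r \<otimes>\<^bsub>R\<^esub> s)) - letter (Inl r) * letter (Inl s)"
 | "x = letter (Inl \<one>\<^bsub>R\<^esub>) - 1"
 | v w where "v : carrier V" "w : carrier V" "x = letter (Inr (badd V v w)) - (letter (Inr v) + letter (Inr w))"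
 | v c where "v : carrier V" "x = letter (Inr (bscale V c v)) - fconst c * letter (Inr v)"
 | r v where "r : carrier R" "v : carrier V" "x = letter (Inr (lact V r v)) - letter (Inl r) * letter (Inr v)"
 | r v where "r : carrier R" "v : carrier V" "x = letter (Inr (ract V v r)) - letter (Inr v) * letter (Inl r)"
 using assms unfolding tensor_relations_def letter_def fconst_def single_word_mult one_freealg mult_1 mult_1_right append.simps
 by blast

end

lemma qscale_commute: "qscale a (qscale b x) = qscale b (qscale a x)"
 by (metis qscale_simps(4) mult.commute)

text \<open>Letters are sent to representatives in the quiver algebra, not to classes, so that only
  \<open>lift_rel\<close> has to be read modulo \<open>I\<close>. The target program
  \<open>P\<close> is not tied to \<open>R\<close>: for the quadratic dual, \<open>R\<close> is the
  degree 0 part of the algebra of one program and the target belongs to the other.\<close>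

locale tensor_rep = tensor_data R V + vprog P U
 for R :: "('k::field, 'r, 'z) module_scheme" and V :: "('k, 'r, 'v) bimodule"
  and P :: "'e program" and U :: "('e => 'k) set" +
 fixes lift :: "'r + 'v => (('e => sign) list \<Rightarrow>\<^sub>0 ('e, 'k) mpoly)"
 assumes lift_bad: "l ~: S ==> lift l = 0"
  and lift_deg: "r : carrier R ==> lift (Inl r) : hcomp Q 0" "v : carrier V ==> lift (Inr v) : hcomp Q 1"
  and lift_rel:
   "r : carrier R ==> s : carrier R ==> lift (Inl (r \<oplus>\<^bsub>R\<^esub> s)) - (lift (Inl r) + lift (Inl s)) : I"
   "r : carrier R ==> lift (Inl (c \<odot>\<^bsub>R\<^esub> r)) - qscale c (lift (Inl r)) : I"
   "r : carrier R ==> s : carrier R ==> lift (Inl (r \<otimes>\<^bsub>R\<^esub> s)) - qmul (lift (Inl r)) (lift (Inl s)) : I"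
   "lift (Inl \<one>\<^bsub>R\<^esub>) - \<one>\<^bsub>Q\<^esub> : I"
   "v : carrier V ==> w : carrier V ==> lift (Inr (badd V v w)) - (lift (Inr v) + lift (Inr w)) : I"
   "v : carrier V ==> lift (Inr (bscale V c v)) - qscale c (lift (Inr v)) : I"
   "r : carrier R ==> v : carrier V ==> lift (Inr (lact V r v)) - qmul (lift (Inl r)) (lift (Inr v)) : I"
   "r : carrier R ==> v : carrier V ==> lift (Inr (ract V v r)) - qmul (lift (Inr v)) (lift (Inl r)) : I"
begin

lemma lift_deg': "lift l : hcomp Q (dg l)"
proof (cases "l : S")
 case True
 then show ?thesis using lift_deg by (auto simp: S_def dg_def)
next
 case False
 then show ?thesis using lift_bad by (simp add: QA.hcomp_eq QA_zero QA.hp_zero)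
qed

lemma lift_Q: "lift l : carrier Q"
 using lift_deg' by (auto simp: QA.hcomp_eq)

definition wlift :: "('r + 'v) list => (('e => sign) list \<Rightarrow>\<^sub>0 ('e, 'k) mpoly)" where
 "wlift w = foldr (%l x. qmul (lift l) x) w \<one>\<^bsub>Q\<^esub>"

definition phi :: "(('r + 'v) list \<Rightarrow>\<^sub>0 'k) => (('e => sign) list \<Rightarrow>\<^sub>0 ('e, 'k) mpoly)" where
 "phi = pm_sum (%w c. qscale c (wlift w))"

lemma wlift_simps [simp]: "wlift [] = \<one>\<^bsub>Q\<^esub>" "wlift (l # w) = qmul (lift l) (wlift w)"
 by (simp_all add: wlift_def)

lemma Q_one: "\<one>\<^bsub>Q\<^esub> : carrier Q"
 by (rule QA.one_closed)

lemma Q_lone: "x : carrier Q ==> qmul \<one>\<^bsub>Q\<^esub> x = x" and Q_rone: "x : carrier Q ==> qmul x \<one>\<^bsub>Q\<^esub> = x"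
 using QA.l_one[of x] QA.r_one[of x] by (simp_all add: QA_simps(3))

lemma wlift_Q: "wlift w : carrier Q"
 by (induction w) (auto intro: Q_one QA_mult lift_Q)

lemma wlift_append: "wlift (v @ w) = qmul (wlift v) (wlift w)"
 by (induction v) (auto simp: Q_lone wlift_Q QA_assoc lift_Q)

lemma phi_additive: "coeff_additive (%w c. qscale c (wlift w))"
 by (rule coeff_additiveI) (simp add: qscale_simps)

lemma phi_add: "phi (x + y) = phi x + phi y" and phi_diff: "phi (x - y) = phi x - phi y"
 and phi_zero: "phi 0 = 0" and phi_single: "phi (single w c) = qscale c (wlift w)"
 and phi_sum: "phi (sum f X) = (\<Sum>i\<in>X. phi (f i))"
 by (simp_all add: phi_def phi_additive pm_sum_add pm_sum_diff pm_sum_sum)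

lemma phi_Q: "phi x : carrier Q"
 by (induction x rule: pm_induct_all) (auto simp: phi_zero phi_add phi_single QA_zero QA_plus qscale_closed wlift_Q)

lemma phi_mult: "phi (x * y) = qmul (phi x) (phi y)"
proof (induction x rule: pm_induct_all)
 case (single v a)
 show ?case
  by (induction y rule: pm_induct_all)
   (auto simp: single_word_mult phi_add phi_zero phi_single wlift_append qscale_qmul qscale_simps qscale_commute[of a] qmul_add_r distrib_left)
qed (auto simp: phi_add phi_zero qmul_add_l distrib_right)

lemma phi_fconst: "phi (fconst c) = qscale c \<one>\<^bsub>Q\<^esub>"
 by (simp add: fconst_def phi_single)

lemma phi_one: "phi 1 = \<one>\<^bsub>Q\<^esub>"
 by (simp add: one_freealg phi_single qscale_simps)

lemma phi_fconst_mult: "phi (fconst c * x) = qscale c (phi x)"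
 by (simp add: phi_mult phi_fconst qscale_qmul Q_lone phi_Q)

lemma phi_letter: "phi (letter l) = lift l"
 by (simp add: letter_def phi_single qscale_simps Q_rone lift_Q)

lemma phi_letter_mult: "phi (letter l * x) = qmul (lift l) (phi x)"
 by (simp add: phi_mult phi_letter)

lemma wlift_deg: "wlift w : hcomp Q (word_degree dg w)"
proof (induction w)
 case Nil
 then show ?case using QA.hp_one Q_one by (simp add: QA.hcomp_eq)
next
 case (Cons l w)
 have "qpart (dg l + word_degree dg w) (qmul (lift l) (wlift w)) = qmul (lift l) (wlift w)"
  by (rule qpart_mult) (use Cons lift_deg'[of l] in \<open>auto simp: QA.hcomp_eq\<close>)
 then show ?case using QA_mult[OF lift_Q wlift_Q] by (simp add: QA.hcomp_eq word_degree_def)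
qed

lemma phi_deg: "x : hcomp Fr n ==> phi x : hcomp Q n"
proof -
 assume "x : hcomp Fr n"
 then have "free_part dg n x = x" by (simp add: FA.hcomp_eq)
 then have "\<forall>w. lookup x w ~= 0 --> word_degree dg w = n" using free_part_degree by blast
 then show ?thesis
 proof (induction x rule: pm_induct[where Q = "%w _. word_degree dg w = n"])
  case (single w c)
  then show ?case using wlift_deg[of w] by (auto simp: phi_single QA.hcomp_eq qscale_closed QA.hp_smult[unfolded QA_simps])
 next
  case (add x y)
  then show ?case by (simp add: phi_add QA.hcomp_eq QA_plus qpart_simps)
 qed (simp add: phi_zero QA.hcomp_eq QA_zero qpart_simps)
qed

lemma phi_J: "x : J ==> phi x : I"
proof -
 assume x: "x : J"
 have "ideal {x \<in> carrier Fr. phi x : I} Fr"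
  by (rule FA.ideal_ab_I)
   (auto simp: Fr_simps FA.zero_in FA.plus_closed phi_zero phi_add phi_mult Fr_mult intro: I_facts phi_Q)
 moreover have "rels \<subseteq> {x \<in> carrier Fr. phi x : I}"
 proof
  fix x assume x: "x : rels"
  then have "phi x : I"
   by (cases rule: rels_cases_T)
    (simp_all add: phi_diff phi_add phi_letter_mult phi_fconst_mult phi_letter phi_one lift_rel)
  then show "x : {x \<in> carrier Fr. phi x : I}" using x rels_carrier_T by blast
 qed
 ultimately have "J \<subseteq> {x \<in> carrier Fr. phi x : I}" unfolding tensor_ideal_def by (rule FA.genideal_minimal)
 then show ?thesis using x by blast
qed

definition nu :: "(('r + 'v) list \<Rightarrow>\<^sub>0 'k) set => (('e => sign) list \<Rightarrow>\<^sub>0 ('e, 'k) mpoly) set" where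
 "nu X = cl (phi (SOME x. x : carrier Fr & X = tc x))"

lemma nu_tc: "x : carrier Fr ==> nu (tc x) = cl (phi x)"
proof -
 assume x: "x : carrier Fr"
 define s where "s = (SOME y. y : carrier Fr & tc x = tc y)"
 have "\<exists>y. y : carrier Fr & tc x = tc y" using x by blast
 then have y: "s : carrier Fr & tc x = tc s"
  unfolding s_def by (rule someI_ex)
 then have "x - s : J" using tc_eq_iff x by blast
 then have "phi x - phi s : I" using phi_J[of "x - s"] by (simp add: phi_diff)
 then have "cl (phi x) = cl (phi s)" using cl_eq_iff[OF phi_Q phi_Q, of x s] by blast
 then show ?thesis unfolding nu_def s_def[symmetric] by (rule sym)
qed

lemma nu_hom: "nu : ring_hom T A"
proof (rule ring_hom_memI)
 show "nu \<one>\<^bsub>T\<^esub> = \<one>\<^bsub>A\<^esub>"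
  using FA.one_closed by (simp add: T_simps A_simps nu_tc Fr_simps phi_one del: FA.one_closed)
 fix X Y assume X: "X : carrier T"
 then obtain x where x: "X = tc x" "x : carrier Fr" by (auto simp: T_carrier)
 show "nu X : carrier A" using x by (simp add: nu_tc A_carrier phi_Q)
 assume "Y : carrier T"
 then obtain y where y: "Y = tc y" "y : carrier Fr" by (auto simp: T_carrier)
 show "nu (X \<otimes>\<^bsub>T\<^esub> Y) = nu X \<otimes>\<^bsub>A\<^esub> nu Y" using x y by (simp add: T_simps A_simps nu_tc Fr_mult phi_Q phi_mult)
 show "nu (X \<oplus>\<^bsub>T\<^esub> Y) = nu X \<oplus>\<^bsub>A\<^esub> nu Y" using x y by (simp add: T_simps A_simps nu_tc FA.plus_closed phi_Q phi_add)
qed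

lemma nu_smult: "X : carrier T ==> nu (c \<odot>\<^bsub>T\<^esub> X) = c \<odot>\<^bsub>A\<^esub> nu X"
proof -
 assume "X : carrier T"
 then obtain x where x: "X = tc x" "x : carrier Fr" by (auto simp: T_carrier)
 have "fconst c * x : carrier Fr" using FA.smult_closed[OF x(2), of c] by (simp add: Fr_simps)
 then show ?thesis using x by (simp add: T_simps A_simps nu_tc phi_Q phi_fconst_mult)
qed

lemma nu_zero_iff: "x : carrier Fr ==> nu (tc x) = \<zero>\<^bsub>A\<^esub> \<longleftrightarrow> phi x : I"
 using cl_eq_iff[of "phi x" 0] by (simp add: nu_tc A_simps phi_Q QA_zero)

text \<open>Surjectivity in each degree: the loops at a vertex of the arrangement generate the variables.\<close>

definition reach :: "nat => (('e => sign) list \<Rightarrow>\<^sub>0 ('e, 'k) mpoly) set" where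
 "reach n = {y \<in> carrier Q. \<exists>x \<in> hcomp Fr n. phi x - y : I}"

lemma reach_add: "x : reach n ==> y : reach n ==> x + y : reach n"
proof -
 assume "x : reach n" "y : reach n"
 then obtain x' y' where a: "x : carrier Q" "y : carrier Q" "x' : hcomp Fr n" "y' : hcomp Fr n" "phi x' - x : I" "phi y' - y : I"
  by (auto simp: reach_def)
 have "phi (x' + y') - (x + y) = (phi x' - x) + (phi y' - y)" by (simp add: phi_add)
 also have "... : I" by (intro I_facts(2) a)
 finally show ?thesis using a hcomp_plus QA_plus unfolding reach_def by blast
qed

lemma reach_zero: "0 : reach n"
proof -
 have "0 : hcomp Fr n" by (simp add: FA.hcomp_eq FA.zero_in FA.hp_zero)
 then show ?thesis unfolding reach_def using phi_zero I_facts(1) QA_zero by force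
qed

lemma reach_sum: "(!!i. i : X ==> f i : reach n) ==> sum f X : reach n"
 by (induction X rule: infinite_finite_induct) (auto simp: reach_zero reach_add)

lemma reach_scale: "x : reach n ==> qscale c x : reach n"
proof -
 assume "x : reach n"
 then obtain x' where a: "x : carrier Q" "x' : hcomp Fr n" "phi x' - x : I" by (auto simp: reach_def)
 have "fconst c * x' : hcomp Fr n"
  using a(2) FA.smult_closed[of x' c] FA.hp_smult[of x' n c] by (auto simp: FA.hcomp_eq Fr_simps)
 moreover have "phi (fconst c * x') - qscale c x : I"
  using I_qscale[OF a(3), of c] by (simp add: phi_fconst_mult qscale_simps)
 ultimately show ?thesis using a(1) qscale_closed unfolding reach_def by blast
qed

lemma reach_mult: "x : reach m ==> y : reach n ==> qmul x y : reach (m + n)"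
proof -
 assume "x : reach m" "y : reach n"
 then obtain x' y' where a: "x : carrier Q" "y : carrier Q" "x' : hcomp Fr m" "y' : hcomp Fr n" "phi x' - x : I" "phi y' - y : I"
  by (auto simp: reach_def)
 have "phi (x' * y') - qmul x y = qmul (phi x' - x) (phi y') + qmul x (phi y' - y)"
  by (simp add: phi_mult qmul_diff_l qmul_diff_r)
 also have "... : I" by (intro I_facts(2,5,6) a phi_Q)
 finally have "phi (x' * y') - qmul x y : I" .
 moreover have "x' * y' : hcomp Fr (m + n)"
  using a(3,4) FA.hp_mult[of x' y' m n] by (auto simp: FA.hcomp_eq Fr_simps Fr_mult)
 ultimately show ?thesis using a QA_mult unfolding reach_def by blast
qed

lemma reach_cong: "x : reach n ==> y : carrier Q ==> x - y : I ==> y : reach n"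
proof -
 assume y: "y : carrier Q" "x - y : I" and "x : reach n"
 then obtain x' where a: "x' : hcomp Fr n" "phi x' - x : I" by (auto simp: reach_def)
 have "phi x' - y : I" using I_facts(2)[OF a(2) y(2)] by simp
 then show ?thesis using a y unfolding reach_def by blast
qed

text \<open>A relation (A4) is a sum over all vertices of the quiver; multiplication by the
  idempotent at \<open>al\<close> isolates one summand.\<close>

lemma form_I: "al : F ==> x : U0 ==> (\<Sum>i\<in>E. qterm [al] (single i 1) (x i)) : I"
proof -
 assume al: "al : F" and x: "x : U0"
 have "qmul (qterm [al] 0 1) (\<Sum>be\<in>F. \<Sum>i\<in>E. qterm [be] (single i 1) (x i)) : I"
  using rels_A4[OF x] rels_I al by (intro I_facts(6) QA_qterm) (auto simp: quiver_path_simps)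
 also have "qmul (qterm [al] 0 1) (\<Sum>be\<in>F. \<Sum>i\<in>E. qterm [be] (single i 1) (x i)) =
  (\<Sum>be\<in>F. if be = al then (\<Sum>i\<in>E. qterm [al] (single i 1) (x i)) else 0)"
  unfolding qmul_sum_r by (intro sum.cong refl) (auto simp: qmul_qterm intro!: sum.neutral)
 also have "... = (\<Sum>i\<in>E. qterm [al] (single i 1) (x i))" using finite_F al by simp
 finally show ?thesis .
qed

context
 assumes reach_vertex: "!!al. al : F ==> qterm [al] 0 1 : reach 0"
  and reach_arrow: "!!al be. al : F ==> be : F ==> adjacent al be ==> qterm [al, be] 0 1 : reach 1"
begin

lemma reach_path: "quiver_path F adjacent p ==> qterm p 0 1 : reach (length p - 1)"
proof (induction p)
 case (Cons v p)
 show ?case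
 proof (cases p)
  case Nil
  then show ?thesis using Cons reach_vertex by (simp add: quiver_path_simps)
 next
  case (Cons w p')
  then have "qmul (qterm [v, w] 0 1) (qterm p 0 1) : reach (1 + (length p - 1))"
   using Cons.prems Cons.IH by (intro reach_mult reach_arrow) (auto simp: quiver_path_def)
  then show ?thesis using Cons by (simp add: qmul_qterm)
 qed
qed (simp add: quiver_path_def)

lemma reach_var: "al : F ==> i : E ==> qterm [al] (single i 1) 1 : reach 2"
proof -
 assume al: "al : F" and i: "i : E"
 obtain b where b: "form_basis E U b" "\<forall>c. support c = E & (\<forall>i. i ~: b --> c i = al i) --> c : F"
  using vertex_ex[OF al] by blast
 obtain c where c: "c : coord_space b" "(%j. unit_form i j - c j) : U0"
  using b(1) i unfolding form_basis_def by blast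
 have bE: "b \<subseteq> E" using b(1) by (simp add: form_basis_def)
 have fl: "flip al l : F" if "l : b" for l
  using b(2) that feasible_supp[OF al] by (auto simp: support_flip flip_apply)
 let ?y = "\<Sum>l\<in>b. qscale (c l) (qterm [al, flip al l, al] 0 1)"
 let ?u = "%l. qterm [al] (single l 1)"
 have path: "quiver_path F adjacent [al, flip al l, al]" if "l : b" for l
  using al fl[OF that] F_adj[OF al, of l] bE that by (auto simp: quiver_path_simps)
 have y: "?y : reach 2"
  by (intro reach_sum reach_scale) (use reach_path[OF path] in \<open>auto simp: numeral_2_eq_2\<close>)
 have uQ: "?u l d : carrier Q" if "l : E" for l d using al that by (intro QA_qterm) (auto simp: quiver_path_simps)
 have "?y - (\<Sum>l\<in>b. ?u l (c l)) = (\<Sum>l\<in>b. qscale (c l) (qterm [al, flip al l, al] 0 1 - ?u l 1))"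
  by (simp add: sum_subtractf qscale_simps)
 also have "... : I"
  by (intro I_facts(7) I_qscale subsetD[OF rels_I] rels_A3) (use al fl bE in auto)
 finally have 1: "?y - (\<Sum>l\<in>b. ?u l (c l)) : I" .
 have "(\<Sum>l\<in>b. ?u l (c l)) - ?u i 1 = - (\<Sum>l\<in>E. ?u l (unit_form i l - c l))"
 proof -
  have "(\<Sum>l\<in>E. ?u l (unit_form i l - c l)) = (\<Sum>l\<in>E. ?u l (unit_form i l)) - (\<Sum>l\<in>E. ?u l (c l))"
   by (simp add: qterm_def single_diff sum_subtractf)
  also have "(\<Sum>l\<in>E. ?u l (unit_form i l)) = (\<Sum>l\<in>E. if l = i then ?u i 1 else 0)"
   by (rule sum.cong) (auto simp: unit_form_def qterm_def)
  also have "... = ?u i 1" using finite_E i by simp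
  also have "(\<Sum>l\<in>E. ?u l (c l)) = (\<Sum>l\<in>b. ?u l (c l))"
   by (rule sum.mono_neutral_right[OF finite_E bE]) (use c(1) in \<open>auto simp: coord_space_def qterm_def\<close>)
  finally show ?thesis by simp
 qed
 also have "... : I" using I_facts(3)[OF I_facts(1) form_I[OF al c(2)]] by simp
 finally have 2: "(\<Sum>l\<in>b. ?u l (c l)) - ?u i 1 : I" .
 have "?y - ?u i 1 : I" using I_facts(2)[OF 1 2] by simp
 then show ?thesis by (rule reach_cong[OF y uQ[OF i]])
qed

lemma reach_monom:
 assumes "al : F" "keys m \<subseteq> E"
 shows "qterm [al] m 1 : reach (2 * monom_degree m)"
 using assms(2)
proof (induction "monom_degree m" arbitrary: m)
 case 0
 then show ?case using reach_vertex[OF assms(1)] by (simp add: monom_degree_eq_0)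
next
 case (Suc n)
 obtain i where i: "i : keys m"
  using Suc.hyps(2) by (force simp: monom_degree_def)
 have li: "lookup m i \<ge> 1" using i by (simp add: in_keys_iff)
 define m' where "m' = m - single i 1"
 have m: "m = m' + single i 1"
  by (rule poly_mapping_eqI) (use li in \<open>auto simp: m'_def lookup_add lookup_minus lookup_single when_def\<close>)
 have "keys m' \<subseteq> keys m"
  by (auto simp: m'_def in_keys_iff lookup_minus)
 then have "qterm [al] m' 1 : reach (2 * monom_degree m')" using Suc.hyps(2) Suc.prems by (intro Suc.hyps(1)) (auto simp: m)
 then have "qmul (qterm [al] m' 1) (qterm [al] (single i 1) 1) : reach (2 * monom_degree m' + 2)"
  using Suc.prems i by (intro reach_mult reach_var assms(1)) auto
 then show ?case by (simp add: qmul_qterm m)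
qed

lemma reach_all:
 assumes "y : hcomp Q n" shows "y : reach n"
proof -
 have y: "y : carrier Q" "qpart n y = y" using assms by (auto simp: QA_hcomp)
 have "\<forall>p m. cf y p m ~= 0 --> quiver_path F adjacent p & keys m \<subseteq> E & qdeg p m = n"
  using y(1) qpart_degree[OF y(2)] by (simp add: QA_carrier)
 then show ?thesis
 proof (induction y rule: qterm_induct)
  case (single p m c)
  have pne: "p ~= []" "last p : F" using single by (auto simp: quiver_path_def)
  have "qmul (qterm p 0 1) (qterm [last p] m 1) : reach ((length p - 1) + 2 * monom_degree m)"
   using single pne by (intro reach_mult reach_path reach_monom) auto
  then have "qterm p m 1 : reach n" using single by (simp add: qmul_qterm qdeg_def)
  then show ?case unfolding qterm_scale[of p m c] by (rule reach_scale)
 qed (auto intro: reach_zero reach_add)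
qed

lemma nu_hcomp: "nu ` hcomp T n = hcomp A n"
proof
 show "nu ` hcomp T n \<subseteq> hcomp A n"
 proof
  fix a assume "a : nu ` hcomp T n"
  then obtain x where x: "x : hcomp Fr n" "a = nu (tc x)" by (auto simp: T_hcomp)
  have "x : carrier Fr" using x(1) by (simp add: FA.hcomp_eq)
  then have "a = cl (phi x)" using x(2) by (simp add: nu_tc)
  then show "a : hcomp A n" using phi_deg[OF x(1)] by (simp add: A_hcomp)
 qed
 show "hcomp A n \<subseteq> nu ` hcomp T n"
 proof
  fix a assume "a : hcomp A n"
  then obtain y where y: "y : hcomp Q n" "a = cl y" by (auto simp: A_hcomp)
  then obtain x where x: "x : hcomp Fr n" "phi x - y : I" "y : carrier Q" using reach_all by (auto simp: reach_def)
  have "nu (tc x) = cl (phi x)" using x(1) by (intro nu_tc) (simp add: FA.hcomp_eq)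
  also have "... = a" using cl_eq_iff[OF phi_Q x(3)] x(2) y(2) by simp
  finally show "a : nu ` hcomp T n" using x(1) by (auto simp: T_hcomp)
 qed
qed

lemma nu_surj: "nu ` carrier T = carrier A"
proof
 show "nu ` carrier T \<subseteq> carrier A" by (auto simp: T_carrier A_carrier nu_tc phi_Q)
 show "carrier A \<subseteq> nu ` carrier T"
 proof
  fix a assume "a : carrier A"
  then obtain y where y: "y : carrier Q" "a = cl y" by (auto simp: A_carrier)
  have "\<exists>x \<in> carrier Fr. phi x - y : I"
  proof -
   have "\<forall>n. \<exists>x. x : hcomp Fr n & phi x - qpart n y : I"
   proof
    fix n
    have "qpart n y : hcomp Q n" using y(1) by (simp add: QA.hcomp_eq QA.hp_closed QA.hp_hp)
    from reach_all[OF this] show "\<exists>x. x : hcomp Fr n & phi x - qpart n y : I" by (auto simp: reach_def)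
   qed
   then obtain x where x: "!!n. x n : hcomp Fr n" "!!n. phi (x n) - qpart n y : I" by metis
   let ?N = "{n. qpart n y ~= 0}"
   have "phi (\<Sum>n\<in>?N. x n) - y = (\<Sum>n\<in>?N. phi (x n) - qpart n y)"
    by (simp add: phi_sum sum_subtractf QA.hp_total)
   also have "... : I" by (intro I_facts(7) x)
   finally show ?thesis using x(1) by (intro bexI[of _ "\<Sum>n\<in>?N. x n"]) (auto intro!: FA.sum_closed simp: FA.hcomp_eq)
  qed
  then obtain x where x: "x : carrier Fr" "phi x - y : I" by blast
  have "nu (tc x) = a" using x cl_eq_iff[OF phi_Q y(1)] y(2) by (simp add: nu_tc)
  then show "a : nu ` carrier T" using x(1) by (auto simp: T_carrier)
 qed
qed

end

text \<open>If \<open>A(P, U)\<close> also maps to \<open>T / L\<close>, inversely on letters, the kernel is \<open>L\<close>.\<close>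

lemma nu_kernel:
 assumes L: "ideal L T" and L0: "!!X. X : L ==> nu X = \<zero>\<^bsub>A\<^esub>"
  and rep: "quad_rep P U (Kt L) fconst eps arr"
  and letters: "!!l. l : S ==> quad_rep.Theta P U fconst eps arr (lift l) - letter l : Kt L"
 shows "a_kernel T A nu = L"
proof -
 interpret QR: quad_rep P U "Kt L" fconst eps arr by (rule rep)
 interpret Li: ideal L T by (rule L)
 have let_bad: "letter l : Kt L" if "l ~: S" for l
 proof -
  have "rho (letter l) = 0" using that by (simp add: rho_def letter_def pm_restrict_single)
  then show ?thesis using Li.zero_closed by (simp add: Kt_def T_simps)
 qed
 have let_all: "QR.cg (QR.Theta (lift l)) (letter l)" for l
 proof (cases "l : S")
  case True then show ?thesis using letters by (simp add: QR.cg_def)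
 next
  case False
  then show ?thesis using let_bad[OF False] QR.K_uminus by (simp add: QR.cg_def lift_bad)
 qed
 \<comment> \<open>\<open>phi\<close> is multiplicative and \<open>Theta\<close> is so modulo the
   ideal; agreement with the identity on letters therefore spreads to the whole free algebra.
   Letters outside \<open>S\<close> are congruent to 0 on both sides.\<close>
 have main: "QR.cg (QR.Theta (phi x)) x" for x
 proof (induction x rule: freealg_induct)
  case (const c)
  have "QR.cg (fconst c * QR.Theta \<one>\<^bsub>Q\<^esub>) (fconst c * 1)" by (rule QR.cg_mult[OF QR.cg_refl QR.Theta_one])
  then show ?case by (simp add: phi_fconst QR.Theta_qscale)
 next
  case (letter l)
  then show ?case using let_all by (simp add: phi_letter)
 next
  case (add x y)
  then show ?case by (simp add: phi_add QR.Theta_add QR.cg_add)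
 next
  case (mult x y)
  have "QR.cg (QR.Theta (phi (x * y))) (QR.Theta (phi x) * QR.Theta (phi y))"
   unfolding phi_mult by (rule QR.Theta_mult[OF phi_Q phi_Q])
  then show ?case by (rule QR.cg_trans) (rule QR.cg_mult[OF mult])
 qed
 show ?thesis
 proof
  show "L \<subseteq> a_kernel T A nu" using L0 Li.Icarr by (auto simp: a_kernel_def kernel_def)
  show "a_kernel T A nu \<subseteq> L"
  proof
   fix X assume "X : a_kernel T A nu"
   then have "X : carrier T" "nu X = \<zero>\<^bsub>A\<^esub>" by (auto simp: a_kernel_def kernel_def)
   then obtain x where x: "X = tc x" "x : carrier Fr" "phi x : I" using nu_zero_iff by (auto simp: T_carrier)
   have "QR.cg x 0" using QR.cg_trans[OF QR.cg_sym[OF main] QR.Theta_ideal[OF x(3)]] .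
   then have "x : Kt L" by (simp add: QR.cg_zero_iff)
   then show "X : L" using x(1,2) by (simp add: Kt_def rho_id)
  qed
 qed
qed

end

subsection \<open>The algebra of a program is quadratic\<close>

lemma degree_zero_simps [simp]:
 "carrier (degree_zero X) = hcomp X 0" "x \<oplus>\<^bsub>degree_zero X\<^esub> y = x \<oplus>\<^bsub>X\<^esub> y" "x \<otimes>\<^bsub>degree_zero X\<^esub> y = x \<otimes>\<^bsub>X\<^esub> y"
 "c \<odot>\<^bsub>degree_zero X\<^esub> x = c \<odot>\<^bsub>X\<^esub> x" "\<one>\<^bsub>degree_zero X\<^esub> = \<one>\<^bsub>X\<^esub>"
 by (simp_all add: degree_zero_def)

lemma degree_one_simps [simp]:
 "carrier (degree_one X) = hcomp X 1" "badd (degree_one X) x y = x \<oplus>\<^bsub>X\<^esub> y" "bscale (degree_one X) c x = c \<odot>\<^bsub>X\<^esub> x"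
 "lact (degree_one X) x y = x \<otimes>\<^bsub>X\<^esub> y" "ract (degree_one X) x y = x \<otimes>\<^bsub>X\<^esub> y"
 by (simp_all add: degree_one_def)

context vprog
begin

lemma Q_hcomp_carrier: "x : hcomp Q n ==> x : carrier Q"
 by (simp add: QA_hcomp)

lemma Q_hcomp_plus: "x : hcomp Q n ==> y : hcomp Q n ==> x + y : hcomp Q n"
 by (simp add: QA_hcomp QA_plus qpart_simps)

lemma Q_hcomp_zero: "0 : hcomp Q n"
 by (simp add: QA_hcomp QA_zero qpart_simps)

lemma Q_hcomp_sum: "(!!i. i : X ==> f i : hcomp Q n) ==> sum f X : hcomp Q n"
 by (induction X rule: infinite_finite_induct) (auto simp: Q_hcomp_zero Q_hcomp_plus)

lemma Q_hcomp_mult: "x : hcomp Q m ==> y : hcomp Q n ==> qmul x y : hcomp Q (m + n)"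
 by (simp add: QA_hcomp QA_mult qpart_mult)

lemma Q_hcomp_scale: "x : hcomp Q n ==> qscale c x : hcomp Q n"
 using QA.hp_smult[of x n c] by (simp add: QA_hcomp qscale_closed QA_simps)

lemma Q_hcomp_qterm: "quiver_path F adjacent p ==> keys m \<subseteq> E ==> qdeg p m = n ==> qterm p m c : hcomp Q n"
 by (simp add: QA_hcomp QA_qterm qpart_simps)

lemma A_hcomp_carrier: "a : hcomp A n ==> a : carrier A"
 by (auto simp: A_hcomp A_carrier Q_hcomp_carrier)

lemma A_hcomp_plus: "a : hcomp A n ==> b : hcomp A n ==> a \<oplus>\<^bsub>A\<^esub> b : hcomp A n"
 unfolding A_hcomp using A_simps(1) Q_hcomp_plus Q_hcomp_carrier by (auto intro!: imageI)

lemma A_hcomp_mult: "a : hcomp A m ==> b : hcomp A n ==> a \<otimes>\<^bsub>A\<^esub> b : hcomp A (m + n)"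
 unfolding A_hcomp using A_simps(2) Q_hcomp_mult Q_hcomp_carrier by (auto intro!: imageI)

lemma A_hcomp_scale: "a : hcomp A n ==> c \<odot>\<^bsub>A\<^esub> a : hcomp A n"
 unfolding A_hcomp using A_simps(3) Q_hcomp_scale Q_hcomp_carrier by (auto intro!: imageI)

lemma A_hcomp_one: "\<one>\<^bsub>A\<^esub> : hcomp A 0"
proof -
 have "\<one>\<^bsub>Q\<^esub> : hcomp Q 0" using QA.hp_one QA.one_closed by (simp add: QA_hcomp)
 then show ?thesis unfolding A_hcomp A_simps(5) by (rule imageI)
qed

definition idem :: "('e => sign) => (('e => sign) list \<Rightarrow>\<^sub>0 ('e, 'k) mpoly) set" where
 "idem al = cl (qterm [al] 0 1)"

definition arrow :: "('e => sign) => ('e => sign) => (('e => sign) list \<Rightarrow>\<^sub>0 ('e, 'k) mpoly) set" where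
 "arrow al be = cl (qterm [al, be] 0 1)"

text \<open>Representatives read off from the coordinates and supported on \<open>B\<close>. As only
  bounded topes occur, the same formula defines an element of the quiver algebra of the dual
  program.\<close>

definition lift0 :: "(('e => sign) list \<Rightarrow>\<^sub>0 ('e, 'k) mpoly) set => (('e => sign) list \<Rightarrow>\<^sub>0 ('e, 'k) mpoly)" where
 "lift0 a = (\<Sum>v\<in>B. qterm [v] 0 (co [v] a))"

definition lift1 :: "(('e => sign) list \<Rightarrow>\<^sub>0 ('e, 'k) mpoly) set => (('e => sign) list \<Rightarrow>\<^sub>0 ('e, 'k) mpoly)" where
 "lift1 a = (\<Sum>(v, w)\<in>arrows. qterm [v, w] 0 (co [v, w] a))"

lemma prog_idem_eq: "prog_idem P U al = idem al"
 by (simp add: prog_idem_def idem_def QA_eq qpath_qterm)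

lemma B_F: "v : B ==> v : F"
 using BF by blast

lemma arrowsD: "(v, w) : arrows ==> v : B & w : B & v : F & w : F & adjacent v w"
 using BF by (auto simp: arrows_def)

lemma vertex_hcomp: "v : F ==> qterm [v] 0 c : hcomp Q 0"
 by (intro Q_hcomp_qterm) (auto simp: quiver_path_simps qdeg_def)

lemma edge_hcomp: "v : F ==> w : F ==> adjacent v w ==> qterm [v, w] 0 c : hcomp Q 1"
 by (intro Q_hcomp_qterm) (auto simp: quiver_path_simps qdeg_def)

lemma lift0_hcomp: "lift0 a : hcomp Q 0"
 unfolding lift0_def by (intro Q_hcomp_sum vertex_hcomp B_F)

lemma lift1_hcomp: "lift1 a : hcomp Q 1"
 unfolding lift1_def by (intro Q_hcomp_sum) (use edge_hcomp arrowsD in auto)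

lemma cl_lift: "a : hcomp A 0 ==> cl (lift0 a) = a" "a : hcomp A 1 ==> cl (lift1 a) = a"
 using A0_expand A1_expand unfolding lift0_def lift1_def by auto

lemma idem_hcomp: "v : F ==> idem v : hcomp A 0"
 unfolding idem_def A_hcomp by (intro imageI vertex_hcomp)

lemma arrow_hcomp: "v : F ==> w : F ==> adjacent v w ==> arrow v w : hcomp A 1"
 unfolding arrow_def A_hcomp by (intro imageI edge_hcomp)

lemma idem_mult: "v : F ==> w : F ==> idem v \<otimes>\<^bsub>A\<^esub> idem w = (if v = w then idem v else \<zero>\<^bsub>A\<^esub>)"
 using Q_hcomp_carrier[OF vertex_hcomp] by (simp add: idem_def A_simps qmul_qterm)

lemma idem_arrow: "v : F ==> w : F ==> adjacent v w ==> idem v \<otimes>\<^bsub>A\<^esub> arrow v w = arrow v w"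
 "v : F ==> w : F ==> adjacent v w ==> arrow v w \<otimes>\<^bsub>A\<^esub> idem w = arrow v w"
 using Q_hcomp_carrier[OF vertex_hcomp] Q_hcomp_carrier[OF edge_hcomp]
 by (simp_all add: idem_def arrow_def A_simps qmul_qterm)

lemma co_idem: "v : B ==> w : B ==> co [v] (idem w) = (if v = w then 1 else 0)"
 unfolding idem_def using Q_hcomp_carrier[OF vertex_hcomp[OF B_F, of w 1]]
 by (simp add: co_cl cf_qterm)

lemma co_arrow: "(v, w) : arrows ==> (v', w') : arrows ==> co [v, w] (arrow v' w') = (if v = v' & w = w' then 1 else 0)"
proof -
 assume a: "(v, w) : arrows" "(v', w') : arrows"
 have "qterm [v', w'] 0 1 : carrier Q" using Q_hcomp_carrier[OF edge_hcomp] arrowsD[OF a(2)] by blast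
 then show ?thesis unfolding arrow_def using arrowsD[OF a(1)] by (auto simp: co_cl cf_qterm)
qed

lemma zero_A_scale: "0 \<odot>\<^bsub>A\<^esub> cl 0 = cl 0"
 by (simp add: A_simps QA_zero qscale_simps)

end

text \<open>Shared by the two tensor algebras over degree 0 of the algebra: the one on its degree 1
  part and the one on the dual bimodule.\<close>

locale tensor_A = vprog P U + tensor_data "degree_zero (prog_algebra P U)" V
 for P :: "'e program" and U :: "('e => 'k::field) set"
  and V :: "('k, (('e => sign) list \<Rightarrow>\<^sub>0 ('e, 'k) mpoly) set, 'v) bimodule"
begin

abbreviation lt :: "((('e => sign) list \<Rightarrow>\<^sub>0 ('e, 'k) mpoly) set + 'v) => (((('e => sign) list \<Rightarrow>\<^sub>0 ('e, 'k) mpoly) set + 'v), 'k) freealg" where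
 "lt \<equiv> letter"

text \<open>Set to 0 off \<open>B\<close>, so that it can serve for the feasible topes of either
  program; a tope outside \<open>B\<close> has to act by 0.\<close>

definition epsT :: "('e => sign) => (((('e => sign) list \<Rightarrow>\<^sub>0 ('e, 'k) mpoly) set + 'v), 'k) freealg" where
 "epsT al = (if al : B then lt (Inl (idem al)) else 0)"

lemma letter_hcomp: "r : hcomp A 0 ==> lt (Inl r) : hcomp Fr 0" "v : carrier V ==> lt (Inr v) : hcomp Fr 1"
 unfolding letter_def by (rule single_hcomp; auto simp: S_def dg_def word_degree_def)+

lemma epsT_hcomp: "epsT al : hcomp Fr 0"
 using letter_hcomp(1)[OF idem_hcomp[OF B_F]] by (auto simp: epsT_def FA.hcomp_eq FA.zero_in FA.hp_zero)

context
 fixes K :: "(((('e => sign) list \<Rightarrow>\<^sub>0 ('e, 'k) mpoly) set + 'v), 'k) freealg set"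
 assumes K: "ring_cong K" and JK: "J \<subseteq> K"
begin

interpretation ring_cong K by (rule K)

lemma rel_cg: "x - y : rels ==> x \<approx> y"
 using rels_J JK by (auto simp: cg_def)

lemma letter_zero: "lt (Inl (cl 0)) \<approx> 0"
proof -
 have "cl 0 : hcomp A 0" unfolding A_hcomp by (intro imageI Q_hcomp_zero)
 then have "lt (Inl (0 \<odot>\<^bsub>A\<^esub> cl 0)) - fconst 0 * lt (Inl (cl 0)) : rels"
  using rels_mem(2)[of "cl 0" 0] by simp
 then have "lt (Inl (0 \<odot>\<^bsub>A\<^esub> cl 0)) \<approx> fconst 0 * lt (Inl (cl 0))" by (rule rel_cg)
 then show ?thesis by (simp add: zero_A_scale)
qed

lemma letter_expand0:
 assumes "a : hcomp A 0"
 shows "lt (Inl a) \<approx> (\<Sum>v\<in>B. fconst (co [v] a) * epsT v)"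
proof -
 have *: "lt (Inl (cl (\<Sum>v\<in>X. qterm [v] 0 (c v)))) \<approx> (\<Sum>v\<in>X. fconst (c v) * epsT v)"
  if "finite X" "X \<subseteq> B" for X and c :: "_ => 'k"
  using that
 proof (induction X rule: finite_induct)
  case empty then show ?case using letter_zero by simp
 next
  case (insert v X)
  let ?s = "\<Sum>v\<in>X. qterm [v] 0 (c v)"
  have v: "v : B" "v : F" using insert.prems BF by auto
  have s: "?s : hcomp Q 0" by (intro Q_hcomp_sum vertex_hcomp) (use insert.prems BF in auto)
  have sA: "cl ?s : hcomp A 0" unfolding A_hcomp by (intro imageI s)
  have e: "c v \<odot>\<^bsub>A\<^esub> idem v : hcomp A 0" by (intro A_hcomp_scale idem_hcomp v)
  have eq: "cl (\<Sum>v\<in>insert v X. qterm [v] 0 (c v)) = (c v \<odot>\<^bsub>A\<^esub> idem v) \<oplus>\<^bsub>A\<^esub> cl ?s"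
   using insert.hyps Q_hcomp_carrier[OF s] Q_hcomp_carrier[OF vertex_hcomp[OF v(2)]]
   by (simp add: idem_def A_simps qscale_simps)
  have "lt (Inl ((c v \<odot>\<^bsub>A\<^esub> idem v) \<oplus>\<^bsub>A\<^esub> cl ?s)) \<approx> lt (Inl (c v \<odot>\<^bsub>A\<^esub> idem v)) + lt (Inl (cl ?s))"
   using rels_mem(1)[of "c v \<odot>\<^bsub>A\<^esub> idem v" "cl ?s"] e sA by (intro rel_cg) simp
  also have "... \<approx> fconst (c v) * lt (Inl (idem v)) + (\<Sum>v\<in>X. fconst (c v) * epsT v)"
  proof (rule cg_add)
   show "lt (Inl (c v \<odot>\<^bsub>A\<^esub> idem v)) \<approx> fconst (c v) * lt (Inl (idem v))"
    using rels_mem(2)[of "idem v" "c v"] idem_hcomp[OF v(2)] by (intro rel_cg) simp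
  qed (use insert in simp)
  finally show ?case unfolding eq using insert.hyps v by (simp add: epsT_def)
 qed
 have "lt (Inl (cl (\<Sum>v\<in>B. qterm [v] 0 (co [v] a)))) \<approx> (\<Sum>v\<in>B. fconst (co [v] a) * epsT v)"
  by (rule *[OF finite_B subset_refl])
 then show ?thesis unfolding A0_expand[OF assms, symmetric] .
qed

lemma epsT_orth:
 assumes "al : F" "be : F"
 shows "epsT al * epsT be \<approx> (if al = be then epsT al else 0)"
proof (cases "al : B & be : B")
 case True
 have "epsT al * epsT be \<approx> lt (Inl (idem al \<otimes>\<^bsub>A\<^esub> idem be))"
  using rels_mem(3)[of "idem al" "idem be"] idem_hcomp assms True by (intro cg_sym[OF rel_cg]) (simp add: epsT_def)
 also have "... \<approx> (if al = be then epsT al else 0)"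
  using letter_zero True by (simp add: idem_mult assms A_simps epsT_def)
 finally show ?thesis .
qed (auto simp: epsT_def)

lemma epsT_one: "(\<Sum>al\<in>F. epsT al) \<approx> 1"
proof -
 have "(\<Sum>al\<in>F. epsT al) = (\<Sum>al\<in>B. epsT al)"
  by (rule sum.mono_neutral_right[OF finite_F BF]) (simp add: epsT_def)
 also have "... = (\<Sum>v\<in>B. fconst (co [v] \<one>\<^bsub>A\<^esub>) * epsT v)" by (rule sum.cong) (simp_all add: co_one)
 also have "... \<approx> lt (Inl \<one>\<^bsub>A\<^esub>)" by (rule cg_sym[OF letter_expand0[OF A_hcomp_one]])
 also have "... \<approx> 1" using rels_mem(4) by (intro rel_cg) simp
 finally show ?thesis .
qed

end

end

context vprog
begin

abbreviation "A0 \<equiv> degree_zero A"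
abbreviation "A1 \<equiv> degree_one A"

sublocale N: tensor_A P U "degree_one (prog_algebra P U)"
 by unfold_locales
  (use A_hcomp_plus A_hcomp_scale A_hcomp_one A_hcomp_mult[of _ 0 _ 0] A_hcomp_mult[of _ 0 _ 1] A_hcomp_mult[of _ 1 _ 0] in simp_all)

definition nlift where
 "nlift l = (if l : N.S then case_sum lift0 lift1 l else 0)"

lemma nlift_simps: "r : hcomp A 0 ==> nlift (Inl r) = lift0 r" "v : hcomp A 1 ==> nlift (Inr v) = lift1 v"
 by (auto simp: nlift_def N.S_def)

lemma lift_carrier: "lift0 a : carrier Q" "lift1 a : carrier Q"
 using lift0_hcomp lift1_hcomp Q_hcomp_carrier by blast+

sublocale NR: tensor_rep "degree_zero (prog_algebra P U)" "degree_one (prog_algebra P U)" P U nlift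
proof unfold_locales
 show "l ~: N.S ==> nlift l = 0" for l by (simp add: nlift_def)
 show "r : carrier A0 ==> nlift (Inl r) : hcomp Q 0" for r by (simp add: nlift_simps lift0_hcomp)
 show "v : carrier A1 ==> nlift (Inr v) : hcomp Q 1" for v by (simp add: nlift_simps lift1_hcomp del: One_nat_def)
 have one: "cl \<one>\<^bsub>Q\<^esub> = \<one>\<^bsub>A\<^esub>" "\<one>\<^bsub>Q\<^esub> : carrier Q" using QA.one_closed by (simp_all add: A_simps)
 have I0: "x - y : I" if "cl x = cl y" "x : carrier Q" "y : carrier Q" for x y using that cl_eq_iff by blast
 note c = lift_carrier QA_plus QA_mult qscale_closed
 note h = A_hcomp_plus A_hcomp_scale A_hcomp_one
 show "nlift (Inl \<one>\<^bsub>A0\<^esub>) - \<one>\<^bsub>Q\<^esub> : I"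
  using A_hcomp_one one by (intro I0) (simp_all add: nlift_simps cl_lift c)
 fix r c assume r: "r : carrier A0"
 show "nlift (Inl (c \<odot>\<^bsub>A0\<^esub> r)) - qscale c (nlift (Inl r)) : I"
  using r by (intro I0) (simp_all add: nlift_simps cl_lift h c A_simps(3)[symmetric])
 {
  fix s assume s: "s : carrier A0"
  show "nlift (Inl (r \<oplus>\<^bsub>A0\<^esub> s)) - (nlift (Inl r) + nlift (Inl s)) : I"
   using r s by (intro I0) (simp_all add: nlift_simps cl_lift h c A_simps(1)[symmetric])
  show "nlift (Inl (r \<otimes>\<^bsub>A0\<^esub> s)) - qmul (nlift (Inl r)) (nlift (Inl s)) : I"
   using r s A_hcomp_mult[of r 0 s 0] by (intro I0) (simp_all add: nlift_simps cl_lift c A_simps(2)[symmetric])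
 next
  fix v assume v: "v : carrier A1"
  then have v1: "v : hcomp A 1" by simp
  show "nlift (Inr (lact A1 r v)) - qmul (nlift (Inl r)) (nlift (Inr v)) : I"
   using r A_hcomp_mult[of r 0 v 1] v1 by (intro I0) (simp_all add: nlift_simps cl_lift c A_simps(2)[symmetric] del: One_nat_def)
  show "nlift (Inr (ract A1 v r)) - qmul (nlift (Inr v)) (nlift (Inl r)) : I"
   using r A_hcomp_mult[of v 1 r 0] v1 by (intro I0) (simp_all add: nlift_simps cl_lift c A_simps(2)[symmetric] del: One_nat_def)
 }
next
 have I0: "x - y : I" if "cl x = cl y" "x : carrier Q" "y : carrier Q" for x y using that cl_eq_iff by blast
 note c = lift_carrier QA_plus QA_mult qscale_closed
 note h = A_hcomp_plus A_hcomp_scale A_hcomp_one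
 fix v c assume v: "v : carrier A1"
 show "nlift (Inr (bscale A1 c v)) - qscale c (nlift (Inr v)) : I"
  using v by (intro I0) (simp_all add: nlift_simps cl_lift h c A_simps(3)[symmetric] del: One_nat_def)
 fix w assume w: "w : carrier A1"
 show "nlift (Inr (badd A1 v w)) - (nlift (Inr v) + nlift (Inr w)) : I"
  using v w by (intro I0) (simp_all add: nlift_simps cl_lift h c A_simps(1)[symmetric] del: One_nat_def)
qed

definition arrT where
 "arrT al be = (if al : B & be : B then N.lt (Inr (arrow al be)) else 0)"

lemma phi_epsT: "al : F ==> NR.phi (N.epsT al) - qterm [al] 0 1 : I"
proof (cases "al : B")
 case True
 assume al: "al : F"
 have "lift0 (idem al) - qterm [al] 0 1 : I"
  using cl_eq_iff[OF lift_carrier(1) Q_hcomp_carrier[OF vertex_hcomp[OF al, of 1]]] cl_lift(1)[OF idem_hcomp[OF al]]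
  by (simp add: idem_def)
 then show ?thesis using True by (simp add: N.epsT_def NR.phi_letter nlift_simps idem_hcomp al)
next
 case False
 assume al: "al : F"
 then show ?thesis using False I_facts(3)[OF I_facts(1) bad_path_I[of "[al]" 0 al 1]]
  by (simp add: N.epsT_def NR.phi_zero quiver_path_simps)
qed

lemma phi_arrT: "al : F ==> be : F ==> adjacent al be ==> NR.phi (arrT al be) - qterm [al, be] 0 1 : I"
proof (cases "al : B & be : B")
 case True
 assume al: "al : F" "be : F" "adjacent al be"
 have "lift1 (arrow al be) - qterm [al, be] 0 1 : I"
  using cl_eq_iff[OF lift_carrier(2) Q_hcomp_carrier[OF edge_hcomp[OF al, of 1]]] cl_lift(2)[OF arrow_hcomp[OF al]]
  by (simp add: arrow_def)
 then show ?thesis using True by (simp add: arrT_def NR.phi_letter nlift_simps arrow_hcomp al del: One_nat_def)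
next
 case False
 assume al: "al : F" "be : F" "adjacent al be"
 obtain v where "v : set [al, be]" "v : F - B" using False al by auto
 then have "qterm [al, be] 0 1 : I" using al by (intro bad_path_I) (auto simp: quiver_path_simps)
 then show ?thesis using False I_facts(3)[OF I_facts(1)] by (auto simp: arrT_def NR.phi_zero)
qed

lemma arrT_hcomp: "al : F ==> be : F ==> adjacent al be ==> arrT al be : hcomp N.Fr 1"
 using N.letter_hcomp(2)[of "arrow al be"] arrow_hcomp[of al be]
 by (auto simp: arrT_def N.FA.hcomp_eq N.FA.zero_in N.FA.hp_zero)

lemma reach_vertex_N: "al : F ==> qterm [al] 0 1 : NR.reach 0"
 unfolding NR.reach_def using phi_epsT N.epsT_hcomp Q_hcomp_carrier[OF vertex_hcomp] by blast

lemma reach_arrow_N: "al : F ==> be : F ==> adjacent al be ==> qterm [al, be] 0 1 : NR.reach 1"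
 unfolding NR.reach_def using phi_arrT arrT_hcomp Q_hcomp_carrier[OF edge_hcomp] by blast

lemma path2_I:
 assumes "al : F" "be : F" "ga : F" "adjacent al ga" "adjacent ga be" "x - qterm [al, ga] 0 1 : I" "y - qterm [ga, be] 0 1 : I"
  "y : carrier Q"
 shows "qmul x y - qterm [al, ga, be] 0 1 : I"
proof -
 have "qmul x y - qterm [al, ga, be] 0 1 =
  qmul (x - qterm [al, ga] 0 1) y + qmul (qterm [al, ga] 0 1) (y - qterm [ga, be] 0 1)"
  by (simp add: qmul_diff_l qmul_diff_r qmul_qterm)
 also have "... : I" by (intro I_facts(2,5,6) assms Q_hcomp_carrier[OF edge_hcomp])
 finally show ?thesis .
qed

text \<open>The candidate for the bimodule of relations: the whole degree 2 part of the kernel. That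
  it generates the kernel is \<open>kernel_nu\<close>.\<close>

definition W0 where
 "W0 = {X \<in> hcomp N.T 2. NR.nu X = \<zero>\<^bsub>A\<^esub>}"

abbreviation "L0 \<equiv> genideal N.T W0"

lemma W0_carrier: "W0 \<subseteq> carrier N.T"
 by (auto simp: W0_def N.T_hcomp N.T_carrier N.FA.hcomp_eq)

lemma nu_ring_hom: "ring_hom_ring N.T A NR.nu"
 by (rule ring_hom_ringI2[OF N.T.ring_axioms A.ring_axioms NR.nu_hom])

lemma ideal_L0: "ideal L0 N.T"
 by (rule N.T.genideal_ideal[OF W0_carrier])

lemma L0_kernel: "L0 \<subseteq> a_kernel N.T A NR.nu"
proof (rule N.T.genideal_minimal)
 interpret H: ring_hom_ring N.T A NR.nu by (rule nu_ring_hom)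
 show "ideal (a_kernel N.T A NR.nu) N.T" by (rule H.kernel_is_ideal)
 show "W0 \<subseteq> a_kernel N.T A NR.nu"
 proof
  fix X assume X: "X : W0"
  have "X : carrier N.T" using W0_carrier X by (rule subsetD)
  moreover have "NR.nu X = \<zero>\<^bsub>A\<^esub>" using X unfolding W0_def by (rule CollectE) (rule conjunct2)
  ultimately show "X : a_kernel N.T A NR.nu" unfolding a_kernel_def' by (intro CollectI conjI)
 qed
qed

text \<open>The square and loop relations demanded by \<open>quad_rep\<close> are of degree 2, so
  verifying them in the algebra places them in the ideal generated by \<open>W0\<close>.\<close>

lemma deg2_Kt:
 assumes "x : hcomp N.Fr 2" "NR.phi x : I"
 shows "x : N.Kt L0"
proof -
 have xF: "x : carrier N.Fr" using assms(1) by (simp add: N.FA.hcomp_eq)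
 have "N.tc x : W0" using assms xF NR.nu_zero_iff by (auto simp: W0_def N.T_hcomp)
 then have "N.tc x : L0" using N.T.genideal_self[OF W0_carrier] by blast
 then show ?thesis by (simp add: N.Kt_def N.rho_id xF)
qed

lemma fconst_hcomp: "x : hcomp N.Fr n ==> fconst c * x : hcomp N.Fr n"
 using N.FA.smult_closed[of x c] N.FA.hp_smult[of x n c] by (auto simp: N.FA.hcomp_eq N.Fr_simps)

lemma mult_hcomp: "x : hcomp N.Fr m ==> y : hcomp N.Fr n ==> x * y : hcomp N.Fr (m + n)"
 using N.FA.hp_mult[of x y m n] by (auto simp: N.FA.hcomp_eq N.Fr_simps N.Fr_mult)

text \<open>By (A3) each loop may be replaced by its variable; what remains is the form
  \<open>y\<close> at \<open>al\<close>, which vanishes by (A4). The elements \<open>x i\<close> are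
  arbitrary representatives of the loops.\<close>

lemma loop_sum_I:
 assumes "al : F" "y : U0" "\<forall>i. flip al i ~: F --> y i = 0"
  "!!i. i : E ==> flip al i : F ==> x i - qterm [al, flip al i, al] 0 1 : I"
 shows "(\<Sum>i\<in>E. qscale (y i) (x i)) : I"
proof -
 have "qscale (y i) (x i) - qterm [al] (single i 1) (y i) : I" if i: "i : E" for i
 proof (cases "flip al i : F")
  case True
  have "qterm [al, flip al i, al] 0 1 - qterm [al] (single i 1) 1 : I"
   using rels_A3[OF i assms(1) True] rels_I by blast
  from I_qscale[OF I_facts(2)[OF assms(4)[OF i True] this], of "y i"] show ?thesis
   by (simp add: qscale_simps)
 next
  case False
  then show ?thesis using assms(3) I_facts(1) by (simp add: qscale_simps qterm_def)
 qed
 then have "(\<Sum>i\<in>E. qscale (y i) (x i) - qterm [al] (single i 1) (y i)) : I" by (intro I_facts(7))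
 from I_facts(2)[OF this NR.form_I[OF assms(1,2)]] show ?thesis by (simp add: sum_subtractf)
qed

lemma quad_rep_N: "quad_rep P U (N.Kt L0) fconst N.epsT arrT"
proof -
 note K = N.Kt_cong[OF ideal_L0]
 have JK: "N.J \<subseteq> N.Kt L0" using N.J_Kt[OF ideal_L0] by blast
 interpret ring_cong "N.Kt L0" by (rule K)
 note rel = N.rel_cg[OF K JK]
 show ?thesis
 proof (intro quad_rep.intro vprog_axioms K quad_rep_axioms.intro)
  fix al be assume al: "al : F" and be: "be : F"
  show "cg (N.epsT al * N.epsT be) ((if al = be then N.epsT al else 0))"
   by (rule N.epsT_orth[OF K JK al be])
  assume adj: "adjacent al be"
  have "cg (N.lt (Inl (idem al)) * N.lt (Inr (arrow al be))) (N.lt (Inr (arrow al be)))"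
   using N.rels_mem(7)[of "idem al" "arrow al be"] idem_hcomp[OF al] arrow_hcomp[OF al be adj]
   by (intro cg_sym[OF rel]) (simp add: idem_arrow al be adj)
  then show "cg (N.epsT al * arrT al be) (arrT al be)" by (simp add: N.epsT_def arrT_def)
  have "cg (N.lt (Inr (arrow al be)) * N.lt (Inl (idem be))) (N.lt (Inr (arrow al be)))"
   using N.rels_mem(8)[of "idem be" "arrow al be"] idem_hcomp[OF be] arrow_hcomp[OF al be adj]
   by (intro cg_sym[OF rel]) (simp add: idem_arrow al be adj)
  then show "cg (arrT al be * N.epsT be) (arrT al be)" by (simp add: N.epsT_def arrT_def)
 next
  show "cg ((\<Sum>al\<in>F. N.epsT al)) (1)" by (rule N.epsT_one[OF K JK])
  show "al : F - B ==> cg (N.epsT al) 0" for al by (simp add: N.epsT_def)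
 next
  fix al be ga de assume sq: "{al, be, ga, de} \<subseteq> F" "distinct [al, be, ga, de]"
   "adjacent al ga" "adjacent al de" "adjacent be ga" "adjacent be de"
  have F4: "al : F" "be : F" "ga : F" "de : F" "adjacent ga be" "adjacent de be" using sq adjacent_sym by auto
  let ?x = "arrT al ga * arrT ga be" and ?y = "arrT al de * arrT de be"
  have h: "?x : hcomp N.Fr 2" "?y : hcomp N.Fr 2"
   using mult_hcomp[OF arrT_hcomp arrT_hcomp] F4 sq by (metis one_add_one)+
  have 1: "NR.phi ?x - qterm [al, ga, be] 0 1 : I" "NR.phi ?y - qterm [al, de, be] 0 1 : I"
   unfolding NR.phi_mult by (intro path2_I phi_arrT NR.phi_Q F4 sq)+
  have 2: "qterm [al, ga, be] 0 1 - qterm [al, de, be] 0 1 : I"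
   using rels_A2[OF sq] rels_I by blast
  have "(NR.phi ?x - qterm [al, ga, be] 0 1) + (qterm [al, ga, be] 0 1 - qterm [al, de, be] 0 1)
   - (NR.phi ?y - qterm [al, de, be] 0 1) : I" by (rule I_facts(3)[OF I_facts(2)[OF 1(1) 2] 1(2)])
  then have "NR.phi (?x - ?y) : I" by (simp add: NR.phi_diff)
  then show "cg (?x) (?y)" unfolding cg_def by (intro deg2_Kt N.hcomp_diff h)
 next
  fix al y assume a: "al : F" "y : U0" "\<forall>i. flip al i ~: F --> y i = 0"
  let ?l = "%i. arrT al (flip al i) * arrT (flip al i) al"
  have "fconst (y i) * ?l i : hcomp N.Fr 2" if i: "i : E" for i
  proof (cases "flip al i : F")
   case True
   have "?l i : hcomp N.Fr (1 + 1)"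
    using F_adj[OF a(1) i] a(1) True by (intro mult_hcomp arrT_hcomp) auto
   then show ?thesis using fconst_hcomp by (metis one_add_one)
  next
   case False
   then show ?thesis using a(3) by (simp add: N.FA.hcomp_eq N.FA.zero_in N.FA.hp_zero)
  qed
  then have h: "(\<Sum>i\<in>E. fconst (y i) * ?l i) : hcomp N.Fr 2"
   by (auto simp: N.FA.hcomp_eq N.FA.hp_sum N.FA.sum_closed)
  have "NR.phi (\<Sum>i\<in>E. fconst (y i) * ?l i) = (\<Sum>i\<in>E. qscale (y i) (NR.phi (?l i)))"
   by (simp only: NR.phi_sum NR.phi_fconst_mult)
  also have "... : I"
  proof (rule loop_sum_I[OF a])
   fix i assume i: "i : E" "flip al i : F"
   show "NR.phi (?l i) - qterm [al, flip al i, al] 0 1 : I"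
    unfolding NR.phi_mult using F_adj[OF a(1) i(1)] by (intro path2_I phi_arrT NR.phi_Q a(1) i) auto
  qed
  finally show "cg ((\<Sum>i\<in>E. fconst (y i) * ?l i)) (0)" unfolding cg_zero_iff by (rule deg2_Kt[OF h])
 next
  show "x * fconst a = fconst a * x" for x a by (rule fconst_commute)
 qed simp_all
qed

lemma letter_expand1:
 assumes "a : hcomp A 1"
 shows "N.lt (Inr a) - (\<Sum>(v, w)\<in>arrows. fconst (co [v, w] a) * arrT v w) : N.Kt L0"
proof -
 note K = N.Kt_cong[OF ideal_L0]
 have JK: "N.J \<subseteq> N.Kt L0" using N.J_Kt[OF ideal_L0] by blast
 interpret ring_cong "N.Kt L0" by (rule K)
 note rel = N.rel_cg[OF K JK]
 have *: "cg (N.lt (Inr (cl (\<Sum>(v, w)\<in>X. qterm [v, w] 0 (c v w))))) ((\<Sum>(v, w)\<in>X. fconst (c v w) * arrT v w))"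
  if "finite X" "X \<subseteq> arrows" for X and c :: "_ => _ => 'k"
  using that
 proof (induction X rule: finite_induct)
  case empty
  have "cl 0 : hcomp A 1" unfolding A_hcomp by (intro imageI Q_hcomp_zero)
  then have "cg (N.lt (Inr (0 \<odot>\<^bsub>A\<^esub> cl 0))) (fconst 0 * N.lt (Inr (cl 0)))"
   using N.rels_mem(6)[of "cl 0" 0] by (intro rel) simp
  then show ?case by (simp add: zero_A_scale)
 next
  case (insert s X)
  obtain v w where s: "s = (v, w)" by (cases s)
  let ?s = "\<Sum>(v, w)\<in>X. qterm [v, w] 0 (c v w)"
  have vw: "v : B" "w : B" "v : F" "w : F" "adjacent v w" using insert.prems arrowsD[of v w] s by auto
  have q: "?s : hcomp Q 1" by (intro Q_hcomp_sum) (use insert.prems arrowsD edge_hcomp in auto)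
  have sA: "cl ?s : hcomp A 1" unfolding A_hcomp by (intro imageI q)
  have e: "c v w \<odot>\<^bsub>A\<^esub> arrow v w : hcomp A 1" by (intro A_hcomp_scale arrow_hcomp vw)
  have eq: "cl (\<Sum>(v, w)\<in>insert s X. qterm [v, w] 0 (c v w)) = (c v w \<odot>\<^bsub>A\<^esub> arrow v w) \<oplus>\<^bsub>A\<^esub> cl ?s"
   using insert.hyps Q_hcomp_carrier[OF q] Q_hcomp_carrier[OF edge_hcomp[OF vw(3-5)]]
   by (simp add: s arrow_def A_simps qscale_simps)
  have "cg (N.lt (Inr ((c v w \<odot>\<^bsub>A\<^esub> arrow v w) \<oplus>\<^bsub>A\<^esub> cl ?s))) (N.lt (Inr (c v w \<odot>\<^bsub>A\<^esub> arrow v w)) + N.lt (Inr (cl ?s)))"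
   using N.rels_mem(5)[of "c v w \<odot>\<^bsub>A\<^esub> arrow v w" "cl ?s"] e sA by (intro rel) simp
  also have "cg ... (fconst (c v w) * N.lt (Inr (arrow v w)) + (\<Sum>(v, w)\<in>X. fconst (c v w) * arrT v w))"
  proof (rule cg_add)
   show "cg (N.lt (Inr (c v w \<odot>\<^bsub>A\<^esub> arrow v w))) (fconst (c v w) * N.lt (Inr (arrow v w)))"
    using N.rels_mem(6)[of "arrow v w" "c v w"] arrow_hcomp[OF vw(3-5)] by (intro rel) simp
  qed (use insert in simp)
  finally show ?case unfolding eq using insert.hyps vw by (simp add: arrT_def s)
 qed
 have "cg (N.lt (Inr a)) ((\<Sum>(v, w)\<in>arrows. fconst (co [v, w] a) * arrT v w))"
  using *[OF finite_arrows subset_refl, of "%v w. co [v, w] a"] unfolding A1_expand[OF assms, symmetric] .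
 then show ?thesis unfolding cg_def .
qed

lemma kernel_nu: "a_kernel N.T A NR.nu = L0"
proof (rule NR.nu_kernel[OF ideal_L0 _ quad_rep_N])
 show "X : L0 ==> NR.nu X = \<zero>\<^bsub>A\<^esub>" for X using L0_kernel by (auto simp: a_kernel_def kernel_def)
 interpret QR: quad_rep P U "N.Kt L0" fconst N.epsT arrT by (rule quad_rep_N)
 have JK: "N.J \<subseteq> N.Kt L0" using N.J_Kt[OF ideal_L0] by blast
 fix l assume "l : N.S"
 then consider r where "l = Inl r" "r : hcomp A 0" | v where "l = Inr v" "v : hcomp A 1" by (auto simp: N.S_def)
 then show "QR.Theta (nlift l) - N.lt l : N.Kt L0"
 proof cases
  case 1
  have "QR.Theta (nlift l) = (\<Sum>v\<in>B. fconst (co [v] r) * N.epsT v)"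
   using 1 by (simp add: nlift_simps lift0_def QR.Theta_sum QR.Theta_qterm QR.zmon_zero)
  then show ?thesis using QR.cg_sym[OF N.letter_expand0[OF N.Kt_cong[OF ideal_L0] JK 1(2)]] 1(1) by (simp add: QR.cg_def)
 next
  case 2
  have "QR.Theta (nlift l) = (\<Sum>(v, w)\<in>arrows. fconst (co [v, w] (projr l)) * (arrT v w * N.epsT w))"
   using 2 by (simp add: nlift_simps lift1_def QR.Theta_sum QR.Theta_qterm QR.zmon_zero split_def del: One_nat_def)
  also have "QR.cg ... (\<Sum>(v, w)\<in>arrows. fconst (co [v, w] (projr l)) * arrT v w)"
   unfolding split_def by (intro QR.cg_sum QR.cg_mult QR.cg_refl QR.arr_eps(2)) (auto dest: arrowsD)
  also have "QR.cg ... (N.lt l)"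
   using QR.cg_sym[of "N.lt l"] letter_expand1[OF 2(2)] 2(1) by (simp add: QR.cg_def)
  finally show ?thesis by (simp add: QR.cg_def)
 qed
qed

lemma eval_word_cl: "set w \<subseteq> N.S ==> eval_word A w = cl (NR.wlift w)"
proof (induction w)
 case Nil then show ?case by (simp add: eval_word_def A_simps)
next
 case (Cons l w)
 have "case_sum id id l = cl (nlift l)"
  using Cons.prems cl_lift by (auto simp: N.S_def nlift_simps simp del: One_nat_def)
 then have "eval_word A (l # w) = cl (nlift l) \<otimes>\<^bsub>A\<^esub> cl (NR.wlift w)" using Cons by (simp add: eval_word_def)
 then show ?case by (simp add: A_simps NR.lift_Q NR.wlift_Q)
qed

lemma eval_free_cl: "x : carrier N.Fr ==> eval_free A x = cl (NR.phi x)"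
proof -
 assume x: "x : carrier N.Fr"
 have "eval_free A x = (\<Oplus>\<^bsub>A\<^esub>w\<in>keys x. cl (qscale (lookup x w) (NR.wlift w)))"
  unfolding eval_free_def
 proof (rule A.add.finprod_cong'[OF refl])
  fix w assume "w : keys x"
  then have "set w \<subseteq> N.S" using x by (simp add: N.Fr_carrier in_keys_iff)
  then show "lookup x w \<odot>\<^bsub>A\<^esub> eval_word A w = cl (qscale (lookup x w) (NR.wlift w))"
   by (simp add: eval_word_cl A_simps NR.wlift_Q)
 qed (auto simp: A_carrier qscale_closed NR.wlift_Q)
 also have "... = cl (\<Sum>w\<in>keys x. qscale (lookup x w) (NR.wlift w))"
  unfolding A_eq by (rule QA.quot_finsum[OF ideal_I]) (auto simp: qscale_closed NR.wlift_Q)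
 also have "... = cl (NR.phi x)" by (simp add: NR.phi_def pm_sum_def)
 finally show ?thesis .
qed

lemma natural_map_nu: "X : carrier N.T ==> natural_map A X = NR.nu X"
proof -
 assume "X : carrier N.T"
 then obtain x where x: "X = N.tc x" "x : carrier N.Fr" by (auto simp: N.T_carrier)
 interpret J: ideal N.J N.Fr by (rule N.ideal_J)
 have "eval_free A y = NR.nu X" if y: "y : N.tc x" for y
 proof -
  have yF: "y : carrier N.Fr" by (rule J.a_elemrcos_carrier[OF x(2) y])
  have "N.tc x = N.tc y" by (rule J.a_repr_independence'[OF y x(2)])
  then show ?thesis using eval_free_cl[OF yF] NR.nu_tc[OF yF] x(1) by simp
 qed
 moreover have "x : N.tc x" by (rule J.a_rcos_self[OF x(2)])
 ultimately have "eval_free A ` X = {NR.nu X}" using x(1) by blast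
 then show ?thesis by (simp add: natural_map_def)
qed

lemma kernel_natural: "a_kernel N.T A (natural_map A) = a_kernel N.T A NR.nu"
 using natural_map_nu by (auto simp: a_kernel_def kernel_def)

lemma sub_bimodule_W0: "sub_bimodule_deg2 N.T W0"
proof -
 interpret H: ring_hom_ring N.T A NR.nu by (rule nu_ring_hom)
 have hT: "a : hcomp N.T n ==> a : carrier N.T" for a n
  by (auto simp: N.T_hcomp N.T_carrier N.FA.hcomp_eq)
 have sm: "c \<odot>\<^bsub>N.T\<^esub> X : hcomp N.T n" if X: "X : hcomp N.T n" for c X n
 proof -
  obtain x where x: "X = N.tc x" "x : hcomp N.Fr n" using X by (auto simp: N.T_hcomp)
  then have "c \<odot>\<^bsub>N.T\<^esub> X = N.tc (fconst c * x)" by (simp add: N.T_simps N.FA.hcomp_eq)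
  then show ?thesis using fconst_hcomp[OF x(2)] by (simp add: N.T_hcomp)
 qed
 have pl: "X \<oplus>\<^bsub>N.T\<^esub> Y : hcomp N.T n" if XY: "X : hcomp N.T n" "Y : hcomp N.T n" for X Y n
 proof -
  obtain x where x: "X = N.tc x" "x : hcomp N.Fr n" using XY(1) by (auto simp: N.T_hcomp)
  obtain y where y: "Y = N.tc y" "y : hcomp N.Fr n" using XY(2) by (auto simp: N.T_hcomp)
  have "X \<oplus>\<^bsub>N.T\<^esub> Y = N.tc (x + y)" using x y by (simp add: N.T_simps N.FA.hcomp_eq)
  then show ?thesis using N.hcomp_plus[OF x(2) y(2)] by (simp add: N.T_hcomp)
 qed
 have mu: "X \<otimes>\<^bsub>N.T\<^esub> Y : hcomp N.T (m + n)" if XY: "X : hcomp N.T m" "Y : hcomp N.T n" for X Y m n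
 proof -
  obtain x where x: "X = N.tc x" "x : hcomp N.Fr m" using XY(1) by (auto simp: N.T_hcomp)
  obtain y where y: "Y = N.tc y" "y : hcomp N.Fr n" using XY(2) by (auto simp: N.T_hcomp)
  have "X \<otimes>\<^bsub>N.T\<^esub> Y = N.tc (x * y)" using x y by (simp add: N.T_simps N.FA.hcomp_eq)
  then show ?thesis using mult_hcomp[OF x(2) y(2)] by (simp add: N.T_hcomp)
 qed
 have zero: "\<zero>\<^bsub>N.T\<^esub> : hcomp N.T n" for n
 proof -
  have "0 : hcomp N.Fr n" by (simp add: N.FA.hcomp_eq N.FA.zero_in N.FA.hp_zero)
  then show ?thesis by (simp add: N.T_simps N.T_hcomp)
 qed
 have inv: "\<ominus>\<^bsub>N.T\<^esub> X = (- 1) \<odot>\<^bsub>N.T\<^esub> X" if X: "X : carrier N.T" for X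
 proof -
  obtain x where x: "X = N.tc x" "x : carrier N.Fr" using X by (auto simp: N.T_carrier)
  have m: "- x : carrier N.Fr" using N.FA.a_inv_closed[OF x(2)] N.FA.uminus_eq[OF x(2)] by simp
  have "(- 1) \<odot>\<^bsub>N.T\<^esub> X \<oplus>\<^bsub>N.T\<^esub> X = \<zero>\<^bsub>N.T\<^esub>" using x m by (simp add: N.T_simps)
  then show ?thesis using X by (metis N.T.minus_equality N.T.smult_closed)
 qed
 have "subgroup W0 (add_monoid N.T)"
 proof
  show "W0 \<subseteq> carrier (add_monoid N.T)" using W0_carrier by simp
  show "\<one>\<^bsub>add_monoid N.T\<^esub> : W0" using zero by (simp add: W0_def)
  show "X \<otimes>\<^bsub>add_monoid N.T\<^esub> Y : W0" if "X : W0" "Y : W0" for X Y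
   using that pl hT by (auto simp: W0_def)
  show "inv\<^bsub>add_monoid N.T\<^esub> X : W0" if "X : W0" for X
  proof -
   have X: "X : carrier N.T" "X : hcomp N.T 2" "NR.nu X = \<zero>\<^bsub>A\<^esub>" using that hT by (auto simp: W0_def)
   have "\<ominus>\<^bsub>N.T\<^esub> X : W0" using X sm[OF X(2), of "- 1"] by (simp add: W0_def inv) (simp add: inv[symmetric])
   then show ?thesis by (simp add: a_inv_def)
  qed
 qed
 moreover have "a \<otimes>\<^bsub>N.T\<^esub> x : W0 & x \<otimes>\<^bsub>N.T\<^esub> a : W0" if "a : hcomp N.T 0" "x : W0" for a x
  using that mu[of a 0 x 2, unfolded add_0] mu[of x 2 a 0, unfolded add_0_right] hT[of a 0] hT[of x 2]
  by (simp add: W0_def)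
 moreover have "W0 \<subseteq> hcomp N.T 2" by (auto simp: W0_def)
 ultimately show ?thesis unfolding sub_bimodule_deg2_def by blast
qed

lemma quadratic_A: "quadratic A"
proof -
 have "natural_map A ` carrier N.T = NR.nu ` carrier N.T" using natural_map_nu by auto
 also have "... = carrier A" by (rule NR.nu_surj[OF reach_vertex_N reach_arrow_N])
 finally have "quadratic_with A W0"
  unfolding quadratic_with_def Let_def
  using graded_algebra_A sub_bimodule_W0 kernel_natural kernel_nu by simp
 then show ?thesis unfolding quadratic_def by blast
qed

text \<open>Any admissible relation space is the degree 2 part of the kernel, by
  \<open>Idl_deg2\<close>; nothing below depends on which \<open>W\<close> was given.\<close>

lemma quadratic_with_iff:
 assumes "quadratic_with A W" "X : hcomp N.T 2"
 shows "X : W \<longleftrightarrow> NR.nu X = \<zero>\<^bsub>A\<^esub>"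
proof -
 have W: "sub_bimodule_deg2 N.T W" "a_kernel N.T A (natural_map A) = genideal N.T W"
  using assms(1) by (auto simp: quadratic_with_def Let_def)
 have XT: "X : carrier N.T" using assms(2) by (auto simp: N.T_hcomp N.T_carrier N.FA.hcomp_eq)
 have WT: "W \<subseteq> carrier N.T" using W(1) by (auto simp: sub_bimodule_deg2_def N.T_hcomp N.T_carrier N.FA.hcomp_eq)
 have "NR.nu X = \<zero>\<^bsub>A\<^esub> \<longleftrightarrow> X : genideal N.T W"
  using W(2) XT unfolding kernel_natural by (auto simp: a_kernel_def kernel_def)
 also have "... \<longleftrightarrow> X : W"
  using N.Idl_deg2[OF W(1) _ assms(2)] N.T.genideal_self[OF WT] by blast
 finally show ?thesis by blast
qed

end

subsection \<open>The dual bimodule\<close>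

lemma sum_sum_list: "(\<Sum>p\<in>X. \<Sum>x\<leftarrow>xs. f x p) = (\<Sum>x\<leftarrow>xs. \<Sum>p\<in>X. f x p :: 'z::comm_monoid_add)"
 by (induction xs) (auto simp: sum.distrib)

lemma qterm_sum_list: "(\<Sum>y\<leftarrow>ys. qterm p m (f y)) = qterm p m (\<Sum>y\<leftarrow>ys. f y)"
proof (induction ys)
 case Nil then show ?case by (simp add: qterm_def)
next
 case (Cons y ys) then show ?case by (simp add: qterm_add)
qed

context vprog
begin

abbreviation "A1d \<equiv> dual_bimodule (degree_one (prog_algebra P U))"

lemma dual_carrier: "\<phi> : carrier A1d \<longleftrightarrow> (\<forall>v \<in> hcomp A 1. \<forall>w \<in> hcomp A 1. \<phi> (v \<oplus>\<^bsub>A\<^esub> w) = \<phi> v + \<phi> w) &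
  (\<forall>c. \<forall>v \<in> hcomp A 1. \<phi> (c \<odot>\<^bsub>A\<^esub> v) = c * \<phi> v) & (\<forall>v. v ~: hcomp A 1 --> \<phi> v = 0)"
 unfolding dual_bimodule_def by simp

lemma dual_simps: "badd A1d \<phi> \<psi> = (%v. \<phi> v + \<psi> v)" "bscale A1d c \<phi> = (%v. c * \<phi> v)"
 "lact A1d a \<phi> = (%v. if v : hcomp A 1 then \<phi> (v \<otimes>\<^bsub>A\<^esub> a) else 0)"
 "ract A1d \<phi> a = (%v. if v : hcomp A 1 then \<phi> (a \<otimes>\<^bsub>A\<^esub> v) else 0)"
 unfolding dual_bimodule_def by (simp_all cong: if_cong)

lemma A_hcomp_mult01: "r : hcomp A 0 ==> v : hcomp A n ==> r \<otimes>\<^bsub>A\<^esub> v : hcomp A n"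
 "r : hcomp A 0 ==> v : hcomp A n ==> v \<otimes>\<^bsub>A\<^esub> r : hcomp A n"
 using A_hcomp_mult[of r 0 v n, unfolded add_0] A_hcomp_mult[of v n r 0, unfolded add_0_right] by blast+

sublocale DT: tensor_A P U "dual_bimodule (degree_one (prog_algebra P U))"
proof unfold_locales
 note h = A_hcomp_plus A_hcomp_scale A_hcomp_mult01
 fix \<phi> assume \<phi>: "\<phi> : carrier A1d"
 then have p: "!!v w. v : hcomp A 1 ==> w : hcomp A 1 ==> \<phi> (v \<oplus>\<^bsub>A\<^esub> w) = \<phi> v + \<phi> w"
  "!!c v. v : hcomp A 1 ==> \<phi> (c \<odot>\<^bsub>A\<^esub> v) = c * \<phi> v" "!!v. v ~: hcomp A 1 ==> \<phi> v = 0"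
  unfolding dual_carrier by blast+
 show "bscale A1d c \<phi> : carrier A1d" for c
  unfolding dual_carrier dual_simps using p by (simp add: distrib_left del: One_nat_def)
 show "badd A1d \<phi> \<psi> : carrier A1d" if "\<psi> : carrier A1d" for \<psi>
  using \<phi> that unfolding dual_carrier dual_simps by (simp add: distrib_left del: One_nat_def)
 fix r assume "r : carrier (degree_zero A)"
 then have r: "r : hcomp A 0" by simp
 note rc = A_hcomp_carrier[OF r] and vc = A_hcomp_carrier
 show "lact A1d r \<phi> : carrier A1d"
  unfolding dual_carrier dual_simps
  using r rc vc p h by (simp add: A.l_distr A.smult_mult_l del: One_nat_def)
 show "ract A1d \<phi> r : carrier A1d"
  unfolding dual_carrier dual_simps
  using r rc vc p h by (simp add: A.r_distr A.smult_mult_r del: One_nat_def)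
qed (use A_hcomp_plus A_hcomp_scale A_hcomp_one A_hcomp_mult01 in simp_all)

lemma dual_sum:
 assumes \<phi>: "\<phi> : carrier A1d" and X: "finite X" "X \<subseteq> arrows"
 shows "\<phi> (cl (\<Sum>(v, w)\<in>X. qterm [v, w] 0 (c v w))) = (\<Sum>(v, w)\<in>X. c v w * \<phi> (arrow v w))"
 using X
proof (induction X rule: finite_induct)
 case empty
 have "cl 0 : hcomp A 1" unfolding A_hcomp by (intro imageI Q_hcomp_zero)
 then have "\<phi> (0 \<odot>\<^bsub>A\<^esub> cl 0) = 0 * \<phi> (cl 0)" using \<phi> unfolding dual_carrier by blast
 then show ?case unfolding zero_A_scale by simp
next
 case (insert s X)
 obtain v w where s: "s = (v, w)" by (cases s)
 let ?s = "\<Sum>(v, w)\<in>X. qterm [v, w] 0 (c v w)"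
 have vw: "v : F" "w : F" "adjacent v w" using insert.prems arrowsD[of v w] s by auto
 have q: "?s : hcomp Q 1" by (intro Q_hcomp_sum) (use insert.prems arrowsD edge_hcomp in auto)
 have sA: "cl ?s : hcomp A 1" unfolding A_hcomp by (intro imageI q)
 have ar: "arrow v w : hcomp A 1" by (rule arrow_hcomp[OF vw])
 have eq: "cl (\<Sum>(v, w)\<in>insert s X. qterm [v, w] 0 (c v w)) = (c v w \<odot>\<^bsub>A\<^esub> arrow v w) \<oplus>\<^bsub>A\<^esub> cl ?s"
  using insert.hyps Q_hcomp_carrier[OF q] Q_hcomp_carrier[OF edge_hcomp[OF vw]]
  by (simp add: s arrow_def A_simps qscale_simps)
 have "\<phi> ((c v w \<odot>\<^bsub>A\<^esub> arrow v w) \<oplus>\<^bsub>A\<^esub> cl ?s) = c v w * \<phi> (arrow v w) + \<phi> (cl ?s)"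
  using \<phi> A_hcomp_scale[OF ar] ar sA unfolding dual_carrier by simp
 then show ?case unfolding eq using insert by (simp add: s)
qed

lemma dual_eval:
 assumes "\<phi> : carrier A1d" "a : hcomp A 1"
 shows "\<phi> a = (\<Sum>(v, w)\<in>arrows. co [v, w] a * \<phi> (arrow v w))"
 using dual_sum[OF assms(1) finite_arrows subset_refl, of "%v w. co [v, w] a"]
 unfolding A1_expand[OF assms(2), symmetric] .

lemma arrow_mult:
 assumes "r : hcomp A 0" "(v, w) : arrows"
 shows "arrow v w \<otimes>\<^bsub>A\<^esub> r = co [w] r \<odot>\<^bsub>A\<^esub> arrow v w" "r \<otimes>\<^bsub>A\<^esub> arrow v w = co [v] r \<odot>\<^bsub>A\<^esub> arrow v w"
proof -
 have vw: "v : B" "w : B" "v : F" "w : F" "adjacent v w" using arrowsD[OF assms(2)] by auto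
 have r: "r = cl (lift0 r)" "lift0 r : carrier Q" using cl_lift(1)[OF assms(1)] lift_carrier by simp_all
 have q: "qterm [v, w] 0 1 : carrier Q" by (rule Q_hcomp_carrier[OF edge_hcomp[OF vw(3-5)]])
 have "qmul (qterm [v, w] 0 1) (lift0 r) = (\<Sum>u\<in>B. if u = w then qterm [v, w] 0 (co [w] r) else 0)"
  unfolding lift0_def qmul_sum_r by (rule sum.cong) (auto simp: qmul_qterm)
 then have 1: "qmul (qterm [v, w] 0 1) (lift0 r) = qscale (co [w] r) (qterm [v, w] 0 1)"
  using finite_B vw by (simp add: qscale_simps)
 have "qmul (lift0 r) (qterm [v, w] 0 1) = (\<Sum>u\<in>B. if u = v then qterm [v, w] 0 (co [v] r) else 0)"
  unfolding lift0_def qmul_sum_l by (rule sum.cong) (auto simp: qmul_qterm)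
 then have 2: "qmul (lift0 r) (qterm [v, w] 0 1) = qscale (co [v] r) (qterm [v, w] 0 1)"
  using finite_B vw by (simp add: qscale_simps)
 have "arrow v w \<otimes>\<^bsub>A\<^esub> cl (lift0 r) = co [w] r \<odot>\<^bsub>A\<^esub> arrow v w"
  unfolding arrow_def using q r(2) by (simp add: A_simps 1)
 then show "arrow v w \<otimes>\<^bsub>A\<^esub> r = co [w] r \<odot>\<^bsub>A\<^esub> arrow v w" unfolding r(1)[symmetric] .
 have "cl (lift0 r) \<otimes>\<^bsub>A\<^esub> arrow v w = co [v] r \<odot>\<^bsub>A\<^esub> arrow v w"
  unfolding arrow_def using q r(2) by (simp add: A_simps 2)
 then show "r \<otimes>\<^bsub>A\<^esub> arrow v w = co [v] r \<odot>\<^bsub>A\<^esub> arrow v w" unfolding r(1)[symmetric] .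
qed

text \<open>The basis of the dual bimodule dual to the arrows, extended by 0 outside degree 1 as
  \<open>dual_bimodule\<close> requires.\<close>

definition delta :: "('e => sign) => ('e => sign) => (('e => sign) list \<Rightarrow>\<^sub>0 ('e, 'k) mpoly) set => 'k" where
 "delta v w a = (if a : hcomp A 1 then co [v, w] a else 0)"

lemma arrow_hcomp': "(v, w) : arrows ==> arrow v w : hcomp A 1"
 using arrow_hcomp arrowsD by blast

lemma co_scale: "a : carrier A ==> set p \<subseteq> B ==> length p \<le> 2 ==> co p (c \<odot>\<^bsub>A\<^esub> a) = c * co p a"
 by (rule co_linear(2))

lemma delta_carrier: "(v, w) : arrows ==> delta v w : carrier A1d"
 unfolding dual_carrier delta_def
 using A_hcomp_plus A_hcomp_scale A_hcomp_carrier arrowsD[of v w] by (simp add: co_linear(1) co_scale del: One_nat_def)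

lemma delta_arrow: "(v, w) : arrows ==> (v', w') : arrows ==>
  delta v w (arrow v' w') = (if v = v' & w = w' then 1 else 0)"
 using arrow_hcomp'[of v' w'] by (simp add: delta_def co_arrow)

lemma delta_expand:
 assumes "\<phi> : carrier A1d"
 shows "\<phi> = (%a. \<Sum>(v, w)\<in>arrows. \<phi> (arrow v w) * delta v w a)"
proof
 fix a show "\<phi> a = (\<Sum>(v, w)\<in>arrows. \<phi> (arrow v w) * delta v w a)"
 proof (cases "a : hcomp A 1")
  case True
  then show ?thesis unfolding dual_eval[OF assms True] by (simp add: delta_def mult.commute)
 next
  case False
  then have "\<phi> a = 0" using assms unfolding dual_carrier by blast
  then show ?thesis using False by (simp add: delta_def split_def)
 qed
qed

definition path2 :: "(('e => sign) \<times> ('e => sign) \<times> ('e => sign)) set" where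
 "path2 = {(a, c, b). (a, c) : arrows & (c, b) : arrows}"

lemma finite_path2: "finite path2"
 by (rule finite_subset[of _ "B \<times> B \<times> B"]) (auto simp: path2_def arrows_def finite_B)

lemma path2_sum:
 "(\<Sum>p\<in>arrows. \<Sum>q\<in>arrows. if snd p = fst q then h (fst p) (snd p) (snd q) else 0) =
  (\<Sum>(a, c, b)\<in>path2. h a c b :: 'z::comm_monoid_add)"
proof -
 have "(\<Sum>p\<in>arrows. \<Sum>q\<in>arrows. if snd p = fst q then h (fst p) (snd p) (snd q) else 0) =
  (\<Sum>s\<in>arrows \<times> arrows. if snd (fst s) = fst (snd s) then h (fst (fst s)) (snd (fst s)) (snd (snd s)) else 0)"
  by (simp add: sum.cartesian_product split_def)
 also have "... = (\<Sum>s\<in>{s \<in> arrows \<times> arrows. snd (fst s) = fst (snd s)}. h (fst (fst s)) (snd (fst s)) (snd (snd s)))"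
  by (rule sum.inter_filter[symmetric]) (simp add: finite_arrows)
 also have "... = (\<Sum>(a, c, b)\<in>path2. h a c b)"
  by (rule sum.reindex_bij_witness[of _ "%(a, c, b). ((a, c), (c, b))" "%((a, c), (c', b)). (a, c, b)"])
   (auto simp: path2_def)
 finally show ?thesis .
qed

lemma qmul_arrows:
 "qmul (\<Sum>(v, w)\<in>arrows. qterm [v, w] 0 (f v w)) (\<Sum>(v, w)\<in>arrows. qterm [v, w] 0 (g v w)) =
  (\<Sum>(a, c, b)\<in>path2. qterm [a, c, b] 0 (f a c * g c b :: 'k))"
 unfolding path2_sum[symmetric, where h = "%a c b. qterm [a, c, b] 0 (f a c * g c b)"]
 unfolding qmul_sum_l unfolding qmul_sum_r by (intro sum.cong refl) (auto simp: qmul_qterm split_def)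

text \<open>Degree 2 elements of the tensor algebras, in coordinates indexed by the paths of length 2.\<close>

definition coeffs where
 "coeffs ys a c b = (\<Sum>(v, w)\<leftarrow>ys. co [a, c] v * co [c, b] w)"

definition dual_coeffs where
 "dual_coeffs xs a c b = (\<Sum>(\<phi>, \<psi>)\<leftarrow>xs. \<psi> (arrow a c) * \<phi> (arrow c b) :: 'k)"


text \<open>The idempotent between the factors selects composable pairs of arrows. \<psi> reads the
  first arrow and \<phi> the second, the reversal built into \<open>dual_pairing\<close>.\<close>

lemma pairing_single:
 assumes "\<phi> : carrier A1d" "\<psi> : carrier A1d" "v : hcomp A 1" "w : hcomp A 1"
 shows "(\<Sum>ga\<in>B. \<psi> (v \<otimes>\<^bsub>A\<^esub> idem ga) * \<phi> (idem ga \<otimes>\<^bsub>A\<^esub> w)) =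
  (\<Sum>(a, c, b)\<in>path2. (\<psi> (arrow a c) * \<phi> (arrow c b)) * (co [a, c] v * co [c, b] w))"
proof -
 let ?x = "%p. co [fst p, snd p] v * \<psi> (arrow (fst p) (snd p))"
 let ?y = "%p. co [fst p, snd p] w * \<phi> (arrow (fst p) (snd p))"
 have l: "\<psi> (v \<otimes>\<^bsub>A\<^esub> idem ga) = (\<Sum>p\<in>arrows. if snd p = ga then ?x p else 0)" if g: "ga : B" for ga
 proof -
  have i: "idem ga : hcomp A 0" by (rule idem_hcomp[OF B_F[OF g]])
  show ?thesis unfolding dual_eval[OF assms(2) A_hcomp_mult01(2)[OF i assms(3)]]
  proof (rule sum.cong[OF refl])
   fix p assume p: "p : arrows"
   obtain a c where ac: "p = (a, c)" by (cases p)
   have "a : B" "c : B" using p arrowsD unfolding ac by blast+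
   then show "(case p of (a, c) => co [a, c] (v \<otimes>\<^bsub>A\<^esub> idem ga) * \<psi> (arrow a c)) = (if snd p = ga then ?x p else 0)"
    unfolding ac using co_mult(2)[OF i A_hcomp_carrier[OF assms(3)], of "[a]" c] g by (simp add: co_idem)
  qed
 qed
 have r: "\<phi> (idem ga \<otimes>\<^bsub>A\<^esub> w) = (\<Sum>q\<in>arrows. if ga = fst q then ?y q else 0)" if g: "ga : B" for ga
 proof -
  have i: "idem ga : hcomp A 0" by (rule idem_hcomp[OF B_F[OF g]])
  show ?thesis unfolding dual_eval[OF assms(1) A_hcomp_mult01(1)[OF i assms(4)]]
  proof (rule sum.cong[OF refl])
   fix p assume p: "p : arrows"
   obtain c b where cb: "p = (c, b)" by (cases p)
   have "b : B" "c : B" using p arrowsD unfolding cb by blast+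
   then show "(case p of (c, b) => co [c, b] (idem ga \<otimes>\<^bsub>A\<^esub> w) * \<phi> (arrow c b)) = (if ga = fst p then ?y p else 0)"
    unfolding cb using co_mult(1)[OF i A_hcomp_carrier[OF assms(4)], of c "[b]"] g by (simp add: co_idem)
  qed
 qed
 have "(\<Sum>ga\<in>B. \<psi> (v \<otimes>\<^bsub>A\<^esub> idem ga) * \<phi> (idem ga \<otimes>\<^bsub>A\<^esub> w)) =
  (\<Sum>ga\<in>B. \<Sum>p\<in>arrows. \<Sum>q\<in>arrows. if snd p = ga then if ga = fst q then ?x p * ?y q else 0 else 0)"
  by (intro sum.cong refl) (auto simp: l r sum_product intro!: sum.cong)
 also have "... = (\<Sum>p\<in>arrows. \<Sum>q\<in>arrows. \<Sum>ga\<in>B. if snd p = ga then if ga = fst q then ?x p * ?y q else 0 else 0)"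
  by (simp only: sum.swap[where A = B])
 also have "... = (\<Sum>p\<in>arrows. \<Sum>q\<in>arrows. if snd p = fst q then ?x p * ?y q else 0)"
 proof (intro sum.cong refl)
  fix p q assume "p : arrows"
  then have "snd p : B" using arrowsD[of "fst p" "snd p"] by simp
  then show "(\<Sum>ga\<in>B. if snd p = ga then if ga = fst q then ?x p * ?y q else 0 else 0) = (if snd p = fst q then ?x p * ?y q else 0)"
   using finite_B by (simp add: sum.delta')
 qed
 also have "... = (\<Sum>p\<in>arrows. \<Sum>q\<in>arrows. if snd p = fst q then
   (\<psi> (arrow (fst p) (snd p)) * \<phi> (arrow (snd p) (snd q))) * (co [fst p, snd p] v * co [snd p, snd q] w) else 0)"
  by (intro sum.cong refl) auto
 also have "... = (\<Sum>(a, c, b)\<in>path2. (\<psi> (arrow a c) * \<phi> (arrow c b)) * (co [a, c] v * co [c, b] w))"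
  by (rule path2_sum)
 finally show ?thesis .
qed

lemma pairing_coeffs:
 assumes "set xs \<subseteq> carrier A1d \<times> carrier A1d" "set ys \<subseteq> hcomp A 1 \<times> hcomp A 1"
 shows "dual_pairing A B (prog_idem P U) xs ys = (\<Sum>(a, c, b)\<in>path2. dual_coeffs xs a c b * coeffs ys a c b)"
proof -
 have "dual_pairing A B (prog_idem P U) xs ys = (\<Sum>x\<leftarrow>xs. \<Sum>y\<leftarrow>ys. \<Sum>(a, c, b)\<in>path2.
   (snd x (arrow a c) * fst x (arrow c b)) * (co [a, c] (fst y) * co [c, b] (snd y)))"
  unfolding dual_pairing_def prog_idem_eq split_def
 proof (intro arg_cong[where f = sum_list] map_cong refl)
  fix x y assume "x : set xs" "y : set ys"
  then have "fst x : carrier A1d" "snd x : carrier A1d" "fst y : hcomp A 1" "snd y : hcomp A 1" using assms by auto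
  from pairing_single[OF this]
  show "(\<Sum>al\<in>B. snd x (fst y \<otimes>\<^bsub>A\<^esub> idem al) * fst x (idem al \<otimes>\<^bsub>A\<^esub> snd y)) =
   (\<Sum>p\<in>path2. snd x (arrow (fst p) (fst (snd p))) * fst x (arrow (fst (snd p)) (snd (snd p))) *
    (co [fst p, fst (snd p)] (fst y) * co [fst (snd p), snd (snd p)] (snd y)))"
   by (simp add: split_def)
 qed
 also have "... = (\<Sum>(a, c, b)\<in>path2. dual_coeffs xs a c b * coeffs ys a c b)"
  unfolding dual_coeffs_def coeffs_def split_def sum_list_mult_const[symmetric]
  unfolding sum_list_const_mult[symmetric] sum_sum_list ..
 finally show ?thesis .
qed

lemma (in tensor_A) letters_hcomp:
 assumes "set ys \<subseteq> carrier V \<times> carrier V"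
 shows "(\<Sum>(v, w)\<leftarrow>ys. letter (Inr v) * letter (Inr w)) : hcomp Fr 2"
 using assms
proof (induction ys)
 case Nil then show ?case by (simp add: FA.hcomp_eq FA.zero_in FA.hp_zero)
next
 case (Cons y ys)
 have "single [Inr (fst y), Inr (snd y)] 1 : hcomp Fr 2"
  by (rule single_hcomp) (use Cons.prems in \<open>auto simp: S_def dg_def word_degree_def\<close>)
 then have "letter (Inr (fst y)) * letter (Inr (snd y)) : hcomp Fr 2"
  by (simp add: letter_def single_word_mult)
 then show ?case using Cons by (auto simp: split_def intro: hcomp_plus)
qed

lemma (in tensor_A) tensor_sum_eq:
 "tensor_sum (degree_zero (prog_algebra P U)) V ys = tc (\<Sum>(v, w)\<leftarrow>ys. letter (Inr v) * letter (Inr w))"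
 unfolding tensor_sum_def by (simp add: letter_def single_word_mult)

text \<open>Membership in \<open>W\<close> becomes a question about linear combinations of paths of
  length 2 in the quiver ideal, by \<open>quadratic_with_iff\<close> and the lifts.\<close>

lemma tensor_sum_W:
 assumes W: "quadratic_with A W" and ys: "set ys \<subseteq> hcomp A 1 \<times> hcomp A 1"
 shows "tensor_sum A0 A1 ys : W \<longleftrightarrow> (\<Sum>(a, c, b)\<in>path2. qterm [a, c, b] 0 (coeffs ys a c b)) : I"
proof -
 let ?x = "\<Sum>(v, w)\<leftarrow>ys. letter (Inr v) * letter (Inr w)"
 have x: "?x : hcomp N.Fr 2" using N.letters_hcomp[of ys] ys by simp
 have "NR.phi ?x = (\<Sum>(v, w)\<leftarrow>ys. qmul (lift1 v) (lift1 w))"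
  using ys
 proof (induction ys)
  case (Cons y ys)
  then show ?case
   by (cases y) (simp add: NR.phi_add NR.phi_mult NR.phi_letter nlift_simps del: One_nat_def)
 qed (simp add: NR.phi_zero)
 also have "... = (\<Sum>(v, w)\<leftarrow>ys. \<Sum>(a, c, b)\<in>path2. qterm [a, c, b] 0 (co [a, c] v * co [c, b] w))"
  unfolding lift1_def qmul_arrows ..
 also have "... = (\<Sum>(a, c, b)\<in>path2. \<Sum>y\<leftarrow>ys. qterm [a, c, b] 0 (co [a, c] (fst y) * co [c, b] (snd y)))"
  by (simp add: sum_sum_list split_def)
 also have "... = (\<Sum>(a, c, b)\<in>path2. qterm [a, c, b] 0 (coeffs ys a c b))"
  by (simp add: qterm_sum_list coeffs_def split_def)
 finally have ph: "NR.phi ?x = (\<Sum>(a, c, b)\<in>path2. qterm [a, c, b] 0 (coeffs ys a c b))" .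
 have "N.tc ?x : hcomp N.T 2" using x by (auto simp: N.T_hcomp)
 then have "N.tc ?x : W \<longleftrightarrow> NR.nu (N.tc ?x) = \<zero>\<^bsub>A\<^esub>" by (rule quadratic_with_iff[OF W])
 also have "... \<longleftrightarrow> NR.phi ?x : I" using x by (intro NR.nu_zero_iff) (simp add: N.FA.hcomp_eq)
 finally show ?thesis unfolding N.tensor_sum_eq ph .
qed

lemma sum_list_path2:
 obtains ps where "distinct ps" "set ps = path2"
 using finite_distinct_list[OF finite_path2] by blast

text \<open>The annihilator condition is stated for lists of tensors; since lists realise arbitrary
  coefficients on \<open>path2\<close>, it is orthogonality to all combinations of paths of length 2
  that lie in \<open>I\<close>.\<close>

lemma perp_coeffs:
 assumes W: "quadratic_with A W" and X: "X : perp A B (prog_idem P U) W"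
 obtains xs where "X = tensor_sum A0 A1d xs" "set xs \<subseteq> carrier A1d \<times> carrier A1d"
  "!!f. (\<Sum>(a, c, b)\<in>path2. qterm [a, c, b] 0 (f a c b)) : I ==> (\<Sum>(a, c, b)\<in>path2. dual_coeffs xs a c b * f a c b) = 0"
proof -
 obtain xs where xs: "X = tensor_sum A0 A1d xs" "set xs \<subseteq> carrier A1d \<times> carrier A1d"
  "\<forall>ys. set ys \<subseteq> carrier A1 \<times> carrier A1 & tensor_sum A0 A1 ys : W --> dual_pairing A B (prog_idem P U) xs ys = 0"
  using X unfolding perp_def Let_def by blast
 have "(\<Sum>(a, c, b)\<in>path2. dual_coeffs xs a c b * f a c b) = 0"
  if f: "(\<Sum>(a, c, b)\<in>path2. qterm [a, c, b] 0 (f a c b)) : I" for f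
 proof -
  obtain ps where ps: "distinct ps" "set ps = path2" by (rule sum_list_path2)
  \<comment> \<open>One tensor of arrows for each path of length 2, scaled so that its coefficient
    there is \<open>f a c b\<close>.\<close>
  define ys where "ys = map (%(a, c, b). (f a c b \<odot>\<^bsub>A\<^esub> arrow a c, arrow c b)) ps"
  have ysA: "set ys \<subseteq> hcomp A 1 \<times> hcomp A 1"
   using ps(2) arrow_hcomp' A_hcomp_scale by (auto simp: ys_def path2_def simp del: One_nat_def)
  have cf: "coeffs ys a c b = f a c b" if p: "(a, c, b) : path2" for a c b
  proof -
   have ac: "(a, c) : arrows" "(c, b) : arrows" using p by (auto simp: path2_def)
   have "coeffs ys a c b = (\<Sum>q\<in>path2. case q of (a', c', b') => co [a, c] (f a' c' b' \<odot>\<^bsub>A\<^esub> arrow a' c') * co [c, b] (arrow c' b'))"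
    by (simp add: sum.distinct_set_conv_list[OF ps(1), unfolded ps(2)] coeffs_def ys_def split_def o_def)
   also have "... = (\<Sum>q\<in>path2. if q = (a, c, b) then f a c b else 0)"
   proof (rule sum.cong[OF refl])
    fix q assume q: "q : path2"
    obtain a' c' b' where q': "q = (a', c', b')" by (cases q) auto
    have r: "(a', c') : arrows" "(c', b') : arrows" using q q' by (auto simp: path2_def)
    have "a : B" "c : B" using arrowsD[OF ac(1)] by auto
    then have "co [a, c] (f a' c' b' \<odot>\<^bsub>A\<^esub> arrow a' c') = f a' c' b' * co [a, c] (arrow a' c')"
     using A_hcomp_carrier[OF arrow_hcomp'[OF r(1)]] by (intro co_scale) auto
    then show "(case q of (a', c', b') => co [a, c] (f a' c' b' \<odot>\<^bsub>A\<^esub> arrow a' c') * co [c, b] (arrow c' b')) =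
     (if q = (a, c, b) then f a c b else 0)"
     using ac r by (auto simp: q' co_arrow)
   qed
   also have "... = f a c b" using p finite_path2 by simp
   finally show ?thesis .
  qed
  have "(\<Sum>(a, c, b)\<in>path2. qterm [a, c, b] 0 (coeffs ys a c b)) = (\<Sum>(a, c, b)\<in>path2. qterm [a, c, b] 0 (f a c b) :: ('e => sign, 'e, 'k) qalg)"
   by (rule sum.cong) (auto simp: cf)
  then have "tensor_sum A0 A1 ys : W" unfolding tensor_sum_W[OF W ysA] using f by simp
  then have "dual_pairing A B (prog_idem P U) xs ys = 0" using xs(3) ysA by simp
  then have "(\<Sum>(a, c, b)\<in>path2. dual_coeffs xs a c b * coeffs ys a c b) = 0"
   unfolding pairing_coeffs[OF xs(2) ysA] .
  moreover have "(\<Sum>(a, c, b)\<in>path2. dual_coeffs xs a c b * coeffs ys a c b) = (\<Sum>(a, c, b)\<in>path2. dual_coeffs xs a c b * f a c b)"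
   by (rule sum.cong) (auto simp: cf)
  ultimately show ?thesis by simp
 qed
 then show thesis by (rule that[OF xs(1,2)])
qed

lemma perp_hcomp:
 assumes "X : perp A B (prog_idem P U) W"
 shows "X : hcomp DT.T 2"
proof -
 obtain xs where xs: "X = tensor_sum A0 A1d xs" "set xs \<subseteq> carrier A1d \<times> carrier A1d"
  using assms unfolding perp_def Let_def by blast
 show ?thesis unfolding xs(1) DT.tensor_sum_eq DT.T_hcomp by (intro imageI DT.letters_hcomp xs(2))
qed

abbreviation "L1 W \<equiv> genideal DT.T (perp A B (prog_idem P U) W)"

lemma perp_carrier: "perp A B (prog_idem P U) W \<subseteq> carrier DT.T"
 using perp_hcomp by (auto simp: DT.T_hcomp DT.T_carrier DT.FA.hcomp_eq)

lemma ideal_L1: "ideal (L1 W) DT.T"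
 by (rule DT.T.genideal_ideal[OF perp_carrier])

text \<open>A functional that vanishes on \<open>I\<close> restricts to paths of length 2 as an
  element of the annihilator of \<open>W\<close>. In terms of dual letters the second arrow of a
  path comes first, and \<open>s\<close> is a scalar left free for the later sign
  normalisation.\<close>

lemma kills_perp:
 assumes W: "quadratic_with A W" and f: "kills f"
 shows "(\<Sum>(a, c, b)\<in>path2. fconst (s * f [a, c, b] 0) * (letter (Inr (delta c b)) * letter (Inr (delta a c)))) : DT.Kt (L1 W)"
  (is "?y : _")
proof -
 note K = DT.Kt_cong[OF ideal_L1, of W]
 have JK: "DT.J \<subseteq> DT.Kt (L1 W)" using DT.J_Kt[OF ideal_L1] by blast
 interpret ring_cong "DT.Kt (L1 W)" by (rule K)
 note rel = DT.rel_cg[OF K JK]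
 obtain ps where ps: "distinct ps" "set ps = path2" by (rule sum_list_path2)
 define h where "h a c b = s * f [a, c, b] 0" for a c b
 define xs where "xs = map (%(a, c, b). (bscale A1d (h a c b) (delta c b), delta a c)) ps"
 have xsA: "set xs \<subseteq> carrier A1d \<times> carrier A1d"
  using ps(2) delta_carrier DT.V_closed(2) by (auto simp: xs_def path2_def)
 have dc: "dual_coeffs xs a c b = h a c b" if p: "(a, c, b) : path2" for a c b
 proof -
  have ac: "(a, c) : arrows" "(c, b) : arrows" using p by (auto simp: path2_def)
  have "dual_coeffs xs a c b = (\<Sum>q\<in>path2. case q of (a', c', b') => delta a' c' (arrow a c) * (h a' c' b' * delta c' b' (arrow c b)))"
   by (simp add: sum.distinct_set_conv_list[OF ps(1), unfolded ps(2)] dual_coeffs_def xs_def split_def o_def dual_simps)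
  also have "... = (\<Sum>q\<in>path2. if q = (a, c, b) then h a c b else 0)"
  proof (rule sum.cong[OF refl])
   fix q assume q: "q : path2"
   obtain a' c' b' where q': "q = (a', c', b')" by (cases q) auto
   have r: "(a', c') : arrows" "(c', b') : arrows" using q q' by (auto simp: path2_def)
   show "(case q of (a', c', b') => delta a' c' (arrow a c) * (h a' c' b' * delta c' b' (arrow c b))) = (if q = (a, c, b) then h a c b else 0)"
    by (auto simp: q' delta_arrow[OF r(1) ac(1)] delta_arrow[OF r(2) ac(2)])
  qed
  also have "... = h a c b" using p finite_path2 by simp
  finally show ?thesis .
 qed
 have "dual_pairing A B (prog_idem P U) xs ys = 0" if ys: "set ys \<subseteq> carrier A1 \<times> carrier A1" "tensor_sum A0 A1 ys : W" for ys
 proof -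
  have ysA: "set ys \<subseteq> hcomp A 1 \<times> hcomp A 1" using ys(1) by simp
  have "(\<Sum>(a, c, b)\<in>path2. qterm [a, c, b] 0 (coeffs ys a c b)) : I"
   using ys(2) unfolding tensor_sum_W[OF W ysA] .
  then have "lam f (\<Sum>(a, c, b)\<in>path2. qterm [a, c, b] 0 (coeffs ys a c b)) = 0" using f by (simp add: kills_def)
  then have z: "(\<Sum>(a, c, b)\<in>path2. coeffs ys a c b * f [a, c, b] 0) = 0" by (simp add: lam_sum lam_qterm split_def)
  have "dual_pairing A B (prog_idem P U) xs ys = (\<Sum>(a, c, b)\<in>path2. s * (coeffs ys a c b * f [a, c, b] 0))"
   unfolding pairing_coeffs[OF xsA ysA] by (rule sum.cong) (auto simp: dc h_def)
  also have "... = s * (\<Sum>(a, c, b)\<in>path2. coeffs ys a c b * f [a, c, b] 0)" by (simp add: sum_distrib_left split_def)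
  finally show ?thesis unfolding z by simp
 qed
 then have "tensor_sum A0 A1d xs : perp A B (prog_idem P U) W" unfolding perp_def Let_def using xsA by blast
 then have "tensor_sum A0 A1d xs : L1 W" using DT.T.genideal_self[OF perp_carrier] by blast
 moreover have "(\<Sum>(v, w)\<leftarrow>xs. letter (Inr v) * letter (Inr w)) : carrier DT.Fr" (is "?x : _")
  using DT.letters_hcomp[OF xsA] by (simp add: DT.FA.hcomp_eq)
 ultimately have "cg ?x 0" unfolding DT.tensor_sum_eq cg_zero_iff by (simp add: DT.Kt_def DT.rho_id)
 moreover have "cg ?x ?y"
 proof -
  have "?x = (\<Sum>(a, c, b)\<in>path2. letter (Inr (bscale A1d (h a c b) (delta c b))) * letter (Inr (delta a c)))"
   by (simp add: sum.distinct_set_conv_list[OF ps(1), unfolded ps(2)] xs_def split_def o_def)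
  also have "cg ... (\<Sum>(a, c, b)\<in>path2. (fconst (h a c b) * letter (Inr (delta c b))) * letter (Inr (delta a c)))"
   unfolding split_def
  proof (intro cg_sum cg_mult cg_refl rel DT.rels_mem(6) delta_carrier)
   fix p assume "p : path2"
   then show "(fst (snd p), snd (snd p)) : arrows" by (auto simp: path2_def)
  qed
  finally show ?thesis unfolding h_def mult.assoc .
 qed
 ultimately have "cg ?y 0" using cg_trans[OF cg_sym] by blast
 then show ?thesis unfolding cg_zero_iff .
qed

end

subsection \<open>The quadratic dual\<close>

lemma fconst_sum: "fconst (sum f X) = (\<Sum>i\<in>X. fconst (f i))"
 by (induction X rule: infinite_finite_induct) auto

lemma fconst_mult2: "(fconst a * x) * (fconst b * y) = fconst (a * b) * (x * y)"
 unfolding mult.assoc fconst_left_commute[of x b] fconst_simps(4) ..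

context vprog
begin

lemma lift0_qmul:
 assumes "v : B"
 shows "qmul (lift0 r) (qterm (v # p) m c) = qterm (v # p) m (co [v] r * c)"
  and "qmul (qterm [w, v] m c) (lift0 r) = qterm [w, v] m (c * co [v] r)"
proof -
 have "qmul (lift0 r) (qterm (v # p) m c) = (\<Sum>u\<in>B. if u = v then qterm (v # p) m (co [v] r * c) else 0)"
  unfolding lift0_def qmul_sum_l by (rule sum.cong) (auto simp: qmul_qterm)
 then show "qmul (lift0 r) (qterm (v # p) m c) = qterm (v # p) m (co [v] r * c)" using finite_B assms by simp
 have "qmul (qterm [w, v] m c) (lift0 r) = (\<Sum>u\<in>B. if u = v then qterm [w, v] m (c * co [v] r) else 0)"
  unfolding lift0_def qmul_sum_r by (rule sum.cong) (auto simp: qmul_qterm)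
 then show "qmul (qterm [w, v] m c) (lift0 r) = qterm [w, v] m (c * co [v] r)" using finite_B assms by simp
qed

lemma arrows_sym: "(v, w) : arrows \<longleftrightarrow> (w, v) : arrows"
 using adjacent_sym by (auto simp: arrows_def)

lemma square_I:
 assumes "{al, be, ga, de} \<subseteq> F" "distinct [al, be, ga, de]" "adjacent al ga" "adjacent al de" "adjacent be ga" "adjacent be de"
 shows "qterm [al, ga, be] 0 1 - qterm [al, de, be] 0 1 : I" "de ~: B ==> qterm [al, ga, be] 0 1 : I"
proof -
 show a: "qterm [al, ga, be] 0 1 - qterm [al, de, be] 0 1 : I" using rels_A2[OF assms] rels_I by blast
 assume "de ~: B"
 then have "qterm [al, de, be] 0 1 : I"
  using assms adjacent_sym by (intro bad_path_I[of _ _ de]) (auto simp: quiver_path_simps)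
 from I_facts(2)[OF a this] show "qterm [al, ga, be] 0 1 : I" by simp
qed

text \<open>A relation between loops at \<open>al\<close>, from (A3) and (A4), with the loops
  through unbounded topes removed by (A1).\<close>

lemma loop_restrict:
 assumes al: "al : F" and y: "y : U0" "\<forall>i. flip al i ~: F --> y i = 0"
 shows "(\<Sum>i\<in>{i \<in> E. flip al i : B}. qterm [al, flip al i, al] 0 (y i)) : I"
proof -
 let ?t = "%i. qterm [al, flip al i, al] 0 (y i) :: ('e => sign, 'e, 'k) qalg" and ?X = "{i \<in> E. flip al i : B}"
 have "(\<Sum>i\<in>E. qscale (y i) (qterm [al, flip al i, al] 0 1)) : I"
  by (rule loop_sum_I[OF al y]) (use I_facts(1) in simp)
 then have 1: "sum ?t E : I" by (simp add: qscale_simps)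
 have 2: "sum ?t (E - ?X) : I"
 proof (rule I_facts(7))
  fix i assume i: "i : E - ?X"
  show "?t i : I"
  proof (cases "flip al i : F")
   case True
   then show ?thesis using i al F_adj[OF al, of i] by (intro bad_path_I[of _ _ "flip al i"]) (auto simp: quiver_path_simps)
  next
   case False
   then show ?thesis using y(2) I_facts(1) by (simp add: qterm_def)
  qed
 qed
 have "sum ?t E = sum ?t (E - ?X) + sum ?t ?X" by (rule sum.subset_diff) (auto simp: finite_E)
 then show ?thesis using I_facts(3)[OF 1 2] by simp
qed

lemma dual_letter_expand:
 assumes K: "ring_cong K" and JK: "DT.J \<subseteq> K" and \<phi>: "\<phi> : carrier A1d"
 shows "ring_cong.cg K (letter (Inr \<phi>)) (\<Sum>(v, w)\<in>arrows. fconst (\<phi> (arrow v w)) * letter (Inr (delta v w)))"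
proof -
 interpret ring_cong K by (rule K)
 note rel = DT.rel_cg[OF K JK]
 have *: "(%a. \<Sum>(v, w)\<in>X. c v w * delta v w a) : carrier A1d &
   cg (letter (Inr (%a. \<Sum>(v, w)\<in>X. c v w * delta v w a))) (\<Sum>(v, w)\<in>X. fconst (c v w) * letter (Inr (delta v w)))"
  if "finite X" "X \<subseteq> arrows" for X and c :: "_ => _ => 'k"
  using that
 proof (induction X rule: finite_induct)
  case empty
  have z: "(%a. 0) : carrier A1d" unfolding dual_carrier by simp
  have "cg (letter (Inr (bscale A1d 0 (%a. 0)))) (fconst 0 * letter (Inr (%a. 0)))"
   by (rule rel[OF DT.rels_mem(6)[OF z]])
  then show ?case using z by (simp add: dual_simps)
 next
  case (insert s X)
  obtain v w where s: "s = (v, w)" by (cases s)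
  let ?r = "%a. \<Sum>(v, w)\<in>X. c v w * delta v w a"
  have d: "delta v w : carrier A1d" using insert.prems s by (intro delta_carrier) simp
  have r: "?r : carrier A1d" and rc: "cg (letter (Inr ?r)) (\<Sum>(v, w)\<in>X. fconst (c v w) * letter (Inr (delta v w)))"
   using insert.IH insert.prems by simp_all
  have e: "(%a. \<Sum>(v, w)\<in>insert s X. c v w * delta v w a) = badd A1d (bscale A1d (c v w) (delta v w)) ?r"
   using insert.hyps by (simp add: s dual_simps)
  have cd: "bscale A1d (c v w) (delta v w) : carrier A1d" by (rule DT.V_closed(2)[OF d])
  have "cg (letter (Inr (badd A1d (bscale A1d (c v w) (delta v w)) ?r))) (letter (Inr (bscale A1d (c v w) (delta v w))) + letter (Inr ?r))"
   by (rule rel[OF DT.rels_mem(5)[OF cd r]])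
  also have "cg ... (fconst (c v w) * letter (Inr (delta v w)) + (\<Sum>(v, w)\<in>X. fconst (c v w) * letter (Inr (delta v w))))"
   by (rule cg_add[OF rel[OF DT.rels_mem(6)[OF d]] rc])
  finally show ?case unfolding e using DT.V_closed(1)[OF cd r] insert.hyps by (simp add: s)
 qed
 have "cg (letter (Inr (%a. \<Sum>(v, w)\<in>arrows. \<phi> (arrow v w) * delta v w a))) (\<Sum>(v, w)\<in>arrows. fconst (\<phi> (arrow v w)) * letter (Inr (delta v w)))"
  by (rule conjunct2[OF *[OF finite_arrows subset_refl]])
 then show ?thesis unfolding delta_expand[OF \<phi>, symmetric] .
qed

end

section \<open>The sign twist and the map from the dual tensor algebra to the algebra of the dual
  program\<close>

locale dual_pair = vprog P U + D: vprog P' U'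
 for P P' :: "'e program" and U U' :: "('e => 'k::field) set" +
 assumes E': "prog_E P' = prog_E P" and B': "bounded_feasible P' = bounded_feasible P"
  and B_eq: "bounded_feasible P = feasible_topes P \<inter> feasible_topes P'"
  and flip_ex: "al : bounded_feasible P ==> i : prog_E P ==> flip al i : feasible_topes P | flip al i : feasible_topes P'"
  and U': "U' = annihilator (prog_E P) U"
begin

abbreviation "F' \<equiv> feasible_topes P'"

lemma B_F': "v : B ==> v : F'"
 using B_eq by blast

lemma arrows': "D.arrows = arrows"
 by (simp add: D.arrows_def arrows_def B')

text \<open>The relations of the quadratic dual are skew where those of the algebra of a program are
 commutative. The signs \<open>eps\<close>, of Koszul type for a fixed order of \<open>E\<close>, make up for this: their
 products along the two sides of a square are opposite.\<close>

definition rk :: "'e => nat" where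
 "rk = (SOME r. inj_on r E)"

lemma rk_inj: "inj_on rk E"
 unfolding rk_def using finite_imp_inj_to_nat_seg[OF finite_E] by (metis (mono_tags, lifting) someI_ex)

definition sg :: "('e => sign) => 'e => 'k" where
 "sg ga i = (\<Prod>j\<in>{j \<in> E. rk j < rk i}. if ga j = Neg then - 1 else 1)"

lemma sg_square: "sg ga i * sg ga i = 1"
 unfolding sg_def prod.distrib[symmetric] by (rule prod.neutral) simp

text \<open>\<open>sg ga j\<close> looks only at coordinates strictly before \<open>j\<close>. Of
  two directions flipped one after the other, exactly one sees the change made by the other, which
  produces the minus sign along squares.\<close>

lemma sg_flip:
 assumes "i : E" "ga i ~= Zero"
 shows "sg (flip ga i) j = (if rk i < rk j then - sg ga j else sg ga j)"
proof (cases "rk i < rk j")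
 case True
 let ?X = "{l \<in> E. rk l < rk j}"
 have X: "finite ?X" "i : ?X" using finite_E assms True by auto
 have "(\<Prod>l\<in>?X - {i}. if flip ga i l = Neg then - 1 else 1 :: 'k) = (\<Prod>l\<in>?X - {i}. if ga l = Neg then - 1 else 1)"
  by (rule prod.cong) (auto simp: flip_apply)
 moreover have "(if flip ga i i = Neg then - 1 else 1 :: 'k) = - (if ga i = Neg then - 1 else 1)"
  using assms(2) by (cases "ga i") (auto simp: flip_apply)
 ultimately show ?thesis using True by (simp add: sg_def prod.remove[OF X])
next
 case False
 then show ?thesis unfolding sg_def by (auto simp: flip_apply intro!: prod.cong)
qed

text \<open>The sign is read at the source, but \<open>sg\<close> ignores the coordinate that is
  flipped, so both directions of an edge carry the same sign.\<close>

definition eps :: "('e => sign) => ('e => sign) => 'k" where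
 "eps al be = sg al (THE i. al i ~= be i)"

lemma eps_flip:
 assumes "i : E" "ga i ~= Zero"
 shows "eps ga (flip ga i) = sg ga i" "eps (flip ga i) ga = sg ga i"
proof -
 have n: "ga i ~= opp (ga i)" using assms(2) by (cases "ga i") auto
 have "(THE j. ga j ~= flip ga i j) = i" "(THE j. flip ga i j ~= ga j) = i"
  by (rule the_equality; use n in \<open>auto simp: flip_apply split: if_splits\<close>)+
 then show "eps ga (flip ga i) = sg ga i" "eps (flip ga i) ga = sg ga i"
  using sg_flip[where ga = ga, OF assms, of i] by (simp_all add: eps_def)
qed

lemma eps_arrow:
 assumes "(v, w) : arrows"
 shows "eps v w * eps v w = 1" "eps w v = eps v w"
proof -
 obtain i where i: "i : E" "w = flip v i" using F_adjE arrowsD[OF assms] by blast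
 have "v i ~= Zero" using F_nz[OF _ i(1)] arrowsD[OF assms] by blast
 then show "eps v w * eps v w = 1" "eps w v = eps v w" using eps_flip[OF i(1)] sg_square by (simp_all add: i(2))
qed

lemma eps_square:
 assumes "i : E" "j : E" "i ~= j" "al i ~= Zero" "al j ~= Zero"
 shows "eps al (flip al j) * eps (flip al j) (flip (flip al i) j) =
  - (eps al (flip al i) * eps (flip al i) (flip (flip al i) j))"
proof -
 have n: "flip al i j ~= Zero" "flip al j i ~= Zero" using assms by (auto simp: flip_apply)
 have r: "rk i ~= rk j" using rk_inj assms by (auto simp: inj_on_def)
 show ?thesis
  unfolding eps_flip(1)[where ga = "flip al i", OF assms(2) n(1)] eps_flip(1)[where ga = al, OF assms(1,4)]
  unfolding flip_commute[of al i j] eps_flip(1)[where ga = "flip al j", OF assms(1) n(2)]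
   eps_flip(1)[where ga = al, OF assms(2,5)] sg_flip[where ga = al, OF assms(1,4)] sg_flip[where ga = al, OF assms(2,5)]
  using r by auto
qed

lemma square_middle:
 assumes "i ~= j" "al i ~= Zero" "al j ~= Zero" "k : E" "al k ~= Zero" "adjacent (flip (flip al i) j) (flip al k)"
 shows "k = i | k = j"
proof (rule ccontr)
 assume k: "~ ?thesis"
 have "opp (al i) ~= al i" "opp (al j) ~= al j" using assms by (cases "al i"; cases "al j"; simp)+
 then have "flip (flip al i) j i ~= flip al k i" "flip (flip al i) j j ~= flip al k j"
  using k assms(1) by (auto simp: flip_apply)
 then show False using assms(1,6) unfolding adjacent_def by blast
qed

text \<open>Up to sign, the arrow from \<open>v\<close> to \<open>w\<close> in the quiver of the
  dual program is the functional dual to the arrow from \<open>w\<close> to \<open>v\<close>; this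
  is the reversal built into \<open>A1d\<close>.\<close>

definition dlift1 :: "((('e => sign) list \<Rightarrow>\<^sub>0 ('e, 'k) mpoly) set => 'k) => (('e => sign) list \<Rightarrow>\<^sub>0 ('e, 'k) mpoly)" where
 "dlift1 \<phi> = (\<Sum>(v, w)\<in>arrows. qterm [v, w] 0 (eps v w * \<phi> (arrow w v)))"

definition dlift where
 "dlift l = (if l : DT.S then case_sum lift0 dlift1 l else 0)"

lemma dlift_simps: "r : hcomp A 0 ==> dlift (Inl r) = lift0 r" "\<phi> : carrier A1d ==> dlift (Inr \<phi>) = dlift1 \<phi>"
 by (auto simp: dlift_def DT.S_def)

lemma lift0_hcomp': "lift0 r : hcomp D.Q 0"
 unfolding lift0_def by (intro D.Q_hcomp_sum D.vertex_hcomp B_F')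

lemma dlift1_hcomp: "dlift1 \<phi> : hcomp D.Q 1"
 unfolding dlift1_def by (intro D.Q_hcomp_sum) (use D.edge_hcomp D.arrowsD arrows' in auto)

text \<open>The two units differ by idempotents at topes in \<open>F' - B\<close>, which the
  relations (A1) of the dual program kill.\<close>

lemma lift0_one: "lift0 \<one>\<^bsub>A\<^esub> - \<one>\<^bsub>D.Q\<^esub> : D.I"
proof -
 have "lift0 \<one>\<^bsub>A\<^esub> = (\<Sum>v\<in>B. qterm [v] 0 1)" unfolding lift0_def by (rule sum.cong) (simp_all add: co_one)
 moreover have "\<one>\<^bsub>D.Q\<^esub> = (\<Sum>v\<in>F'. qterm [v] 0 1)" by (simp add: D.QA_simps D.QA_one)
 moreover have "(\<Sum>v\<in>F'. qterm [v] 0 1) = (\<Sum>v\<in>F' - B. qterm [v] 0 1) + (\<Sum>v\<in>B. qterm [v] 0 (1::'k) :: ('e => sign, 'e, 'k) qalg)"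
  by (rule sum.subset_diff) (use B_eq D.finite_F in auto)
 moreover have "(\<Sum>v\<in>F' - B. qterm [v] 0 1) : D.I"
  by (rule D.I_facts(7)) (use D.rels_A1 D.rels_I B' in blast)
 ultimately show ?thesis using D.I_facts(3)[OF D.I_facts(1)] by fastforce
qed

lemma dual_arrow_act:
 assumes "r : hcomp A 0" "\<phi> : carrier A1d" "(v, w) : arrows"
 shows "lact A1d r \<phi> (arrow v w) = co [w] r * \<phi> (arrow v w)" "ract A1d \<phi> r (arrow v w) = co [v] r * \<phi> (arrow v w)"
 using assms(2) arrow_hcomp'[OF assms(3)] unfolding dual_simps arrow_mult[OF assms(1,3)] dual_carrier by simp_all

sublocale DR: tensor_rep "degree_zero (prog_algebra P U)" "dual_bimodule (degree_one (prog_algebra P U))" P' U' dlift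
proof unfold_locales
 have z: "x - y : D.I" if "x = y" for x y using D.I_facts(1) that by simp
 have B1: "set [v] \<subseteq> B" "length [v] \<le> 2" if "v : B" for v using that by auto
 have aB: "fst p : B" "snd p : B" "(fst p, snd p) : arrows" "(snd p, fst p) : arrows" if "p : arrows" for p
  using that arrowsD[of "fst p" "snd p"] arrows_sym[of "fst p" "snd p"] by auto
 show "l ~: DT.S ==> dlift l = 0" for l by (simp add: dlift_def)
 show "r : carrier A0 ==> dlift (Inl r) : hcomp D.Q 0" for r by (simp add: dlift_simps lift0_hcomp')
 show "v : carrier A1d ==> dlift (Inr v) : hcomp D.Q 1" for v by (simp add: dlift_simps dlift1_hcomp del: One_nat_def)
 show "dlift (Inl \<one>\<^bsub>A0\<^esub>) - \<one>\<^bsub>D.Q\<^esub> : D.I" using lift0_one A_hcomp_one by (simp add: dlift_simps)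
 show "dlift (Inr (bscale A1d c \<phi>)) - qscale c (dlift (Inr \<phi>)) : D.I" if \<phi>: "\<phi> : carrier A1d" for c \<phi>
  using \<phi> DT.V_closed(2)[OF \<phi>, of c]
  by (intro z) (simp add: dlift_simps dlift1_def qscale_sum qscale_simps dual_simps split_def mult.left_commute)
 show "dlift (Inr (badd A1d \<phi> \<psi>)) - (dlift (Inr \<phi>) + dlift (Inr \<psi>)) : D.I" if \<phi>: "\<phi> : carrier A1d" "\<psi> : carrier A1d" for \<phi> \<psi>
  using \<phi> DT.V_closed(1)[OF \<phi>]
  by (intro z) (simp add: dlift_simps dlift1_def dual_simps split_def distrib_left qterm_add sum.distrib)
 fix r assume r0: "r : carrier A0"
 then have r: "r : hcomp A 0" by simp
 note rc = A_hcomp_carrier[OF r]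
 show "dlift (Inl (c \<odot>\<^bsub>A0\<^esub> r)) - qscale c (dlift (Inl r)) : D.I" for c
  using r A_hcomp_scale[OF r, of c] rc
  by (intro z) (simp add: dlift_simps lift0_def qscale_sum qscale_simps co_scale B1 del: set_simps cong: sum.cong)
 show "dlift (Inl (r \<oplus>\<^bsub>A0\<^esub> s)) - (dlift (Inl r) + dlift (Inl s)) : D.I" if "s : carrier A0" for s
  using r that A_hcomp_plus[OF r] rc A_hcomp_carrier[of s]
  by (intro z) (simp add: dlift_simps lift0_def sum.distrib[symmetric] qterm_add[symmetric] co_linear(1) B1 del: set_simps cong: sum.cong)
 show "dlift (Inl (r \<otimes>\<^bsub>A0\<^esub> s)) - qmul (dlift (Inl r)) (dlift (Inl s)) : D.I" if "s : carrier A0" for s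
 proof (rule z)
  have s: "s : hcomp A 0" using that by simp
  have "qmul (lift0 r) (lift0 s) = (\<Sum>v\<in>B. qterm [v] 0 (co [v] r * co [v] s))"
   unfolding lift0_def[of s] qmul_sum_r by (rule sum.cong) (simp_all add: lift0_qmul)
  also have "... = lift0 (r \<otimes>\<^bsub>A\<^esub> s)"
   unfolding lift0_def by (rule sum.cong) (use co_mult(1)[OF r A_hcomp_carrier[OF s], of _ "[]"] in simp_all)
  finally show "dlift (Inl (r \<otimes>\<^bsub>A0\<^esub> s)) = qmul (dlift (Inl r)) (dlift (Inl s))"
   using r s A_hcomp_mult01(1)[OF r s] by (simp add: dlift_simps)
 qed
 fix \<phi> assume \<phi>: "\<phi> : carrier A1d"
 show "dlift (Inr (lact A1d r \<phi>)) - qmul (dlift (Inl r)) (dlift (Inr \<phi>)) : D.I"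
 proof (rule z)
  have "qmul (lift0 r) (dlift1 \<phi>) = dlift1 (lact A1d r \<phi>)"
   unfolding dlift1_def qmul_sum_r split_def
   by (rule sum.cong) (simp_all add: lift0_qmul aB dual_arrow_act[OF r \<phi>] mult.left_commute)
  then show "dlift (Inr (lact A1d r \<phi>)) = qmul (dlift (Inl r)) (dlift (Inr \<phi>))"
   using r \<phi> DT.V_closed(3)[OF r0 \<phi>] by (simp add: dlift_simps)
 qed
 show "dlift (Inr (ract A1d \<phi> r)) - qmul (dlift (Inr \<phi>)) (dlift (Inl r)) : D.I"
 proof (rule z)
  have "qmul (dlift1 \<phi>) (lift0 r) = dlift1 (ract A1d \<phi> r)"
   unfolding dlift1_def qmul_sum_l split_def
   by (rule sum.cong) (simp_all add: lift0_qmul aB dual_arrow_act[OF r \<phi>] ac_simps)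
  then show "dlift (Inr (ract A1d \<phi> r)) = qmul (dlift (Inr \<phi>)) (dlift (Inl r))"
   using r \<phi> DT.V_closed(4)[OF r0 \<phi>] by (simp add: dlift_simps)
 qed
qed

text \<open>Inverse to \<open>dlift1\<close> on arrows, since the signs square to 1; arrows that
  leave \<open>B\<close> are sent to 0.\<close>

definition arrD where
 "arrD al be = (if (al, be) : arrows then fconst (eps al be) * DT.lt (Inr (delta be al)) else 0)"

lemma reach_vertex_D: "al : F' ==> qterm [al] 0 1 : DR.reach 0"
proof -
 assume al: "al : F'"
 have "DR.phi (DT.epsT al) - qterm [al] 0 1 : D.I"
 proof (cases "al : B")
  case True
  have "lift0 (idem al) = (\<Sum>v\<in>B. if v = al then qterm [al] 0 1 else 0)"
   unfolding lift0_def by (rule sum.cong) (use True in \<open>auto simp: co_idem qterm_def\<close>)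
  then have "lift0 (idem al) = qterm [al] 0 1" using finite_B True by simp
  then show ?thesis using True D.I_facts(1) idem_hcomp[OF B_F]
   by (simp add: DT.epsT_def DR.phi_letter dlift_simps)
 next
  case False
  have "qterm [al] 0 1 : D.I"
   by (rule D.bad_path_I[of _ _ al]) (use al False B' in \<open>auto simp: D.quiver_path_simps\<close>)
  then show ?thesis using False D.I_facts(3)[OF D.I_facts(1)] by (simp add: DT.epsT_def DR.phi_zero)
 qed
 then show ?thesis unfolding DR.reach_def using DT.epsT_hcomp D.Q_hcomp_carrier[OF D.vertex_hcomp[OF al]] by blast
qed

lemma reach_arrow_D: "al : F' ==> be : F' ==> adjacent al be ==> qterm [al, be] 0 1 : DR.reach 1"
proof -
 assume al: "al : F'" "be : F'" "adjacent al be"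
 have "DR.phi (arrD al be) - qterm [al, be] 0 1 : D.I & arrD al be : hcomp DT.Fr 1"
 proof (cases "(al, be) : arrows")
  case True
  then have True': "(be, al) : arrows" using arrows_sym by blast
  note d = delta_carrier[OF True']
  have "dlift1 (delta be al) = (\<Sum>p\<in>arrows. if p = (al, be) then qterm [al, be] 0 (eps al be) else 0)"
   unfolding dlift1_def
  proof (rule sum.cong[OF refl])
   fix p assume p: "p : arrows"
   obtain v w where vw: "p = (v, w)" by (cases p)
   have "(w, v) : arrows" using p arrows_sym unfolding vw by blast
   then show "(case p of (v, w) => qterm [v, w] 0 (eps v w * delta be al (arrow w v))) = (if p = (al, be) then qterm [al, be] 0 (eps al be) else 0)"
    using delta_arrow[OF True'] by (auto simp: vw qterm_def)
  qed
  then have "dlift1 (delta be al) = qterm [al, be] 0 (eps al be)" using finite_arrows True by simp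
  then have "DR.phi (arrD al be) = qterm [al, be] 0 1"
   using True d eps_arrow(1)[OF True] by (simp add: arrD_def DR.phi_fconst_mult DR.phi_letter dlift_simps qscale_simps)
  moreover have "arrD al be = single [Inr (delta be al)] (eps al be)"
   using True by (simp add: arrD_def fconst_def letter_def single_word_mult)
  moreover have "single [Inr (delta be al)] (eps al be) : hcomp DT.Fr 1"
   by (rule DT.single_hcomp) (use d in \<open>auto simp: DT.S_def DT.dg_def word_degree_def\<close>)
  ultimately show ?thesis using D.I_facts(1) by simp
 next
  case False
  then obtain v where "v : set [al, be]" "v : F' - B" using al by (auto simp: arrows_def)
  then have "qterm [al, be] 0 1 : D.I" using al B' by (intro D.bad_path_I[of _ _ v]) (auto simp: D.quiver_path_simps)
  then show ?thesis using False D.I_facts(3)[OF D.I_facts(1)]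
   by (auto simp: arrD_def DR.phi_zero DT.FA.hcomp_eq DT.FA.zero_in DT.FA.hp_zero)
 qed
 then show ?thesis unfolding DR.reach_def using D.Q_hcomp_carrier[OF D.edge_hcomp[OF al]] by blast
qed

end

lemma qterm_minus: "qterm p m (- c) = - qterm p m c"
 by (simp add: qterm_def single_uminus)

context dual_pair
begin

lemma square_middle_F:
 assumes "i : E" "j : E" "i ~= j" "support al = E" "x : F" "adjacent al x" "adjacent (flip (flip al i) j) x"
 shows "x = flip al i | x = flip al j"
proof -
 have nz: "al k ~= Zero" if "k : E" for k using that assms(4) by (auto simp: support_def)
 obtain k where k: "k : E" "x = flip al k"
  using adjacentE[OF assms(6,4) feasible_supp[OF assms(5)]] by blast
 have "k = i | k = j"
  using square_middle[of i j al k] assms nz k by blast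
 then show ?thesis using k(2) by blast
qed

lemma kills_arrD:
 assumes W: "quadratic_with A W" and f: "kills f"
 shows "(\<Sum>(a, c, b)\<in>path2. fconst (s * f [a, c, b] 0) * (DT.lt (Inr (delta c b)) * DT.lt (Inr (delta a c)))) : DT.Kt (L1 W)"
 by (rule kills_perp[OF W f])

lemma arrD_mult: "arrD al ga * arrD ga be = (if (be, ga, al) : path2
  then fconst (eps al ga * eps ga be) * (DT.lt (Inr (delta ga al)) * DT.lt (Inr (delta be ga))) else 0)"
 using arrows_sym[of al ga] arrows_sym[of ga be]
 by (simp add: arrD_def path2_def fconst_mult2 del: fconst_simps(4))

text \<open>The relations of the dual program are found among the elements supplied by
  \<open>kills_perp\<close>. For a square, \<open>kills_square\<close> gives the sum of the two
  paths, which the signs turn into their difference; for loops, \<open>loop_fun\<close> with the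
  given form \<open>y\<close> gives the relation directly. If an end point lies outside
  \<open>B\<close>, both sides are 0.\<close>

lemma quad_rep_D:
 assumes W: "quadratic_with A W"
 shows "quad_rep P' U' (DT.Kt (L1 W)) fconst DT.epsT arrD"
proof -
 note K = DT.Kt_cong[OF ideal_L1, of W]
 have JK: "DT.J \<subseteq> DT.Kt (L1 W)" using DT.J_Kt[OF ideal_L1] by blast
 interpret ring_cong "DT.Kt (L1 W)" by (rule K)
 note rel = DT.rel_cg[OF K JK]
 show ?thesis
 proof (intro quad_rep.intro D.vprog_axioms K quad_rep_axioms.intro)
  show "x * fconst a = fconst a * x" for x a by (rule fconst_commute)
  show "cg (DT.epsT al) 0" if "al : F' - D.B" for al using that by (simp add: DT.epsT_def B')
  have "(\<Sum>al\<in>F'. DT.epsT al) = (\<Sum>al\<in>B. DT.epsT al)"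
   by (rule sum.mono_neutral_right[OF D.finite_F]) (auto simp: B_F' DT.epsT_def)
  also have "... = (\<Sum>al\<in>F. DT.epsT al)"
   by (rule sum.mono_neutral_left[OF finite_F]) (auto simp: B_F DT.epsT_def)
  finally show "cg (\<Sum>al\<in>F'. DT.epsT al) 1" using DT.epsT_one[OF K JK] by simp
 next
  fix al be assume al: "al : F'" and be: "be : F'"
  show "cg (DT.epsT al * DT.epsT be) (if al = be then DT.epsT al else 0)"
  proof (cases "al : B & be : B")
   case True
   then show ?thesis using DT.epsT_orth[OF K JK, of al be] B_F by blast
  next
   case False
   then have "DT.epsT al * DT.epsT be = 0" "(if al = be then DT.epsT al else 0) = 0" by (auto simp: DT.epsT_def)
   then show ?thesis by (simp only: cg_refl)
  qed
  have "cg (DT.epsT al * arrD al be) (arrD al be) & cg (arrD al be * DT.epsT be) (arrD al be)"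
  proof (cases "(al, be) : arrows")
   case True
   then have s: "(be, al) : arrows" using arrows_sym by blast
   have m: "al : B" "be : B" using arrowsD[OF True] by auto
   note i = idem_hcomp[OF B_F]
   note d = delta_carrier[OF s]
   have l: "lact A1d (idem al) (delta be al) = delta be al"
   proof
    fix v show "lact A1d (idem al) (delta be al) v = delta be al v"
     using co_mult(2)[OF i[OF m(1)] A_hcomp_carrier[of v 1], of "[be]" al] m A_hcomp_mult01(2)[OF i[OF m(1)], of v 1]
     by (simp add: dual_simps delta_def co_idem del: One_nat_def)
   qed
   have r: "ract A1d (delta be al) (idem be) = delta be al"
   proof
    fix v show "ract A1d (delta be al) (idem be) v = delta be al v"
     using co_mult(1)[OF i[OF m(2)] A_hcomp_carrier[of v 1], of be "[al]"] m A_hcomp_mult01(1)[OF i[OF m(2)], of v 1]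
     by (simp add: dual_simps delta_def co_idem del: One_nat_def)
   qed
   have "cg (DT.lt (Inl (idem al)) * DT.lt (Inr (delta be al))) (DT.lt (Inr (delta be al)))"
    using cg_sym[OF rel[OF DT.rels_mem(7)[OF _ d]], of "idem al"] i[OF m(1)] unfolding l by simp
   then have 1: "cg (fconst (eps al be) * (DT.lt (Inl (idem al)) * DT.lt (Inr (delta be al)))) (fconst (eps al be) * DT.lt (Inr (delta be al)))"
    by (rule cg_mult[OF cg_refl])
   have "cg (DT.lt (Inr (delta be al)) * DT.lt (Inl (idem be))) (DT.lt (Inr (delta be al)))"
    using cg_sym[OF rel[OF DT.rels_mem(8)[OF _ d]], of "idem be"] i[OF m(2)] unfolding r by simp
   then have 2: "cg (fconst (eps al be) * (DT.lt (Inr (delta be al)) * DT.lt (Inl (idem be)))) (fconst (eps al be) * DT.lt (Inr (delta be al)))"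
    by (rule cg_mult[OF cg_refl])
   show ?thesis using 1 2 True m
    by (simp add: arrD_def DT.epsT_def mult.assoc fconst_left_commute[of "DT.lt (Inl (idem al))"])
  next
   case False
   then have "arrD al be = 0" by (simp add: arrD_def)
   then show ?thesis by (simp add: cg_refl)
  qed
  then show "cg (DT.epsT al * arrD al be) (arrD al be)" "cg (arrD al be * DT.epsT be) (arrD al be)" by blast+
 next
  fix al be ga de assume sq: "{al, be, ga, de} \<subseteq> F'" "distinct [al, be, ga, de]"
   "adjacent al ga" "adjacent al de" "adjacent be ga" "adjacent be de"
  show "cg (arrD al ga * arrD ga be) (arrD al de * arrD de be)"
  proof (cases "al : B & be : B")
   case True
   obtain i j where ij: "i : E" "j : E" "i ~= j" "ga = flip al i" "de = flip al j" "be = flip (flip al i) j"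
    by (rule D.square_cases[OF sq]) (simp add: E')
   have sup: "support al = E" using feasible_supp B_F True by blast
   have nz: "al i ~= Zero" "al j ~= Zero" using sup ij by (auto simp: support_def)
   have mid: "x = ga | x = de" if "x : F" "adjacent al x" "adjacent be x" for x
    using square_middle_F[OF ij(1-3) sup, of x] that ij by simp
   \<comment> \<open>The end points are exchanged because dual letters compose backwards. Every
     common neighbour in \<open>F\<close> is \<open>ga\<close> or \<open>de\<close>; these lie in
     \<open>F'\<close> as well, hence in \<open>B\<close>.\<close>
   have kf: "kills (%w m. if (\<exists>x \<in> B. w = [be, x, al]) & m = 0 then 1 else 0)"
   proof (rule kills_square)
    show "be ~= al" using sq(2) by auto
    fix x assume "x : F" "adjacent be x" "adjacent al x"
    then show "x : B" using mid[of x] sq(1) B_eq by auto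
   qed (use True in simp_all)
   define s where "s = eps al ga * eps ga be"
   have s2: "eps al de * eps de be = - s" unfolding s_def ij(4-6) by (rule eps_square[OF ij(1-3) nz])
   define t where "t x = fconst s * (DT.lt (Inr (delta x al)) * DT.lt (Inr (delta be x)))" for x
   let ?f = "%a c b. if \<exists>x \<in> B. [a, c, b] = [be, x, al] then 1 else 0 :: 'k"
   have "(\<Sum>(a, c, b)\<in>path2. fconst (s * ?f a c b) * (DT.lt (Inr (delta c b)) * DT.lt (Inr (delta a c)))) =
    (\<Sum>p\<in>path2. (if p = (be, ga, al) then t ga else 0) + (if p = (be, de, al) then t de else 0))"
   proof (rule sum.cong[OF refl])
    fix p assume p: "p : path2"
    obtain a c b where abc: "p = (a, c, b)" by (cases p) auto
    have m: "c : B" "c : F" "adjacent a c" "adjacent b c" using p adjacent_sym arrowsD by (auto simp: abc path2_def)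
    have "ga ~= de" using sq(2) by auto
    then show "(case p of (a, c, b) => fconst (s * ?f a c b) * (DT.lt (Inr (delta c b)) * DT.lt (Inr (delta a c)))) =
     (if p = (be, ga, al) then t ga else 0) + (if p = (be, de, al) then t de else 0)"
     using mid[of c] m by (cases "a = be & b = al") (auto simp: abc t_def)
   qed
   also have "... = arrD al ga * arrD ga be - arrD al de * arrD de be"
    unfolding arrD_mult s2 s_def[symmetric] using finite_path2 by (simp add: sum.distrib t_def)
   finally show ?thesis using kills_arrD[OF W kf, of s] by (simp add: cg_def)
  next
   case False
   then have "arrD al ga * arrD ga be = 0" "arrD al de * arrD de be = 0" by (auto simp: arrD_def arrows_def)
   then show ?thesis by (simp only: cg_refl)
  qed
 next
  fix al y assume a: "al : F'" "y : annihilator D.E U'" "\<forall>i. flip al i ~: F' --> y i = 0"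
  show "cg (\<Sum>i\<in>D.E. fconst (y i) * (arrD al (flip al i) * arrD (flip al i) al)) 0"
  proof (cases "al : B")
   case True
   \<comment> \<open>A flip in \<open>F - B\<close> is not in \<open>F'\<close>, and there
     \<open>y\<close> vanishes by assumption; this is the boundedness condition of
     \<open>kills_loop\<close>.\<close>
   have kf: "kills (loop_fun al y)"
   proof (rule kills_loop[OF True])
    show "y : annihilator E U0" using a(2) by (simp add: E' U')
    show "y i = 0" if "flip al i : F - B" for i using that a(3) B_eq by blast
   qed
   let ?t = "%i. fconst (y i) * (DT.lt (Inr (delta (flip al i) al)) * DT.lt (Inr (delta al (flip al i))))"
   have "(\<Sum>(a, c, b)\<in>path2. fconst (1 * loop_fun al y [a, c, b] 0) * (DT.lt (Inr (delta c b)) * DT.lt (Inr (delta a c)))) =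
    (\<Sum>p\<in>path2. \<Sum>i\<in>E. if p = (al, flip al i, al) then ?t i else 0)"
   proof (rule sum.cong[OF refl])
    fix p assume p: "p : path2"
    obtain a c b where abc: "p = (a, c, b)" by (cases p) auto
    show "(case p of (a, c, b) => fconst (1 * loop_fun al y [a, c, b] 0) * (DT.lt (Inr (delta c b)) * DT.lt (Inr (delta a c)))) =
     (\<Sum>i\<in>E. if p = (al, flip al i, al) then ?t i else 0)"
     by (auto simp: abc loop_fun_def fconst_sum sum_distrib_right intro!: sum.cong)
   qed
   also have "... = (\<Sum>i\<in>E. if (al, flip al i, al) : path2 then ?t i else 0)"
    unfolding sum.swap[of _ E] using finite_path2 by simp
   also have "... = (\<Sum>i\<in>D.E. fconst (y i) * (arrD al (flip al i) * arrD (flip al i) al))"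
    unfolding E'
   proof (rule sum.cong[OF refl])
    fix i
    show "(if (al, flip al i, al) : path2 then ?t i else 0) = fconst (y i) * (arrD al (flip al i) * arrD (flip al i) al)"
     unfolding arrD_mult using eps_arrow[of al "flip al i"] by (auto simp: path2_def simp del: fconst_simps(4))
   qed
   finally show ?thesis using kills_arrD[OF W kf, of 1] by (simp add: cg_zero_iff)
  next
   case False
   then have "arrD al x = 0" for x by (simp add: arrD_def arrows_def)
   then show ?thesis by (simp add: cg_refl)
  qed
 qed simp_all
qed

text \<open>Here \<open>h\<close> are the coefficients of an element of the annihilator of
  \<open>W\<close>, and the twisted, reversed combination is its image in the quiver algebra of
  \<open>P'\<close>. The sum is split by end points: for equal ends \<open>form_basis_extend\<close>
  exhibits the coefficients as a form relation of the dual program, for different ends at most two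
  paths have to be compared.\<close>

lemma dual_relation:
 assumes T: "!!f. (\<Sum>(a, c, b)\<in>path2. qterm [a, c, b] 0 (f a c b)) : I ==> (\<Sum>(a, c, b)\<in>path2. h a c b * f a c b) = 0"
 shows "(\<Sum>(a, c, b)\<in>path2. qterm [a, c, b] 0 (eps a c * eps c b * h b c a)) : D.I"
proof -
 \<comment> \<open>Relations supported on part of \<open>path2\<close> are extended by 0, so that
   \<open>h\<close> can be tested on one pair of end points at a time.\<close>
 have TX: "(\<Sum>(a, c, b)\<in>X. h a c b * e a c b) = 0"
  if X: "X \<subseteq> path2" and e: "(\<Sum>(a, c, b)\<in>X. qterm [a, c, b] 0 (e a c b)) : I" for X e
 proof -
  define f where "f a c b = (if (a, c, b) : X then e a c b else 0)" for a c b
  have "(\<Sum>(a, c, b)\<in>path2. qterm [a, c, b] 0 (f a c b)) = (\<Sum>(a, c, b)\<in>X. qterm [a, c, b] 0 (e a c b) :: ('e => sign, 'e, 'k) qalg)"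
   by (rule sum.mono_neutral_cong_right[OF finite_path2 X]) (auto simp: f_def qterm_def)
  then have "(\<Sum>(a, c, b)\<in>path2. h a c b * f a c b) = 0" using e by (intro T) simp
  moreover have "(\<Sum>(a, c, b)\<in>path2. h a c b * f a c b) = (\<Sum>(a, c, b)\<in>X. h a c b * e a c b)"
   by (rule sum.mono_neutral_cong_right[OF finite_path2 X]) (auto simp: f_def)
  ultimately show ?thesis by simp
 qed
 let ?q = "%(a, c, b). qterm [a, c, b] 0 (eps a c * eps c b * h b c a) :: ('e => sign, 'e, 'k) qalg"
 let ?S = "%a b. {p \<in> path2. (fst p, snd (snd p)) = (a, b)}"
 have pB: "a : B" "c : B" "b : B" "(a, c) : arrows" "(c, b) : arrows" "(b, c, a) : path2" "adjacent a c" "adjacent c b"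
  if "(a, c, b) : path2" for a c b using that arrows_sym arrowsD unfolding path2_def by blast+
 have loop: "sum ?q (?S a a) : D.I" if a: "a : B" for a
 proof -
  let ?X = "{i \<in> E. flip a i : B}"
  have aF: "a : F" "a : F'" using a B_F B_F' by auto
  have inj: "inj_on (%i. (a, flip a i, a)) ?X" by (rule inj_onI) (use flip_inj[OF aF(1)] in auto)
  have sub: "(%i. (a, flip a i, a)) ` ?X \<subseteq> path2"
   using a F_adj[OF aF(1)] by (auto simp: path2_def arrows_def)
  have SX: "?S a a = (%i. (a, flip a i, a)) ` ?X"
  proof (intro equalityI subsetI)
   fix p assume p: "p : ?S a a"
   obtain c where c: "p = (a, c, a)" using p by (cases p) auto
   then have ac: "c : B" "adjacent a c" using p pB[of a c a] by auto
   obtain i where "i : E" "c = flip a i" using F_adjE[OF aF(1) B_F[OF ac(1)] ac(2)] by blast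
   then show "p : (%i. (a, flip a i, a)) ` ?X" using c ac by blast
  qed (use sub in auto)
  let ?m = "%i. h a (flip a i) a"
  \<comment> \<open>\<open>?S1\<close> contains the directions of a vertex basis next to
    \<open>a\<close>, \<open>?S1\<close> and \<open>?S2\<close> cover \<open>E\<close> by
    \<open>flip_ex\<close>, and they meet in \<open>?X\<close>: this is the situation of
    \<open>form_basis_extend\<close>, whose result is supported on \<open>?S2\<close>.\<close>
  let ?S1 = "{i \<in> E. flip a i : F}" and ?S2 = "{i \<in> E. flip a i : F'}"
  have S12: "?S1 \<inter> ?S2 = ?X" using B_eq by blast
  obtain b where b: "form_basis E U b" "\<forall>c. support c = E & (\<forall>i. i ~: b --> c i = a i) --> c : F"
   using vertex_ex[OF aF(1)] by blast
  have "\<exists>x \<in> annihilator E (annihilator E U). (\<forall>i \<in> ?S1 \<inter> ?S2. x i = ?m i) & (\<forall>i. i ~: ?S2 --> x i = 0)"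
  proof (rule form_basis_extend[OF finite_E b(1)])
   show "b \<subseteq> ?S1"
   proof
    fix i assume i: "i : b"
    have "flip a i : F" using b(2) feasible_supp[OF aF(1)] i by (auto simp: support_flip flip_apply)
    moreover have "i : E" using b(1) i by (auto simp: form_basis_def)
    ultimately show "i : ?S1" by blast
   qed
   show "?S1 \<union> ?S2 = E" using flip_ex[OF a] by blast
   fix y assume y: "y : annihilator E U" "\<forall>i. i ~: ?S1 --> y i = 0"
   have yI: "(\<Sum>i\<in>?X. qterm [a, flip a i, a] 0 (y i)) : I" by (rule loop_restrict[OF aF(1) y(1)]) (use y(2) in blast)
   \<comment> \<open>The direction \<open>i\<close> is recovered from the middle vertex of the loop,
     so that coefficients indexed by directions become coefficients indexed by paths.\<close>
   define e where "e x c z = y (THE i. c = flip a i & i : E)" for x c z :: "'e => sign"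
   have ey: "e x (flip a i) z = y i" if "i : E" for x z i
    unfolding e_def by (rule arg_cong[where f = y], rule the_equality) (use that flip_inj[OF aF(1)] in auto)
   have "(\<Sum>(a, c, b)\<in>(%i. (a, flip a i, a)) ` ?X. qterm [a, c, b] 0 (e a c b)) =
    (\<Sum>i\<in>?X. qterm [a, flip a i, a] 0 (y i) :: ('e => sign, 'e, 'k) qalg)"
    unfolding sum.reindex[OF inj] by (rule sum.cong) (auto simp: ey)
   then have "(\<Sum>(a, c, b)\<in>(%i. (a, flip a i, a)) ` ?X. h a c b * e a c b) = 0"
    using yI by (intro TX[OF sub]) simp
   moreover have "(\<Sum>(a, c, b)\<in>(%i. (a, flip a i, a)) ` ?X. h a c b * e a c b) = (\<Sum>i\<in>?X. ?m i * y i)"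
    unfolding sum.reindex[OF inj] by (rule sum.cong) (auto simp: ey)
   ultimately show "(\<Sum>i\<in>?S1 \<inter> ?S2. ?m i * y i) = 0" unfolding S12 by simp
  qed blast
  then obtain x where x: "x : D.U0" "\<forall>i \<in> ?X. x i = ?m i" "\<forall>i. i ~: ?S2 --> x i = 0"
   unfolding S12 E' U' by blast
  have "(\<Sum>i\<in>{i \<in> D.E. flip a i : D.B}. qterm [a, flip a i, a] 0 (x i)) : D.I"
   by (rule D.loop_restrict[OF aF(2) x(1)]) (use x(3) in blast)
  moreover have "(\<Sum>i\<in>{i \<in> D.E. flip a i : D.B}. qterm [a, flip a i, a] 0 (x i)) = sum ?q (?S a a)"
   unfolding SX E' B' sum.reindex[OF inj]
  proof (rule sum.cong[OF refl])
   fix i assume i: "i : ?X"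
   then have "(a, flip a i) : arrows" using a F_adj[OF aF(1)] by (auto simp: arrows_def)
   from eps_arrow[OF this] show "qterm [a, flip a i, a] 0 (x i) = (?q \<circ> (%i. (a, flip a i, a))) i" using x(2) i by simp
  qed
  ultimately show ?thesis by simp
 qed
 have square: "sum ?q (?S a b) : D.I" if ab: "a ~= b" "a : B" "b : B" for a b
 proof (cases "?S a b = {}")
  case True
  then show ?thesis using D.I_facts(1) by (simp only: sum.empty)
 next
  case False
  then obtain ga where ga: "(a, ga, b) : path2" by auto
  have F4: "a : F" "b : F" "ga : F" "a : F'" "b : F'" "ga : F'" using ab pB[OF ga] B_F B_F' by auto
  obtain i where i: "i : E" "ga = flip a i" by (rule F_adjE[OF F4(1,3) pB(7)[OF ga]])
  obtain j where j: "j : E" "b = flip ga j" by (rule F_adjE[OF F4(3,2) pB(8)[OF ga]])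
  have ij: "i ~= j" using ab(1) i j by auto
  have nz: "a i ~= Zero" "a j ~= Zero" using F_nz F4(1) i j by auto
  define de where "de = flip a j"
  have gade: "ga ~= de" using flip_inj[OF F4(1) i(1), of j] ij by (simp add: i de_def)
  have bi: "b = flip (flip a i) j" "b = flip de i" using i j flip_commute[of a i j] by (simp_all add: de_def)
  have dei: "de i ~= Zero" using nz ij by (simp add: de_def flip_apply)
  have adj: "adjacent a ga" "adjacent b ga" "adjacent a de" "adjacent b de"
   using pB(7,8)[OF ga] adjacent_sym adjacent_flip[of a j, OF nz(2)] adjacent_flip[of de i, OF dei] bi(2) de_def by auto
  have dist: "distinct [a, b, ga, de]" "distinct [b, a, ga, de]"
   using ab(1) gade adj by (auto simp: adjacent_def)
  have mid: "c = ga | c = de" if "(a, c, b) : path2" for c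
   using square_middle_F[OF i(1) j(1) ij feasible_supp[OF F4(1)], of c] pB(2,7)[OF that] adjacent_sym[OF pB(8)[OF that]] B_F
   by (simp add: i(2)[symmetric] j(2)[symmetric] de_def)
  have Smem: "p = (a, ga, b) | p = (a, de, b) & de : B" if p: "p : ?S a b" for p
  proof -
   obtain c where c: "p = (a, c, b)" "(a, c, b) : path2" using p by (cases p) auto
   then show ?thesis using mid[OF c(2)] pB(2)[OF c(2)] by auto
  qed
  have s: "eps a de * eps de b = - (eps a ga * eps ga b)"
   unfolding i(2) de_def bi(1) by (rule eps_square[OF i(1) j(1) ij nz])
  have q: "qterm [a, ga, b] 0 c = qscale c (qterm [a, ga, b] 0 1)" for c by (simp add: qscale_simps)
  show ?thesis
  proof (cases "de : B")
   case True
   then have de: "(a, de, b) : path2" using adj ab adjacent_sym by (auto simp: path2_def arrows_def)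
   have "?S a b = {(a, ga, b), (a, de, b)}"
    by (rule equalityI, use Smem in blast) (use ga de in auto)
   then have S: "sum ?q (?S a b) = ?q (a, ga, b) + ?q (a, de, b)" using gade by simp
   have "qterm [b, ga, a] 0 1 - qterm [b, de, a] 0 1 : I"
    using square_I(1)[OF _ dist(2) adj(2,4,1,3)] F4 True B_F by auto
   \<comment> \<open>Testing \<open>h\<close> on the commutativity relation of \<open>P\<close>
     gives equal coefficients on the two paths; the opposite signs from \<open>eps_square\<close>
     then turn the sum into a multiple of the commutativity relation of \<open>P'\<close>.\<close>
   moreover define e where "e x c z = (if c = ga then 1 else - 1 :: 'k)" for x c z :: "'e => sign"
   ultimately have "(\<Sum>(a, c, b)\<in>{(b, ga, a), (b, de, a)}. qterm [a, c, b] 0 (e a c b)) : I"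
    using gade by (simp add: qterm_minus)
   from TX[OF _ this] have "h b ga a = h b de a" using pB(6) ga de gade by (simp add: e_def)
   then have "sum ?q (?S a b) = qscale (eps a ga * eps ga b * h b ga a) (qterm [a, ga, b] 0 1 - qterm [a, de, b] 0 1)"
    unfolding S by (simp add: s qscale_simps qterm_minus)
   then show ?thesis
    using D.I_qscale[OF D.square_I(1)[OF _ dist(1) adj(1,3,2,4)]] F4 True B_F' by auto
  next
   case False
   have "?S a b = {(a, ga, b)}"
    by (rule equalityI, use Smem False in blast) (use ga in auto)
   then have S: "sum ?q (?S a b) = qscale (eps a ga * eps ga b * h b ga a) (qterm [a, ga, b] 0 1)" by (simp add: qscale_simps)
   \<comment> \<open>The fourth corner \<open>de\<close> is not in \<open>B\<close>. If it is
     feasible for \<open>P\<close>, the reversed path through \<open>ga\<close> vanishes in the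
     algebra of \<open>P\<close>, and testing on it gives coefficient 0. If it is feasible for
     \<open>P'\<close>, the path through \<open>ga\<close> vanishes in the algebra of
     \<open>P'\<close>.\<close>
   from flip_ex[OF ab(2) j(1)] consider "de : F" | "de : F'" unfolding de_def by blast
   then show ?thesis
   proof cases
    case 1
    then have "(\<Sum>(a, c, b)\<in>{(b, ga, a)}. qterm [a, c, b] 0 1) : I"
     using square_I(2)[OF _ dist(2) adj(2,4,1,3) False] F4 by simp
    from TX[OF _ this] have "h b ga a = 0" using pB(6)[OF ga] by simp
    then show ?thesis unfolding S using D.I_facts(1) by (simp add: qscale_simps qterm_def)
   next
    case 2
    then have "qterm [a, ga, b] 0 1 : D.I" using D.square_I(2)[OF _ dist(1) adj(1,3,2,4)] F4 False B' by simp
    then show ?thesis unfolding S by (rule D.I_qscale)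
   qed
  qed
 qed
 have "(\<Sum>y\<in>B \<times> B. sum ?q {p \<in> path2. (fst p, snd (snd p)) = y}) = sum ?q path2"
  by (rule sum.group[OF finite_path2]) (use finite_B pB in auto)
 moreover have "(\<Sum>y\<in>B \<times> B. sum ?q {p \<in> path2. (fst p, snd (snd p)) = y}) : D.I"
 proof (rule D.I_facts(7))
  fix y assume "y : B \<times> B"
  then obtain a b where "y = (a, b)" "a : B" "b : B" by blast
  then show "sum ?q {p \<in> path2. (fst p, snd (snd p)) = y} : D.I"
   using loop[of a] square[of a b] by (cases "a = b") simp_all
 qed
 ultimately show ?thesis by simp
qed

end

lemma ring_iso_quot: "ring_iso (galg_quot X L) Y = ring_iso (X Quot L) Y"
 by (simp add: ring_iso_def ring_hom_def galg_quot_def)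

context dual_pair
begin

lemma phi_letters:
 assumes "set xs \<subseteq> carrier A1d \<times> carrier A1d"
 shows "DR.phi (\<Sum>(v, w)\<leftarrow>xs. letter (Inr v) * letter (Inr w)) =
  (\<Sum>(a, c, b)\<in>path2. qterm [a, c, b] 0 (eps a c * eps c b * dual_coeffs xs b c a))"
proof -
 have "DR.phi (\<Sum>(v, w)\<leftarrow>xs. letter (Inr v) * letter (Inr w)) = (\<Sum>(v, w)\<leftarrow>xs. qmul (dlift1 v) (dlift1 w))"
  using assms
 proof (induction xs)
  case (Cons x xs)
  then show ?case by (cases x) (simp add: DR.phi_add DR.phi_mult DR.phi_letter dlift_simps)
 qed (simp add: DR.phi_zero)
 also have "... = (\<Sum>(a, c, b)\<in>path2. qterm [a, c, b] 0 (\<Sum>(v, w)\<leftarrow>xs. (eps a c * v (arrow c a)) * (eps c b * w (arrow b c))))"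
  unfolding dlift1_def qmul_arrows unfolding split_def qterm_sum_list[symmetric] sum_sum_list ..
 also have "... = (\<Sum>(a, c, b)\<in>path2. qterm [a, c, b] 0 (eps a c * eps c b * dual_coeffs xs b c a))"
  by (simp add: dual_coeffs_def split_def sum_list_const_mult[symmetric] ac_simps)
 finally show ?thesis .
qed

text \<open>\<open>dual_relation\<close> shows that the annihilator of \<open>W\<close> maps to 0;
  \<open>nu_kernel\<close> with \<open>quad_rep_D\<close> gives the opposite inclusion. On letters,
  the sign in \<open>dlift1\<close> cancels against the one in \<open>arrD\<close>.\<close>

lemma kernel_D:
 assumes W: "quadratic_with A W"
 shows "a_kernel DT.T D.A DR.nu = L1 W"
proof (rule DR.nu_kernel[OF ideal_L1 _ quad_rep_D[OF W]])
 interpret H: ring_hom_ring DT.T D.A DR.nu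
  by (rule ring_hom_ringI2[OF DT.T.ring_axioms D.A.ring_axioms DR.nu_hom])
 have "perp A B (prog_idem P U) W \<subseteq> a_kernel DT.T D.A DR.nu"
 proof
  fix X assume X: "X : perp A B (prog_idem P U) W"
  have "DR.nu X = \<zero>\<^bsub>D.A\<^esub>"
  proof (rule perp_coeffs[OF W X])
   fix xs assume xs: "X = tensor_sum A0 A1d xs" "set xs \<subseteq> carrier A1d \<times> carrier A1d"
    "!!f. (\<Sum>(a, c, b)\<in>path2. qterm [a, c, b] 0 (f a c b)) : I ==> (\<Sum>(a, c, b)\<in>path2. dual_coeffs xs a c b * f a c b) = 0"
   have "DR.phi (\<Sum>(v, w)\<leftarrow>xs. letter (Inr v) * letter (Inr w)) : D.I"
    unfolding phi_letters[OF xs(2)] by (rule dual_relation[OF xs(3)])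
   moreover have "(\<Sum>(v, w)\<leftarrow>xs. letter (Inr v) * letter (Inr w)) : carrier DT.Fr"
    using DT.letters_hcomp[OF xs(2)] by (simp add: DT.FA.hcomp_eq)
   ultimately show "DR.nu X = \<zero>\<^bsub>D.A\<^esub>" unfolding xs(1) DT.tensor_sum_eq by (simp only: DR.nu_zero_iff)
  qed
  moreover have "X : carrier DT.T" using perp_carrier X by (rule subsetD)
  ultimately show "X : a_kernel DT.T D.A DR.nu" unfolding a_kernel_def' by (intro CollectI conjI)
 qed
 then have "L1 W \<subseteq> a_kernel DT.T D.A DR.nu" by (rule DT.T.genideal_minimal[OF H.kernel_is_ideal])
 then show "X : L1 W ==> DR.nu X = \<zero>\<^bsub>D.A\<^esub>" for X unfolding a_kernel_def' by blast
 interpret QR: quad_rep P' U' "DT.Kt (L1 W)" fconst DT.epsT arrD by (rule quad_rep_D[OF W])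
 have JK: "DT.J \<subseteq> DT.Kt (L1 W)" using DT.J_Kt[OF ideal_L1] by blast
 note K = DT.Kt_cong[OF ideal_L1, of W]
 fix l assume "l : DT.S"
 then consider r where "l = Inl r" "r : hcomp A 0" | \<phi> where "l = Inr \<phi>" "\<phi> : carrier A1d" by (auto simp: DT.S_def)
 then show "QR.Theta (dlift l) - DT.lt l : DT.Kt (L1 W)"
 proof cases
  case 1
  have "QR.Theta (dlift l) = (\<Sum>v\<in>B. fconst (co [v] r) * DT.epsT v)"
   using 1 by (simp add: dlift_simps lift0_def QR.Theta_sum QR.Theta_qterm QR.zmon_zero)
  then show ?thesis using QR.cg_sym[OF DT.letter_expand0[OF K JK 1(2)]] 1(1) by (simp add: QR.cg_def)
 next
  case 2
  have aF: "fst p : F'" "snd p : F'" "adjacent (fst p) (snd p)" if "p : arrows" for p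
   using that arrowsD[of "fst p" "snd p"] B_F' by auto
  have "QR.Theta (dlift l) = (\<Sum>(v, w)\<in>arrows. fconst (eps v w * \<phi> (arrow w v)) * (arrD v w * DT.epsT w))"
   using 2 by (simp add: dlift_simps dlift1_def QR.Theta_sum QR.Theta_qterm QR.zmon_zero split_def del: fconst_simps(4))
  also have "QR.cg ... (\<Sum>(v, w)\<in>arrows. fconst (eps v w * \<phi> (arrow w v)) * arrD v w)"
   unfolding split_def
   by (intro QR.cg_sum QR.cg_mult QR.cg_refl QR.arr_eps(2) aF)
  also have "... = (\<Sum>(v, w)\<in>arrows. fconst (\<phi> (arrow w v)) * DT.lt (Inr (delta w v)))"
  proof (rule sum.cong[OF refl])
   fix p assume p: "p : arrows"
   obtain v w where vw: "p = (v, w)" by (cases p)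
   have "fconst (eps v w * \<phi> (arrow w v)) * (fconst (eps v w) * DT.lt (Inr (delta w v))) =
    fconst (eps v w * \<phi> (arrow w v) * eps v w) * DT.lt (Inr (delta w v))"
    unfolding fconst_simps(4) mult.assoc ..
   also have "eps v w * \<phi> (arrow w v) * eps v w = \<phi> (arrow w v)"
    using eps_arrow(1)[OF p[unfolded vw]] by (simp add: mult.commute mult.left_commute)
   finally show "(case p of (v, w) => fconst (eps v w * \<phi> (arrow w v)) * arrD v w) =
    (case p of (v, w) => fconst (\<phi> (arrow w v)) * DT.lt (Inr (delta w v)))"
    using p by (simp add: vw arrD_def del: fconst_simps(4))
  qed
  also have "... = (\<Sum>(v, w)\<in>arrows. fconst (\<phi> (arrow v w)) * DT.lt (Inr (delta v w)))"
   by (rule sum.reindex_bij_witness[of _ prod.swap prod.swap]) (use arrows_sym in auto)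
  also have "QR.cg ... (DT.lt l)"
   unfolding 2(1) by (rule QR.cg_sym[OF dual_letter_expand[OF K JK 2(2)]])
  finally show ?thesis by (simp add: QR.cg_def)
 qed
qed

text \<open>The first isomorphism theorem for \<open>DR.nu\<close> yields the ring isomorphism;
  compatibility with scalars and degrees is inherited from \<open>DR.nu\<close> on
  representatives.\<close>

lemma quadratic_dual_isomorphic:
 assumes W: "quadratic_with A W"
 shows "galg_isomorphic (quadratic_dual A B (prog_idem P U) W) D.A"
proof -
 interpret H: ring_hom_ring DT.T D.A DR.nu
  by (rule ring_hom_ringI2[OF DT.T.ring_axioms D.A.ring_axioms DR.nu_hom])
 let ?h = "%X. the_elem (DR.nu ` X)" and ?G = "galg_quot DT.T (L1 W)"
 have iso: "?h : ring_iso ?G D.A"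
  using H.FactRing_iso_set[OF DR.nu_surj[OF reach_vertex_D reach_arrow_D]] unfolding kernel_D[OF W] ring_iso_quot .
 have hx: "?h (L1 W +>\<^bsub>DT.T\<^esub> x) = DR.nu x" if "x : carrier DT.T" for x
  using H.the_elem_simp[OF that] unfolding kernel_D[OF W] .
 have sm: "?h (c \<odot>\<^bsub>?G\<^esub> X) = c \<odot>\<^bsub>D.A\<^esub> ?h X" if X: "X : carrier ?G" for c X
 proof -
  obtain x where x: "X = L1 W +>\<^bsub>DT.T\<^esub> x" "x : carrier DT.T" using X unfolding DT.T.quot_carrier by blast
  show ?thesis
   unfolding x(1) DT.T.quot_smult[OF ideal_L1 x(2)] hx[OF x(2)] hx[OF DT.T.smult_closed[OF x(2)]]
   by (rule DR.nu_smult[OF x(2)])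
 qed
 have hc: "?h ` hcomp ?G n = hcomp D.A n" for n
 proof -
  have "?h ` hcomp ?G n = DR.nu ` hcomp DT.T n"
   unfolding DT.T.quot_hcomp image_image
   by (rule image_cong[OF refl hx]) (auto simp: DT.T_hcomp DT.T_carrier DT.FA.hcomp_eq)
  also have "... = hcomp D.A n" by (rule DR.nu_hcomp[OF reach_vertex_D reach_arrow_D])
  finally show ?thesis .
 qed
 show ?thesis
  unfolding galg_isomorphic_def quadratic_dual_def Let_def
  by (rule bexI[OF _ iso]) (intro conjI allI ballI sm hc)
qed

end

section \<open>Application to a generic program and its dual\<close>

context om_prog
begin

lemma vprog_parameter:
 fixes U :: "('e => 'k::field) set"
 assumes "!!b. b : matroid_bases (prog_M P) ==> form_basis (prog_E P) U b"
 shows "vprog P U"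
proof
 show "finite (prog_E P)" by (rule finite_E)
 show "support al = prog_E P" if "al : feasible_topes P" for al by (rule feasible_support[OF that])
 show "\<exists>b. form_basis (prog_E P) U b & (\<forall>c. support c = prog_E P & (\<forall>i. i ~: b --> c i = al i) --> c : feasible_topes P)"
  if "al : feasible_topes P" for al
  using feasible_vertex[OF that] assms by blast
 show "\<exists>b. form_basis (prog_E P) U b & j : b & (\<forall>c. support c = prog_E P & (\<forall>i. i ~: b --> c i = al i) --> c : feasible_topes P)"
  if "al : feasible_topes P" "flip al j : feasible_topes P" "j : prog_E P" for al j
  using feasible_edge_vertex[OF that] assms by blast
qed

text \<open>Bases of the dual matroid are complements of bases, which is why
  \<open>parameter_space_form_basis\<close> treats \<open>b\<close> for \<open>U\<close> and its
  complement for the annihilator together.\<close>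

lemma dual_pair_parameter:
 fixes U :: "('e => 'k::field) set"
 assumes "parameter_space (prog_M P) U"
 shows "dual_pair P (dual_program P) U (annihilator (prog_E P) U)"
proof -
 note f = parameter_space_form_basis[OF M.om assms, unfolded ground_M]
 have "vprog P U" by (rule vprog_parameter[OF f(1)])
 moreover have "vprog (dual_program P) (annihilator (prog_E P) U)"
 proof (rule om_prog.vprog_parameter[OF om_prog_dual])
  fix c assume "c : matroid_bases (prog_M (dual_program P))"
  then obtain b where b: "b : matroid_bases (prog_M P)" "c = prog_E P - b"
   unfolding prog_M_dual M.bases_om_dual ground_M by blast
  show "form_basis (prog_E (dual_program P)) (annihilator (prog_E P) U) c"
   using f(2)[OF b(1)] unfolding b(2) prog_E_dual .
 qed
 ultimately show ?thesis
 proof (rule dual_pair.intro)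
  show "dual_pair_axioms P (dual_program P) U (annihilator (prog_E P) U)"
   by unfold_locales (use bounded_feasible_dual bounded_feasible_eq flip_feasible_or_dual in auto)
 qed
qed

end

theorem theorem1p10:
  fixes P :: "'e program" and U :: "('e \<Rightarrow> 'k::field) set"
  assumes "om_program P" and "generic_program P" and "parameter_space (prog_M P) U"
  shows "quadratic (prog_algebra P U) \<and>
    (\<forall>W. quadratic_with (prog_algebra P U) W \<longrightarrow>
      galg_isomorphic
        (quadratic_dual (prog_algebra P U) (bounded_feasible P) (prog_idem P U) W)
        (prog_algebra (dual_program P) (annihilator (prog_E P) U)))"
proof -
  have "om_prog P" by unfold_locales (rule assms)+
  then interpret dual_pair P "dual_program P" U "annihilator (prog_E P) U"
    by (rule om_prog.dual_pair_parameter[OF _ assms(3)])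
  show ?thesis by (intro conjI allI impI quadratic_A quadratic_dual_isomorphic)
qed

end
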